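(* Let $X$, $G$, $L_1,\dots,L_s$, $L=L_1+\cdots+L_s$, $V$, $B$, $\mathcal Y$ satisfy the standing assumptions listed in the context, for the principal bundle $\mathbb C^\times-K_X^\times\to X$ (so $H=\mathbb C^\times$ and $L=L_\chi$ for a $\mathbb C^\times$-character $\chi$). Then the global Poincaré residue map $$\mathbf R:H^0(X,L+K_X)\to H^0(B,\mathbb H^{top})$$ is $G$-equivariant and is given by $$\mathbf R_\sigma(\tau)=\mathrm{Res}\,\tau\Omega_\sigma,\qquad \tau\in H^0(X,L+K_X),\ \sigma=(\sigma_1,\dots,\sigma_s)\in B,$$ where $$\tau\Omega_\sigma:=\frac{\tau\,\iota_{x_0}\hat\omega}{\sigma_1\cdots\sigma_s}.$$
   Context: Line bundles are written additively. Standing assumptions. $X$ is a compact connected complex manifold of dimension $d$ and $G\subset\mathrm{Aut}\,X$ is a complex Lie subgroup (possibly trivial). $L_1,\dots,L_s$ ($s<d$) are nontrivial $G$-equivariant line bundles on $X$ with $H^0(X,L+K_X)\ne0$, where $L=L_1+\cdots+L_s$; each linear system $V_i^*:=H^0(X,L_i)$ is base point free; and there is a holomorphic character $\chi$ of $H=\mathbb C^\times$ with $L=L_\chi:=K_X^\times\times_H\mathbb C_\chi$. Here $K_X^\times$ is the complement of the zero section in $K_X$, $h\in H$ acts on it by $m\mapsto h^{-1}m$, and $L_\chi$ is the quotient of $K_X^\times\times\mathbb C$ by $h\cdot(m,v)=(h^{-1}m,\chi(h)v)$. For general $\sigma_i\in V_i^*$ the intersection $Y_\sigma=Y_{\sigma_1}\cap\cdots\cap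 Y_{\sigma_s}$, $Y_{\sigma_i}=\{\sigma_i=0\}$, is smooth of codimension $s$. Put $V=V_1\times\cdots\times V_s$ and $B=V^*-D$, where $D$ is the set of $\sigma=(\sigma_1,\dots,\sigma_s)\in V^*$ such that $Y_\sigma$ is not smooth of codimension $s$; $\mathcal Y$ is the family of the $Y_\sigma$ over $B$. The number $\dim H^0(Y_\sigma,K_{Y_\sigma})$ is assumed locally constant on $B$, and $\mathbb H^{top}$ is the vector bundle on $B$ with fiber $H^0(Y_\sigma,K_{Y_\sigma})$ at $\sigma$. The map $\mathbf R$: for $\sigma\in B$, $\mathbf R_\sigma:H^0(X,L+K_X)\to H^0(Y_\sigma,K_{Y_\sigma})$ is restriction to $Y_\sigma$ followed by the canonical adjunction isomorphism $(L+K_X)|_{Y_\sigma}\cong K_{Y_\sigma}$ (locally, with frames $e_i$ of $L_i$ and coordinates $z_1,\dots,z_d$ such that $\sigma_i=z_ie_i$ for $i\le s$, it sends $g\,e_1\otimes\cdots\otimes e_s\otimes dz_1\wedge\cdots\wedge dz_d$ to $g\,dz_{s+1}\wedge\cdots\wedge dz_d|_{Y_\sigma}$); $\mathbf R(\tau)$ is the section $\sigma\mapsto\mathbf R_\sigma(\tau)$. Residue: $\mathrm{Res}:H^0(\Omega_X^d(\cup_iY_{\sigma_i}))\to H^0(\Omega^{d-s}_{Y_\sigma})$ is induced by the Poincaré residue sheaf map $\frac{g}{z_1\cdots z_s}dz_1\wedge\cdots\wedge dz_d\mapsto g\,dz_{s+1}\wedge\cdots\wedge dz_d|_{Y_\sigma}$,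 where $z_i=0$ is a local equation of $Y_{\sigma_i}$. The form: a chart $w$ on $X$ induces coordinates $(z_w,w)$ on $K_X$ with $z_w(\eta)=\eta(\partial/\partial w_1,\dots,\partial/\partial w_d)$; $\hat\omega=dz_w\wedge dw_1\wedge\cdots\wedge dw_d$ is a well-defined global nowhere vanishing top form on $K_X$, and $x_0=z_w\partial/\partial z_w$ is the Euler field on the fibers, so $\iota_{x_0}\hat\omega=z_w\,dw_1\wedge\cdots\wedge dw_d$. Sections of $L_{\chi'}$ are identified with holomorphic functions $f$ on $K_X^\times$ satisfying $f(h^{-1}m)=\chi'(h)f(m)$ (the section being $[m]\mapsto[m,f(m)]$). In the definition of $\tau\Omega_\sigma$, $\sigma_1\cdots\sigma_s\in H^0(L)=H^0(L_\chi)$ and $\tau\in H^0(L+K_X)=H^0(L_{\chi\chi_1})$ (with $K_X= L_{\chi_1}$ canonically, $\chi_1(h)=h$) denote these functions; $\tau\Omega_\sigma$ descends to a meromorphic $d$-form on $X$ with pole along $\cup_iY_{\sigma_i}$. $G$-actions: $G$ acts on sections of a $G$-equivariant bundle by $\Gamma_g\sigma=g\circ\sigma\circ g^{-1}$; $G$ acts on $B$ accordingly, on $\mathbb H^{top}$ via the isomorphisms $H^0(K_{Y_\sigma})\to H^0(K_{Y_{\Gamma_g\sigma}})$ induced by $g:Y_\sigma\to Y_{\Gamma_g\sigma}$, and on $H^0(B,\mathbb H^{top})$ by the induced action on sections. *)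

theory Defs
  imports "HOL-Analysis.Analysis" "HOL-Library.Function_Algebras" "HOL-Combinatorics.Permutations"
begin

section \<open>Complex model spaces and holomorphic maps between them\<close>

class complex_model = real_normed_vector +
  fixes cscale :: "complex \<Rightarrow> 'a \<Rightarrow> 'a"  (infixr \<open>*c\<close> 75)
  assumes cscale_add_right: "c *c (x + y) = c *c x + c *c y"
    and cscale_add_left: "(c + c') *c x = c *c x + c' *c x"
    and cscale_cscale: "c *c (c' *c x) = (c * c') *c x"
    and cscale_of_real: "complex_of_real r *c x = r *\<^sub>R x"
    and norm_cscale: "norm (c *c x) = cmod c * norm x"
    and finite_dim_model: "\<exists>S. finite S \<and> (\<forall>x. \<exists>a. x = (\<Sum>b\<in>S. a b *c b))"

lemma cscale_zero_left: "0 *c (x::'a::complex_model) = 0"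
  using cscale_of_real[of 0 x] by simp

lemma cscale_zero_right: "c *c (0::'a::complex_model) = 0"
  using cscale_add_right[of c "0::'a" 0] by simp

instantiation complex :: complex_model
begin
definition "cscale_complex (c::complex) (x::complex) = c * x"
instance
proof
  show "\<exists>S::complex set. finite S \<and> (\<forall>x. \<exists>a. x = (\<Sum>b\<in>S. a b *c b))"
    by (rule exI[of _ "{1}"]) (auto simp: cscale_complex_def)
qed (auto simp: cscale_complex_def algebra_simps scaleR_conv_of_real norm_mult)
end

instantiation vec :: (complex_model, finite) complex_model
begin
definition "cscale_vec c (x :: 'a ^ 'b) = (\<chi> i. c *c (x $ i))"
instance
proof
  fix c :: complex and x :: "'a ^ 'b"
  show "norm (c *c x) = cmod c * norm x"
    by (simp add: cscale_vec_def norm_vec_def norm_cscale L2_set_right_distrib)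
next
  obtain S :: "'a set" where S: "finite S" "\<And>x. \<exists>a. x = (\<Sum>b\<in>S. a b *c b)"
    using finite_dim_model by blast
  then obtain a where a: "\<And>x. x = (\<Sum>b\<in>S. a x b *c b)" by metis
  let ?f = "\<lambda>(i, b). axis i b :: 'a ^ 'b"
  let ?C = "?f ` (UNIV \<times> (S - {0}))"
  have inj: "inj_on ?f (UNIV \<times> (S - {0}))"
    by (auto simp: inj_on_def axis_eq_axis)
  have "\<exists>a. x = (\<Sum>b\<in>?C. a b *c b)" for x :: "'a ^ 'b"
  proof -
    define g where "g = (\<lambda>y. let (i, b) = inv_into (UNIV \<times> (S - {0})) ?f y in a (x $ i) b)"
    have g: "g (axis i b) = a (x $ i) b" if "b \<in> S - {0}" for i b
      using inv_into_f_f[OF inj, of "(i, b)"] that by (simp add: g_def)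
    have "(\<Sum>y\<in>?C. g y *c y) = (\<Sum>(i, b)\<in>UNIV \<times> (S - {0}). a (x $ i) b *c axis i b)"
    proof (subst sum.reindex[OF inj], rule sum.cong)
      fix y assume "y \<in> (UNIV :: 'b set) \<times> (S - {0})"
      then show "((\<lambda>y. g y *c y) \<circ> ?f) y = (case y of (i, b) \<Rightarrow> a (x $ i) b *c axis i b)"
        using g[of "snd y" "fst y"] by (cases y) simp
    qed simp
    also have "\<dots> = (\<Sum>i\<in>UNIV. \<Sum>b\<in>S - {0}. a (x $ i) b *c axis i b)"
      by (simp add: sum.cartesian_product)
    also have "\<dots> = x"
    proof (subst vec_eq_iff, intro allI)
      fix j
      have "(\<Sum>i\<in>UNIV. \<Sum>b\<in>S - {0}. a (x $ i) b *c axis i b) $ j =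
            (\<Sum>i\<in>UNIV. if i = j then \<Sum>b\<in>S - {0}. a (x $ j) b *c b else 0)"
      proof (subst sum_component, rule sum.cong)
        fix i
        show "(\<Sum>b\<in>S - {0}. a (x $ i) b *c axis i b) $ j =
            (if i = j then \<Sum>b\<in>S - {0}. a (x $ j) b *c b else 0)"
          by (cases "i = j") (auto simp: sum_component cscale_vec_def axis_def cscale_zero_right)
      qed simp
      also have "\<dots> = (\<Sum>b\<in>S - {0}. a (x $ j) b *c b)" by simp
      also have "\<dots> = (\<Sum>b\<in>S. a (x $ j) b *c b)"
        using S(1) by (intro sum.mono_neutral_left) (auto simp: cscale_zero_right)
      also have "\<dots> = x $ j" by (rule a[symmetric])
      finally show "(\<Sum>i\<in>UNIV. \<Sum>b\<in>S - {0}. a (x $ i) b *c axis i b) $ j = x $ j" .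
    qed
    finally show ?thesis by (intro exI[of _ g]) (rule sym)
  qed
  moreover have "finite ?C" using S(1) by simp
  ultimately show "\<exists>S::('a ^ 'b) set. finite S \<and> (\<forall>x. \<exists>a. x = (\<Sum>b\<in>S. a b *c b))" by blast
qed (auto simp: cscale_vec_def vec_eq_iff cscale_add_right cscale_add_left cscale_cscale cscale_of_real)
end

instantiation prod :: (complex_model, complex_model) complex_model
begin
definition "cscale_prod c (x :: 'a \<times> 'b) = (c *c fst x, c *c snd x)"
instance
proof
  fix c :: complex and x :: "'a \<times> 'b"
  have "(cmod c * norm (fst x))\<^sup>2 + (cmod c * norm (snd x))\<^sup>2 =
        (cmod c)\<^sup>2 * ((norm (fst x))\<^sup>2 + (norm (snd x))\<^sup>2)"
    by (simp add: power_mult_distrib distrib_left)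
  then show "norm (c *c x) = cmod c * norm x"
    by (simp add: cscale_prod_def norm_prod_def norm_cscale real_sqrt_mult)
next
  obtain S :: "'a set" where S: "finite S" "\<And>x. \<exists>a. x = (\<Sum>b\<in>S. a b *c b)"
    using finite_dim_model by blast
  obtain T :: "'b set" where T: "finite T" "\<And>x. \<exists>a. x = (\<Sum>b\<in>T. a b *c b)"
    using finite_dim_model by blast
  let ?C = "(S - {0}) \<times> {0} \<union> {0} \<times> T"
  have "\<exists>a. x = (\<Sum>b\<in>?C. a b *c b)" for x :: "'a \<times> 'b"
  proof -
    obtain a where a: "fst x = (\<Sum>b\<in>S. a b *c b)" using S(2)[of "fst x"] by blast
    obtain a' where a': "snd x = (\<Sum>b\<in>T. a' b *c b)" using T(2)[of "snd x"] by blast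
    define g where "g = (\<lambda>(u, v). if u = 0 then a' v else a u)"
    have "(\<Sum>y\<in>?C. g y *c y) = (\<Sum>y\<in>(S - {0}) \<times> {0}. g y *c y) + (\<Sum>y\<in>{0} \<times> T. g y *c y)"
      using S(1) T(1) by (intro sum.union_disjoint) auto
    also have "(\<Sum>y\<in>(S - {0}) \<times> {0}. g y *c y) = (\<Sum>b\<in>S - {0}. (a b *c b, 0))"
      by (rule sum.reindex_bij_witness[of _ "\<lambda>b. (b, 0)" fst])
         (auto simp: g_def cscale_prod_def cscale_zero_right)
    also have "\<dots> = (\<Sum>b\<in>S. (a b *c b, 0))"
      using S(1) by (intro sum.mono_neutral_left) (auto simp: cscale_zero_right zero_prod_def)
    also have "(\<Sum>y\<in>{0} \<times> T. g y *c y) = (\<Sum>b\<in>T. (0, a' b *c b))"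
      by (rule sum.reindex_bij_witness[of _ "\<lambda>b. (0, b)" snd])
         (auto simp: g_def cscale_prod_def cscale_zero_right)
    also have "(\<Sum>b\<in>S. (a b *c b, 0)) + (\<Sum>b\<in>T. (0, a' b *c b)) = x"
      by (rule prod_eqI) (simp_all add: fst_sum snd_sum a[symmetric] a'[symmetric])
    finally show ?thesis by (intro exI[of _ g]) (rule sym)
  qed
  moreover have "finite ?C" using S(1) T(1) by simp
  ultimately show "\<exists>S::('a \<times> 'b) set. finite S \<and> (\<forall>x. \<exists>a. x = (\<Sum>b\<in>S. a b *c b))" by blast
qed (auto simp: cscale_prod_def cscale_add_right cscale_add_left cscale_cscale cscale_of_real)
end

text \<open>The zero-dimensional model space, so that discrete (in particular trivial) groups are
  complex Lie groups in the sense below.\<close>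

instantiation unit :: real_normed_vector
begin
definition "(0::unit) = ()"
definition "(x::unit) + y = ()"
definition "r *\<^sub>R (x::unit) = ()"
definition "norm (x::unit) = (0::real)"
definition "dist (x::unit) (y::unit) = (0::real)"
definition "sgn (x::unit) = ()"
definition "(uniformity :: (unit \<times> unit) filter) = (INF e\<in>{0 <..}. principal {(x, y). dist x y < e})"
definition "open (U::unit set) = True"
instance
proof
  fix U :: "unit set"
  have "top \<le> principal {(x, y). dist (x::unit) y < e}" if "0 < e" for e
    using that by (simp add: dist_unit_def flip: top_eq_principal_UNIV)
  then have "top \<le> (uniformity :: (unit \<times> unit) filter)"
    unfolding uniformity_unit_def by (intro INF_greatest) simp
  then have "(uniformity :: (unit \<times> unit) filter) = top" by (rule top_le)
  then show "open U = (\<forall>x\<in>U. \<forall>\<^sub>F (x', y) in uniformity. x' = x \<longrightarrow> y \<in> U)"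
    by (simp add: open_unit_def unit_eq)
qed (simp_all add: norm_unit_def dist_unit_def uniformity_unit_def)
end

instantiation unit :: complex_model
begin
definition "cscale_unit (c::complex) (x::unit) = ()"
instance
proof
  show "\<exists>S::unit set. finite S \<and> (\<forall>x. \<exists>a. x = (\<Sum>b\<in>S. a b *c b))"
    by (intro exI[of _ UNIV]) simp
qed (simp_all add: norm_unit_def)
end

text \<open>Only used for sets that are open in the model space or in a complex linear subspace of it;
  on the latter this is holomorphy in the coordinates of the subspace.\<close>

definition holo :: "('a::complex_model \<Rightarrow> 'b::complex_model) \<Rightarrow> 'a set \<Rightarrow> bool" where
  "holo f S \<longleftrightarrow> (\<forall>x\<in>S. \<exists>f'. (f has_derivative f') (at x within S) \<and> (\<forall>c v. f' (c *c v) = c *c f' v))"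


section \<open>Complex manifolds\<close>

type_synonym ('y, 'e) chart = "'y set \<times> ('y \<Rightarrow> 'e)"

definition is_chart :: "'y topology \<Rightarrow> ('y, 'e::complex_model) chart \<Rightarrow> bool" where
  "is_chart T c \<longleftrightarrow> (case c of (U, \<phi>) \<Rightarrow> openin T U \<and> open (\<phi> ` U) \<and>
     homeomorphic_map (subtopology T U) (top_of_set (\<phi> ` U)) \<phi>)"

definition transition :: "('y, 'e) chart \<Rightarrow> ('y, 'e) chart \<Rightarrow> 'e \<Rightarrow> 'e" where
  "transition c c' = snd c' \<circ> inv_into (fst c) (snd c)"

definition compatible :: "('y, 'e::complex_model) chart \<Rightarrow> ('y, 'e) chart \<Rightarrow> bool" where
  "compatible c c' \<longleftrightarrow> holo (transition c c') (snd c ` (fst c \<inter> fst c'))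
     \<and> holo (transition c' c) (snd c' ` (fst c \<inter> fst c'))"

text \<open>A complex structure is a maximal holomorphic atlas.\<close>

definition complex_manifold :: "'y topology \<Rightarrow> ('y, 'e::complex_model) chart set \<Rightarrow> bool" where
  "complex_manifold T A \<longleftrightarrow> Hausdorff_space T \<and> second_countable T \<and>
     (\<forall>c\<in>A. is_chart T c) \<and> (\<Union>c\<in>A. fst c) = topspace T \<and>
     (\<forall>c\<in>A. \<forall>c'\<in>A. compatible c c') \<and>
     (\<forall>c. is_chart T c \<and> (\<forall>c'\<in>A. compatible c c') \<longrightarrow> c \<in> A)"

definition prod_atlas :: "('y, 'e) chart set \<Rightarrow> ('z, 'f) chart set \<Rightarrow> ('y \<times> 'z, 'e \<times> 'f) chart set" where
  "prod_atlas A A' = {(U \<times> V, \<lambda>(y, z). (\<phi> y, \<psi> z)) | U \<phi> V \<psi>. (U, \<phi>) \<in> A \<and> (V, \<psi>) \<in> A'}"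

text \<open>Holomorphic maps; the openness condition expresses continuity.\<close>

definition mholo :: "('y, 'e::complex_model) chart set \<Rightarrow> ('z, 'f::complex_model) chart set \<Rightarrow>
    'y set \<Rightarrow> ('y \<Rightarrow> 'z) \<Rightarrow> bool" where
  "mholo A A' W F \<longleftrightarrow> (\<forall>(U, \<phi>)\<in>A. \<forall>(V, \<psi>)\<in>A'.
     open (\<phi> ` (U \<inter> W \<inter> F -` V)) \<and> holo (\<psi> \<circ> F \<circ> inv_into U \<phi>) (\<phi> ` (U \<inter> W \<inter> F -` V)))"

abbreviation holo_fun :: "('y, 'e::complex_model) chart set \<Rightarrow> 'y set \<Rightarrow> ('y \<Rightarrow> complex) \<Rightarrow> bool" where
  "holo_fun A W f \<equiv> mholo A {(UNIV, id)} W f"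

definition Aut :: "('x, 'e::complex_model) chart set \<Rightarrow> ('x \<Rightarrow> 'x) set" where
  "Aut A = {g. bij g \<and> mholo A A UNIV g \<and> mholo A A UNIV (inv g)}"

text \<open>The topology \<open>T\<close> and the atlas \<open>AG\<close> are those of the Lie subgroup, which need not be embedded.
  That the inclusion into \<open>Aut X\<close> is holomorphic is expressed by holomorphy of the evaluation map.\<close>

definition complex_lie_subgroup :: "('x, 'e::complex_model) chart set \<Rightarrow> ('x \<Rightarrow> 'x) set \<Rightarrow>
    ('x \<Rightarrow> 'x) topology \<Rightarrow> ('x \<Rightarrow> 'x, 'm::complex_model) chart set \<Rightarrow> bool" where
  "complex_lie_subgroup A G T AG \<longleftrightarrow>
     G \<subseteq> Aut A \<and> id \<in> G \<and> (\<forall>g\<in>G. \<forall>h\<in>G. g \<circ> h \<in> G) \<and> (\<forall>g\<in>G. inv g \<in> G) \<and>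
     topspace T = G \<and> complex_manifold T AG \<and>
     mholo (prod_atlas AG AG) AG (G \<times> G) (\<lambda>(g, h). g \<circ> h) \<and> mholo AG AG G inv \<and>
     mholo (prod_atlas AG A) A (G \<times> UNIV) (\<lambda>(g, x). g x)"


section \<open>Tangent vectors and differential forms\<close>

text \<open>A tangent vector at \<open>p\<close> is given by its components in all charts at \<open>p\<close>, related by the
  Jacobians of the coordinate changes (and set to 0 on all other arguments).\<close>

type_synonym ('y, 'e) tvec = "('y, 'e) chart \<Rightarrow> 'e"

definition tangent :: "('y, 'e::real_normed_vector) chart set \<Rightarrow> 'y \<Rightarrow> ('y, 'e) tvec set" where
  "tangent A p = {v.
     (\<forall>c. \<not> (c \<in> A \<and> p \<in> fst c) \<longrightarrow> v c = 0) \<and>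
     (\<forall>c\<in>A. \<forall>c'\<in>A. p \<in> fst c \<longrightarrow> p \<in> fst c' \<longrightarrow>
        v c' = frechet_derivative (transition c c') (at (snd c p)) (v c))}"

definition chart_at :: "('y, 'e) chart set \<Rightarrow> 'y \<Rightarrow> ('y, 'e) chart" where
  "chart_at A p = (SOME c. c \<in> A \<and> p \<in> fst c)"

text \<open>\<open>differential A f p v\<close> is \<open>df(v)\<close>, which does not depend on the chart.\<close>

definition differential :: "('y, 'e::real_normed_vector) chart set \<Rightarrow> ('y \<Rightarrow> complex) \<Rightarrow> 'y \<Rightarrow>
    ('y, 'e) tvec \<Rightarrow> complex" where
  "differential A f p v = (let c = chart_at A p in
     frechet_derivative (f \<circ> inv_into (fst c) (snd c)) (at (snd c p)) (v c))"

type_synonym 'n cvec = "(complex, 'n) vec"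

text \<open>Coordinates are numbered from 0.\<close>

definition coord :: "nat \<Rightarrow> 'n::{finite, linorder}" where
  "coord i = sorted_list_of_set (UNIV :: 'n set) ! i"

definition coord_vec :: "('y, 'n::{finite, linorder} cvec) chart set \<Rightarrow> ('y, 'n cvec) chart \<Rightarrow>
    nat \<Rightarrow> 'y \<Rightarrow> ('y, 'n cvec) tvec" where
  "coord_vec A c j p = (\<lambda>c'. if c' \<in> A \<and> p \<in> fst c'
     then frechet_derivative (transition c c') (at (snd c p)) (axis (coord j) 1) else 0)"

type_synonym 't form = "(nat \<Rightarrow> 't) \<Rightarrow> complex"

text \<open>Alternating \<open>k\<close>-forms on a space \<open>T\<close> of tangent vectors take the arguments \<open>u 0, \<dots>, u (k - 1)\<close>;
  by convention they vanish on arguments outside \<open>T\<close>.\<close>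

definition alt_forms :: "nat \<Rightarrow> ('y, 'n::finite cvec) tvec set \<Rightarrow> ('y, 'n cvec) tvec form set" where
  "alt_forms k T = {\<alpha>.
     (\<forall>u. (\<exists>i<k. u i \<notin> T) \<longrightarrow> \<alpha> u = 0) \<and>
     (\<forall>u u'. (\<forall>i<k. u i = u' i) \<longrightarrow> \<alpha> u = \<alpha> u') \<and>
     (\<forall>u i v w a b. (\<forall>j<k. u j \<in> T) \<and> i < k \<and> v \<in> T \<and> w \<in> T \<longrightarrow>
        \<alpha> (u(i := (\<lambda>c. a *c v c + b *c w c))) = a * \<alpha> (u(i := v)) + b * \<alpha> (u(i := w))) \<and>
     (\<forall>u i j. (\<forall>l<k. u l \<in> T) \<and> i < k \<and> j < k \<and> i \<noteq> j \<and> u i = u j \<longrightarrow> \<alpha> u = 0)}"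

definition leibniz_det :: "nat \<Rightarrow> (nat \<Rightarrow> nat \<Rightarrow> complex) \<Rightarrow> complex" where
  "leibniz_det k a = (\<Sum>\<pi> | \<pi> permutes {..<k}. of_int (sign \<pi>) * (\<Prod>i<k. a i (\<pi> i)))"

text \<open>\<open>coord_form c T m k\<close> is the restriction to \<open>T\<close> of
  \<open>dz\<^bsub>m\<^esub> \<and> \<dots> \<and> dz\<^bsub>m + k - 1\<^esub>\<close> for the coordinates \<open>z\<close> of the chart \<open>c\<close>.\<close>

definition coord_form :: "('y, 'n::{finite, linorder} cvec) chart \<Rightarrow> ('y, 'n cvec) tvec set \<Rightarrow>
    nat \<Rightarrow> nat \<Rightarrow> ('y, 'n cvec) tvec form" where
  "coord_form c T m k = (\<lambda>u. if \<forall>j<k. u j \<in> T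
     then leibniz_det k (\<lambda>i j. u j c $ coord (m + i)) else 0)"

text \<open>The pushforward of tangent vectors along an automorphism \<open>g\<close>: the component of \<open>dg(v)\<close> in a chart
  \<open>(U, \<phi>)\<close> is the component of \<open>v\<close> in the chart \<open>(g\<^sup>-\<^sup>1(U), \<phi> \<circ> g)\<close>, since these two charts represent \<open>g\<close> by the identity.\<close>

definition push_vec :: "('y \<Rightarrow> 'y) \<Rightarrow> ('y, 'e) tvec \<Rightarrow> ('y, 'e) tvec" where
  "push_vec g v = (\<lambda>(U, \<phi>). v (g -` U, \<phi> \<circ> g))"

definition push_form :: "('y \<Rightarrow> 'y) \<Rightarrow> ('y, 'e) tvec form \<Rightarrow> ('y, 'e) tvec form" where
  "push_form g \<alpha> = (\<lambda>u. \<alpha> (\<lambda>i. push_vec (inv g) (u i)))"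


section \<open>Holomorphic line bundles\<close>

text \<open>A line bundle is given by its total space, projection, fiberwise operations and a collection of
  local holomorphic frames.\<close>

record ('x, 'l) line_bundle =
  Tot :: "'l set"
  Proj :: "'l \<Rightarrow> 'x"
  Add :: "'l \<Rightarrow> 'l \<Rightarrow> 'l"
  Smul :: "complex \<Rightarrow> 'l \<Rightarrow> 'l"
  Frames :: "('x set \<times> ('x \<Rightarrow> 'l)) set"

definition fiber :: "('x, 'l) line_bundle \<Rightarrow> 'x \<Rightarrow> 'l set" where
  "fiber E p = {u \<in> Tot E. Proj E u = p}"

definition nonzero :: "('x, 'l) line_bundle \<Rightarrow> 'l set" where
  "nonzero E = {u \<in> Tot E. Smul E 0 u \<noteq> u}"

definition ratio :: "('x, 'l) line_bundle \<Rightarrow> 'l \<Rightarrow> 'l \<Rightarrow> complex" where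
  "ratio E u e = (THE c. u = Smul E c e)"

text \<open>The conditions on a frame say that \<open>c \<mapsto> c e(p)\<close> is an isomorphism from \<open>\<complex>\<close> to the fiber at \<open>p\<close>,
  so the fibers are one-dimensional complex vector spaces.\<close>

definition is_line_bundle :: "('x::topological_space, 'e::complex_model) chart set \<Rightarrow> ('x, 'l) line_bundle \<Rightarrow> bool" where
  "is_line_bundle A E \<longleftrightarrow>
     (\<forall>(U, e)\<in>Frames E. open U \<and> (\<forall>p\<in>U. bij_betw (\<lambda>c. Smul E c (e p)) UNIV (fiber E p) \<and>
        e p \<in> fiber E p \<and>
        (\<forall>a b. Smul E a (Smul E b (e p)) = Smul E (a * b) (e p) \<and>
               Add E (Smul E a (e p)) (Smul E b (e p)) = Smul E (a + b) (e p)))) \<and>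
     (\<Union>(U, e)\<in>Frames E. U) = UNIV \<and>
     (\<forall>(U, e)\<in>Frames E. \<forall>(U', e')\<in>Frames E. holo_fun A (U \<inter> U') (\<lambda>p. ratio E (e' p) (e p)))"

definition holo_section :: "('x, 'e::complex_model) chart set \<Rightarrow> ('x, 'l) line_bundle \<Rightarrow> 'x set \<Rightarrow>
    ('x \<Rightarrow> 'l) \<Rightarrow> bool" where
  "holo_section A E W \<sigma> \<longleftrightarrow> (\<forall>p\<in>W. \<sigma> p \<in> fiber E p) \<and>
     (\<forall>(U, e)\<in>Frames E. holo_fun A (U \<inter> W) (\<lambda>p. ratio E (\<sigma> p) (e p)))"

definition H0 :: "('x, 'e::complex_model) chart set \<Rightarrow> ('x, 'l) line_bundle \<Rightarrow> ('x \<Rightarrow> 'l) set" where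
  "H0 A E = {\<sigma>. holo_section A E UNIV \<sigma>}"

definition local_frame :: "('x::topological_space, 'e::complex_model) chart set \<Rightarrow> ('x, 'l) line_bundle \<Rightarrow>
    'x set \<Rightarrow> ('x \<Rightarrow> 'l) \<Rightarrow> bool" where
  "local_frame A E U e \<longleftrightarrow> open U \<and> holo_section A E U e \<and> (\<forall>p\<in>U. e p \<in> nonzero E)"

definition line_bundle_iso :: "('x, 'e::complex_model) chart set \<Rightarrow> ('x, 'l) line_bundle \<Rightarrow>
    ('x, 'k) line_bundle \<Rightarrow> ('l \<Rightarrow> 'k) \<Rightarrow> bool" where
  "line_bundle_iso A E F \<Phi> \<longleftrightarrow> bij_betw \<Phi> (Tot E) (Tot F) \<and>
     (\<forall>u\<in>Tot E. Proj F (\<Phi> u) = Proj E u \<and> (\<forall>c. \<Phi> (Smul E c u) = Smul F c (\<Phi> u)) \<and>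
        (\<forall>v\<in>fiber E (Proj E u). \<Phi> (Add E u v) = Add F (\<Phi> u) (\<Phi> v))) \<and>
     (\<forall>(U, e)\<in>Frames E. \<forall>(V, f)\<in>Frames F. holo_fun A (U \<inter> V) (\<lambda>p. ratio F (\<Phi> (e p)) (f p)))"

definition product_bundle :: "('x, 'x \<times> complex) line_bundle" where
  "product_bundle = \<lparr>Tot = UNIV, Proj = fst, Add = (\<lambda>u v. (fst u, snd u + snd v)),
     Smul = (\<lambda>c u. (fst u, c * snd u)), Frames = {(UNIV, \<lambda>p. (p, 1))}\<rparr>"

definition trivial_bundle :: "('x, 'e::complex_model) chart set \<Rightarrow> ('x, 'l) line_bundle \<Rightarrow> bool" where
  "trivial_bundle A E \<longleftrightarrow> (\<exists>\<Phi>. line_bundle_iso A E product_bundle \<Phi>)"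

definition base_point_free :: "('x, 'e::complex_model) chart set \<Rightarrow> ('x, 'l) line_bundle \<Rightarrow> bool" where
  "base_point_free A E \<longleftrightarrow> (\<forall>p. \<exists>\<sigma>\<in>H0 A E. \<sigma> p \<in> nonzero E)"

subsection \<open>Tensor products\<close>

text \<open>An element \<open>t\<close> of a tensor product of lines is encoded by its coefficients with respect to all
  choices of nonzero vectors: the value of \<open>t\<close> at \<open>(e, f)\<close> is the number \<open>c\<close> with
  \<open>t = c (e \<otimes> f)\<close>. The base point is recorded alongside.\<close>

definition tens :: "('x, 'l) line_bundle \<Rightarrow> ('x, 'k) line_bundle \<Rightarrow> 'l \<Rightarrow> 'k \<Rightarrow> 'x \<times> ('l \<times> 'k \<Rightarrow> complex)" where
  "tens E F u v = (Proj E u, \<lambda>(e, f).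
     if e \<in> nonzero E \<and> f \<in> nonzero F \<and> Proj E e = Proj E u \<and> Proj F f = Proj E u
     then ratio E u e * ratio F v f else 0)"

definition tensor_bundle :: "('x, 'l) line_bundle \<Rightarrow> ('x, 'k) line_bundle \<Rightarrow>
    ('x, 'x \<times> ('l \<times> 'k \<Rightarrow> complex)) line_bundle" where
  "tensor_bundle E F = \<lparr>Tot = {tens E F u v | u v. u \<in> Tot E \<and> v \<in> fiber F (Proj E u)}, Proj = fst,
     Add = (\<lambda>t t'. (fst t, \<lambda>e. snd t e + snd t' e)), Smul = (\<lambda>c t. (fst t, \<lambda>e. c * snd t e)),
     Frames = {(U \<inter> V, \<lambda>p. tens E F (e p) (f p)) | U e V f. (U, e) \<in> Frames E \<and> (V, f) \<in> Frames F}\<rparr>"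

text \<open>\<open>tens_list L s p u\<close> is \<open>u 0 \<otimes> \<dots> \<otimes> u (s - 1)\<close> at the point \<open>p\<close>.\<close>

definition tens_list :: "(nat \<Rightarrow> ('x, 'l) line_bundle) \<Rightarrow> nat \<Rightarrow> 'x \<Rightarrow> (nat \<Rightarrow> 'l) \<Rightarrow>
    'x \<times> ((nat \<Rightarrow> 'l) \<Rightarrow> complex)" where
  "tens_list L s p u = (p, \<lambda>e. if \<forall>i<s. e i \<in> nonzero (L i) \<and> Proj (L i) (e i) = p
     then \<Prod>i<s. ratio (L i) (u i) (e i) else 0)"

definition tensor_list_bundle :: "(nat \<Rightarrow> ('x, 'l) line_bundle) \<Rightarrow> nat \<Rightarrow>
    ('x, 'x \<times> ((nat \<Rightarrow> 'l) \<Rightarrow> complex)) line_bundle" where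
  "tensor_list_bundle L s = \<lparr>
     Tot = {(p, \<lambda>e. c * snd (tens_list L s p u) e) | p c u. \<forall>i<s. u i \<in> fiber (L i) p}, Proj = fst,
     Add = (\<lambda>t t'. (fst t, \<lambda>e. snd t e + snd t' e)), Smul = (\<lambda>c t. (fst t, \<lambda>e. c * snd t e)),
     Frames = {(\<Inter>i<s. U i, \<lambda>p. tens_list L s p (\<lambda>i. e i p)) | U e. \<forall>i<s. (U i, e i) \<in> Frames (L i)}\<rparr>"

subsection \<open>The canonical bundle\<close>

definition canonical_bundle :: "('x, 'n::{finite, linorder} cvec) chart set \<Rightarrow>
    ('x, 'x \<times> ('x, 'n cvec) tvec form) line_bundle" where
  "canonical_bundle A = \<lparr>Tot = {(p, \<alpha>) | p \<alpha>. \<alpha> \<in> alt_forms CARD('n) (tangent A p)}, Proj = fst,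
     Add = (\<lambda>\<eta> \<eta>'. (fst \<eta>, \<lambda>u. snd \<eta> u + snd \<eta>' u)), Smul = (\<lambda>c \<eta>. (fst \<eta>, \<lambda>u. c * snd \<eta> u)),
     Frames = {(fst c, \<lambda>p. (p, coord_form c (tangent A p) 0 CARD('n))) | c. c \<in> A}\<rparr>"

subsection \<open>Line bundles associated to the principal bundle of nonzero vectors\<close>

definition holo_character :: "(complex \<Rightarrow> complex) \<Rightarrow> bool" where
  "holo_character chi \<longleftrightarrow> chi holomorphic_on (- {0}) \<and> (\<forall>h. h \<noteq> 0 \<longrightarrow> chi h \<noteq> 0) \<and>
     (\<forall>h k. h \<noteq> 0 \<longrightarrow> k \<noteq> 0 \<longrightarrow> chi (h * k) = chi h * chi k)"

text \<open>\<open>assoc_class K chi m v\<close> is the class \<open>[m, v]\<close>, i.e. the orbit of \<open>(m, v)\<close> under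
  \<open>h \<cdot> (m, v) = (h\<^sup>-\<^sup>1 m, chi(h) v)\<close>.\<close>

definition assoc_class :: "('x, 'k) line_bundle \<Rightarrow> (complex \<Rightarrow> complex) \<Rightarrow> 'k \<Rightarrow> complex \<Rightarrow> ('k \<times> complex) set" where
  "assoc_class K chi m v = {(Smul K (inverse h) m, chi h * v) | h. h \<noteq> 0}"

definition assoc_bundle :: "('x, 'k) line_bundle \<Rightarrow> (complex \<Rightarrow> complex) \<Rightarrow> ('x, ('k \<times> complex) set) line_bundle" where
  "assoc_bundle K chi = \<lparr>Tot = {assoc_class K chi m v | m v. m \<in> nonzero K},
     Proj = (\<lambda>q. THE p. \<exists>m v. (m, v) \<in> q \<and> Proj K m = p),
     Add = (\<lambda>q q'. {(m, v + v') | m v v'. (m, v) \<in> q \<and> (m, v') \<in> q'}),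
     Smul = (\<lambda>c q. {(m, c * v) | m v. (m, v) \<in> q}),
     Frames = {(U, \<lambda>p. assoc_class K chi (k p) 1) | U k. (U, k) \<in> Frames K}\<rparr>"

text \<open>The function \<open>f\<close> with \<open>\<sigma>(x) = [m, f(m)]\<close> for \<open>m\<close> over \<open>x\<close>.\<close>

definition assoc_fun :: "('x, 'k) line_bundle \<Rightarrow> (complex \<Rightarrow> complex) \<Rightarrow> ('x \<Rightarrow> ('k \<times> complex) set) \<Rightarrow> 'k \<Rightarrow> complex" where
  "assoc_fun K chi \<sigma> m = (THE f. \<sigma> (Proj K m) = assoc_class K chi m f)"

text \<open>The isomorphism \<open>L + K \<rightarrow> L\<^bsub>chi chi\<^sub>1\<^esub>\<close> obtained from \<open>\<Phi>: L \<rightarrow> L\<^bsub>chi\<^esub>\<close> and the canonical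
  isomorphism \<open>K = L\<^bsub>chi\<^sub>1\<^esub>\<close>, \<open>b m \<mapsto> [m, b]\<close>.\<close>

definition assoc_twist :: "('x, 'l) line_bundle \<Rightarrow> ('x, 'k) line_bundle \<Rightarrow> (complex \<Rightarrow> complex) \<Rightarrow>
    ('l \<Rightarrow> ('k \<times> complex) set) \<Rightarrow> 'x \<times> ('l \<times> 'k \<Rightarrow> complex) \<Rightarrow> ('k \<times> complex) set" where
  "assoc_twist E K chi \<Phi> t = (THE q. \<exists>u m a b. u \<in> Tot E \<and> m \<in> nonzero K \<and> Proj K m = Proj E u \<and>
     t = tens E K u (Smul K b m) \<and> \<Phi> u = assoc_class K chi m a \<and>
     q = assoc_class K (\<lambda>h. chi h * h) m (a * b))"

subsection \<open>Equivariant structures\<close>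

text \<open>Charts of the total space of a line bundle.\<close>

definition total_atlas :: "('x, 'e) chart set \<Rightarrow> ('x, 'l) line_bundle \<Rightarrow> ('l, complex \<times> 'e) chart set" where
  "total_atlas A E = {({u \<in> Tot E. Proj E u \<in> U \<inter> V}, \<lambda>u. (ratio E u (e (Proj E u)), \<phi> (Proj E u))) | U \<phi> V e.
     (U, \<phi>) \<in> A \<and> (V, e) \<in> Frames E}"

definition equivariant_structure :: "('x, 'e::complex_model) chart set \<Rightarrow> ('x \<Rightarrow> 'x) set \<Rightarrow>
    ('x \<Rightarrow> 'x, 'm::complex_model) chart set \<Rightarrow> ('x, 'l) line_bundle \<Rightarrow> (('x \<Rightarrow> 'x) \<Rightarrow> 'l \<Rightarrow> 'l) \<Rightarrow> bool" where
  "equivariant_structure A G AG E \<rho> \<longleftrightarrow>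
     (\<forall>u\<in>Tot E. \<rho> id u = u) \<and>
     (\<forall>g\<in>G. \<forall>h\<in>G. \<forall>u\<in>Tot E. \<rho> (g \<circ> h) u = \<rho> g (\<rho> h u)) \<and>
     (\<forall>g\<in>G. \<forall>u\<in>Tot E. \<rho> g u \<in> fiber E (g (Proj E u)) \<and> (\<forall>c. \<rho> g (Smul E c u) = Smul E c (\<rho> g u)) \<and>
        (\<forall>v\<in>fiber E (Proj E u). \<rho> g (Add E u v) = Add E (\<rho> g u) (\<rho> g v))) \<and>
     mholo (prod_atlas AG (total_atlas A E)) (total_atlas A E) (G \<times> Tot E) (\<lambda>(g, u). \<rho> g u)"

definition canonical_act :: "('x \<Rightarrow> 'x) \<Rightarrow> 'x \<times> ('x, 'e) tvec form \<Rightarrow> 'x \<times> ('x, 'e) tvec form" where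
  "canonical_act g \<eta> = (g (fst \<eta>), push_form g (snd \<eta>))"

definition tens_act :: "('x, 'l) line_bundle \<Rightarrow> ('x, 'k) line_bundle \<Rightarrow> ('l \<Rightarrow> 'l) \<Rightarrow> ('k \<Rightarrow> 'k) \<Rightarrow>
    'x \<times> ('l \<times> 'k \<Rightarrow> complex) \<Rightarrow> 'x \<times> ('l \<times> 'k \<Rightarrow> complex)" where
  "tens_act E F a b t = (THE w. \<exists>u v. u \<in> Tot E \<and> v \<in> fiber F (Proj E u) \<and>
     t = tens E F u v \<and> w = tens E F (a u) (b v))"

definition tens_list_act :: "(nat \<Rightarrow> ('x, 'l) line_bundle) \<Rightarrow> nat \<Rightarrow> ('x \<Rightarrow> 'x) \<Rightarrow> (nat \<Rightarrow> 'l \<Rightarrow> 'l) \<Rightarrow>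
    'x \<times> ((nat \<Rightarrow> 'l) \<Rightarrow> complex) \<Rightarrow> 'x \<times> ((nat \<Rightarrow> 'l) \<Rightarrow> complex)" where
  "tens_list_act L s g a t = (THE w. \<exists>p c u. (\<forall>i<s. u i \<in> fiber (L i) p) \<and>
     t = Smul (tensor_list_bundle L s) c (tens_list L s p u) \<and>
     w = Smul (tensor_list_bundle L s) c (tens_list L s (g p) (\<lambda>i. a i (u i))))"

definition section_act :: "('x \<Rightarrow> 'x) \<Rightarrow> ('l \<Rightarrow> 'l) \<Rightarrow> ('x \<Rightarrow> 'l) \<Rightarrow> ('x \<Rightarrow> 'l)" where
  "section_act g a \<sigma> = a \<circ> \<sigma> \<circ> inv g"


section \<open>The family of complete intersections\<close>

text \<open>Tuples \<open>\<sigma> = (\<sigma> 0, \<dots>, \<sigma> (s - 1))\<close> are extensional functions on \<open>{..<s}\<close>.\<close>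

definition Vstar :: "('x, 'e::complex_model) chart set \<Rightarrow> (nat \<Rightarrow> ('x, 'l) line_bundle) \<Rightarrow> nat \<Rightarrow>
    (nat \<Rightarrow> 'x \<Rightarrow> 'l) set" where
  "Vstar A L s = PiE {..<s} (\<lambda>i. H0 A (L i))"

definition Yhyp :: "('x, 'l) line_bundle \<Rightarrow> ('x \<Rightarrow> 'l) \<Rightarrow> 'x set" where
  "Yhyp E \<sigma> = {p. \<sigma> p \<notin> nonzero E}"

definition Yset :: "(nat \<Rightarrow> ('x, 'l) line_bundle) \<Rightarrow> nat \<Rightarrow> (nat \<Rightarrow> 'x \<Rightarrow> 'l) \<Rightarrow> 'x set" where
  "Yset L s \<sigma> = (\<Inter>i<s. Yhyp (L i) (\<sigma> i))"

definition polar_divisor :: "(nat \<Rightarrow> ('x, 'l) line_bundle) \<Rightarrow> nat \<Rightarrow> (nat \<Rightarrow> 'x \<Rightarrow> 'l) \<Rightarrow> 'x set" where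
  "polar_divisor L s \<sigma> = (\<Union>i<s. Yhyp (L i) (\<sigma> i))"

text \<open>Smoothness of codimension \<open>s\<close> of the scheme-theoretic intersection: the differentials of
  \<open>\<sigma> 0, \<dots>, \<sigma> (s - 1)\<close>, computed in arbitrary local frames, are linearly independent along it.\<close>

definition smooth_codim :: "('x, 'e::complex_model) chart set \<Rightarrow> (nat \<Rightarrow> ('x, 'l) line_bundle) \<Rightarrow> nat \<Rightarrow>
    (nat \<Rightarrow> 'x \<Rightarrow> 'l) \<Rightarrow> bool" where
  "smooth_codim A L s \<sigma> \<longleftrightarrow> (\<forall>p\<in>Yset L s \<sigma>. \<forall>U e. (\<forall>i<s. (U i, e i) \<in> Frames (L i) \<and> p \<in> U i) \<longrightarrow>
     (\<forall>a. (\<forall>v\<in>tangent A p. (\<Sum>i<s. a i * differential A (\<lambda>q. ratio (L i) (\<sigma> i q) (e i q)) p v) = 0) \<longrightarrow>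
       (\<forall>i<s. a i = 0)))"

definition Bset :: "('x, 'e::complex_model) chart set \<Rightarrow> (nat \<Rightarrow> ('x, 'l) line_bundle) \<Rightarrow> nat \<Rightarrow>
    (nat \<Rightarrow> 'x \<Rightarrow> 'l) set" where
  "Bset A L s = {\<sigma> \<in> Vstar A L s. smooth_codim A L s \<sigma>}"

definition tangentY :: "('x, 'e::complex_model) chart set \<Rightarrow> (nat \<Rightarrow> ('x, 'l) line_bundle) \<Rightarrow> nat \<Rightarrow>
    (nat \<Rightarrow> 'x \<Rightarrow> 'l) \<Rightarrow> 'x \<Rightarrow> ('x, 'e) tvec set" where
  "tangentY A L s \<sigma> p = {v \<in> tangent A p. \<forall>i<s. \<forall>(U, e)\<in>Frames (L i). p \<in> U \<longrightarrow>
     differential A (\<lambda>q. ratio (L i) (\<sigma> i q) (e q)) p v = 0}"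

text \<open>\<open>H\<^sup>0(Y\<^sub>\<sigma>, K)\<close>: holomorphic forms of top degree on \<open>Y\<^sub>\<sigma>\<close>, extended by 0 to points outside \<open>Y\<^sub>\<sigma>\<close>.
  Holomorphy is tested in the charts of \<open>Y\<^sub>\<sigma>\<close> given by the last \<open>d - s\<close> coordinates of those charts of
  \<open>X\<close> whose first \<open>s\<close> coordinates cut out \<open>Y\<^sub>\<sigma>\<close>.\<close>

definition H0KY :: "('x, 'n::{finite, linorder} cvec) chart set \<Rightarrow> (nat \<Rightarrow> ('x, 'l) line_bundle) \<Rightarrow>
    nat \<Rightarrow> (nat \<Rightarrow> 'x \<Rightarrow> 'l) \<Rightarrow> ('x \<Rightarrow> ('x, 'n cvec) tvec form) set" where
  "H0KY A L s \<sigma> = {\<alpha>.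
     (\<forall>p. p \<notin> Yset L s \<sigma> \<longrightarrow> \<alpha> p = (\<lambda>_. 0)) \<and>
     (\<forall>p\<in>Yset L s \<sigma>. \<alpha> p \<in> alt_forms (CARD('n) - s) (tangentY A L s \<sigma> p)) \<and>
     (\<forall>(U, z)\<in>A. Yset L s \<sigma> \<inter> U = {p \<in> U. \<forall>i<s. z p $ coord i = 0} \<longrightarrow>
        holo (\<lambda>w. let p = inv_into U z w in \<alpha> p (\<lambda>j. coord_vec A (U, z) (s + j) p)) (z ` (Yset L s \<sigma> \<inter> U)))}"

definition hdim :: "('x \<Rightarrow> 't form) set \<Rightarrow> nat" where
  "hdim = vector_space.dim (\<lambda>(c::complex) \<alpha> p u. c * \<alpha> p u)"

text \<open>Linear coordinates \<open>\<Psi>\<close> on the finite-dimensional vector space \<open>V\<^sup>*\<close>; they provide its topology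
  and complex structure.\<close>

definition linear_coords :: "('x, 'e::complex_model) chart set \<Rightarrow> (nat \<Rightarrow> ('x, 'l) line_bundle) \<Rightarrow> nat \<Rightarrow>
    ('v::complex_model \<Rightarrow> nat \<Rightarrow> 'x \<Rightarrow> 'l) \<Rightarrow> bool" where
  "linear_coords A L s \<Psi> \<longleftrightarrow> bij_betw \<Psi> UNIV (Vstar A L s) \<and>
     (\<forall>v w. \<forall>i<s. \<forall>p. \<Psi> (v + w) i p = Add (L i) (\<Psi> v i p) (\<Psi> w i p)) \<and>
     (\<forall>c v. \<forall>i<s. \<forall>p. \<Psi> (c *c v) i p = Smul (L i) c (\<Psi> v i p))"

text \<open>Charts \<open>(v, x) \<mapsto> (v, \<zeta>(v, x))\<close> on open subsets \<open>N\<close> of \<open>B \<times> X\<close> over \<open>B\<close> in which the total space of the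
  family \<open>\<Y>\<close> is given by the vanishing of the first \<open>s\<close> components of \<open>\<zeta>\<close>.\<close>

definition family_chart :: "('x::topological_space, 'n::{finite, linorder} cvec) chart set \<Rightarrow>
    (nat \<Rightarrow> ('x, 'l) line_bundle) \<Rightarrow> nat \<Rightarrow> ('v::complex_model \<Rightarrow> nat \<Rightarrow> 'x \<Rightarrow> 'l) \<Rightarrow>
    ('v \<times> 'x) set \<Rightarrow> ('v \<times> 'x \<Rightarrow> 'n cvec) \<Rightarrow> bool" where
  "family_chart A L s \<Psi> N \<zeta> \<longleftrightarrow> open N \<and> \<Psi> ` fst ` N \<subseteq> Bset A L s \<and>
     mholo (prod_atlas {(UNIV, id)} A) {(UNIV, id)} N \<zeta> \<and>
     (\<forall>v\<in>fst ` N. ({x. (v, x) \<in> N}, \<lambda>x. \<zeta> (v, x)) \<in> A) \<and>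
     (\<forall>(v, x)\<in>N. x \<in> Yset L s (\<Psi> v) \<longleftrightarrow> (\<forall>i<s. \<zeta> (v, x) $ coord i = 0))"

text \<open>The sections of the direct image of the relative canonical bundle of \<open>\<Y>\<close> over \<open>B\<close>, i.e. of the
  bundle with fiber \<open>H\<^sup>0(Y\<^sub>\<sigma>, K)\<close> at \<open>\<sigma>\<close>: families of forms whose coefficient in the
  relative coordinates \<open>\<zeta>\<^bsub>s\<^esub>, \<dots>, \<zeta>\<^bsub>d - 1\<^esub>\<close> depends holomorphically on \<open>(\<sigma>, x) \<in> \<Y>\<close>.\<close>

definition H0Htop :: "('x::topological_space, 'n::{finite, linorder} cvec) chart set \<Rightarrow>
    (nat \<Rightarrow> ('x, 'l) line_bundle) \<Rightarrow> nat \<Rightarrow> ('v::complex_model \<Rightarrow> nat \<Rightarrow> 'x \<Rightarrow> 'l) \<Rightarrow>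
    ((nat \<Rightarrow> 'x \<Rightarrow> 'l) \<Rightarrow> 'x \<Rightarrow> ('x, 'n cvec) tvec form) set" where
  "H0Htop A L s \<Psi> = {r \<in> PiE (Bset A L s) (H0KY A L s). \<forall>N \<zeta>. family_chart A L s \<Psi> N \<zeta> \<longrightarrow>
     holo (\<lambda>(v, w). let c = ({x. (v, x) \<in> N}, \<lambda>x. \<zeta> (v, x)); p = inv_into (fst c) (snd c) w in
             r (\<Psi> v) p (\<lambda>j. coord_vec A c (s + j) p))
       {(v, \<zeta> (v, x)) | v x. (v, x) \<in> N \<and> x \<in> Yset L s (\<Psi> v)}}"

text \<open>\<open>\<Gamma>\<^sub>g\<close> on \<open>V\<^sup>*\<close>, for lifts \<open>\<rho> i\<close> of the action to \<open>L i\<close>, and the induced action on sections of the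
  bundle over \<open>B\<close>: the value of \<open>g \<cdot> r\<close> at \<open>\<sigma>\<close> is the image of \<open>r (\<Gamma>\<^sub>g\<^sup>-\<^sup>1 \<sigma>)\<close> under \<open>g\<close>.\<close>

definition Vstar_act :: "nat \<Rightarrow> (nat \<Rightarrow> ('x \<Rightarrow> 'x) \<Rightarrow> 'l \<Rightarrow> 'l) \<Rightarrow> ('x \<Rightarrow> 'x) \<Rightarrow> (nat \<Rightarrow> 'x \<Rightarrow> 'l) \<Rightarrow> (nat \<Rightarrow> 'x \<Rightarrow> 'l)" where
  "Vstar_act s \<rho> g \<sigma> = (\<lambda>i\<in>{..<s}. section_act g (\<rho> i g) (\<sigma> i))"

definition Htop_act :: "('x, 'n::{finite, linorder} cvec) chart set \<Rightarrow> (nat \<Rightarrow> ('x, 'l) line_bundle) \<Rightarrow> nat \<Rightarrow>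
    (nat \<Rightarrow> ('x \<Rightarrow> 'x) \<Rightarrow> 'l \<Rightarrow> 'l) \<Rightarrow> ('x \<Rightarrow> 'x) \<Rightarrow>
    ((nat \<Rightarrow> 'x \<Rightarrow> 'l) \<Rightarrow> 'x \<Rightarrow> ('x, 'n cvec) tvec form) \<Rightarrow>
    ((nat \<Rightarrow> 'x \<Rightarrow> 'l) \<Rightarrow> 'x \<Rightarrow> ('x, 'n cvec) tvec form)" where
  "Htop_act A L s \<rho> g r = (\<lambda>\<sigma>\<in>Bset A L s. \<lambda>p. push_form g (r (Vstar_act s \<rho> (inv g) \<sigma>) (inv g p)))"


section \<open>The global Poincare residue map\<close>

abbreviation LK :: "('x, 'n::{finite, linorder} cvec) chart set \<Rightarrow> (nat \<Rightarrow> ('x, 'l) line_bundle) \<Rightarrow> nat \<Rightarrow>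
    ('x, 'x \<times> (('x \<times> ((nat \<Rightarrow> 'l) \<Rightarrow> complex)) \<times> ('x \<times> ('x, 'n cvec) tvec form) \<Rightarrow> complex)) line_bundle" where
  "LK A L s \<equiv> tensor_bundle (tensor_list_bundle L s) (canonical_bundle A)"

abbreviation LK_act where
  "LK_act A L s \<rho> g \<equiv> tens_act (tensor_list_bundle L s) (canonical_bundle A)
     (tens_list_act L s g (\<lambda>i. \<rho> i g)) (canonical_act g)"

text \<open>Restriction of \<open>\<tau>\<close> to \<open>Y\<^sub>\<sigma>\<close> followed by the adjunction isomorphism
  \<open>g e\<^sub>1 \<otimes> \<dots> \<otimes> e\<^sub>s \<otimes> dz\<^sub>1 \<and> \<dots> \<and> dz\<^sub>d \<mapsto> g dz\<^bsub>s+1\<^esub> \<and> \<dots> \<and> dz\<^sub>d\<close>, where \<open>\<sigma>\<^sub>i = z\<^sub>i e\<^sub>i\<close>.\<close>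

definition R_at :: "('x::topological_space, 'n::{finite, linorder} cvec) chart set \<Rightarrow>
    (nat \<Rightarrow> ('x, 'l) line_bundle) \<Rightarrow> nat \<Rightarrow> (nat \<Rightarrow> 'x \<Rightarrow> 'l) \<Rightarrow>
    ('x \<Rightarrow> 'x \<times> (('x \<times> ((nat \<Rightarrow> 'l) \<Rightarrow> complex)) \<times> ('x \<times> ('x, 'n cvec) tvec form) \<Rightarrow> complex)) \<Rightarrow>
    'x \<Rightarrow> ('x, 'n cvec) tvec form" where
  "R_at A L s \<sigma> \<tau> p = (if p \<in> Yset L s \<sigma> then
     (THE \<alpha>. \<forall>U z e g. (U, z) \<in> A \<and> p \<in> U \<and>
        (\<forall>i<s. local_frame A (L i) U (e i) \<and> (\<forall>q\<in>U. \<sigma> i q = Smul (L i) (z q $ coord i) (e i q))) \<and>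
        \<tau> p = Smul (LK A L s) g (tens (tensor_list_bundle L s) (canonical_bundle A)
                 (tens_list L s p (\<lambda>i. e i p)) (p, coord_form (U, z) (tangent A p) 0 CARD('n))) \<longrightarrow>
        \<alpha> = (\<lambda>u. g * coord_form (U, z) (tangentY A L s \<sigma> p) s (CARD('n) - s) u))
     else (\<lambda>_. 0))"

definition R_map :: "('x::topological_space, 'n::{finite, linorder} cvec) chart set \<Rightarrow>
    (nat \<Rightarrow> ('x, 'l) line_bundle) \<Rightarrow> nat \<Rightarrow>
    ('x \<Rightarrow> 'x \<times> (('x \<times> ((nat \<Rightarrow> 'l) \<Rightarrow> complex)) \<times> ('x \<times> ('x, 'n cvec) tvec form) \<Rightarrow> complex)) \<Rightarrow>
    (nat \<Rightarrow> 'x \<Rightarrow> 'l) \<Rightarrow> 'x \<Rightarrow> ('x, 'n cvec) tvec form" where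
  "R_map A L s \<tau> = (\<lambda>\<sigma>\<in>Bset A L s. R_at A L s \<sigma> \<tau>)"

subsection \<open>Poincare residues\<close>

text \<open>\<open>H\<^sup>0(\<Omega>\<^sup>d\<^sub>X(\<Union>\<^sub>i Y\<^bsub>\<sigma>\<^sub>i\<^esub>))\<close>: \<open>d\<close>-forms on the complement of \<open>\<Union>\<^sub>i Y\<^bsub>\<sigma>\<^sub>i\<^esub>\<close>
  (extended by 0) which become holomorphic after multiplication with local equations of all
  \<open>Y\<^bsub>\<sigma>\<^sub>i\<^esub>\<close>.\<close>

definition polar_forms :: "('x::topological_space, 'n::{finite, linorder} cvec) chart set \<Rightarrow>
    (nat \<Rightarrow> ('x, 'l) line_bundle) \<Rightarrow> nat \<Rightarrow> (nat \<Rightarrow> 'x \<Rightarrow> 'l) \<Rightarrow>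
    ('x \<Rightarrow> ('x, 'n cvec) tvec form) set" where
  "polar_forms A L s \<sigma> = {\<beta>.
     (\<forall>p\<in>polar_divisor L s \<sigma>. \<beta> p = (\<lambda>_. 0)) \<and>
     (\<forall>c\<in>A. \<forall>e. (\<forall>i<s. local_frame A (L i) (fst c) (e i)) \<longrightarrow>
        (\<exists>g. holo_fun A (fst c) g \<and> (\<forall>p\<in>fst c - polar_divisor L s \<sigma>. \<beta> p =
           (\<lambda>u. g p / (\<Prod>i<s. ratio (L i) (\<sigma> i p) (e i p)) * coord_form c (tangent A p) 0 CARD('n) u))))}"

definition local_equation :: "('x::topological_space, 'e::complex_model) chart set \<Rightarrow> ('x, 'l) line_bundle \<Rightarrow>
    ('x \<Rightarrow> 'l) \<Rightarrow> 'x set \<Rightarrow> ('x \<Rightarrow> complex) \<Rightarrow> bool" where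
  "local_equation A E \<sigma> U f \<longleftrightarrow> (\<exists>e. local_frame A E U e \<and> (\<forall>p\<in>U. \<sigma> p = Smul E (f p) (e p)))"

definition Res :: "('x::topological_space, 'n::{finite, linorder} cvec) chart set \<Rightarrow>
    (nat \<Rightarrow> ('x, 'l) line_bundle) \<Rightarrow> nat \<Rightarrow> (nat \<Rightarrow> 'x \<Rightarrow> 'l) \<Rightarrow>
    ('x \<Rightarrow> ('x, 'n cvec) tvec form) \<Rightarrow> ('x \<Rightarrow> ('x, 'n cvec) tvec form)" where
  "Res A L s \<sigma> \<beta> = (THE r. r \<in> H0KY A L s \<sigma> \<and>
     (\<forall>(U, z)\<in>A. \<forall>g. (\<forall>i<s. local_equation A (L i) (\<sigma> i) U (\<lambda>p. z p $ coord i)) \<and> holo_fun A U g \<and>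
        (\<forall>p\<in>U - polar_divisor L s \<sigma>. \<beta> p =
           (\<lambda>u. g p / (\<Prod>i<s. z p $ coord i) * coord_form (U, z) (tangent A p) 0 CARD('n) u)) \<longrightarrow>
        (\<forall>p\<in>U \<inter> Yset L s \<sigma>. r p = (\<lambda>u. g p * coord_form (U, z) (tangentY A L s \<sigma> p) s (CARD('n) - s) u))))"

subsection \<open>The form on the total space of the canonical bundle\<close>

text \<open>The coordinates \<open>(z\<^sub>w, w)\<close> on the canonical bundle induced by a chart \<open>w\<close>.\<close>

definition K_chart :: "('x, 'n::{finite, linorder} cvec) chart set \<Rightarrow> ('x, 'n cvec) chart \<Rightarrow>
    ('x \<times> ('x, 'n cvec) tvec form, complex \<times> 'n cvec) chart" where
  "K_chart A c = ({\<eta> \<in> Tot (canonical_bundle A). fst \<eta> \<in> fst c},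
     \<lambda>\<eta>. (snd \<eta> (\<lambda>j. coord_vec A c j (fst \<eta>)), snd c (fst \<eta>)))"

definition K_atlas :: "('x, 'n::{finite, linorder} cvec) chart set \<Rightarrow>
    ('x \<times> ('x, 'n cvec) tvec form, complex \<times> 'n cvec) chart set" where
  "K_atlas A = K_chart A ` A"

text \<open>\<open>dz\<^sub>w \<and> dw\<^sub>1 \<and> \<dots> \<and> dw\<^sub>d\<close> at \<open>\<eta>\<close>, which does not depend on the chart \<open>w\<close>.\<close>

definition omega_hat :: "('x, 'n::{finite, linorder} cvec) chart set \<Rightarrow> 'x \<times> ('x, 'n cvec) tvec form \<Rightarrow>
    ('x \<times> ('x, 'n cvec) tvec form, complex \<times> 'n cvec) tvec form" where
  "omega_hat A \<eta> W = (let c = K_chart A (chart_at A (fst \<eta>)) in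
     leibniz_det (Suc CARD('n)) (\<lambda>i j. case i of 0 \<Rightarrow> fst (W j c) | Suc i' \<Rightarrow> snd (W j c) $ coord i'))"

definition euler_field :: "('x, 'n::{finite, linorder} cvec) chart set \<Rightarrow> 'x \<times> ('x, 'n cvec) tvec form \<Rightarrow>
    ('x \<times> ('x, 'n cvec) tvec form, complex \<times> 'n cvec) tvec" where
  "euler_field A \<eta> = (\<lambda>c. if c \<in> K_atlas A \<and> \<eta> \<in> fst c then (fst (snd c \<eta>), 0) else 0)"

definition contract :: "'t \<Rightarrow> 't form \<Rightarrow> 't form" where
  "contract x \<alpha> = (\<lambda>u. \<alpha> (case_nat x u))"

text \<open>The differential of the projection from the canonical bundle to the manifold.\<close>

definition K_dproj :: "('x, 'n::{finite, linorder} cvec) chart set \<Rightarrow> 'x \<times> ('x, 'n cvec) tvec form \<Rightarrow>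
    ('x \<times> ('x, 'n cvec) tvec form, complex \<times> 'n cvec) tvec \<Rightarrow> ('x, 'n cvec) tvec" where
  "K_dproj A \<eta> W = (\<lambda>c. if c \<in> A \<and> fst \<eta> \<in> fst c then snd (W (K_chart A c)) else 0)"

text \<open>\<open>\<tau> \<Omega>\<^sub>\<sigma>\<close>: the form on the complement of \<open>\<Union>\<^sub>i Y\<^bsub>\<sigma>\<^sub>i\<^esub>\<close> whose pullback to the nonzero vectors \<open>m\<close> in the
  canonical bundle is \<open>\<tau> \<iota>\<^bsub>x\<^sub>0\<^esub> \<omega> / (\<sigma>\<^sub>1 \<cdots> \<sigma>\<^sub>s)\<close>. Here \<open>\<Phi>\<close> is the identification of \<open>L\<close> with \<open>L\<^bsub>chi\<^esub>\<close>.\<close>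

definition tau_Omega :: "('x::topological_space, 'n::{finite, linorder} cvec) chart set \<Rightarrow>
    (nat \<Rightarrow> ('x, 'l) line_bundle) \<Rightarrow> nat \<Rightarrow> (complex \<Rightarrow> complex) \<Rightarrow>
    ('x \<times> ((nat \<Rightarrow> 'l) \<Rightarrow> complex) \<Rightarrow> (('x \<times> ('x, 'n cvec) tvec form) \<times> complex) set) \<Rightarrow>
    ('x \<Rightarrow> 'x \<times> (('x \<times> ((nat \<Rightarrow> 'l) \<Rightarrow> complex)) \<times> ('x \<times> ('x, 'n cvec) tvec form) \<Rightarrow> complex)) \<Rightarrow>
    (nat \<Rightarrow> 'x \<Rightarrow> 'l) \<Rightarrow> 'x \<Rightarrow> ('x, 'n cvec) tvec form" where
  "tau_Omega A L s chi \<Phi> \<tau> \<sigma> p = (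
     let K = canonical_bundle A;
         f\<tau> = assoc_fun K (\<lambda>h. chi h * h) (\<lambda>q. assoc_twist (tensor_list_bundle L s) K chi \<Phi> (\<tau> q));
         f\<sigma> = assoc_fun K chi (\<lambda>q. \<Phi> (tens_list L s q (\<lambda>i. \<sigma> i q)))
     in if p \<in> polar_divisor L s \<sigma> then (\<lambda>_. 0)
        else (THE \<beta>. \<beta> \<in> alt_forms CARD('n) (tangent A p) \<and>
          (\<forall>m\<in>nonzero K. Proj K m = p \<longrightarrow> (\<forall>W. (\<forall>j<CARD('n). W j \<in> tangent (K_atlas A) m) \<longrightarrow>
             \<beta> (\<lambda>j. K_dproj A m (W j)) =
               f\<tau> m * contract (euler_field A m) (omega_hat A m) W / f\<sigma> m))))"

end

theory Submission
  imports Defs "HOL-Complex_Analysis.Cauchy_Integral_Formula" "Jordan_Normal_Form.Determinant"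
begin

text \<open>
  Near a point of \<open>Y\<^sub>\<sigma>\<close> the inverse function theorem yields a chart \<open>z\<close> of \<open>X\<close> and frames \<open>e\<^sub>i\<close> with
  \<open>\<sigma>\<^sub>i = z\<^sub>i e\<^sub>i\<close>, and smoothness of \<open>Y\<^sub>\<sigma>\<close> is equivalent to the existence of such special data. The adjunction
  isomorphism computed in special data does not depend on them, because its value \<open>\<alpha>\<close> is determined by the
  frame-free formula \<open>\<alpha> \<and> d\<sigma>\<^sub>1 \<and> \<dots> \<and> d\<sigma>\<^sub>s = \<tau>\<close> on \<open>Y\<^sub>\<sigma>\<close>. In charts of the family \<open>Y\<close> the same formula
  expresses the coefficient of \<open>R\<^sub>\<sigma>(\<tau>)\<close> as a quotient of determinants depending holomorphically on \<open>\<sigma>\<close> and the point.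

  An element \<open>g\<close> of \<open>G\<close> maps special data for \<open>\<sigma>\<close> to special data for \<open>\<Gamma>\<^sub>g \<sigma>\<close> without changing the coefficient of
  \<open>\<tau>\<close>, whence equivariance.

  On \<open>K\<^sub>X\<^sup>\<times>\<close>, over a point where all \<open>\<sigma>\<^sub>i\<close> are nonzero, \<open>\<tau> = b \<sigma>\<^sub>1 \<otimes> \<dots> \<otimes> \<sigma>\<^sub>s \<otimes> m\<close> turns the quotient of the functions
  \<open>\<tau>\<close> and \<open>\<sigma>\<^sub>1 \<cdots> \<sigma>\<^sub>s\<close> at \<open>m\<close> into \<open>b\<close>, while the contraction of the canonical form with the Euler field at \<open>m\<close> is the pullback of
  \<open>m\<close> itself. So \<open>\<tau>\<Omega>\<^sub>\<sigma>\<close> is \<open>g dz\<^sub>1 \<and> \<dots> \<and> dz\<^sub>d / (z\<^sub>1 \<cdots> z\<^sub>s)\<close> in special data, where \<open>g\<close> is the coefficient of \<open>\<tau>\<close>, and its residue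
  is \<open>R\<^sub>\<sigma>(\<tau>)\<close>.
\<close>


text \<open>Holomorphy means complex differentiability at each point; continuity of the derivative
  is not part of it. Yet the residue coefficients contain first derivatives of sections and of
  coordinate changes, so derivatives must be shown to be holomorphic again, which is done by Cauchy
  estimates on complex lines. The same estimates supply the Lipschitz bound for the contraction
  argument of the inverse function theorem. The charts that test holomorphy on Y and on the family
  only cut out Y as a set and need not satisfy
  \<open>\<sigma>\<^sub>i = z\<^sub>i e\<^sub>i\<close>, so the adjunction formula cannot be read
  off in them. But there the last d - s coordinate directions stay inside Y, hence the differentials
  of the sections vanish on them; smoothness then makes the remaining s by s determinant nonzero,
  and the frame-free formula can be divided by it. A family chart is a chart of X for each fixed
  \<sigma> and holomorphic in the pair of \<sigma> and the point; that its inverse is also jointly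
  holomorphic is the reason for carrying a parameter through the inverse function theorem.\<close>

no_notation vec_index (infixl "$" 100)
unbundle no m_inv_syntax

section \<open>Holomorphy at a point\<close>

text \<open>In contrast to \<open>holo\<close>, the derivative is taken in a full neighbourhood,
  which makes it unique: \<open>frechet_derivative f (at x)\<close> then names it, and it is complex
  linear.\<close>

definition holo_at :: "('a::complex_model \<Rightarrow> 'b::complex_model) \<Rightarrow> 'a \<Rightarrow> bool" where
  "holo_at f x \<longleftrightarrow> (\<exists>f'. (f has_derivative f') (at x) \<and> (\<forall>c v. f' (c *c v) = c *c f' v))"

lemma cscale_nth [simp]: "(c *c x) $ i = c *c (x $ i)"
  by (simp add: cscale_vec_def)

lemma holo_atI: "(f has_derivative f') (at x) \<Longrightarrow> (\<And>c v. f' (c *c v) = c *c f' v) \<Longrightarrow> holo_at f x"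
  unfolding holo_at_def by (intro exI[of _ f'] conjI allI)

lemma holo_at_derivative:
  assumes "holo_at f x"
  shows "(f has_derivative frechet_derivative f (at x)) (at x)"
    and "frechet_derivative f (at x) (c *c v) = c *c frechet_derivative f (at x) v"
proof -
  obtain f' where f': "(f has_derivative f') (at x)" "\<forall>c v. f' (c *c v) = c *c f' v"
    using assms unfolding holo_at_def by (elim exE conjE)
  from frechet_derivative_at[OF f'(1)] f'
  show "(f has_derivative frechet_derivative f (at x)) (at x)"
    "frechet_derivative f (at x) (c *c v) = c *c frechet_derivative f (at x) v"
    by simp_all
qed

lemma holo_at_linear:
  assumes "holo_at f x"
  shows "bounded_linear (frechet_derivative f (at x))"
  using holo_at_derivative(1)[OF assms] by (rule has_derivative_bounded_linear)

lemma holo_on_open: "open S \<Longrightarrow> holo f S \<longleftrightarrow> (\<forall>x\<in>S. holo_at f x)"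
  unfolding holo_def holo_at_def
  by (intro ball_cong refl arg_cong[of _ _ Ex] ext) (metis at_within_open)

lemma holo_if_holo_at: "(\<And>x. x \<in> S \<Longrightarrow> holo_at f x) \<Longrightarrow> holo f S"
  unfolding holo_def holo_at_def by (meson has_derivative_at_withinI)

lemma has_derivative_nhds_cong:
  assumes "(f has_derivative f') (at x)" "eventually (\<lambda>y. f y = g y) (nhds x)"
  shows "(g has_derivative f') (at x)"
proof (rule has_derivative_transform_eventually[OF assms(1)])
  show "eventually (\<lambda>y. f y = g y) (at x)" "f x = g x"
    using assms(2) by (auto simp: eventually_at_filter elim: eventually_mono eventually_nhds_x_imp_x)
qed simp

lemma holo_at_cong:
  assumes "eventually (\<lambda>y. f y = g y) (nhds x)" "holo_at f x"
  shows "holo_at g x"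
proof -
  obtain f' where f': "(f has_derivative f') (at x)" "\<forall>c v. f' (c *c v) = c *c f' v"
    using assms(2) by (auto simp: holo_at_def)
  have "(g has_derivative f') (at x)"
    using f'(1) by (rule has_derivative_nhds_cong[OF _ assms(1)])
  then show ?thesis using f'(2) by (blast intro: holo_atI)
qed

lemma frechet_derivative_cong:
  assumes "eventually (\<lambda>y. f y = g y) (nhds x)"
  shows "frechet_derivative f (at x) = frechet_derivative g (at x)"
proof -
  have "(f has_derivative f') (at x) \<longleftrightarrow> (g has_derivative f') (at x)" for f'
  proof
    show "(g has_derivative f') (at x)" if "(f has_derivative f') (at x)"
      using that by (rule has_derivative_nhds_cong[OF _ assms])
    show "(f has_derivative f') (at x)" if "(g has_derivative f') (at x)"
      using that by (rule has_derivative_nhds_cong) (use assms in \<open>auto elim: eventually_mono\<close>)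
  qed
  then show ?thesis by (simp add: frechet_derivative_def)
qed

lemma holo_at_isCont: "holo_at f x \<Longrightarrow> isCont f x"
  using holo_at_derivative(1) has_derivative_continuous by blast

lemma holo_at_compose:
  assumes "holo_at f x" "holo_at g (f x)"
  shows "holo_at (\<lambda>y. g (f y)) x"
proof (rule holo_atI)
  show "((\<lambda>y. g (f y)) has_derivative (\<lambda>h. frechet_derivative g (at (f x)) (frechet_derivative f (at x) h))) (at x)"
    by (rule has_derivative_compose) (use assms holo_at_derivative in auto)
qed (simp add: holo_at_derivative assms)

lemma frechet_derivative_compose_holo:
  assumes "holo_at f x" "holo_at g (f x)"
  shows "frechet_derivative (\<lambda>y. g (f y)) (at x) h =
    frechet_derivative g (at (f x)) (frechet_derivative f (at x) h)"
proof -
  have "((\<lambda>y. g (f y)) has_derivative (\<lambda>h. frechet_derivative g (at (f x)) (frechet_derivative f (at x) h))) (at x)"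
    by (rule has_derivative_compose) (use assms holo_at_derivative in auto)
  from frechet_derivative_at[OF this] show ?thesis by metis
qed

lemma cscale_scaleR: "c *c (r *\<^sub>R x) = r *\<^sub>R (c *c (x::'a::complex_model))"
  by (simp add: cscale_of_real[symmetric] cscale_cscale mult.commute)

lemma bounded_linear_cscale_right: "bounded_linear (\<lambda>x::'a::complex_model. c *c x)"
  by (rule bounded_linear_intro[where K="cmod c"])
     (auto simp: cscale_add_right cscale_scaleR norm_cscale mult.commute)

lemma bounded_linear_cscale_left: "bounded_linear (\<lambda>c. c *c (x::'a::complex_model))"
  by (rule bounded_linear_intro[where K="norm x"])
     (auto simp: cscale_add_left norm_cscale cscale_cscale cscale_of_real[symmetric] scaleR_conv_of_real
       simp del: cscale_of_real simp: cscale_complex_def)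

lemma cscale_one: "1 *c (x::'a::complex_model) = x"
  using cscale_of_real[of 1 x] by simp

lemma cscale_diff: "c *c (x - y) = c *c x - c *c (y::'a::complex_model)"
  using linear_diff[OF bounded_linear.linear[OF bounded_linear_cscale_right]] by auto

lemma cscale_sum: "c *c (\<Sum>i\<in>I. f i) = (\<Sum>i\<in>I. c *c (f i::'a::complex_model))"
  using linear_sum[OF bounded_linear.linear[OF bounded_linear_cscale_right]] by auto

lemma cscale_complex: "(c::complex) *c x = c * x"
  by (simp add: cscale_complex_def)

lemma cscale_Pair: "c *c (x, y) = (c *c x, c *c y)"
  by (simp add: cscale_prod_def)

lemma holo_at_bounded_linear:
  "bounded_linear f \<Longrightarrow> (\<And>c v. f (c *c v) = c *c f v) \<Longrightarrow> holo_at f x"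
  by (rule holo_atI[OF bounded_linear_imp_has_derivative])

lemma holo_at_const [simp]: "holo_at (\<lambda>x. c) x"
  by (rule holo_atI[OF has_derivative_const]) (simp add: cscale_zero_right)

lemma holo_at_ident [simp]: "holo_at (\<lambda>x. x) x"
  by (rule holo_atI[OF has_derivative_ident]) simp

lemma holo_at_add: "holo_at f x \<Longrightarrow> holo_at g x \<Longrightarrow> holo_at (\<lambda>x. f x + g x) x"
  by (rule holo_atI[OF has_derivative_add[OF holo_at_derivative(1) holo_at_derivative(1)]])
     (auto simp: holo_at_derivative(2) cscale_add_right)

lemma holo_at_diff: "holo_at f x \<Longrightarrow> holo_at g x \<Longrightarrow> holo_at (\<lambda>x. f x - g x) x"
  by (rule holo_atI[OF has_derivative_diff[OF holo_at_derivative(1) holo_at_derivative(1)]])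
     (auto simp: holo_at_derivative(2) cscale_diff)

lemma holo_at_mult: "holo_at f x \<Longrightarrow> holo_at g x \<Longrightarrow> holo_at (\<lambda>x. f x * g x :: complex) x"
  by (rule holo_atI[OF has_derivative_mult[OF holo_at_derivative(1) holo_at_derivative(1)]])
     (auto simp: holo_at_derivative(2) cscale_complex algebra_simps)

lemma holo_at_inverse:
  assumes "holo_at f x" "f x \<noteq> (0::complex)"
  shows "holo_at (\<lambda>x. inverse (f x)) x"
  by (rule holo_atI[OF Deriv.has_derivative_inverse[OF assms(2) holo_at_derivative(1)[OF assms(1)]]])
     (auto simp: holo_at_derivative(2) assms cscale_complex algebra_simps)

lemma holo_at_divide:
  "holo_at f x \<Longrightarrow> holo_at g x \<Longrightarrow> g x \<noteq> 0 \<Longrightarrow> holo_at (\<lambda>x. f x / g x :: complex) x"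
  unfolding divide_inverse by (intro holo_at_mult holo_at_inverse)

lemma holo_at_sum: "(\<And>i. i \<in> I \<Longrightarrow> holo_at (f i) x) \<Longrightarrow> holo_at (\<lambda>x. \<Sum>i\<in>I. f i x) x"
  by (induction I rule: infinite_finite_induct) (auto intro: holo_at_add)

lemma holo_at_prod: "(\<And>i. i \<in> I \<Longrightarrow> holo_at (f i) x) \<Longrightarrow> holo_at (\<lambda>x. \<Prod>i\<in>I. f i x :: complex) x"
  by (induction I rule: infinite_finite_induct) (auto intro: holo_at_mult)

lemma holo_at_Pair: "holo_at f x \<Longrightarrow> holo_at g x \<Longrightarrow> holo_at (\<lambda>x. (f x, g x)) x"
  by (rule holo_atI[OF has_derivative_Pair[OF holo_at_derivative(1) holo_at_derivative(1)]])
     (auto simp: holo_at_derivative(2) cscale_Pair)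

lemma holo_at_fst: "holo_at f x \<Longrightarrow> holo_at (\<lambda>x. fst (f x)) x"
  by (rule holo_atI[OF has_derivative_fst[OF holo_at_derivative(1)]])
     (auto simp: holo_at_derivative(2) cscale_prod_def)

lemma holo_at_snd: "holo_at f x \<Longrightarrow> holo_at (\<lambda>x. snd (f x)) x"
  by (rule holo_atI[OF has_derivative_snd[OF holo_at_derivative(1)]])
     (auto simp: holo_at_derivative(2) cscale_prod_def)

lemma holo_at_nth: "holo_at f x \<Longrightarrow> holo_at (\<lambda>x. f x $ i) x"
  by (rule holo_at_compose[OF _ holo_at_bounded_linear[OF bounded_linear_vec_nth]]) auto

lemma frechet_derivative_nth:
  assumes "holo_at f x"
  shows "frechet_derivative (\<lambda>y. f y $ i) (at x) h = frechet_derivative f (at x) h $ i"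
proof -
  have "((\<lambda>y. f y $ i) has_derivative (\<lambda>h. frechet_derivative f (at x) h $ i)) (at x)"
    using bounded_linear.has_derivative[OF bounded_linear_vec_nth holo_at_derivative(1)[OF assms]] .
  from frechet_derivative_at[OF this] show ?thesis by metis
qed

lemma holo_at_vec:
  fixes f :: "'a::complex_model \<Rightarrow> 'n::finite cvec"
  assumes "\<And>i. holo_at (\<lambda>x. f x $ i) x"
  shows "holo_at f x"
proof (rule holo_atI)
  have "(f has_derivative (\<lambda>h. \<Sum>i\<in>UNIV. axis i (frechet_derivative (\<lambda>x. f x $ i) (at x) h))) (at x)"
  proof -
    have bl: "bounded_linear (axis i :: complex \<Rightarrow> 'n cvec)" for i
      unfolding linear_conv_bounded_linear[symmetric] by (rule linearI) (auto simp: axis_def Finite_Cartesian_Product.vec_eq_iff)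
    have "f = (\<lambda>x. \<Sum>i\<in>UNIV. axis i (f x $ i))"
      by (auto simp: Finite_Cartesian_Product.vec_eq_iff axis_def fun_eq_iff if_distrib sum.delta cong: if_cong)
    moreover have "((\<lambda>x. \<Sum>i\<in>UNIV. axis i (f x $ i)) has_derivative
        (\<lambda>h. \<Sum>i\<in>UNIV. axis i (frechet_derivative (\<lambda>x. f x $ i) (at x) h))) (at x)"
      by (intro has_derivative_sum bounded_linear.has_derivative[OF bl holo_at_derivative(1)[OF assms]])
    ultimately show ?thesis by simp
  qed
  then show "(f has_derivative (\<lambda>h. \<chi> i. frechet_derivative (\<lambda>x. f x $ i) (at x) h)) (at x)"
    by (rule has_derivative_eq_rhs)
       (auto simp: Finite_Cartesian_Product.vec_eq_iff axis_def fun_eq_iff if_distrib sum.delta cong: if_cong)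
  show "(\<chi> i. frechet_derivative (\<lambda>x. f x $ i) (at x) (c *c v)) =
      c *c (\<chi> i. frechet_derivative (\<lambda>x. f x $ i) (at x) v)" for c v
    by (subst Finite_Cartesian_Product.vec_eq_iff) (simp add: holo_at_derivative(2)[OF assms])
qed

section \<open>Cauchy estimates\<close>

text \<open>Complex linearity of the derivative is exactly what turns the real derivative of the
  restriction to a complex line into a field derivative, so that one-variable theory
  applies.\<close>

lemma line_derivative:
  assumes "holo_at f (x + z *c h)"
  shows "((\<lambda>z. f (x + z *c h)) has_field_derivative frechet_derivative f (at (x + z *c h)) h) (at z)"
proof -
  have "((\<lambda>z. x + z *c h) has_derivative (\<lambda>z. z *c h)) (at z)"
    by (auto intro!: derivative_eq_intros bounded_linear.has_derivative[OF bounded_linear_cscale_left])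
  from has_derivative_compose[OF this holo_at_derivative(1)[OF assms]]
  show ?thesis unfolding has_field_derivative_def
    by (rule has_derivative_eq_rhs) (auto simp: fun_eq_iff holo_at_derivative(2)[OF assms] cscale_complex)
qed

text \<open>Both bounds are one-variable estimates for \<phi>(z) = f(x + z h), which is holomorphic
  and bounded by M where |z| |h| < R. The first is Cauchy's inequality for the derivative at 0, the
  second Taylor's formula of order one between 0 and 1. The constants are not optimal.\<close>

lemma Cauchy_estimates_holo:
  fixes f :: "'a::complex_model \<Rightarrow> complex"
  assumes R: "R > 0" and f: "\<And>y. y \<in> ball x R \<Longrightarrow> holo_at f y"
    and M: "\<And>y. y \<in> ball x R \<Longrightarrow> cmod (f y) \<le> M"
  shows "cmod (frechet_derivative f (at x) h) \<le> 2 * M * norm h / R"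
    and "norm h \<le> R / 4 \<Longrightarrow>
      cmod (f (x + h) - f x - frechet_derivative f (at x) h) \<le> 32 * M * (norm h)\<^sup>2 / R\<^sup>2"
proof -
  define \<phi> where "\<phi> = (\<lambda>z. f (x + z *c h))"
  have fx: "holo_at f x" using f R by simp
  have M0: "M \<ge> 0" using M[of x] R norm_ge_zero order_trans by (metis centre_in_ball)
  have inb: "x + z *c h \<in> ball x R" if "cmod z * norm h < R" for z
    using that by (simp add: dist_norm norm_cscale)
  have d\<phi>: "(\<phi> has_field_derivative frechet_derivative f (at (x + z *c h)) h) (at z)"
    if "cmod z * norm h < R" for z
    unfolding \<phi>_def by (rule line_derivative) (use inb[OF that] f in auto)
  have d0: "deriv \<phi> 0 = frechet_derivative f (at x) h"
    using d\<phi>[of 0] R by (auto dest: DERIV_imp_deriv simp: cscale_zero_left)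
  let ?S = "{z. cmod z * norm h < R}"
  have opS: "open ?S" by (intro open_Collect_less continuous_intros)
  have hol: "\<phi> holomorphic_on ?S"
    using d\<phi> by (auto simp: holomorphic_on_open[OF opS])
  have bound: "cmod (\<phi> z) \<le> M" if "cmod z * norm h < R" for z
    unfolding \<phi>_def using inb[OF that] M by blast
  have cauchy: "cmod ((deriv ^^ n) \<phi> z) \<le> fact n * M / r ^ n"
    if "r > 0" "(cmod z + r) * norm h < R" for n z r
  proof (rule Cauchy_inequality)
    have sub: "w \<in> ?S" if "w \<in> cball z r" for w
    proof -
      have "cmod w \<le> cmod z + r"
        using that norm_triangle_ineq[of z "w - z"] by (simp add: dist_norm norm_minus_commute)
      then have "cmod w * norm h \<le> (cmod z + r) * norm h" by (simp add: mult_right_mono)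
      then show ?thesis using \<open>(cmod z + r) * norm h < R\<close> by simp
    qed
    then show "\<phi> holomorphic_on ball z r" by (intro holomorphic_on_subset[OF hol]) auto
    show "continuous_on (cball z r) \<phi>"
      using sub by (intro continuous_on_subset[OF holomorphic_on_imp_continuous_on[OF hol]]) auto
    show "cmod (\<phi> w) \<le> M" if "cmod (z - w) = r" for w
      using sub[of w] bound that by (auto simp: dist_norm)
  qed (use that in auto)
  show 1: "cmod (frechet_derivative f (at x) h) \<le> 2 * M * norm h / R"
  proof (cases "h = 0")
    case True
    then show ?thesis using linear_0[OF bounded_linear.linear[OF holo_at_linear[OF fx]]] by simp
  next
    case False
    \<comment> \<open>Half of the admissible radius R / |h|, so that the closed disc lies in the
      domain of \<phi>.\<close>
    then have "cmod (deriv \<phi> 0) \<le> M / (R / (2 * norm h))"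
      using cauchy[of "R / (2 * norm h)" 0 1] R by simp
    then show ?thesis using False d0 by (simp add: field_simps)
  qed
  show "cmod (f (x + h) - f x - frechet_derivative f (at x) h) \<le> 32 * M * (norm h)\<^sup>2 / R\<^sup>2"
    if h: "norm h \<le> R / 4"
  proof (cases "h = 0")
    case True
    then show ?thesis using linear_0[OF bounded_linear.linear[OF holo_at_linear[OF fx]]] by simp
  next
    case False
    \<comment> \<open>For |z| \<le> 1 and |h| \<le> R / 4 the disc of radius r about z satisfies
      (|z| + r) |h| \<le> R / 2. Cauchy's inequality then bounds the second derivative by 2 M / r^2,
      which is 32 M |h|^2 / R^2.\<close>
    define r where "r = R / (4 * norm h)"
    have r: "r > 0" "r * norm h = R / 4" "1 * norm h \<le> R / 4" using R False h by (auto simp: r_def)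
    have "cmod (deriv (deriv \<phi>) z) \<le> 2 * M / r\<^sup>2" if "z \<in> cball 0 1" for z
    proof -
      have "cmod z * norm h \<le> 1 * norm h" using that by (intro mult_right_mono) auto
      then have "(cmod z + r) * norm h < R" using r R by (simp add: distrib_right)
      then show ?thesis using cauchy[OF r(1), of z 2] by (simp add: numeral_2_eq_2)
    qed
    moreover have zS: "z \<in> ?S" if "z \<in> cball 0 1" for z
    proof -
      have "cmod z * norm h \<le> 1 * norm h" using that by (intro mult_right_mono) auto
      then show ?thesis using r R by simp
    qed
    moreover have "(\<phi> has_field_derivative deriv \<phi> z) (at z within cball 0 1)"
      "(deriv \<phi> has_field_derivative deriv (deriv \<phi>) z) (at z within cball 0 1)"
      if "z \<in> cball 0 1" for z
      using zS[OF that] hol opS holomorphic_deriv[OF hol opS] holomorphic_derivI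
      by (metis has_field_derivative_at_within)+
    ultimately have "cmod ((deriv ^^ 0) \<phi> 1 - (\<Sum>i\<le>1. (deriv ^^ i) \<phi> 0 * (1 - 0) ^ i / fact i))
        \<le> 2 * M / r\<^sup>2 * cmod (1 - 0) ^ Suc 1 / fact 1"
      by (intro complex_Taylor[where S="cball 0 1" and f="\<lambda>i. (deriv ^^ i) \<phi>"])
         (auto simp: le_Suc_eq)
    then have "cmod (\<phi> 1 - \<phi> 0 - deriv \<phi> 0) \<le> 2 * M / r\<^sup>2"
      by (simp add: algebra_simps)
    moreover have "2 * M / r\<^sup>2 = 32 * M * (norm h)\<^sup>2 / R\<^sup>2"
      using False R by (simp add: r_def field_simps power2_eq_square)
    ultimately show ?thesis by (simp add: d0) (simp add: \<phi>_def cscale_one cscale_zero_left)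
  qed
qed

lemma holo_locally_bounded:
  fixes f :: "'a::complex_model \<Rightarrow> complex"
  assumes "open S" "x \<in> S" "\<And>y. y \<in> S \<Longrightarrow> holo_at f y"
  obtains R M where "R > 0" "ball x R \<subseteq> S" "M \<ge> 0" "\<And>y. y \<in> ball x R \<Longrightarrow> cmod (f y) \<le> M"
proof -
  obtain R1 where R1: "R1 > 0" "ball x R1 \<subseteq> S"
    using assms(1,2) open_contains_ball by blast
  have "isCont f x" by (rule holo_at_isCont) (use assms in auto)
  then obtain R2 where R2: "R2 > 0" "\<And>y. dist y x < R2 \<Longrightarrow> dist (f y) (f x) < 1"
    unfolding continuous_at_eps_delta by (meson less_numeral_extra(1))
  show ?thesis
  proof (rule that[of "min R1 R2" "cmod (f x) + 1"])
    fix y assume "y \<in> ball x (min R1 R2)"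
    then have "dist (f y) (f x) < 1" using R2(2)[of y] by (simp add: dist_commute)
    then show "cmod (f y) \<le> cmod (f x) + 1"
      using norm_triangle_ineq[of "f x" "f y - f x"] by (simp add: dist_norm)
  qed (use R1 R2(1) in auto)
qed

text \<open>Weierstrass: the Cauchy estimate applied to \<open>g n - g m\<close> shows that the
  derivatives at x converge, and the quadratic remainder bound, which depends only on M and R,
  passes to the limit; so the limit of the derivatives is the derivative of G.\<close>

lemma holo_uniform_limit:
  fixes g :: "nat \<Rightarrow> 'a::complex_model \<Rightarrow> complex"
  assumes R: "R > 0" and hol: "\<And>n y. y \<in> ball x R \<Longrightarrow> holo_at (g n) y"
    and M: "\<And>n y. y \<in> ball x R \<Longrightarrow> cmod (g n y) \<le> M"
    and lim: "\<And>n y. y \<in> ball x R \<Longrightarrow> cmod (g n y - G y) \<le> e n" and e: "e \<longlonglongrightarrow> 0"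
  shows "holo_at G x"
proof -
  have xin: "x \<in> ball x R" using R by simp
  define D where "D = (\<lambda>n. frechet_derivative (g n) (at x))"
  have D: "(g n has_derivative D n) (at x)" "D n (c *c h) = c *c D n h" for n c h
    unfolding D_def using holo_at_derivative hol[OF xin] by blast+
  have Dlin: "linear (D n)" for n
    using D(1) has_derivative_linear by blast
  have est: "cmod (D n h - D m h) \<le> 2 * (e n + e m) * norm h / R" for n m h
  proof -
    have "((\<lambda>y. g n y - g m y) has_derivative (\<lambda>h. D n h - D m h)) (at x)"
      by (rule has_derivative_diff[OF D(1) D(1)])
    from frechet_derivative_at[OF this]
    have eq: "frechet_derivative (\<lambda>y. g n y - g m y) (at x) h = D n h - D m h" by metis
    have "cmod (frechet_derivative (\<lambda>y. g n y - g m y) (at x) h) \<le> 2 * (e n + e m) * norm h / R"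
    proof (rule Cauchy_estimates_holo(1)[OF R])
      fix y assume y: "y \<in> ball x R"
      show "holo_at (\<lambda>y. g n y - g m y) y" by (intro holo_at_diff hol[OF y])
      show "cmod (g n y - g m y) \<le> e n + e m"
        using norm_triangle_ineq4[of "g n y - G y" "g m y - G y"] lim[OF y, of n] lim[OF y, of m] by simp
    qed
    then show ?thesis by (simp add: eq)
  qed
  have "Cauchy (\<lambda>n. D n h)" for h
  proof (rule CauchyI)
    fix r :: real assume r: "r > 0"
    have "(\<lambda>n. 2 * e n * norm h / R) \<longlonglongrightarrow> 2 * 0 * norm h / R"
      using R by (intro tendsto_intros e) auto
    then have "(\<lambda>n. 2 * e n * norm h / R) \<longlonglongrightarrow> 0" by simp
    then obtain N where N: "\<And>n. n \<ge> N \<Longrightarrow> norm (2 * e n * norm h / R - 0) < r / 2"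
      using LIMSEQ_D half_gt_zero[OF r] by metis
    show "\<exists>N. \<forall>m\<ge>N. \<forall>n\<ge>N. norm (D m h - D n h) < r"
    proof (intro exI allI impI)
      fix m n assume mn: "m \<ge> N" "n \<ge> N"
      have "2 * (e m + e n) * norm h / R = 2 * e m * norm h / R + 2 * e n * norm h / R"
        by (simp add: algebra_simps add_divide_distrib)
      also have "\<dots> < r" using N[OF mn(1)] N[OF mn(2)] by (simp add: abs_if split: if_splits)
      finally show "norm (D m h - D n h) < r" using est[of m h n] by linarith
    qed
  qed
  then have "\<exists>L. (\<lambda>n. D n h) \<longlonglongrightarrow> L" for h
    by (simp add: Cauchy_convergent_iff convergent_def)
  then obtain l where l: "\<And>h. (\<lambda>n. D n h) \<longlonglongrightarrow> l h" by metis
  have gG: "(\<lambda>n. g n y) \<longlonglongrightarrow> G y" if "y \<in> ball x R" for y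
  proof -
    have "(\<lambda>n. g n y - G y) \<longlonglongrightarrow> 0"
      by (rule Lim_null_comparison[OF _ e]) (use lim[OF that] in auto)
    then show ?thesis by (simp add: LIM_zero_iff)
  qed
  have add: "l (h + k) = l h + l k" for h k
    using LIMSEQ_unique[OF l[of "h + k"]] tendsto_add[OF l[of h] l[of k]] linear_add[OF Dlin] by simp
  have cs: "l (c *c h) = c *c l h" for c h
  proof (rule LIMSEQ_unique[OF l])
    show "(\<lambda>n. D n (c *c h)) \<longlonglongrightarrow> c *c l h"
      unfolding D(2) cscale_complex by (intro tendsto_intros l)
  qed
  have bound: "cmod (l h) \<le> norm h * (2 * M / R)" for h
  proof (rule tendsto_upperbound[OF tendsto_norm[OF l]])
    have "cmod (D n h) \<le> 2 * M * norm h / R" for n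
      unfolding D_def by (rule Cauchy_estimates_holo(1)[OF R]) (use hol M in auto)
    then show "\<forall>\<^sub>F n in sequentially. cmod (D n h) \<le> norm h * (2 * M / R)"
      by (simp add: mult_ac)
  qed simp
  have bl: "bounded_linear l"
  proof (rule bounded_linear_intro[OF add _ bound])
    show "l (r *\<^sub>R h) = r *\<^sub>R l h" for r h
      using cs[of "of_real r" h] by (simp add: cscale_of_real)
  qed
  have rem: "cmod (G (x + h) - G x - l h) \<le> 32 * M * (norm h)\<^sup>2 / R\<^sup>2" if "norm h \<le> R / 4" for h
  proof (rule tendsto_upperbound[where f="\<lambda>n. cmod (g n (x + h) - g n x - D n h)"])
    have "x + h \<in> ball x R" using that R by (simp add: dist_norm)
    then show "((\<lambda>n. cmod (g n (x + h) - g n x - D n h)) \<longlongrightarrow> cmod (G (x + h) - G x - l h)) sequentially"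
      by (intro tendsto_intros gG l xin)
    have "cmod (g n (x + h) - g n x - D n h) \<le> 32 * M * (norm h)\<^sup>2 / R\<^sup>2" for n
      unfolding D_def by (rule Cauchy_estimates_holo(2)[OF R]) (use hol M that in auto)
    then show "\<forall>\<^sub>F n in sequentially. cmod (g n (x + h) - g n x - D n h) \<le> 32 * M * (norm h)\<^sup>2 / R\<^sup>2"
      by simp
  qed simp
  have "(G has_derivative l) (at x)"
  proof (rule has_derivativeI_sandwich[where e="R / 4" and H="\<lambda>y. 32 * M / R\<^sup>2 * norm (y - x)"])
    fix y assume y: "y \<noteq> x" "dist y x < R / 4"
    have "norm (G y - G x - l (y - x)) \<le> 32 * M * (norm (y - x))\<^sup>2 / R\<^sup>2"
      using rem[of "y - x"] y by (simp add: dist_norm)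
    then show "norm (G y - G x - l (y - x)) / norm (y - x) \<le> 32 * M / R\<^sup>2 * norm (y - x)"
      using y R by (simp add: field_simps power2_eq_square)
  next
    have "((\<lambda>y. 32 * M / R\<^sup>2 * norm (y - x)) \<longlongrightarrow> 32 * M / R\<^sup>2 * norm (x - x)) (at x)"
      using R by (intro tendsto_intros) auto
    then show "((\<lambda>y. 32 * M / R\<^sup>2 * norm (y - x)) \<longlongrightarrow> 0) (at x)" by simp
  qed (use R bl in auto)
  then show ?thesis using cs by (rule holo_atI)
qed

text \<open>The map y \<mapsto> Df(y) h is the limit of difference quotients along h, which are
  holomorphic in y; the quadratic remainder bound makes the convergence uniform near x.\<close>

lemma holo_at_frechet_derivative:
  fixes f :: "'a::complex_model \<Rightarrow> complex"
  assumes S: "open S" "x \<in> S" and f: "\<And>y. y \<in> S \<Longrightarrow> holo_at f y"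
  shows "holo_at (\<lambda>y. frechet_derivative f (at y) h) x"
proof -
  obtain R M where R: "R > 0" "ball x R \<subseteq> S" and M0: "M \<ge> 0"
    and M: "\<And>y. y \<in> ball x R \<Longrightarrow> cmod (f y) \<le> M"
    using holo_locally_bounded[OF S f] by metis
  \<comment> \<open>Shifting the sequence by N keeps the steps \<open>t n *\<^sub>R h\<close> within
    R / 8, a quarter of the radius R / 2 on which the remainder bound is applied around each
    y.\<close>
  obtain N :: nat where N: "8 * norm h / R < real N" using reals_Archimedean2 by blast
  define t where "t = (\<lambda>n. 1 / real (n + N + 1))"
  have t: "0 < t n" "t n \<le> 1" "norm (t n *\<^sub>R h) \<le> R / 8" for n
  proof -
    show "0 < t n" "t n \<le> 1" by (auto simp: t_def)
    have "8 * norm h / R < real (n + N + 1)" using N by simp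
    then show "norm (t n *\<^sub>R h) \<le> R / 8" using R(1) by (simp add: t_def field_simps)
  qed
  have inb: "ball y (R / 2) \<subseteq> ball x R" if "y \<in> ball x (R / 2)" for y
  proof
    fix z assume "z \<in> ball y (R / 2)"
    then show "z \<in> ball x R" using that dist_triangle[of x z y] by simp
  qed
  have holb: "holo_at f z" and Mb: "cmod (f z) \<le> M" if "y \<in> ball x (R / 2)" "z \<in> ball y (R / 2)" for y z
    using inb[OF that(1)] that(2) R(2) f M by blast+
  define g where "g = (\<lambda>n y. (f (y + t n *\<^sub>R h) - f y) / of_real (t n))"
  \<comment> \<open>The remainder bound 32 M |t h|^2 / (R / 2)^2, divided by t.\<close>
  define e where "e = (\<lambda>n. t n * (128 * M * (norm h)\<^sup>2 / R\<^sup>2))"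
  have ginb: "y \<in> S" "y + t n *\<^sub>R h \<in> S" if y: "y \<in> ball x (R / 2)" for y n
  proof -
    have "y + t n *\<^sub>R h \<in> ball y (R / 2)" using t(3)[of n] R(1) by (simp add: dist_norm)
    then show "y + t n *\<^sub>R h \<in> S" using inb[OF y] R by blast
    have "y \<in> ball y (R / 2)" using R(1) by simp
    then show "y \<in> S" using inb[OF y] R by blast
  qed
  have lim: "cmod (g n y - frechet_derivative f (at y) h) \<le> e n" if y: "y \<in> ball x (R / 2)" for n y
  proof -
    have lin: "linear (frechet_derivative f (at y))"
      using holo_at_linear[OF f[OF ginb(1)[OF y]]] bounded_linear.linear by blast
    have "cmod (f (y + t n *\<^sub>R h) - f y - frechet_derivative f (at y) (t n *\<^sub>R h))
        \<le> 32 * M * (norm (t n *\<^sub>R h))\<^sup>2 / (R / 2)\<^sup>2"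
      by (intro Cauchy_estimates_holo(2) holb[OF y] Mb[OF y]) (use R(1) t(3)[of n] in auto)
    also have "\<dots> = t n * e n"
      using t(1)[of n] R(1) by (simp add: e_def power2_eq_square field_simps)
    also have "f (y + t n *\<^sub>R h) - f y - frechet_derivative f (at y) (t n *\<^sub>R h)
        = of_real (t n) * (g n y - frechet_derivative f (at y) h)"
    proof -
      have "of_real (t n) * g n y = f (y + t n *\<^sub>R h) - f y" using t(1)[of n] by (simp add: g_def)
      then show ?thesis by (simp add: linear_scale[OF lin] right_diff_distrib scaleR_conv_of_real)
    qed
    finally have "cmod (of_real (t n) * (g n y - frechet_derivative f (at y) h)) \<le> t n * e n" .
    then show ?thesis using t(1)[of n] by (simp add: norm_mult)
  qed
  show ?thesis
  proof (rule holo_uniform_limit[where R="R / 2" and g=g and e=e and M="4 * M * norm h / R + 128 * M * (norm h)\<^sup>2 / R\<^sup>2"])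
    fix n y assume y: "y \<in> ball x (R / 2)"
    show "holo_at (g n) y" unfolding g_def
    proof (intro holo_at_divide holo_at_diff holo_at_const)
      show "holo_at (\<lambda>y. f (y + t n *\<^sub>R h)) y"
        by (rule holo_at_compose[OF holo_at_add[OF holo_at_ident holo_at_const]]) (rule f[OF ginb(2)[OF y]])
      show "holo_at f y" by (rule f[OF ginb(1)[OF y]])
    qed (use t(1)[of n] in simp)
    have "cmod (frechet_derivative f (at y) h) \<le> 2 * M * norm h / (R / 2)"
      by (intro Cauchy_estimates_holo(1) holb[OF y] Mb[OF y]) (use R(1) in auto)
    moreover have "e n \<le> 128 * M * (norm h)\<^sup>2 / R\<^sup>2"
      unfolding e_def using M0 t(1,2)[of n] by (intro mult_left_le_one_le) auto
    moreover have "cmod (g n y) \<le> cmod (frechet_derivative f (at y) h) + cmod (g n y - frechet_derivative f (at y) h)"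
      by (metis add.commute diff_add_cancel norm_triangle_ineq)
    ultimately show "cmod (g n y) \<le> 4 * M * norm h / R + 128 * M * (norm h)\<^sup>2 / R\<^sup>2"
      using lim[OF y, of n] by simp
    show "cmod (g n y - frechet_derivative f (at y) h) \<le> e n" by (rule lim[OF y])
  next
    have "t \<longlonglongrightarrow> 0"
    proof -
      have "(\<lambda>n. 1 / real (n + (N + 1))) \<longlonglongrightarrow> 0"
        by (rule LIMSEQ_ignore_initial_segment[of "\<lambda>n. 1 / real n"]) (rule lim_1_over_n)
      then show ?thesis by (simp add: t_def add.assoc)
    qed
    then have "e \<longlonglongrightarrow> 0 * (128 * M * (norm h)\<^sup>2 / R\<^sup>2)"
      unfolding e_def by (rule tendsto_mult_right)
    then show "e \<longlonglongrightarrow> 0" by simp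
  qed (use R in simp)
qed

lemma holo_at_frechet_derivative_vec:
  fixes f :: "'a::complex_model \<Rightarrow> 'n::finite cvec"
  assumes S: "open S" "x \<in> S" and f: "\<And>y. y \<in> S \<Longrightarrow> holo_at f y"
  shows "holo_at (\<lambda>y. frechet_derivative f (at y) h) x"
proof (rule holo_at_vec)
  fix i
  have "holo_at (\<lambda>y. frechet_derivative (\<lambda>y. f y $ i) (at y) h) x"
    by (rule holo_at_frechet_derivative[OF S]) (rule holo_at_nth[OF f])
  then show "holo_at (\<lambda>y. frechet_derivative f (at y) h $ i) x"
  proof (rule holo_at_cong[rotated])
    show "\<forall>\<^sub>F y in nhds x. frechet_derivative (\<lambda>y. f y $ i) (at y) h = frechet_derivative f (at y) h $ i"
      using frechet_derivative_nth[OF f] S by (auto simp: eventually_nhds)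
  qed
qed

text \<open>Takes the place of continuous differentiability in the inverse function theorem. It
  expands the holomorphic function k(y) = Df(y) h to first order, and all bounds on k are
  proportional to |h|.\<close>

lemma holo_derivative_Lipschitz:
  fixes f :: "'a::complex_model \<Rightarrow> complex"
  assumes S: "open S" "x \<in> S" and f: "\<And>y. y \<in> S \<Longrightarrow> holo_at f y"
  shows "\<exists>d>0. \<exists>C\<ge>0. \<forall>y\<in>ball x d. \<forall>h. y \<in> S \<and>
    cmod (frechet_derivative f (at y) h - frechet_derivative f (at x) h) \<le> C * norm (y - x) * norm h"
proof -
  obtain R M where R: "R > 0" "ball x R \<subseteq> S" and M0: "M \<ge> 0"
    and M: "\<And>y. y \<in> ball x R \<Longrightarrow> cmod (f y) \<le> M"
    using holo_locally_bounded[OF S f] by metis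
  have inb: "ball y (R / 2) \<subseteq> ball x R" if "y \<in> ball x (R / 2)" for y
  proof
    fix z assume "z \<in> ball y (R / 2)"
    then show "z \<in> ball x R" using that dist_triangle[of x z y] by simp
  qed
  have holb: "holo_at f z" and Mb: "cmod (f z) \<le> M" if "y \<in> ball x (R / 2)" "z \<in> ball y (R / 2)" for y z
    using inb[OF that(1)] that(2) R(2) f M by blast+
  show ?thesis
  \<comment> \<open>On the ball of radius R / 2 the function k is bounded by 4 M |h| / R. Its first
    derivative contributes 16 to the constant 80, and its remainder, with one factor |y - x|
    replaced by R / 8, contributes 64.\<close>
  proof (rule exI[of _ "R / 8"], rule conjI[rotated], rule exI[of _ "80 * M / R\<^sup>2"], intro conjI ballI allI)
    fix y h assume y: "y \<in> ball x (R / 8)"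
    then show "y \<in> S" using R by auto
    define k where "k = (\<lambda>y. frechet_derivative f (at y) h)"
    have hol: "holo_at k z" if "z \<in> ball x (R / 2)" for z
      unfolding k_def using that R by (intro holo_at_frechet_derivative[OF S(1) _ f]) auto
    have b: "cmod (k z) \<le> 4 * M * norm h / R" if "z \<in> ball x (R / 2)" for z
    proof -
      have "cmod (k z) \<le> 2 * M * norm h / (R / 2)"
        unfolding k_def by (intro Cauchy_estimates_holo(1) holb[OF that] Mb[OF that]) (use R(1) in auto)
      then show ?thesis by simp
    qed
    have xy: "x + (y - x) = y" by simp
    have ny: "norm (y - x) \<le> R / 2 / 4" using y by (simp add: dist_norm norm_minus_commute)
    have 1: "cmod (k (x + (y - x)) - k x - frechet_derivative k (at x) (y - x))
        \<le> 32 * (4 * M * norm h / R) * (norm (y - x))\<^sup>2 / (R / 2)\<^sup>2"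
      by (rule Cauchy_estimates_holo(2)) (use R hol b ny in auto)
    have 2: "cmod (frechet_derivative k (at x) (y - x)) \<le> 2 * (4 * M * norm h / R) * norm (y - x) / (R / 2)"
      by (rule Cauchy_estimates_holo(1)) (use R hol b in auto)
    have "32 * (4 * M * norm h / R) * (norm (y - x))\<^sup>2 / (R / 2)\<^sup>2
        = 512 * M * norm h * norm (y - x) / R ^ 3 * norm (y - x)"
      using R(1) by (simp add: field_simps power2_eq_square power3_eq_cube)
    also have "\<dots> \<le> 512 * M * norm h * norm (y - x) / R ^ 3 * (R / 8)"
      using ny R(1) M0 by (intro mult_left_mono) auto
    also have "\<dots> = 64 * M / R\<^sup>2 * norm (y - x) * norm h"
      using R(1) by (simp add: field_simps power2_eq_square power3_eq_cube)
    finally have 3: "32 * (4 * M * norm h / R) * (norm (y - x))\<^sup>2 / (R / 2)\<^sup>2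
        \<le> 64 * M / R\<^sup>2 * norm (y - x) * norm h" .
    have 4: "2 * (4 * M * norm h / R) * norm (y - x) / (R / 2) = 16 * M / R\<^sup>2 * norm (y - x) * norm h"
      using R(1) by (simp add: field_simps power2_eq_square)
    have "cmod (k y - k x) \<le> cmod (k y - k x - frechet_derivative k (at x) (y - x))
        + cmod (frechet_derivative k (at x) (y - x))"
      by (metis diff_add_cancel norm_triangle_ineq)
    also have "\<dots> \<le> 64 * M / R\<^sup>2 * norm (y - x) * norm h + 16 * M / R\<^sup>2 * norm (y - x) * norm h"
      using 1[unfolded xy] 2 3 4 by linarith
    also have "\<dots> = 80 * M / R\<^sup>2 * norm (y - x) * norm h" by (simp add: field_simps)
    finally show "cmod (frechet_derivative f (at y) h - frechet_derivative f (at x) h)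
        \<le> 80 * M / R\<^sup>2 * norm (y - x) * norm h" by (simp add: k_def)
  qed (use R M0 in auto)
qed

lemma holo_derivative_Lipschitz_vec:
  fixes f :: "'a::complex_model \<Rightarrow> 'n::finite cvec"
  assumes S: "open S" "x \<in> S" and f: "\<And>y. y \<in> S \<Longrightarrow> holo_at f y"
  shows "\<exists>d>0. \<exists>C\<ge>0. \<forall>y\<in>ball x d. \<forall>h. y \<in> S \<and>
    norm (frechet_derivative f (at y) h - frechet_derivative f (at x) h) \<le> C * norm (y - x) * norm h"
proof -
  have "\<forall>i. \<exists>d>0. \<exists>C\<ge>0. \<forall>y\<in>ball x d. \<forall>h. y \<in> S \<and>
     cmod (frechet_derivative (\<lambda>y. f y $ i) (at y) h - frechet_derivative (\<lambda>y. f y $ i) (at x) h)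
       \<le> C * norm (y - x) * norm h"
    using holo_derivative_Lipschitz[OF S holo_at_nth[OF f]] by blast
  then obtain d C where dC: "\<And>i. d i > (0::real)" "\<And>i. C i \<ge> (0::real)"
    "\<And>i y h. y \<in> ball x (d i) \<Longrightarrow> y \<in> S \<and>
     cmod (frechet_derivative (\<lambda>y. f y $ i) (at y) h - frechet_derivative (\<lambda>y. f y $ i) (at x) h)
       \<le> C i * norm (y - x) * norm h" by metis
  show ?thesis
  proof (rule exI[of _ "Min (range d)"], rule conjI[rotated], rule exI[of _ "\<Sum>i\<in>UNIV. C i"], intro conjI ballI allI)
    show "Min (range d) > 0" using dC(1) by simp
    show "(\<Sum>i\<in>UNIV. C i) \<ge> 0" using dC(2) by (simp add: sum_nonneg)
    fix y h assume y: "y \<in> ball x (Min (range d))"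
    then have yi: "y \<in> ball x (d i)" for i by simp
    show yS: "y \<in> S" using dC(3)[OF yi] by blast
    have "norm (frechet_derivative f (at y) h - frechet_derivative f (at x) h)
      \<le> (\<Sum>i\<in>UNIV. cmod ((frechet_derivative f (at y) h - frechet_derivative f (at x) h) $ i))"
      unfolding norm_vec_def by (rule L2_set_le_sum) simp
    also have "\<dots> \<le> (\<Sum>i\<in>UNIV. C i * norm (y - x) * norm h)"
    proof (rule sum_mono)
      fix i
      show "cmod ((frechet_derivative f (at y) h - frechet_derivative f (at x) h) $ i) \<le> C i * norm (y - x) * norm h"
        using conjunct2[OF dC(3)[OF yi[of i], of h]]
        by (simp add: frechet_derivative_nth[OF f[OF yS]] frechet_derivative_nth[OF f[OF S(2)]])
    qed
    finally show "norm (frechet_derivative f (at y) h - frechet_derivative f (at x) h)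
      \<le> (\<Sum>i\<in>UNIV. C i) * norm (y - x) * norm h" by (simp add: sum_distrib_right)
  qed
qed

section \<open>The inverse function theorem with parameters\<close>

text \<open>With B inverse to the derivative A of T in y at the base point, y \<mapsto> y - B (T (v,
  y)) contracts by 1/2 on one closed ball, for all v near v0 at once. The contraction yields the
  lower bound for T in y and, with Banach's theorem applied to y - B (T (v, y)) + B w, the solutions
  of T (v, y) = w.\<close>

lemma param_inverse_local:
  fixes T :: "'v::complex_model \<times> 'n::finite cvec \<Rightarrow> 'n cvec"
  assumes W: "open W" "(v0, y0) \<in> W" and hol: "\<And>q. q \<in> W \<Longrightarrow> holo_at T q"
    and inj: "\<And>h. frechet_derivative T (at (v0, y0)) (0, h) = 0 \<Longrightarrow> h = 0"
  obtains \<epsilon> \<delta> K where "\<epsilon> > 0" "\<delta> > 0" "K > 0" "\<delta> \<le> \<epsilon>"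
    "\<And>v y. v \<in> ball v0 \<epsilon> \<Longrightarrow> y \<in> cball y0 \<epsilon> \<Longrightarrow> (v, y) \<in> W"
    "\<And>v y y'. v \<in> ball v0 \<epsilon> \<Longrightarrow> y \<in> cball y0 \<epsilon> \<Longrightarrow> y' \<in> cball y0 \<epsilon> \<Longrightarrow>
       norm (y - y') \<le> K * norm (T (v, y) - T (v, y'))"
    "\<And>v w. v \<in> ball v0 \<delta> \<Longrightarrow> w \<in> ball (T (v0, y0)) \<delta> \<Longrightarrow> \<exists>y\<in>ball y0 \<epsilon>. T (v, y) = w"
proof -
  define A where "A = (\<lambda>h. frechet_derivative T (at (v0, y0)) (0, h))"
  have Tlin: "bounded_linear (frechet_derivative T (at q))" if "q \<in> W" for q
    by (rule holo_at_linear[OF hol[OF that]])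
  have linA: "linear A"
    using linear_compose[of "\<lambda>h. (0, h)", OF _ bounded_linear.linear[OF Tlin[OF W(2)]]]
    by (simp add: A_def comp_def linear_iff)
  have "inj A" using inj linA by (simp add: linear_injective_0 A_def)
  then obtain B where B: "linear B" "\<And>x. B (A x) = x" "\<And>x. A (B x) = x"
    using linear_injective_isomorphism[OF linA] by blast
  then have blB: "bounded_linear B" by (simp add: linear_conv_bounded_linear)
  obtain b where b: "b > 0" "\<And>z. norm (B z) \<le> norm z * b"
    using bounded_linear.pos_bounded[OF blB] by blast
  obtain d C where dC: "d > 0" "C \<ge> 0" "\<And>q h. q \<in> ball (v0, y0) d \<Longrightarrow> q \<in> W \<and>
    norm (frechet_derivative T (at q) h - frechet_derivative T (at (v0, y0)) h) \<le> C * norm (q - (v0, y0)) * norm h"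
    using holo_derivative_Lipschitz_vec[OF W hol] by metis
  \<comment> \<open>Within distance \<rho> the partial derivative differs from A by at most 1 / (2
    b), so B composed with it differs from the identity by at most 1/2. The summand 1 covers C =
    0.\<close>
  define \<rho> where "\<rho> = min d (1 / (2 * b * (C + 1)))"
  have \<rho>: "\<rho> > 0" using dC b by (simp add: \<rho>_def)
  \<comment> \<open>The norm of a pair is bounded by the sum of the two norms, here at most two
    thirds of \<rho>.\<close>
  define \<epsilon> where "\<epsilon> = \<rho> / 3"
  have \<epsilon>: "\<epsilon> > 0" using \<rho> by (simp add: \<epsilon>_def)
  have near: "(v, y) \<in> ball (v0, y0) \<rho>" if "v \<in> ball v0 \<epsilon>" "y \<in> cball y0 \<epsilon>" for v y
  proof -
    have "norm ((v, y) - (v0, y0)) \<le> norm (v - v0) + norm (y - y0)"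
      by (simp add: norm_Pair_le)
    also have "\<dots> < \<rho>" using that \<epsilon> by (simp add: \<epsilon>_def dist_norm norm_minus_commute)
    finally have "dist (v, y) (v0, y0) < \<rho>" by (simp only: dist_norm)
    then show ?thesis by (simp only: mem_ball dist_commute)
  qed
  have inW: "(v, y) \<in> W" if "v \<in> ball v0 \<epsilon>" "y \<in> cball y0 \<epsilon>" for v y
    using near[OF that] dC(3) by (simp add: \<rho>_def)
  define F where "F = (\<lambda>v y. y - B (T (v, y)))"
  have contr: "norm (F v y - F v y') \<le> 1 / 2 * norm (y - y')"
    if v: "v \<in> ball v0 \<epsilon>" and y: "y \<in> cball y0 \<epsilon>" "y' \<in> cball y0 \<epsilon>" for v y y'
  proof (rule differentiable_bound[where S="cball y0 \<epsilon>" and f="F v" and B="1/2"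
        and f'="\<lambda>y h. h - B (frechet_derivative T (at (v, y)) (0, h))"])
    fix z assume z: "z \<in> cball y0 \<epsilon>"
    note zW = inW[OF v z]
    have "((\<lambda>y. (v, y)) has_derivative (\<lambda>h. (0, h))) (at z)"
      by (auto intro!: derivative_eq_intros)
    from has_derivative_compose[OF this holo_at_derivative(1)[OF hol[OF zW]]]
    have "((\<lambda>y. T (v, y)) has_derivative (\<lambda>h. frechet_derivative T (at (v, z)) (0, h))) (at z)" .
    from has_derivative_diff[OF has_derivative_ident bounded_linear.has_derivative[OF blB this]]
    show "(F v has_derivative (\<lambda>h. h - B (frechet_derivative T (at (v, z)) (0, h)))) (at z within cball y0 \<epsilon>)"
      unfolding F_def by (rule has_derivative_at_withinI)
    show "onorm (\<lambda>h. h - B (frechet_derivative T (at (v, z)) (0, h))) \<le> 1 / 2"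
    proof (rule onorm_bound)
      fix h
      define E where "E = frechet_derivative T (at (v, z)) (0, h) - A h"
      have "dist (v, z) (v0, y0) < \<rho>" using near[OF v z] by (simp only: mem_ball dist_commute)
      then have q: "(v, z) \<in> ball (v0, y0) d" "norm ((v, z) - (v0, y0)) \<le> 1 / (2 * b * (C + 1))"
        by (simp_all only: \<rho>_def mem_ball dist_commute dist_norm[symmetric])
      have "norm E \<le> C * norm ((v, z) - (v0, y0)) * norm h"
        using dC(3)[OF q(1), of "(0, h)"] by (simp add: E_def A_def norm_Pair)
      also have "\<dots> \<le> C * (1 / (2 * b * (C + 1))) * norm h"
        using q(2) dC(2) by (intro mult_right_mono mult_left_mono) auto
      finally have "norm E * b \<le> C * (1 / (2 * b * (C + 1))) * norm h * b"
        by (rule mult_right_mono) (use b(1) in simp)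
      also have "\<dots> = C / (C + 1) * (1 / 2 * norm h)"
      proof -
        have "C * (1 / (2 * b * k)) * norm h * b = C / k * (1 / 2 * norm h)" if "k \<noteq> 0" for k
          using b(1) that by (simp add: field_simps)
        then show ?thesis using dC(2) by simp
      qed
      also have "\<dots> \<le> 1 * (1 / 2 * norm h)" using dC(2) by (intro mult_right_mono) auto
      finally have "norm (B E) \<le> 1 / 2 * norm h" using b(2)[of E] by simp
      moreover have "B E = B (frechet_derivative T (at (v, z)) (0, h)) - h"
        by (simp add: E_def linear_diff[OF B(1)] B(2))
      ultimately show "norm (h - B (frechet_derivative T (at (v, z)) (0, h))) \<le> 1 / 2 * norm h"
        by (simp add: norm_minus_commute)
    qed simp
  qed (use y in auto)
  have est: "norm (y - y') \<le> 2 * b * norm (T (v, y) - T (v, y'))"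
    if "v \<in> ball v0 \<epsilon>" "y \<in> cball y0 \<epsilon>" "y' \<in> cball y0 \<epsilon>" for v y y'
  proof -
    have "y - y' = (F v y - F v y') + B (T (v, y) - T (v, y'))"
      by (simp add: F_def linear_diff[OF B(1)])
    then have "norm (y - y') \<le> norm (F v y - F v y') + norm (B (T (v, y) - T (v, y')))"
      by (metis norm_triangle_ineq)
    then show ?thesis using contr[OF that] b(2)[of "T (v, y) - T (v, y')"] by (simp add: mult_ac)
  qed
  have "isCont T (v0, y0)" by (rule holo_at_isCont[OF hol[OF W(2)]])
  then obtain d' where d': "d' > 0" "\<And>q. dist q (v0, y0) < d' \<Longrightarrow> dist (T q) (T (v0, y0)) < \<epsilon> / (8 * b)"
    unfolding continuous_at_eps_delta using \<epsilon> b(1) by (metis divide_pos_pos mult_pos_pos zero_less_numeral)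
  \<comment> \<open>Then w and T (v, y0) both lie within \<epsilon> / (8 b) of T (v0, y0), so B maps
    their difference to norm at most \<epsilon> / 4. Together with the \<epsilon> / 2 from the
    contraction, the iteration stays within 3 \<epsilon> / 4 of y0, which puts the solution into the
    open ball.\<close>
  define \<delta> where "\<delta> = min \<epsilon> (min d' (\<epsilon> / (8 * b)))"
  have \<delta>: "\<delta> > 0" using \<epsilon> d'(1) b(1) by (simp add: \<delta>_def)
  show ?thesis
  proof (rule that[of \<epsilon> \<delta> "2 * b"])
    fix v w assume v: "v \<in> ball v0 \<delta>" and w: "w \<in> ball (T (v0, y0)) \<delta>"
    have v\<epsilon>: "v \<in> ball v0 \<epsilon>" using v by (simp add: \<delta>_def)
    define P where "P = (\<lambda>y. F v y + B w)"
    have "dist (v, y0) (v0, y0) < d'" using v by (simp add: dist_Pair_Pair \<delta>_def dist_commute)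
    then have "dist (T (v, y0)) (T (v0, y0)) < \<epsilon> / (8 * b)" by (rule d'(2))
    moreover have "dist w (T (v0, y0)) < \<epsilon> / (8 * b)" using w by (simp add: \<delta>_def dist_commute)
    ultimately have "norm (w - T (v, y0)) \<le> \<epsilon> / (4 * b)"
      using dist_triangle2[of w "T (v, y0)" "T (v0, y0)"] by (simp add: dist_norm)
    then have "norm (w - T (v, y0)) * b \<le> \<epsilon> / (4 * b) * b"
      by (rule mult_right_mono) (use b(1) in simp)
    then have small: "norm (B (w - T (v, y0))) \<le> \<epsilon> / 4" using b(2)[of "w - T (v, y0)"] b(1) by simp
    have P0: "norm (P y - y0) \<le> 3 / 4 * \<epsilon>" if y: "y \<in> cball y0 \<epsilon>" for y
    proof -
      have "P y - y0 = (F v y - F v y0) + B (w - T (v, y0))"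
        by (simp add: P_def F_def linear_diff[OF B(1)])
      then have "norm (P y - y0) \<le> norm (F v y - F v y0) + norm (B (w - T (v, y0)))"
        by (metis norm_triangle_ineq)
      moreover have "norm (y - y0) \<le> \<epsilon>" using y by (simp add: dist_norm norm_minus_commute)
      ultimately show ?thesis using contr[OF v\<epsilon> y, of y0] small \<epsilon> by simp
    qed
    have "\<exists>!y\<in>cball y0 \<epsilon>. P y = y"
    proof (rule Banach_fix[where c="1/2"])
      show "P ` cball y0 \<epsilon> \<subseteq> cball y0 \<epsilon>"
        using P0 \<epsilon> by (force simp: dist_norm norm_minus_commute)
      show "dist (P y) (P y') \<le> 1 / 2 * dist y y'" if "y \<in> cball y0 \<epsilon>" "y' \<in> cball y0 \<epsilon>" for y y'
        using contr[OF v\<epsilon> that] by (simp add: dist_norm P_def)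
    qed (use \<epsilon> in \<open>auto simp: complete_eq_closed\<close>)
    then obtain y where y: "y \<in> cball y0 \<epsilon>" "P y = y" by blast
    have "B w = B (T (v, y))" using y(2) by (simp add: P_def F_def algebra_simps)
    then have "w = T (v, y)" by (metis B(3))
    moreover have "y \<in> ball y0 \<epsilon>" using P0[OF y(1)] \<epsilon> y(2) by (simp add: dist_norm norm_minus_commute)
    ultimately show "\<exists>y\<in>ball y0 \<epsilon>. T (v, y) = w" by blast
  qed (use \<epsilon> \<delta> b inW est in \<open>auto simp: \<delta>_def\<close>)
qed

text \<open>Y is a given left inverse of T in y rather than one constructed here; as the local
  solutions lie in W, it must return them. Its derivative comes from G(v, w) = (v, Y (v, w)), a
  continuous right inverse of F(v, y) = (v, T (v, y)), whose derivative is block triangular and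
  invertible.\<close>

lemma holo_at_param_inverse:
  fixes T :: "'v::complex_model \<times> 'n::finite cvec \<Rightarrow> 'n cvec"
  assumes W: "open W" "(v0, y0) \<in> W" and hol: "\<And>q. q \<in> W \<Longrightarrow> holo_at T q"
    and inj: "\<And>h. frechet_derivative T (at (v0, y0)) (0, h) = 0 \<Longrightarrow> h = 0"
    and Y: "\<And>v y. (v, y) \<in> W \<Longrightarrow> Y (v, T (v, y)) = y"
  shows "holo_at Y (v0, T (v0, y0))"
    and "\<forall>\<^sub>F q in nhds (v0, T (v0, y0)). (fst q, Y q) \<in> W \<and> T (fst q, Y q) = snd q"
proof -
  define w0 where "w0 = T (v0, y0)"
  have Y0: "Y (v0, w0) = y0" using Y[OF W(2)] by (simp add: w0_def)
  obtain \<epsilon> \<delta> K where e: "\<epsilon> > 0" "\<delta> > 0" "K > 0" "\<delta> \<le> \<epsilon>"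
    "\<And>v y. v \<in> ball v0 \<epsilon> \<Longrightarrow> y \<in> cball y0 \<epsilon> \<Longrightarrow> (v, y) \<in> W"
    "\<And>v y y'. v \<in> ball v0 \<epsilon> \<Longrightarrow> y \<in> cball y0 \<epsilon> \<Longrightarrow> y' \<in> cball y0 \<epsilon> \<Longrightarrow>
       norm (y - y') \<le> K * norm (T (v, y) - T (v, y'))"
    "\<And>v w. v \<in> ball v0 \<delta> \<Longrightarrow> w \<in> ball w0 \<delta> \<Longrightarrow> \<exists>y\<in>ball y0 \<epsilon>. T (v, y) = w"
    unfolding w0_def using param_inverse_local[OF W hol inj] by blast
  have Yin: "Y (v, w) \<in> ball y0 \<epsilon> \<and> T (v, Y (v, w)) = w \<and> (v, Y (v, w)) \<in> W"
    if vw: "v \<in> ball v0 \<delta>" "w \<in> ball w0 \<delta>" for v w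
  proof -
    obtain y where y: "y \<in> ball y0 \<epsilon>" "T (v, y) = w" using e(7)[OF vw] by blast
    have "v \<in> ball v0 \<epsilon>" using vw(1) e(4) by auto
    then have "(v, y) \<in> W" using e(5) y(1) by simp
    then show ?thesis using Y[of v y] y by auto
  qed
  define O' where "O' = ball v0 \<delta> \<times> ball w0 \<delta>"
  have O': "open O'" "(v0, w0) \<in> O'" using e(2) by (auto simp: O'_def open_Times)
  show ev: "\<forall>\<^sub>F q in nhds (v0, T (v0, y0)). (fst q, Y q) \<in> W \<and> T (fst q, Y q) = snd q"
    unfolding eventually_nhds using O' Yin by (intro exI[of _ O']) (auto simp: O'_def w0_def)
  \<comment> \<open>From the lower bound for T: |Y (v, w) - y0| \<le> K |w - T (v, y0)|, and the
    right side tends to 0.\<close>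
  have cont: "isCont Y (v0, w0)"
  proof -
    have bound: "norm (Y q - y0) \<le> K * norm (snd q - T (fst q, y0))" if "q \<in> O'" for q
    proof -
      define v w where "v = fst q" and "w = snd q"
      have q: "q = (v, w)" "v \<in> ball v0 \<delta>" "w \<in> ball w0 \<delta>"
        using that by (auto simp: O'_def v_def w_def mem_Times_iff)
      have "v \<in> ball v0 \<epsilon>" using q(2) e(4) by auto
      then show ?thesis using e(6)[of v "Y q" y0] Yin[OF q(2,3)] e(1) by (simp add: q(1))
    qed
    have "((\<lambda>q. K * norm (snd q - T (fst q, y0))) \<longlongrightarrow> K * norm (snd (v0, w0) - T (fst (v0, w0), y0))) (at (v0, w0))"
    proof (intro tendsto_intros isCont_tendsto_compose[of _ T])
      show "isCont T (fst (v0, w0), y0)" using holo_at_isCont[OF hol[OF W(2)]] by simp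
    qed
    then have lim: "((\<lambda>q. K * norm (snd q - T (fst q, y0))) \<longlongrightarrow> 0) (at (v0, w0))"
      by (simp add: w0_def)
    have "\<forall>\<^sub>F q in at (v0, w0). norm (Y q - y0) \<le> K * norm (snd q - T (fst q, y0))"
      using bound O' by (auto simp: eventually_at_topological)
    then have "((\<lambda>q. Y q - y0) \<longlongrightarrow> 0) (at (v0, w0))"
      using lim by (rule Lim_null_comparison)
    then show ?thesis unfolding isCont_def Y0 by (simp add: LIM_zero_iff)
  qed
  define DT where "DT = frechet_derivative T (at (v0, y0))"
  have hT: "holo_at T (v0, y0)" by (rule hol[OF W(2)])
  have DT: "bounded_linear DT" "\<And>c v. DT (c *c v) = c *c DT v"
    unfolding DT_def using holo_at_linear[OF hT] holo_at_derivative(2)[OF hT] by auto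
  have DTadd: "DT (a + c, h + k) = DT (a, h) + DT (c, k)" for a c h k
    using linear_add[OF bounded_linear.linear[OF DT(1)], of "(a, h)" "(c, k)"] by simp
  have linA: "linear (\<lambda>h. DT (0, h))"
    using linear_compose[of "\<lambda>h. (0, h)", OF _ bounded_linear.linear[OF DT(1)]]
    by (simp add: comp_def linear_iff)
  have "inj (\<lambda>h. DT (0, h))" using inj linA by (simp add: linear_injective_0 DT_def)
  then obtain B where B: "linear B" "\<And>x. B (DT (0, x)) = x" "\<And>x. DT (0, B x) = x"
    using linear_injective_isomorphism[OF linA] by blast
  have blB: "bounded_linear B" using B(1) by (simp add: linear_conv_bounded_linear)
  have BC: "B (c *c x) = c *c B x" for c x
  proof -
    have "DT (0, c *c B x) = c *c x"
      using DT(2)[of c "(0, B x)"] B(3) by (simp add: cscale_Pair cscale_zero_right)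
    then show ?thesis by (metis B(2))
  qed
  \<comment> \<open>Inverse of (a, h) \<mapsto> (a, DT (a, h)): given k, solve DT (a, 0) + DT (0, h)
    = k for h.\<close>
  define g' where "g' = (\<lambda>(a, k). (a, B (k - DT (a, 0))))"
  define F where "F = (\<lambda>q. (fst q, T q))"
  define G where "G = (\<lambda>q. (fst q, Y q))"
  have G0: "G (v0, w0) = (v0, y0)" by (simp add: G_def Y0)
  have "(G has_derivative g') (at (v0, w0))"
  proof (rule has_derivative_inverse_basic[where f=F and f'="\<lambda>q. (fst q, DT q)" and T=O'])
    show "(F has_derivative (\<lambda>q. (fst q, DT q))) (at (G (v0, w0)))"
      unfolding F_def G0 DT_def by (intro has_derivative_Pair has_derivative_fst has_derivative_ident holo_at_derivative(1) hT)
    have bl0: "bounded_linear (\<lambda>a. DT (a, 0))"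
      by (rule bounded_linear_compose[OF DT(1)]) (intro bounded_linear_Pair bounded_linear_ident bounded_linear_zero)
    show "bounded_linear g'" unfolding g'_def split_def
      by (intro bounded_linear_Pair bounded_linear_fst bounded_linear_compose[OF blB] bounded_linear_sub
          bounded_linear_snd bounded_linear_compose[OF bl0])
    show "g' \<circ> (\<lambda>q. (fst q, DT q)) = id"
    proof (rule ext)
      fix q :: "'v \<times> 'n cvec"
      obtain a h where q: "q = (a, h)" by force
      have "DT (a, h) - DT (a, 0) = DT (0, h)" using DTadd[of a 0 0 h] by simp
      then show "(g' \<circ> (\<lambda>q. (fst q, DT q))) q = id q" by (simp add: g'_def q B(2))
    qed
    show "continuous (at (v0, w0)) G" unfolding G_def using cont by (intro continuous_intros) auto
    show "F (G z) = z" if "z \<in> O'" for z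
      using that Yin by (auto simp: F_def G_def O'_def)
  qed (use O' in auto)
  then have "(Y has_derivative (\<lambda>q. snd (g' q))) (at (v0, w0))"
    using has_derivative_snd by (fastforce simp: G_def)
  moreover have "snd (g' (c *c q)) = c *c snd (g' q)" for c q
  proof -
    obtain a k where q: "q = (a, k)" by force
    have "DT (c *c a, 0) = c *c DT (a, 0)" using DT(2)[of c "(a, 0)"] by (simp add: cscale_Pair cscale_zero_right)
    then show ?thesis by (simp add: q g'_def cscale_Pair cscale_diff[symmetric] BC)
  qed
  ultimately show "holo_at Y (v0, T (v0, y0))" unfolding w0_def by (rule holo_atI)
qed

section \<open>Coordinate functionals\<close>

text \<open>Equivalence of norms in finite dimension, by induction. By the bound for S, coefficients
  of a convergent sequence in the span of S are Cauchy, so this span is closed and b0 has a positive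
  distance d from it. That bounds the coefficient of b0, and subtracting its term reduces to
  S.\<close>

lemma complex_independent_coeff_bound:
  fixes S :: "'v::complex_model set"
  assumes "finite S" "\<forall>c. (\<Sum>b\<in>S. c b *c b) = 0 \<longrightarrow> (\<forall>b\<in>S. c b = 0)"
  shows "\<exists>K>0. \<forall>c. (\<Sum>b\<in>S. cmod (c b)) \<le> K * norm (\<Sum>b\<in>S. c b *c b)"
  using assms
proof (induction S rule: finite_induct)
  case empty
  show ?case by (intro exI[of _ 1]) simp
next
  case (insert b0 S)
  have "\<forall>c. (\<Sum>b\<in>S. c b *c b) = 0 \<longrightarrow> (\<forall>b\<in>S. c b = 0)"
  proof (intro allI impI)
    fix c assume c: "(\<Sum>b\<in>S. c b *c b) = 0"
    have "(\<Sum>b\<in>S. (c(b0 := 0)) b *c b) = (\<Sum>b\<in>S. c b *c b)"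
      using insert.hyps(2) by (intro sum.cong) auto
    then have "(\<Sum>b\<in>insert b0 S. (c(b0 := 0)) b *c b) = 0"
      using insert.hyps c by (simp add: cscale_zero_left)
    then have "\<forall>b\<in>insert b0 S. (c(b0 := 0)) b = 0" using insert.prems by blast
    then show "\<forall>b\<in>S. c b = 0" using insert.hyps(2) by (auto split: if_splits)
  qed
  then obtain K where K: "K > 0" "\<And>c. (\<Sum>b\<in>S. cmod (c b)) \<le> K * norm (\<Sum>b\<in>S. c b *c b)"
    using insert.IH by blast
  have diffsum: "(\<Sum>b\<in>S. (c b - c' b) *c b) = (\<Sum>b\<in>S. c b *c b) - (\<Sum>b\<in>S. c' b *c b)" for c c' :: "'v \<Rightarrow> complex"
  proof -
    have "(c b - c' b) *c b = c b *c b - c' b *c b" for b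
      using cscale_add_left[of "c b - c' b" "c' b" b] by (simp add: algebra_simps)
    then show ?thesis by (simp add: sum_subtractf)
  qed
  have "\<exists>d>0. \<forall>c. d \<le> norm (b0 - (\<Sum>b\<in>S. c b *c b))"
  proof (rule ccontr)
    assume "\<not> (\<exists>d>0. \<forall>c. d \<le> norm (b0 - (\<Sum>b\<in>S. c b *c b)))"
    then have "\<forall>n. \<exists>c. norm (b0 - (\<Sum>b\<in>S. c b *c b)) < inverse (real (Suc n))"
      by (metis inverse_positive_iff_positive not_le of_nat_0_less_iff zero_less_Suc)
    then obtain c where c: "\<And>n. norm (b0 - (\<Sum>b\<in>S. c n b *c b)) < inverse (real (Suc n))"
      by metis
    define x where "x = (\<lambda>n. \<Sum>b\<in>S. c n b *c b)"
    have x: "x \<longlonglongrightarrow> b0"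
    proof -
      have "(\<lambda>n. x n - b0) \<longlonglongrightarrow> 0"
      proof (rule Lim_null_comparison[OF _ LIMSEQ_inverse_real_of_nat])
        show "\<forall>\<^sub>F n in sequentially. norm (x n - b0) \<le> inverse (real (Suc n))"
          using less_imp_le[OF c] by (simp add: x_def norm_minus_commute)
      qed
      then show ?thesis by (simp add: LIM_zero_iff)
    qed
    have "Cauchy (\<lambda>n. c n b)" if b: "b \<in> S" for b
    proof (rule CauchyI)
      fix e :: real assume e: "e > 0"
      have "Cauchy x" using x by (rule LIMSEQ_imp_Cauchy)
      then obtain M where M: "\<And>m n. m \<ge> M \<Longrightarrow> n \<ge> M \<Longrightarrow> norm (x m - x n) < e / K"
        using CauchyD[of x "e / K"] e K(1) by auto
      show "\<exists>M. \<forall>m\<ge>M. \<forall>n\<ge>M. norm (c m b - c n b) < e"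
      proof (intro exI allI impI)
        fix m n assume mn: "m \<ge> M" "n \<ge> M"
        have "norm (c m b - c n b) \<le> (\<Sum>b\<in>S. cmod (c m b - c n b))"
          using b insert.hyps(1) by (intro member_le_sum) auto
        also have "\<dots> \<le> K * norm (\<Sum>b\<in>S. (c m b - c n b) *c b)" by (rule K(2))
        also have "\<dots> = K * norm (x m - x n)" by (simp add: diffsum x_def)
        also have "\<dots> < e" using M[OF mn] K(1) by (simp add: field_simps)
        finally show "norm (c m b - c n b) < e" .
      qed
    qed
    then have "\<exists>l. (\<lambda>n. c n b) \<longlonglongrightarrow> l" if "b \<in> S" for b
      using that by (simp add: Cauchy_convergent_iff convergent_def)
    then obtain l where l: "\<And>b. b \<in> S \<Longrightarrow> (\<lambda>n. c n b) \<longlonglongrightarrow> l b" by metis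
    have "x \<longlonglongrightarrow> (\<Sum>b\<in>S. l b *c b)"
      unfolding x_def by (intro tendsto_sum bounded_linear.tendsto[OF bounded_linear_cscale_left] l)
    then have b0: "b0 = (\<Sum>b\<in>S. l b *c b)" using x LIMSEQ_unique by blast
    \<comment> \<open>A limit b0 in the span of S gives a relation with coefficient -1 at b0,
      against independence.\<close>
    have "(\<Sum>b\<in>S. (l(b0 := -1)) b *c b) = (\<Sum>b\<in>S. l b *c b)"
      using insert.hyps(2) by (intro sum.cong) auto
    moreover have "(-1) *c b0 = - b0" using cscale_of_real[of "-1" b0] by simp
    ultimately have "(\<Sum>b\<in>insert b0 S. (l(b0 := -1)) b *c b) = 0"
      using insert.hyps b0 by simp
    then have "(l(b0 := -1)) b0 = 0" using insert.prems by blast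
    then show False by simp
  qed
  then obtain d where d: "d > 0" "\<And>c. d \<le> norm (b0 - (\<Sum>b\<in>S. c b *c b))" by blast
  show ?case
  \<comment> \<open>The coefficient of b0 is at most |X| / d, so the part in the span of S has norm
    at most |X| (1 + |b0| / d), to which the constant K applies.\<close>
  proof (intro exI[of _ "1 / d + K * (1 + norm b0 / d)"] conjI allI)
    show "1 / d + K * (1 + norm b0 / d) > 0" 
    proof -
      have "1 + norm b0 / d > 0" using d(1) by (intro add_pos_nonneg) auto
      then have "K * (1 + norm b0 / d) > 0" using K(1) by (rule mult_pos_pos[rotated])
      then show ?thesis using d(1) by (simp add: add_pos_pos)
    qed
    fix c
    define y where "y = (\<Sum>b\<in>S. c b *c b)"
    define X where "X = c b0 *c b0 + y"
    have 1: "cmod (c b0) \<le> norm X / d"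
    proof (cases "c b0 = 0")
      case True
      then show ?thesis using d(1) by simp
    next
      case False
      have "c b0 *c (b0 - (\<Sum>b\<in>S. (- c b / c b0) *c b)) = c b0 *c b0 - (\<Sum>b\<in>S. - c b *c b)"
        using False by (simp add: cscale_diff cscale_sum cscale_cscale)
      also have "(\<Sum>b\<in>S. - c b *c b) = - y"
        using diffsum[of "\<lambda>_. 0" c] by (simp add: y_def cscale_zero_left)
      finally have "c b0 *c (b0 - (\<Sum>b\<in>S. (- c b / c b0) *c b)) = X" by (simp add: X_def)
      then have "norm X = cmod (c b0) * norm (b0 - (\<Sum>b\<in>S. (- c b / c b0) *c b))"
        using norm_cscale by metis
      moreover have "cmod (c b0) * d \<le> cmod (c b0) * norm (b0 - (\<Sum>b\<in>S. (- c b / c b0) *c b))"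
        using d(2)[of "\<lambda>b. - c b / c b0"] by (rule mult_left_mono) simp
      ultimately show ?thesis using d(1) by (simp add: pos_le_divide_eq)
    qed
    have "norm y \<le> norm X + norm (c b0 *c b0)"
      using norm_triangle_ineq4[of X "c b0 *c b0"] by (simp add: X_def)
    also have "norm (c b0 *c b0) \<le> norm X / d * norm b0"
      unfolding norm_cscale using 1 by (rule mult_right_mono) simp
    finally have "norm y \<le> norm X * (1 + norm b0 / d)" by (simp add: algebra_simps)
    then have "K * norm y \<le> K * (norm X * (1 + norm b0 / d))" using K(1) by simp
    then have "(\<Sum>b\<in>S. cmod (c b)) \<le> K * (norm X * (1 + norm b0 / d))"
      using K(2)[of c] by (simp add: y_def)
    then have "(\<Sum>b\<in>insert b0 S. cmod (c b)) \<le> norm X / d + K * (norm X * (1 + norm b0 / d))"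
      using 1 insert.hyps by simp
    also have "\<dots> = (1 / d + K * (1 + norm b0 / d)) * norm X" by (simp add: algebra_simps)
    also have "X = (\<Sum>b\<in>insert b0 S. c b *c b)" using insert.hyps by (simp add: X_def y_def)
    finally show "(\<Sum>b\<in>insert b0 S. cmod (c b)) \<le> (1 / d + K * (1 + norm b0 / d)) * norm (\<Sum>b\<in>insert b0 S. c b *c b)" .
  qed
qed

text \<open>A model space comes only with a finite spanning set. One of least cardinality is a
  basis; its coordinate functionals are complex linear and bounded, hence holomorphic. They serve to
  expand sections that depend linearly on a parameter.\<close>

lemma complex_coordinates:
  obtains S :: "'v::complex_model set" and a :: "'v \<Rightarrow> 'v \<Rightarrow> complex"
  where "finite S" "\<And>v. v = (\<Sum>b\<in>S. a b v *c b)" "\<And>b x. b \<in> S \<Longrightarrow> holo_at (a b) x"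
proof -
  define P where "P = (\<lambda>n. \<exists>S::'v set. finite S \<and> card S = n \<and> (\<forall>x. \<exists>a. x = (\<Sum>b\<in>S. a b *c b)))"
  have "\<exists>n. P n" unfolding P_def using finite_dim_model by blast
  then have "P (LEAST n. P n)" by (rule LeastI_ex)
  then obtain S :: "'v set" where S: "finite S" "card S = (LEAST n. P n)" "\<And>x. \<exists>a. x = (\<Sum>b\<in>S. a b *c b)"
    unfolding P_def by blast
  have indep: "\<forall>c. (\<Sum>b\<in>S. c b *c b) = 0 \<longrightarrow> (\<forall>b\<in>S. c b = 0)"
  proof (intro allI impI ballI, rule ccontr)
    fix c b0 assume c: "(\<Sum>b\<in>S. c b *c b) = 0" "b0 \<in> S" "c b0 \<noteq> 0"
    \<comment> \<open>The relation c lets b0 be eliminated: subtract the multiple r of it that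
      cancels the coefficient of b0.\<close>
    have "\<exists>a. x = (\<Sum>b\<in>S - {b0}. a b *c b)" for x
    proof -
      obtain a where a: "x = (\<Sum>b\<in>S. a b *c b)" using S(3) by blast
      define r where "r = a b0 / c b0"
      have "(\<Sum>b\<in>S. (a b - r * c b) *c b) = (\<Sum>b\<in>S. a b *c b) - r *c (\<Sum>b\<in>S. c b *c b)"
      proof -
        have "(a b - r * c b) *c b = a b *c b - r *c (c b *c b)" for b
          using cscale_add_left[of "a b - r * c b" "r * c b" b] by (simp add: cscale_cscale algebra_simps)
        then show ?thesis by (simp add: sum_subtractf cscale_sum)
      qed
      then have "x = (\<Sum>b\<in>S. (a b - r * c b) *c b)" using a c(1) by (simp add: cscale_zero_right)
      also have "\<dots> = (a b0 - r * c b0) *c b0 + (\<Sum>b\<in>S - {b0}. (a b - r * c b) *c b)"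
        by (rule sum.remove[OF S(1) c(2)])
      also have "a b0 - r * c b0 = 0" using c(3) by (simp add: r_def)
      finally have "x = (\<Sum>b\<in>S - {b0}. (a b - r * c b) *c b)" by (simp add: cscale_zero_left)
      then show ?thesis by (rule exI[of _ "\<lambda>b. a b - r * c b"])
    qed
    then have "P (card (S - {b0}))" unfolding P_def using S(1) by blast
    then have "card S \<le> card (S - {b0})" unfolding S(2) by (rule Least_le)
    then show False using card_Diff1_less[OF S(1) c(2)] by simp
  qed
  obtain K where K: "K > 0" "\<And>c. (\<Sum>b\<in>S. cmod (c b)) \<le> K * norm (\<Sum>b\<in>S. c b *c b)"
    using complex_independent_coeff_bound[OF S(1) indep] by blast
  have "\<exists>a. \<forall>v. v = (\<Sum>b\<in>S. a v b *c b)" using S(3) by metis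
  then obtain a where a: "\<And>v. v = (\<Sum>b\<in>S. a v b *c b)" by blast
  have uniq: "c b = c' b" if "(\<Sum>b\<in>S. c b *c b) = (\<Sum>b\<in>S. c' b *c b)" "b \<in> S" for c c' b
  proof -
    have "(\<Sum>b\<in>S. (c b - c' b) *c b) = (\<Sum>b\<in>S. c b *c b) - (\<Sum>b\<in>S. c' b *c b)"
    proof -
      have "(c b - c' b) *c b = c b *c b - c' b *c b" for b
        using cscale_add_left[of "c b - c' b" "c' b" b] by (simp add: algebra_simps)
      then show ?thesis by (simp add: sum_subtractf)
    qed
    then have "(\<Sum>b\<in>S. (c b - c' b) *c b) = 0" using that(1) by simp
    then have "c b - c' b = 0" using that(2) by (rule indep[THEN spec, THEN mp, THEN bspec])
    then show ?thesis by simp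
  qed
  have "holo_at (\<lambda>v. a v b) x" if b: "b \<in> S" for b x
  proof (rule holo_at_bounded_linear)
    have cs: "a (c *c v) b = c * a v b" for c v
    proof (rule uniq[OF _ b, of "a (c *c v)" "\<lambda>b. c * a v b"])
      have "(\<Sum>b\<in>S. (c * a v b) *c b) = c *c (\<Sum>b\<in>S. a v b *c b)"
        by (simp add: cscale_sum cscale_cscale)
      then show "(\<Sum>b\<in>S. a (c *c v) b *c b) = (\<Sum>b\<in>S. (c * a v b) *c b)" by (simp add: a[symmetric])
    qed
    show "bounded_linear (\<lambda>v. a v b)"
    proof (rule bounded_linear_intro[where K=K])
      show "a (v + w) b = a v b + a w b" for v w
      proof (rule uniq[OF _ b, of "a (v + w)" "\<lambda>b. a v b + a w b"])
        show "(\<Sum>b\<in>S. a (v + w) b *c b) = (\<Sum>b\<in>S. (a v b + a w b) *c b)"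
          by (simp add: cscale_add_left sum.distrib a[symmetric])
      qed
      show "a (r *\<^sub>R v) b = r *\<^sub>R a v b" for r v
        using cs[of "of_real r" v] by (simp add: cscale_of_real scaleR_conv_of_real)
      show "norm (a v b) \<le> norm v * K" for v
      proof -
        have "cmod (a v b) \<le> (\<Sum>b\<in>S. cmod (a v b))" using b S(1) by (intro member_le_sum) auto
        also have "\<dots> \<le> K * norm (\<Sum>b\<in>S. a v b *c b)" by (rule K(2))
        finally show ?thesis by (simp add: a[symmetric] mult.commute)
      qed
    qed
    show "a (c *c v) b = c *c a v b" for c v by (simp add: cs cscale_complex)
  qed
  then show ?thesis using that[of S "\<lambda>b v. a v b"] S(1) a by blast
qed

section \<open>Determinants and alternating forms\<close>

abbreviation nmat :: "nat \<Rightarrow> (nat \<Rightarrow> nat \<Rightarrow> complex) \<Rightarrow> complex mat" where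
  "nmat k a \<equiv> mat k k (\<lambda>(i, j). a i j)"

lemma leibniz_det_mat: "leibniz_det k a = Determinant.det (nmat k a)"
proof -
  have "signof p = (of_int (sign p) :: complex)" for p :: "nat \<Rightarrow> nat"
    by (cases p rule: sign_cases) auto
  then show ?thesis
    unfolding leibniz_det_def Determinant.det_def atLeast0LessThan
    by (auto intro!: sum.cong prod.cong simp: permutes_in_image[of _ "{..<k}", simplified])
qed

lemma leibniz_det_cong:
  assumes "\<And>i j. i < k \<Longrightarrow> j < k \<Longrightarrow> a i j = b i j"
  shows "leibniz_det k a = leibniz_det k b"
  unfolding leibniz_det_mat using assms by (intro arg_cong[of _ _ Determinant.det] eq_matI) auto

lemma leibniz_det_transpose: "leibniz_det k (\<lambda>i j. a j i) = leibniz_det k a"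
proof -
  have "transpose_mat (nmat k a) = nmat k (\<lambda>i j. a j i)" by (intro eq_matI) auto
  then show ?thesis using det_transpose[of "nmat k a" k] by (simp add: leibniz_det_mat)
qed

lemma leibniz_det_one: "leibniz_det k (\<lambda>i j. if i = j then 1 else 0) = 1"
proof -
  have "nmat k (\<lambda>i j. if i = j then 1 else 0) = 1\<^sub>m k" by (intro eq_matI) auto
  then show ?thesis by (simp add: leibniz_det_mat)
qed

lemma leibniz_det_row_scale: "leibniz_det k (\<lambda>i j. c i * a i j) = (\<Prod>i<k. c i) * leibniz_det k a"
  by (simp add: leibniz_det_def prod.distrib sum_distrib_left mult_ac)

text \<open>In special coordinates vectors tangent to Y have vanishing first s components; this is
  the resulting splitting of the volume form.\<close>

lemma leibniz_det_block:
  assumes "s \<le> d" "\<And>i j. i < s \<Longrightarrow> s \<le> j \<Longrightarrow> j < d \<Longrightarrow> a i j = 0"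
  shows "leibniz_det d a = leibniz_det s a * leibniz_det (d - s) (\<lambda>i j. a (s + i) (s + j))"
proof -
  let ?A3 = "mat (d - s) s (\<lambda>(i, j). a (s + i) j)"
  let ?A4 = "nmat (d - s) (\<lambda>i j. a (s + i) (s + j))"
  have "nmat d a = four_block_mat (nmat s a) (0\<^sub>m s (d - s)) ?A3 ?A4"
    using assms by (intro eq_matI) auto
  then show ?thesis
    unfolding leibniz_det_mat
    by (simp add: det_four_block_mat_upper_right_zero[OF _ refl])
qed

text \<open>The shape met when the Euler field is contracted into the form on K_X: the field has
  only a fiber component, so its column has a single entry.\<close>

lemma leibniz_det_block_col:
  assumes "\<And>i. 0 < i \<Longrightarrow> i < Suc d \<Longrightarrow> a i 0 = 0"
  shows "leibniz_det (Suc d) a = a 0 0 * leibniz_det d (\<lambda>i j. a (Suc i) (Suc j))"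
proof -
  have "leibniz_det (Suc d) a = leibniz_det (Suc d) (\<lambda>i j. a j i)" by (rule leibniz_det_transpose[symmetric])
  also have "\<dots> = leibniz_det 1 (\<lambda>i j. a j i) * leibniz_det (Suc d - 1) (\<lambda>i j. a (1 + j) (1 + i))"
    by (rule leibniz_det_block) (use assms in auto)
  also have "leibniz_det 1 (\<lambda>i j. a j i) = a 0 0"
    by (simp add: leibniz_det_mat det_single[of _])
  also have "leibniz_det (Suc d - 1) (\<lambda>i j. a (1 + j) (1 + i)) = leibniz_det d (\<lambda>i j. a (Suc i) (Suc j))"
    using leibniz_det_transpose[of d "\<lambda>i j. a (Suc i) (Suc j)"] by simp
  finally show ?thesis .
qed

lemma leibniz_det_nonzero_iff:
  "leibniz_det k a \<noteq> 0 \<longleftrightarrow> (\<forall>c. (\<forall>j<k. (\<Sum>i<k. c i * a i j) = 0) \<longrightarrow> (\<forall>i<k. c i = 0))"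
proof -
  \<comment> \<open>The left kernel of a is the kernel of its transpose, to which
    \<open>det_0_iff_vec_prod_zero\<close> applies.\<close>
  let ?B = "nmat k (\<lambda>i j. a j i)"
  have det: "leibniz_det k a = Determinant.det ?B"
    unfolding leibniz_det_mat[symmetric] by (rule leibniz_det_transpose[symmetric])
  have mv: "?B *\<^sub>v v = 0\<^sub>v k \<longleftrightarrow> (\<forall>j<k. (\<Sum>i<k. vec_index v i * a i j) = 0)" if "v \<in> carrier_vec k" for v
    using that by (auto simp: vec_eq_iff scalar_prod_def atLeast0LessThan mult.commute)
  have "leibniz_det k a = 0 \<longleftrightarrow> (\<exists>v. v \<in> carrier_vec k \<and> v \<noteq> 0\<^sub>v k \<and> ?B *\<^sub>v v = 0\<^sub>v k)"
    unfolding det by (rule det_0_iff_vec_prod_zero) simp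
  also have "\<dots> \<longleftrightarrow> (\<exists>c. (\<forall>j<k. (\<Sum>i<k. c i * a i j) = 0) \<and> (\<exists>i<k. c i \<noteq> 0))"
  proof
    assume "\<exists>v. v \<in> carrier_vec k \<and> v \<noteq> 0\<^sub>v k \<and> ?B *\<^sub>v v = 0\<^sub>v k"
    then obtain v where v: "v \<in> carrier_vec k" "v \<noteq> 0\<^sub>v k" "?B *\<^sub>v v = 0\<^sub>v k" by blast
    then have "\<exists>i<k. vec_index v i \<noteq> 0" by (metis carrier_vecD eq_vecI index_zero_vec)
    then show "\<exists>c. (\<forall>j<k. (\<Sum>i<k. c i * a i j) = 0) \<and> (\<exists>i<k. c i \<noteq> 0)"
      using v mv by blast
  next
    assume "\<exists>c. (\<forall>j<k. (\<Sum>i<k. c i * a i j) = 0) \<and> (\<exists>i<k. c i \<noteq> 0)"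
    then obtain c where c: "\<forall>j<k. (\<Sum>i<k. c i * a i j) = 0" "\<exists>i<k. c i \<noteq> 0" by blast
    let ?v = "Matrix.vec k c"
    have "?v \<noteq> 0\<^sub>v k" using c(2) by (metis index_vec index_zero_vec(1))
    moreover have "?B *\<^sub>v ?v = 0\<^sub>v k" using c(1) by (subst mv) auto
    ultimately show "\<exists>v. v \<in> carrier_vec k \<and> v \<noteq> 0\<^sub>v k \<and> ?B *\<^sub>v v = 0\<^sub>v k" by (metis vec_carrier)
  qed
  finally show ?thesis by blast
qed

lemma leibniz_det_row_linear:
  assumes m: "m < k"
  shows "leibniz_det k (\<lambda>i j. if i = m then x * v j + y * w j else a i j) =
    x * leibniz_det k (\<lambda>i j. if i = m then v j else a i j) +
    y * leibniz_det k (\<lambda>i j. if i = m then w j else a i j)"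
proof -
  have "(\<Prod>i<k. if i = m then f (\<pi> i) else a i (\<pi> i)) = f (\<pi> m) * (\<Prod>i\<in>{..<k} - {m}. a i (\<pi> i))"
    for f :: "nat \<Rightarrow> complex" and \<pi>
    using m by (subst prod.remove[of _ m]) auto
  from this[of v] this[of w] this[of "\<lambda>j. x * v j + y * w j"] show ?thesis
    by (simp add: leibniz_det_def sum_distrib_left sum.distrib[symmetric] algebra_simps)
qed

lemma leibniz_det_col_linear:
  assumes m: "m < k"
  shows "leibniz_det k (\<lambda>i j. if j = m then x * v i + y * w i else a i j) =
    x * leibniz_det k (\<lambda>i j. if j = m then v i else a i j) +
    y * leibniz_det k (\<lambda>i j. if j = m then w i else a i j)"
  using leibniz_det_row_linear[OF m, of x v y w "\<lambda>i j. a j i"]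
  by (simp only: leibniz_det_transpose[of k "\<lambda>i j. if j = m then x * v i + y * w i else a i j", symmetric]
      leibniz_det_transpose[of k "\<lambda>i j. if j = m then v i else a i j", symmetric]
      leibniz_det_transpose[of k "\<lambda>i j. if j = m then w i else a i j", symmetric])

lemma leibniz_det_equal_cols:
  assumes "p < k" "q < k" "p \<noteq> q" "\<And>i. i < k \<Longrightarrow> a i p = a i q"
  shows "leibniz_det k a = 0"
  unfolding leibniz_det_mat
proof (rule det_identical_columns[of _ k p q])
  show "col (nmat k a) p = col (nmat k a) q" using assms by (intro eq_vecI) auto
qed (use assms in auto)

lemma holo_at_leibniz_det:
  "(\<And>i j. i < k \<Longrightarrow> j < k \<Longrightarrow> holo_at (\<lambda>x. a x i j) x) \<Longrightarrow> holo_at (\<lambda>x. leibniz_det k (a x)) x"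
  unfolding leibniz_det_def
  by (intro holo_at_sum holo_at_mult holo_at_const holo_at_prod)
     (auto simp: permutes_in_image[of _ "{..<k}", simplified])

text \<open>Linear subspace, except that the empty set qualifies; statements that use the zero
  vector assume it separately. The operations are pointwise because tangent vectors are functions on
  charts.\<close>

definition lin_closed :: "('y, 'n::finite cvec) tvec set \<Rightarrow> bool" where
  "lin_closed T \<longleftrightarrow> (\<forall>v\<in>T. \<forall>w\<in>T. \<forall>a b. (\<lambda>c. a *c v c + b *c w c) \<in> T)"

lemma alt_forms_scale: "\<alpha> \<in> alt_forms k T \<Longrightarrow> (\<lambda>u. g * \<alpha> u) \<in> alt_forms k T"
  unfolding alt_forms_def by (auto simp: algebra_simps)

lemma alt_forms_coord_form:
  fixes T :: "('y, 'n::{finite, linorder} cvec) tvec set"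
  assumes "lin_closed T"
  shows "coord_form c T m k \<in> alt_forms k T"
proof -
  have 1: "coord_form c T m k u = 0" if "\<exists>i<k. u i \<notin> T" for u
    using that by (auto simp: coord_form_def)
  have 2: "coord_form c T m k u = coord_form c T m k u'" if "\<forall>i<k. u i = u' i" for u u'
    using that by (auto simp: coord_form_def intro!: leibniz_det_cong)
  have 3: "coord_form c T m k (u(i := (\<lambda>c. a *c v c + b *c w c))) =
      a * coord_form c T m k (u(i := v)) + b * coord_form c T m k (u(i := w))"
    if "\<forall>j<k. u j \<in> T" "i < k" "v \<in> T" "w \<in> T" for u i v w a b
  proof -
    have "(\<lambda>c. a *c v c + b *c w c) \<in> T" using assms that by (simp add: lin_closed_def)
    then have "coord_form c T m k (u(i := (\<lambda>c. a *c v c + b *c w c))) =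
      leibniz_det k (\<lambda>i' j. if j = i then a * (v c $ coord (m + i')) + b * (w c $ coord (m + i')) else u j c $ coord (m + i'))"
      using that by (auto simp: coord_form_def cscale_complex if_distrib[of "\<lambda>f. f c $ _"] intro!: leibniz_det_cong)
    also have "\<dots> = a * leibniz_det k (\<lambda>i' j. if j = i then v c $ coord (m + i') else u j c $ coord (m + i'))
        + b * leibniz_det k (\<lambda>i' j. if j = i then w c $ coord (m + i') else u j c $ coord (m + i'))"
      by (rule leibniz_det_col_linear[OF that(2)])
    also have "leibniz_det k (\<lambda>i' j. if j = i then v c $ coord (m + i') else u j c $ coord (m + i')) =
        coord_form c T m k (u(i := v))"
      using that by (auto simp: coord_form_def intro!: leibniz_det_cong)
    also have "leibniz_det k (\<lambda>i' j. if j = i then w c $ coord (m + i') else u j c $ coord (m + i')) =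
        coord_form c T m k (u(i := w))"
      using that by (auto simp: coord_form_def intro!: leibniz_det_cong)
    finally show ?thesis .
  qed
  have 4: "coord_form c T m k u = 0" if "i < k" "j < k" "i \<noteq> j" "u i = u j" for u i j
    using that by (auto simp: coord_form_def intro!: leibniz_det_equal_cols[of i k j])
  show ?thesis unfolding alt_forms_def using 1 2 3 4 by blast
qed

lemma alt_forms_outside: "\<alpha> \<in> alt_forms k T \<Longrightarrow> i < k \<Longrightarrow> u i \<notin> T \<Longrightarrow> \<alpha> u = 0"
  unfolding alt_forms_def by blast

lemma alt_forms_cong: "\<alpha> \<in> alt_forms k T \<Longrightarrow> (\<And>i. i < k \<Longrightarrow> u i = u' i) \<Longrightarrow> \<alpha> u = \<alpha> u'"
  unfolding alt_forms_def by blast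

lemma alt_forms_linear:
  "\<alpha> \<in> alt_forms k T \<Longrightarrow> (\<And>j. j < k \<Longrightarrow> u j \<in> T) \<Longrightarrow> i < k \<Longrightarrow> v \<in> T \<Longrightarrow> w \<in> T \<Longrightarrow>
    \<alpha> (u(i := (\<lambda>c. a *c v c + b *c w c))) = a * \<alpha> (u(i := v)) + b * \<alpha> (u(i := w))"
  unfolding alt_forms_def by blast

lemma alt_forms_equal:
  "\<alpha> \<in> alt_forms k T \<Longrightarrow> (\<And>j. j < k \<Longrightarrow> u j \<in> T) \<Longrightarrow> i < k \<Longrightarrow> j < k \<Longrightarrow> i \<noteq> j \<Longrightarrow> u i = u j \<Longrightarrow> \<alpha> u = 0"
  unfolding alt_forms_def by blast

text \<open>Polarization: alternation is stated as vanishing on equal arguments. Put the sum of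
  \<open>u a\<close> and \<open>u b\<close> into both slots; of the four terms two vanish and the
  other two add up to 0.\<close>

lemma alt_forms_swap:
  assumes \<alpha>: "\<alpha> \<in> alt_forms k T" and T: "lin_closed T" and u: "\<And>j. j < k \<Longrightarrow> u j \<in> T"
    and ab: "a < k" "b < k" "a \<noteq> b"
  shows "\<alpha> (u \<circ> Transposition.transpose a b) = - \<alpha> u"
proof -
  define s where "s = (\<lambda>c. 1 *c u a c + 1 *c u b c)"
  have s: "s \<in> T" using T u ab by (auto simp: lin_closed_def s_def)
  have lin: "\<alpha> (w(i := s)) = \<alpha> (w(i := u a)) + \<alpha> (w(i := u b))" if "\<And>j. j < k \<Longrightarrow> w j \<in> T" "i < k" for w i
    using alt_forms_linear[OF \<alpha> that, where v="u a" and w="u b" and a=1 and b=1] u ab by (simp add: s_def)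
  have "0 = \<alpha> (u(a := s, b := s))"
    using alt_forms_equal[OF \<alpha>, of "u(a := s, b := s)" a b] ab u s by auto
  also have "\<dots> = \<alpha> (u(a := s, b := u a)) + \<alpha> (u(a := s, b := u b))"
    by (rule lin) (use u s ab in auto)
  also have "\<alpha> (u(a := s, b := u a)) = \<alpha> ((u(b := u a))(a := s))" using ab by (simp add: fun_upd_twist)
  also have "\<dots> = \<alpha> (u(b := u a, a := u a)) + \<alpha> (u(b := u a, a := u b))"
    by (rule lin) (use u ab in auto)
  also have "\<alpha> (u(b := u a, a := u a)) = 0"
    by (rule alt_forms_equal[OF \<alpha>, of _ a b]) (use ab u in auto)
  also have "\<alpha> (u(a := s, b := u b)) = \<alpha> (u(a := s))" using ab by (intro arg_cong[of _ _ \<alpha>]) auto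
  also have "\<dots> = \<alpha> (u(a := u a)) + \<alpha> (u(a := u b))" by (rule lin) (use u ab in auto)
  also have "\<alpha> (u(a := u b)) = 0" by (rule alt_forms_equal[OF \<alpha>, of _ a b]) (use ab u in auto)
  also have "u(b := u a, a := u b) = u \<circ> Transposition.transpose a b"
    using ab by (auto simp: fun_eq_iff Transposition.transpose_def)
  finally have "0 = \<alpha> (u \<circ> Transposition.transpose a b) + \<alpha> u" by (simp add: comp_def)
  then show ?thesis by (metis eq_neg_iff_add_eq_0)
qed

lemma alt_forms_permute:
  assumes \<alpha>: "\<alpha> \<in> alt_forms k T" and T: "lin_closed T" and p: "p permutes {..<k}"
    and E: "\<And>j. j < k \<Longrightarrow> E j \<in> T"
  shows "\<alpha> (E \<circ> p) = of_int (sign p) * \<alpha> E"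
proof -
  have "\<forall>E. (\<forall>j<k. E j \<in> T) \<longrightarrow> \<alpha> (E \<circ> p) = of_int (sign p) * \<alpha> E"
    using p finite_lessThan
  proof (induction p rule: permutes_induct)
    case id
    then show ?case by (simp add: sign_id)
  next
    case (swap a b p)
    show ?case
    proof (intro allI impI)
      fix E assume E: "\<forall>j<k. E j \<in> T"
      have perm: "permutation p" using swap by (metis finite_lessThan permutation_permutes)
      have E': "\<forall>j<k. (E \<circ> Transposition.transpose a b) j \<in> T"
        using E swap.hyps by (auto simp: Transposition.transpose_def)
      have "\<alpha> (E \<circ> (Transposition.transpose a b \<circ> p)) = of_int (sign p) * \<alpha> (E \<circ> Transposition.transpose a b)"
        using swap.IH E' by (metis comp_assoc)
      also have "\<alpha> (E \<circ> Transposition.transpose a b) = - \<alpha> E"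
        using alt_forms_swap[OF \<alpha> T] E swap.hyps by simp
      finally have eq: "\<alpha> (E \<circ> (Transposition.transpose a b \<circ> p)) = of_int (sign p) * - \<alpha> E" .
      have sg: "sign (Transposition.transpose a b \<circ> p) = - sign p"
        using swap.hyps perm by (simp add: sign_compose permutation_swap_id sign_swap_id)
      show "\<alpha> (E \<circ> (Transposition.transpose a b \<circ> p)) = of_int (sign (Transposition.transpose a b \<circ> p)) * \<alpha> E"
        by (simp only: eq sg of_int_minus mult_minus_left mult_minus_right)
    qed
  qed
  then show ?thesis using E by blast
qed

definition lincomb :: "nat \<Rightarrow> (nat \<Rightarrow> complex) \<Rightarrow> (nat \<Rightarrow> ('y, 'n::finite cvec) tvec) \<Rightarrow> ('y, 'n cvec) tvec" where
  "lincomb k a E = (\<lambda>c. \<Sum>l<k. a l *c E l c)"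

lemma lincomb_in:
  assumes T: "lin_closed T" and E: "\<And>l. l < k \<Longrightarrow> E l \<in> T" and T0: "(\<lambda>c. 0) \<in> T"
  shows "lincomb k a E \<in> T"
  using E
proof (induction k)
  case 0
  then show ?case using T0 by (simp add: lincomb_def)
next
  case (Suc k)
  have "(\<lambda>c. 1 *c lincomb k a E c + a k *c E k c) \<in> T"
    using T Suc by (auto simp: lin_closed_def)
  then show ?case by (simp add: lincomb_def cscale_one)
qed

lemma alt_forms_lincomb:
  assumes \<alpha>: "\<alpha> \<in> alt_forms k T" and T: "lin_closed T" and T0: "(\<lambda>c. 0) \<in> T"
    and u: "\<And>j. j < k \<Longrightarrow> u j \<in> T" and i: "i < k" and E: "\<And>l. l < n \<Longrightarrow> E l \<in> T"
  shows "\<alpha> (u(i := lincomb n a E)) = (\<Sum>l<n. a l * \<alpha> (u(i := E l)))"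
  using E
proof (induction n)
  case 0
  have "\<alpha> (u(i := (\<lambda>c. 0 *c (0::'b cvec) + 0 *c 0))) = 0 * \<alpha> (u(i := (\<lambda>c. 0))) + 0 * \<alpha> (u(i := (\<lambda>c. 0)))"
    by (rule alt_forms_linear[OF \<alpha> u i T0 T0])
  moreover have "lincomb 0 a E = (\<lambda>c. 0)" by (simp add: lincomb_def)
  ultimately show ?case by (simp only: cscale_zero_left lessThan_0 sum.empty mult_zero_left add_0_right)
next
  case (Suc n)
  have "lincomb (Suc n) a E = (\<lambda>c. 1 *c lincomb n a E c + a n *c E n c)"
    by (simp add: lincomb_def cscale_one)
  moreover have "\<alpha> (u(i := (\<lambda>c. 1 *c lincomb n a E c + a n *c E n c))) =
      1 * \<alpha> (u(i := lincomb n a E)) + a n * \<alpha> (u(i := E n))"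
    by (rule alt_forms_linear[OF \<alpha> u i]) (use Suc.prems lincomb_in[OF T _ T0] in auto)
  moreover have "\<alpha> (u(i := lincomb n a E)) = (\<Sum>l<n. a l * \<alpha> (u(i := E l)))"
    by (rule Suc.IH) (use Suc.prems in simp)
  ultimately show ?case by (simp only: sum.lessThan_Suc mult_1)
qed

text \<open>Multilinear expansion gives a sum over all maps f from slots to basis indices.
  Non-injective f contribute 0 by alternation; the others are permutations and contribute their
  sign, which is the Leibniz formula of the transposed matrix.\<close>

lemma alt_forms_det:
  assumes \<alpha>: "\<alpha> \<in> alt_forms k T" and T: "lin_closed T" and T0: "(\<lambda>c. 0) \<in> T"
    and E: "\<And>l. l < k \<Longrightarrow> E l \<in> T" and u: "\<And>j. j < k \<Longrightarrow> u j = lincomb k (\<lambda>l. a l j) E"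
  shows "\<alpha> u = leibniz_det k a * \<alpha> E"
proof -
  have uT: "u j \<in> T" if "j < k" for j using u[OF that] lincomb_in[OF T E T0] by simp
  \<comment> \<open>Induction on the number m of slots already expanded; the slots from m on still
    hold u.\<close>
  have expand: "\<alpha> u = (\<Sum>f\<in>PiE {..<m} (\<lambda>_. {..<k}). (\<Prod>j<m. a (f j) j) * \<alpha> (\<lambda>j. if j < m then E (f j) else u j))"
    if "m \<le> k" for m
    using that
  proof (induction m)
    case 0
    then show ?case by simp
  next
    case (Suc m)
    let ?g = "\<lambda>f j. if j < m then E (f j) else u j"
    have "\<alpha> u = (\<Sum>f\<in>PiE {..<m} (\<lambda>_. {..<k}). (\<Prod>j<m. a (f j) j) * \<alpha> (?g f))"
      using Suc by simp
    also have "\<dots> = (\<Sum>f\<in>PiE {..<m} (\<lambda>_. {..<k}). \<Sum>l<k. a l m * (\<Prod>j<m. a (f j) j) * \<alpha> ((?g f)(m := E l)))"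
    proof (rule sum.cong[OF refl])
      fix f assume f: "f \<in> PiE {..<m} (\<lambda>_. {..<k})"
      have "\<alpha> (?g f) = \<alpha> ((?g f)(m := lincomb k (\<lambda>l. a l m) E))"
        using u[of m] Suc.prems by (intro arg_cong[of _ _ \<alpha>]) (auto simp: fun_eq_iff)
      also have "\<dots> = (\<Sum>l<k. a l m * \<alpha> ((?g f)(m := E l)))"
        by (rule alt_forms_lincomb[OF \<alpha> T T0]) (use Suc.prems f E uT in \<open>auto simp: PiE_iff\<close>)
      finally show "(\<Prod>j<m. a (f j) j) * \<alpha> (?g f) = (\<Sum>l<k. a l m * (\<Prod>j<m. a (f j) j) * \<alpha> ((?g f)(m := E l)))"
        by (simp add: sum_distrib_left mult_ac)
    qed
    also have "\<dots> = (\<Sum>(l, f)\<in>{..<k} \<times> PiE {..<m} (\<lambda>_. {..<k}). a l m * (\<Prod>j<m. a (f j) j) * \<alpha> ((?g f)(m := E l)))"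
      by (subst sum.swap) (simp add: sum.cartesian_product)
    also have "\<dots> = (\<Sum>f\<in>PiE {..<Suc m} (\<lambda>_. {..<k}). (\<Prod>j<Suc m. a (f j) j) * \<alpha> (\<lambda>j. if j < Suc m then E (f j) else u j))"
      unfolding lessThan_Suc PiE_insert_eq
    proof (subst sum.reindex)
      show "inj_on (\<lambda>(y, g). g(m := y)) ({..<k} \<times> PiE {..<m} (\<lambda>_. {..<k}))"
        by (rule inj_combinator) simp
      show "(\<Sum>(l, f)\<in>{..<k} \<times> PiE {..<m} (\<lambda>_. {..<k}). a l m * (\<Prod>j<m. a (f j) j) * \<alpha> ((?g f)(m := E l))) =
        sum ((\<lambda>f. (\<Prod>j\<in>insert m {..<m}. a (f j) j) * \<alpha> (\<lambda>j. if j < Suc m then E (f j) else u j)) \<circ> (\<lambda>(y, g). g(m := y)))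
          ({..<k} \<times> PiE {..<m} (\<lambda>_. {..<k}))"
      proof (rule sum.cong[OF refl])
        fix x assume "x \<in> {..<k} \<times> PiE {..<m} (\<lambda>_. {..<k})"
        obtain l f where x: "x = (l, f)" by (cases x)
        have A: "(\<Prod>j\<in>insert m {..<m}. a ((f(m := l)) j) j) = a l m * (\<Prod>j<m. a (f j) j)"
        proof -
          have "(\<Prod>j<m. a ((f(m := l)) j) j) = (\<Prod>j<m. a (f j) j)" by (rule prod.cong) auto
          then show ?thesis by simp
        qed
        have B: "(?g f)(m := E l) = (\<lambda>j. if j < Suc m then E ((f(m := l)) j) else u j)"
          by (auto simp: fun_eq_iff)
        show "(case x of (l, f) \<Rightarrow> a l m * (\<Prod>j<m. a (f j) j) * \<alpha> ((?g f)(m := E l))) =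
          ((\<lambda>f. (\<Prod>j\<in>insert m {..<m}. a (f j) j) * \<alpha> (\<lambda>j. if j < Suc m then E (f j) else u j)) \<circ> (\<lambda>(y, g). g(m := y))) x"
          by (simp only: x prod.case comp_apply A B)
      qed
    qed
    finally show ?case .
  qed
  let ?F = "PiE {..<k} (\<lambda>_. {..<k})"
  let ?P = "{p. p permutes {..<k}}"
  let ?h = "\<lambda>f. (\<Prod>j<k. a (f j) j) * \<alpha> (\<lambda>j. if j < k then E (f j) else u j)"
  let ?r = "\<lambda>p. restrict p {..<k}"
  have "\<alpha> u = (\<Sum>f\<in>?F. ?h f)" using expand[of k] by simp
  also have "\<dots> = (\<Sum>f\<in>?r ` ?P. ?h f)"
  proof (rule sum.mono_neutral_right)
    show "finite ?F" by (intro finite_PiE) auto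
    show "?r ` ?P \<subseteq> ?F"
      by (rule image_subsetI) (auto simp: restrict_PiE_iff permutes_in_image[of _ "{..<k}", simplified])
    show "\<forall>f\<in>?F - ?r ` ?P. ?h f = 0"
    proof
      fix f assume f: "f \<in> ?F - ?r ` ?P"
      have "\<not> inj_on f {..<k}"
      proof
        assume inj: "inj_on f {..<k}"
        \<comment> \<open>\<open>permutes\<close> asks for the identity outside
          \<open>{..<k}\<close>, whereas f is undefined there; hence this extension.\<close>
        define p where "p = (\<lambda>j. if j < k then f j else j)"
        have "f ` {..<k} \<subseteq> {..<k}" using f by (auto simp: PiE_iff)
        then have "bij_betw f {..<k} {..<k}" using inj by (simp add: bij_betw_def endo_inj_surj)
        then have "bij_betw p {..<k} {..<k}" by (rule bij_betw_cong[THEN iffD1, rotated]) (simp add: p_def)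
        then have "p permutes {..<k}" by (rule bij_imp_permutes) (simp add: p_def)
        moreover have "f = ?r p" using f by (auto simp: p_def fun_eq_iff PiE_iff extensional_def)
        ultimately show False using f by blast
      qed
      then obtain i j where ij: "i < k" "j < k" "i \<noteq> j" "f i = f j" by (auto simp: inj_on_def)
      have "\<alpha> (\<lambda>j. if j < k then E (f j) else u j) = 0"
        by (rule alt_forms_equal[OF \<alpha> _ ij(1-3)]) (use ij f E in \<open>auto simp: PiE_iff\<close>)
      then show "?h f = 0" by simp
    qed
  qed
  also have "\<dots> = (\<Sum>p\<in>?P. ?h (?r p))"
  proof (subst sum.reindex)
    show "inj_on ?r ?P"
    proof (rule inj_onI)
      fix p q assume pq: "p \<in> ?P" "q \<in> ?P" "?r p = ?r q"
      show "p = q"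
      proof
        fix j show "p j = q j"
        proof (cases "j < k")
          case True
          then show ?thesis using fun_cong[OF pq(3), of j] by simp
        next
          case False
          then show ?thesis using pq(1,2) by (auto dest!: permutes_not_in[of _ _ j])
        qed
      qed
    qed
  qed simp
  also have "\<dots> = (\<Sum>p\<in>?P. of_int (sign p) * (\<Prod>j<k. a (p j) j) * \<alpha> E)"
  proof (rule sum.cong[OF refl])
    fix p assume "p \<in> ?P"
    then have p: "p permutes {..<k}" by simp
    have "\<alpha> (\<lambda>j. if j < k then E (?r p j) else u j) = \<alpha> (E \<circ> p)"
      by (rule alt_forms_cong[OF \<alpha>]) simp
    also have "\<dots> = of_int (sign p) * \<alpha> E" by (rule alt_forms_permute[OF \<alpha> T p E])
    finally have B: "\<alpha> (\<lambda>j. if j < k then E (?r p j) else u j) = of_int (sign p) * \<alpha> E" .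
    have A: "(\<Prod>j<k. a (?r p j) j) = (\<Prod>j<k. a (p j) j)" by (rule prod.cong) auto
    show "?h (?r p) = of_int (sign p) * (\<Prod>j<k. a (p j) j) * \<alpha> E"
      unfolding A B by (simp only: mult_ac)
  qed
  also have "\<dots> = leibniz_det k (\<lambda>i j. a j i) * \<alpha> E"
    by (simp add: leibniz_det_def sum_distrib_right)
  also have "leibniz_det k (\<lambda>i j. a j i) = leibniz_det k a" by (rule leibniz_det_transpose)
  finally show ?thesis .
qed

section \<open>The inverse function theorem without parameters\<close>

lemma local_inverse:
  fixes T :: "'n::finite cvec \<Rightarrow> 'n cvec"
  assumes W: "open W" "y0 \<in> W" and hol: "\<And>y. y \<in> W \<Longrightarrow> holo_at T y"
    and inj: "\<And>h. frechet_derivative T (at y0) h = 0 \<Longrightarrow> h = 0"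
  obtains V where "open V" "y0 \<in> V" "V \<subseteq> W" "inj_on T V" "open (T ` V)"
    "\<And>w. w \<in> T ` V \<Longrightarrow> holo_at (inv_into V T) w"
proof -
  \<comment> \<open>A parameter in the zero-dimensional space \<open>unit\<close> reduces the claim
    to the version with parameters.\<close>
  define S where "S = (\<lambda>q::unit \<times> 'n cvec. T (snd q))"
  have holS: "holo_at S q" if "q \<in> UNIV \<times> W" for q
    unfolding S_def by (rule holo_at_compose[OF holo_at_snd[OF holo_at_ident] hol]) (use that in auto)
  have opS: "open (UNIV \<times> W :: (unit \<times> 'n cvec) set)" using W(1) by (intro open_Times) auto
  have DS: "frechet_derivative S (at ((), y)) ((), h) = frechet_derivative T (at y) h" if "y \<in> W" for y h
  proof -
    have "frechet_derivative S (at ((), y)) ((), h) =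
        frechet_derivative T (at (snd ((), y))) (frechet_derivative snd (at ((), y)) ((), h))"
      unfolding S_def by (rule frechet_derivative_compose_holo[OF holo_at_snd[OF holo_at_ident]]) (simp add: hol that)
    also have "frechet_derivative snd (at ((), y)) = (snd :: unit \<times> 'n cvec \<Rightarrow> _)"
      using frechet_derivative_at[OF bounded_linear_imp_has_derivative[OF bounded_linear_snd]] by metis
    finally show ?thesis by simp
  qed
  have unit0: "(0::unit) = ()" by simp
  obtain \<epsilon> \<delta> K where e: "\<epsilon> > 0" "\<delta> > 0" "K > 0" "\<delta> \<le> \<epsilon>"
    "\<And>v y. v \<in> ball () \<epsilon> \<Longrightarrow> y \<in> cball y0 \<epsilon> \<Longrightarrow> (v, y) \<in> UNIV \<times> W"
    "\<And>v y y'. v \<in> ball () \<epsilon> \<Longrightarrow> y \<in> cball y0 \<epsilon> \<Longrightarrow> y' \<in> cball y0 \<epsilon> \<Longrightarrow>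
       norm (y - y') \<le> K * norm (S (v, y) - S (v, y'))"
    "\<And>v w. v \<in> ball () \<delta> \<Longrightarrow> w \<in> ball (S ((), y0)) \<delta> \<Longrightarrow> \<exists>y\<in>ball y0 \<epsilon>. S (v, y) = w"
  proof (rule param_inverse_local[OF opS _ holS])
    show "((), y0) \<in> UNIV \<times> W" using W by simp
    show "h = 0" if "frechet_derivative S (at ((), y0)) (0, h) = 0" for h
      using that DS[OF W(2), of h] inj by (simp only: unit0)
  qed blast+
  have ub: "() \<in> ball () r" if "r > 0" for r using that by simp
  have sub: "y \<in> W" if "y \<in> cball y0 \<epsilon>" for y
    using e(5)[OF ub[OF e(1)] that] by simp
  have est: "norm (y - y') \<le> K * norm (T y - T y')" if "y \<in> cball y0 \<epsilon>" "y' \<in> cball y0 \<epsilon>" for y y'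
    using e(6)[OF ub[OF e(1)] that] by (simp add: S_def)
  define V where "V = {y \<in> ball y0 \<epsilon>. T y \<in> ball (T y0) \<delta>}"
  have Vsub: "V \<subseteq> W" "V \<subseteq> cball y0 \<epsilon>" using sub by (auto simp: V_def)
  have contT: "continuous_on (ball y0 \<epsilon>) T"
    by (intro continuous_at_imp_continuous_on ballI holo_at_isCont hol sub) simp
  have opV: "open V"
  proof -
    have "V = ball y0 \<epsilon> \<inter> T -` ball (T y0) \<delta>" by (auto simp: V_def)
    then show ?thesis using continuous_open_preimage[OF contT open_ball open_ball] by simp
  qed
  have y0V: "y0 \<in> V" using e(1,2) by (simp add: V_def)
  have injV: "inj_on T V"
  proof (rule inj_onI)
    fix y y' assume y: "y \<in> V" "y' \<in> V" and eq: "T y = T y'"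
    show "y = y'" using est[OF subsetD[OF Vsub(2) y(1)] subsetD[OF Vsub(2) y(2)]] eq by simp
  qed
  have img: "T ` V = ball (T y0) \<delta>"
  proof
    show "ball (T y0) \<delta> \<subseteq> T ` V"
    proof
      fix w assume w: "w \<in> ball (T y0) \<delta>"
      then obtain y where "y \<in> ball y0 \<epsilon>" "T y = w"
        using e(7)[OF ub[OF e(2)], of w] by (auto simp: S_def)
      then show "w \<in> T ` V" using w by (auto simp: V_def)
    qed
  qed (auto simp: V_def)
  have "holo_at (inv_into V T) w" if w: "w \<in> T ` V" for w
  proof -
    obtain y where y: "y \<in> V" "w = T y" using w by blast
    \<comment> \<open>Injectivity of the derivative is assumed at y0 only. At other y it follows
      from |y' - y| \<le> K |T y' - T y|: a kernel direction would lead to points where T changes by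
      at most half of |y' - y| / K.\<close>
    have inj_y: "h = 0" if h: "frechet_derivative T (at y) h = 0" for h
    proof (rule ccontr)
      assume "h \<noteq> 0"
      have yW: "y \<in> W" using y Vsub by blast
      have der: "(T has_derivative frechet_derivative T (at y)) (at y)"
        by (rule holo_at_derivative(1)[OF hol[OF yW]])
      have "0 < 1 / (2 * K)" using e(3) by simp
      then obtain d where d: "d > 0"
        "\<And>y'. norm (y' - y) < d \<Longrightarrow> norm (T y' - T y - frechet_derivative T (at y) (y' - y)) \<le> 1 / (2 * K) * norm (y' - y)"
        using der unfolding has_derivative_at_alt by blast
      obtain d' where d': "d' > 0" "ball y d' \<subseteq> V" using opV y(1) open_contains_ball by blast
      define t where "t = min d d' / (2 * norm h)"
      have t: "t > 0" using d(1) d'(1) \<open>h \<noteq> 0\<close> by (simp add: t_def)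
      have tn: "norm (t *\<^sub>R h) = min d d' / 2" using t \<open>h \<noteq> 0\<close> d(1) d'(1) by (simp add: t_def)
      define y' where "y' = y + t *\<^sub>R h"
      have "norm (y' - y) < d" "y' \<in> ball y d'" using tn d(1) d'(1) by (auto simp: y'_def dist_norm)
      then have y'V: "y' \<in> V" using d'(2) by blast
      have lin: "linear (frechet_derivative T (at y))" using der has_derivative_linear by blast
      have "frechet_derivative T (at y) (y' - y) = 0" using h by (simp add: y'_def linear_scale[OF lin])
      then have "norm (T y' - T y) \<le> 1 / (2 * K) * norm (y' - y)" using d(2)[OF \<open>norm (y' - y) < d\<close>] by simp
      then have "K * norm (T y' - T y) \<le> K * (1 / (2 * K) * norm (y' - y))"
        by (rule mult_left_mono) (use e(3) in simp)
      moreover have "norm (y' - y) \<le> K * norm (T y' - T y)" using est y'V y(1) Vsub(2) by blast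
      moreover have "K * (1 / (2 * K) * norm (y' - y)) = norm (y' - y) / 2" using e(3) by simp
      ultimately have "norm (y' - y) \<le> 0" by linarith
      moreover have "t * norm h > 0" using t \<open>h \<noteq> 0\<close> by simp
      ultimately show False using t by (simp add: y'_def)
    qed
    define Y where "Y = (\<lambda>q::unit \<times> 'n cvec. inv_into V T (snd q))"
    have "holo_at Y ((), S ((), y))"
    proof (rule holo_at_param_inverse(1)[where W="UNIV \<times> V"])
      show "open (UNIV \<times> V :: (unit \<times> 'n cvec) set)" using opV by (intro open_Times) auto
      show "holo_at S q" if "q \<in> UNIV \<times> V" for q using that Vsub(1) by (intro holS) auto
      show "h = 0" if "frechet_derivative S (at ((), y)) (0, h) = 0" for h
        using that DS[of y h] y(1) Vsub(1) inj_y by (auto simp only: unit0)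
      show "Y (v, S (v, y)) = y" if "(v, y) \<in> UNIV \<times> V" for v y
        using that injV by (simp add: Y_def S_def inv_into_f_f)
    qed (use y in simp)
    then have "holo_at (\<lambda>w. Y ((), w)) w"
      using holo_at_compose[OF holo_at_Pair[OF holo_at_const holo_at_ident], of Y "()" w] y(2) by (simp add: S_def)
    then show ?thesis by (simp add: Y_def)
  qed
  then show ?thesis using that[of V] opV y0V Vsub(1) injV img by simp
qed

section \<open>Calculus on complex manifolds\<close>

lemma coord_bij: "bij_betw coord {..<CARD('n)} (UNIV :: 'n::{finite, linorder} set)"
proof -
  let ?xs = "sorted_list_of_set (UNIV :: 'n set)"
  have "bij_betw ((!) ?xs) {..<length ?xs} (set ?xs)"
    by (rule bij_betw_nth) auto
  then show ?thesis unfolding coord_def[abs_def] by simp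
qed

lemma coord_eq_iff: "i < CARD('n) \<Longrightarrow> j < CARD('n) \<Longrightarrow> (coord i :: 'n::{finite, linorder}) = coord j \<longleftrightarrow> i = j"
  using bij_betw_imp_inj_on[OF coord_bij[where 'n='n]] by (auto simp: inj_on_def)

lemma coord_surj: "\<exists>i<CARD('n). coord i = (q :: 'n::{finite, linorder})"
  using bij_betw_imp_surj_on[OF coord_bij[where 'n='n]] by (metis UNIV_I imageE lessThan_iff)

lemma vec_eq_coord: "(\<And>i. i < CARD('n) \<Longrightarrow> x $ coord i = y $ coord i) \<Longrightarrow> x = (y :: 'n::{finite, linorder} cvec)"
  by (metis coord_surj Finite_Cartesian_Product.vec_eq_iff)

lemma vec_coord_expansion: "x = (\<Sum>l<CARD('n). (x $ coord l) *c axis (coord l) 1)"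
  for x :: "'n::{finite, linorder} cvec"
proof (rule vec_eq_coord)
  fix i assume i: "i < CARD('n)"
  have "(\<Sum>l<CARD('n). (x $ coord l) *c axis (coord l) (1::complex)) $ (coord i :: 'n) =
      (\<Sum>l<CARD('n). if l = i then x $ coord i else 0)"
    unfolding sum_component
    by (rule sum.cong) (auto simp: cscale_complex axis_def coord_eq_iff i)
  also have "\<dots> = x $ coord i" using i by simp
  finally show "x $ coord i = (\<Sum>l<CARD('n). (x $ coord l) *c axis (coord l) (1::complex)) $ (coord i :: 'n)"
    by simp
qed

abbreviation cinv :: "('y, 'e) chart \<Rightarrow> 'e \<Rightarrow> 'y" where
  "cinv c \<equiv> inv_into (fst c) (snd c)"

locale cmfd =
  fixes A :: "('x::topological_space, 'n::{finite, linorder} cvec) chart set"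
  assumes manifold: "complex_manifold (euclidean :: 'x topology) A"
begin

lemma chart_is_chart: "c \<in> A \<Longrightarrow> is_chart euclidean c"
  using manifold by (simp add: complex_manifold_def)

lemma chart_open: "c \<in> A \<Longrightarrow> open (fst c)" "c \<in> A \<Longrightarrow> open (snd c ` fst c)"
  using chart_is_chart[of c] by (auto simp: is_chart_def split_def)

lemma chart_homeo: "c \<in> A \<Longrightarrow> homeomorphic_map (top_of_set (fst c)) (top_of_set (snd c ` fst c)) (snd c)"
  using chart_is_chart[of c] by (auto simp: is_chart_def split_def)

lemma chart_inj: "c \<in> A \<Longrightarrow> inj_on (snd c) (fst c)"
  using homeomorphic_imp_injective_map[OF chart_homeo] by simp

lemma chart_continuous: "c \<in> A \<Longrightarrow> continuous_on (fst c) (snd c)"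
  using homeomorphic_imp_continuous_map[OF chart_homeo] by (simp add: continuous_map_in_subtopology)

lemma chart_cinv: "c \<in> A \<Longrightarrow> p \<in> fst c \<Longrightarrow> cinv c (snd c p) = p"
  by (simp add: chart_inj inv_into_f_f)

lemma cinv_chart: "w \<in> snd c ` fst c \<Longrightarrow> snd c (cinv c w) = w \<and> cinv c w \<in> fst c"
  by (simp add: f_inv_into_f inv_into_into)

lemma chart_open_image:
  assumes "c \<in> A" "open W"
  shows "open (snd c ` (fst c \<inter> W))"
proof -
  have "open_map (top_of_set (fst c)) (top_of_set (snd c ` fst c)) (snd c)"
    by (rule homeomorphic_imp_open_map[OF chart_homeo[OF assms(1)]])
  moreover have "openin (top_of_set (fst c)) (fst c \<inter> W)" using assms(2) by (rule openin_open_Int)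
  ultimately have "openin (top_of_set (snd c ` fst c)) (snd c ` (fst c \<inter> W))"
    by (simp add: open_map_def)
  then show ?thesis using chart_open(2)[OF assms(1)] openin_open_trans by blast
qed

lemma cinv_continuous:
  assumes "c \<in> A"
  shows "continuous_on (snd c ` fst c) (cinv c)"
proof (rule continuous_on_open_vimage[OF chart_open(2)[OF assms], THEN iffD2], intro allI impI)
  fix B :: "'x set" assume B: "open B"
  have "cinv c -` B \<inter> snd c ` fst c = snd c ` (fst c \<inter> B)"
    using chart_cinv[OF assms] by auto
  then show "open (cinv c -` B \<inter> snd c ` fst c)" using chart_open_image[OF assms B] by simp
qed

lemma chart_cover: "\<exists>c\<in>A. p \<in> fst c"
proof -
  have "(\<Union>c\<in>A. fst c) = (UNIV :: 'x set)" using manifold by (simp add: complex_manifold_def)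
  then show ?thesis by blast
qed

lemma chart_at: "chart_at A p \<in> A" "p \<in> fst (chart_at A p)"
proof -
  have "\<exists>c. c \<in> A \<and> p \<in> fst c" using chart_cover by blast
  then have "chart_at A p \<in> A \<and> p \<in> fst (chart_at A p)" unfolding chart_at_def by (rule someI_ex)
  then show "chart_at A p \<in> A" "p \<in> fst (chart_at A p)" by auto
qed

lemma transition_holo:
  assumes "c \<in> A" "c' \<in> A" "p \<in> fst c" "p \<in> fst c'"
  shows "holo_at (transition c c') (snd c p)"
proof -
  have "compatible c c'" using manifold assms by (auto simp: complex_manifold_def)
  then have "holo (transition c c') (snd c ` (fst c \<inter> fst c'))" by (simp add: compatible_def)
  then show ?thesis
    using holo_on_open[OF chart_open_image[OF assms(1) chart_open(1)[OF assms(2)]]] assms by blast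
qed

lemma chart_maximal:
  "is_chart euclidean c \<Longrightarrow> (\<And>c'. c' \<in> A \<Longrightarrow> compatible c c') \<Longrightarrow> c \<in> A"
  using manifold unfolding complex_manifold_def by blast

lemma eventually_chart:
  assumes "c \<in> A" "p \<in> fst c" "\<forall>\<^sub>F q in nhds p. P q"
  shows "\<forall>\<^sub>F w in nhds (snd c p). w \<in> snd c ` fst c \<and> P (cinv c w)"
proof -
  obtain W where W: "open W" "p \<in> W" "\<And>q. q \<in> W \<Longrightarrow> P q" using assms(3) by (auto simp: eventually_nhds)
  show ?thesis unfolding eventually_nhds
    using chart_open_image[OF assms(1) W(1)] assms W chart_cinv[OF assms(1)]
    by (intro exI[of _ "snd c ` (fst c \<inter> W)"]) auto
qed

lemma eventually_in: "open W \<Longrightarrow> p \<in> W \<Longrightarrow> \<forall>\<^sub>F q in nhds p. q \<in> W" for p :: 'x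
  by (auto simp: eventually_nhds)

lemma eventually_from_chart:
  assumes "c \<in> A" "p \<in> fst c" "\<forall>\<^sub>F w in nhds (snd c p). P w"
  shows "\<forall>\<^sub>F q in nhds p. q \<in> fst c \<and> P (snd c q)"
proof -
  obtain W where W: "open W" "snd c p \<in> W" "\<And>q. q \<in> W \<Longrightarrow> P q" using assms(3) by (auto simp: eventually_nhds)
  have "open (fst c \<inter> snd c -` W)"
    using continuous_open_preimage[OF chart_continuous chart_open(1) W(1)] assms(1) by blast
  then show ?thesis unfolding eventually_nhds using W assms
    by (intro exI[of _ "fst c \<inter> snd c -` W"]) auto
qed

text \<open>One chart suffices because transition maps are holomorphic; \<open>hol_at_chart\<close>
  gives every other chart around p.\<close>

definition hol_at :: "('x \<Rightarrow> 'b::complex_model) \<Rightarrow> 'x \<Rightarrow> bool" where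
  "hol_at f p \<longleftrightarrow> (\<exists>c\<in>A. p \<in> fst c \<and> holo_at (f \<circ> cinv c) (snd c p))"

lemma hol_atI: "c \<in> A \<Longrightarrow> p \<in> fst c \<Longrightarrow> holo_at (f \<circ> cinv c) (snd c p) \<Longrightarrow> hol_at f p"
  by (auto simp: hol_at_def)

lemma transition_at: "c \<in> A \<Longrightarrow> p \<in> fst c \<Longrightarrow> transition c c' (snd c p) = snd c' p"
  by (simp add: transition_def chart_cinv)

lemma eventually_transition:
  assumes "c \<in> A" "c' \<in> A" "p \<in> fst c" "p \<in> fst c'"
  shows "\<forall>\<^sub>F w in nhds (snd c p). cinv c' (transition c c' w) = cinv c w"
  using eventually_chart[OF assms(1,3) eventually_in[OF chart_open(1)[OF assms(2)] assms(4)]]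
  by eventually_elim (simp add: transition_def chart_cinv assms)

lemma hol_at_chart:
  assumes "hol_at f p" "c \<in> A" "p \<in> fst c"
  shows "holo_at (f \<circ> cinv c) (snd c p)"
proof -
  obtain c' where c': "c' \<in> A" "p \<in> fst c'" "holo_at (f \<circ> cinv c') (snd c' p)"
    using assms(1) by (auto simp: hol_at_def)
  have "holo_at (\<lambda>w. (f \<circ> cinv c') (transition c c' w)) (snd c p)"
    by (rule holo_at_compose[OF transition_holo[OF assms(2) c'(1) assms(3) c'(2)]])
       (use c'(3) in \<open>simp add: transition_at assms comp_def\<close>)
  then show ?thesis
    by (rule holo_at_cong[rotated])
       (use eventually_transition[OF assms(2) c'(1) assms(3) c'(2)] in \<open>auto elim: eventually_mono\<close>)
qed

lemma hol_at_cong: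
  assumes "hol_at f p" "\<forall>\<^sub>F q in nhds p. f q = g q"
  shows "hol_at g p"
proof -
  obtain c where c: "c \<in> A" "p \<in> fst c" using chart_cover by blast
  have "holo_at (g \<circ> cinv c) (snd c p)"
    by (rule holo_at_cong[OF _ hol_at_chart[OF assms(1) c]])
       (use eventually_chart[OF c assms(2)] in \<open>auto elim: eventually_mono\<close>)
  then show ?thesis using c hol_atI by blast
qed

lemma hol_at_compose:
  assumes "hol_at f p" "holo_at F (f p)"
  shows "hol_at (\<lambda>q. F (f q)) p"
proof -
  obtain c where c: "c \<in> A" "p \<in> fst c" using chart_cover by blast
  have "holo_at (\<lambda>w. F ((f \<circ> cinv c) w)) (snd c p)"
    by (rule holo_at_compose[OF hol_at_chart[OF assms(1) c]]) (simp add: chart_cinv c assms)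
  then show ?thesis by (intro hol_atI[OF c]) (simp add: comp_def)
qed

lemma hol_at_const [simp]: "hol_at (\<lambda>q. k) p"
proof -
  obtain c where c: "c \<in> A" "p \<in> fst c" using chart_cover by blast
  show ?thesis by (rule hol_atI[OF c]) (simp add: comp_def)
qed

lemma hol_at_Pair:
  assumes "hol_at f p" "hol_at g p"
  shows "hol_at (\<lambda>q. (f q, g q)) p"
proof -
  obtain c where c: "c \<in> A" "p \<in> fst c" using chart_cover by blast
  show ?thesis
    using holo_at_Pair[OF hol_at_chart[OF assms(1) c] hol_at_chart[OF assms(2) c]]
    by (intro hol_atI[OF c]) (simp add: comp_def)
qed

lemma hol_at_mult:
  assumes "hol_at f p" "hol_at g p"
  shows "hol_at (\<lambda>q. f q * g q :: complex) p"
  using hol_at_compose[OF hol_at_Pair[OF assms], of "\<lambda>z. fst z * snd z"]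
  by (simp add: holo_at_mult holo_at_fst holo_at_snd)

lemma hol_at_divide:
  assumes "hol_at f p" "hol_at g p" "g p \<noteq> 0"
  shows "hol_at (\<lambda>q. f q / g q :: complex) p"
  using hol_at_compose[OF hol_at_Pair[OF assms(1,2)], of "\<lambda>z. fst z / snd z"] assms(3)
  by (simp add: holo_at_divide holo_at_fst holo_at_snd)

lemma hol_at_prod: "(\<And>i. i \<in> I \<Longrightarrow> hol_at (f i) p) \<Longrightarrow> hol_at (\<lambda>q. \<Prod>i\<in>I. f i q :: complex) p"
  by (induction I rule: infinite_finite_induct) (auto intro: hol_at_mult)

lemma hol_at_coordinate:
  assumes "c \<in> A" "p \<in> fst c"
  shows "hol_at (snd c) p"
proof (rule hol_atI[OF assms])
  show "holo_at (snd c \<circ> cinv c) (snd c p)"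
  proof (rule holo_at_cong[OF _ holo_at_ident])
    show "\<forall>\<^sub>F w in nhds (snd c p). w = (snd c \<circ> cinv c) w"
      using eventually_chart[OF assms, of "\<lambda>_. True"] by (auto elim!: eventually_mono simp: f_inv_into_f)
  qed
qed

lemma hol_at_nth: "hol_at f p \<Longrightarrow> hol_at (\<lambda>q. f q $ i) p" for f :: "'x \<Rightarrow> 'm::finite cvec"
  by (rule hol_at_compose[of f p "\<lambda>x. x $ i"]) (auto intro: holo_at_nth)

lemma hol_at_tendsto:
  assumes "hol_at f p"
  shows "(f \<longlongrightarrow> f p) (nhds p)"
proof -
  obtain c where c: "c \<in> A" "p \<in> fst c" using chart_cover by blast
  have 1: "((f \<circ> cinv c) \<longlongrightarrow> (f \<circ> cinv c) (snd c p)) (nhds (snd c p))"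
    using holo_at_isCont[OF hol_at_chart[OF assms c]] by (simp only: isCont_def tendsto_at_iff_tendsto_nhds)
  have 2: "filterlim (snd c) (nhds (snd c p)) (nhds p)"
    unfolding filterlim_iff
  proof (intro allI impI)
    fix P assume "eventually P (nhds (snd c p))"
    from eventually_from_chart[OF c this] show "\<forall>\<^sub>F q in nhds p. P (snd c q)"
      by (rule eventually_mono) simp
  qed
  have "((\<lambda>q. (f \<circ> cinv c) (snd c q)) \<longlongrightarrow> (f \<circ> cinv c) (snd c p)) (nhds p)"
    by (rule filterlim_compose[OF 1 2])
  then have "((\<lambda>q. (f \<circ> cinv c) (snd c q)) \<longlongrightarrow> f p) (nhds p)" by (simp add: chart_cinv c)
  then show ?thesis
  proof (rule Lim_transform_eventually)
    show "\<forall>\<^sub>F q in nhds p. (f \<circ> cinv c) (snd c q) = f q"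
      using eventually_in[OF chart_open(1)[OF c(1)] c(2)] by eventually_elim (simp add: chart_cinv c)
  qed
qed

lemma holo_fun_iff:
  assumes "open W"
  shows "holo_fun A W f \<longleftrightarrow> (\<forall>p\<in>W. hol_at f p)"
proof
  assume h: "holo_fun A W f"
  show "\<forall>p\<in>W. hol_at f p"
  proof
    fix p assume p: "p \<in> W"
    obtain c where c: "c \<in> A" "p \<in> fst c" using chart_cover by blast
    have "open (snd c ` (fst c \<inter> W))" "holo (f \<circ> cinv c) (snd c ` (fst c \<inter> W))"
      using h c(1) by (auto simp: mholo_def split_def)
    then have "holo_at (f \<circ> cinv c) (snd c p)" using holo_on_open p c by blast
    then show "hol_at f p" using c hol_atI by blast
  qed
next
  assume h: "\<forall>p\<in>W. hol_at f p"
  show "holo_fun A W f"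
    unfolding mholo_def
  proof (clarsimp simp: id_def[symmetric] comp_id, intro conjI)
    fix U \<phi> assume c: "(U, \<phi>) \<in> A"
    show "open (\<phi> ` (U \<inter> W))" using chart_open_image[OF c assms] by simp
    show "holo (f \<circ> inv_into U \<phi>) (\<phi> ` (U \<inter> W))"
      using h hol_at_chart[OF _ c] by (intro holo_if_holo_at) auto
  qed
qed

subsection \<open>Making charts\<close>

text \<open>By maximality of the atlas it is enough that \<psi> be a homeomorphism onto an open set,
  compatible with all charts. Both follow from holomorphy of \<psi> and of its inverse read in the
  single chart c, by composing with transition maps.\<close>

lemma chartI:
  assumes c: "c \<in> A" and U: "open U" "U \<subseteq> fst c" and inj: "inj_on \<psi> U" and op: "open (\<psi> ` U)"
    and h1: "\<And>p. p \<in> U \<Longrightarrow> hol_at \<psi> p"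
    and h2: "\<And>w. w \<in> \<psi> ` U \<Longrightarrow> holo_at (snd c \<circ> inv_into U \<psi>) w"
  shows "(U, \<psi>) \<in> A"
proof (rule chart_maximal)
  have invU: "inv_into U \<psi> (\<psi> q) = q" if "q \<in> U" for q using inj that by (simp add: inv_into_f_f)
  have c1: "continuous_on U \<psi>"
    unfolding continuous_on_def using hol_at_tendsto[OF h1] by (auto intro!: tendsto_mono[OF inf_le1] simp: at_within_def)
  have c2: "continuous_on (\<psi> ` U) (inv_into U \<psi>)"
  proof (rule continuous_on_eq)
    have "continuous_on (\<psi> ` U) (snd c \<circ> inv_into U \<psi>)"
      using h2 holo_at_isCont by (intro continuous_at_imp_continuous_on) blast
    moreover have "(snd c \<circ> inv_into U \<psi>) ` \<psi> ` U \<subseteq> snd c ` fst c"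
      using U(2) by (auto simp: invU)
    ultimately show "continuous_on (\<psi> ` U) (cinv c \<circ> (snd c \<circ> inv_into U \<psi>))"
      using continuous_on_compose continuous_on_subset[OF cinv_continuous[OF c]] by blast
    show "(cinv c \<circ> (snd c \<circ> inv_into U \<psi>)) w = inv_into U \<psi> w" if "w \<in> \<psi> ` U" for w
      using that U(2) by (auto simp: invU chart_cinv[OF c])
  qed
  have "homeomorphic_maps (top_of_set U) (top_of_set (\<psi> ` U)) \<psi> (inv_into U \<psi>)"
    unfolding homeomorphic_maps_def using c1 c2 invU
    by (auto simp: continuous_map_in_subtopology)
  then show "is_chart euclidean (U, \<psi>)"
    using U(1) op homeomorphic_maps_map by (auto simp: is_chart_def)
  have opimg: "open (\<psi> ` (U \<inter> W))" if "open W" for W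
  proof -
    have "\<psi> ` (U \<inter> W) = inv_into U \<psi> -` W \<inter> \<psi> ` U" by (auto simp: invU)
    then show ?thesis using continuous_on_open_vimage[OF op, THEN iffD1, OF c2] that by simp
  qed
  fix c' assume c': "c' \<in> A"
  show "compatible (U, \<psi>) c'"
    unfolding compatible_def
  proof
    show "holo (transition (U, \<psi>) c') (snd (U, \<psi>) ` (fst (U, \<psi>) \<inter> fst c'))"
    proof (rule holo_if_holo_at)
      fix w assume "w \<in> snd (U, \<psi>) ` (fst (U, \<psi>) \<inter> fst c')"
      then obtain p where p: "p \<in> U" "p \<in> fst c'" "w = \<psi> p" by auto
      have "holo_at (\<lambda>w. transition c c' ((snd c \<circ> inv_into U \<psi>) w)) w"
      proof (rule holo_at_compose[where g="transition c c'"])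
        show "holo_at (snd c \<circ> inv_into U \<psi>) w" by (rule h2) (use p in blast)
        show "holo_at (transition c c') ((snd c \<circ> inv_into U \<psi>) w)"
          using p U(2) transition_holo[OF c c', of p] by (auto simp: invU)
      qed
      then show "holo_at (transition (U, \<psi>) c') w"
      proof (rule holo_at_cong[rotated])
        show "\<forall>\<^sub>F w in nhds w. transition c c' ((snd c \<circ> inv_into U \<psi>) w) = transition (U, \<psi>) c' w"
          unfolding eventually_nhds
        proof (intro exI[of _ "\<psi> ` U"] conjI ballI)
          show "open (\<psi> ` U)" by (rule op)
          show "w \<in> \<psi> ` U" using p by simp
          fix w' assume "w' \<in> \<psi> ` U"
          then show "transition c c' ((snd c \<circ> inv_into U \<psi>) w') = transition (U, \<psi>) c' w'"
            using U(2) by (auto simp: transition_def invU chart_cinv[OF c])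
        qed
      qed
    qed
    show "holo (transition c' (U, \<psi>)) (snd c' ` (fst (U, \<psi>) \<inter> fst c'))"
    proof (rule holo_if_holo_at)
      fix w assume "w \<in> snd c' ` (fst (U, \<psi>) \<inter> fst c')"
      then obtain p where p: "p \<in> U" "p \<in> fst c'" "w = snd c' p" by auto
      show "holo_at (transition c' (U, \<psi>)) w"
        using hol_at_chart[OF h1[OF p(1)] c' p(2)] p(3) by (simp add: transition_def comp_def)
    qed
  qed
qed

lemma chart_restrict:
  assumes c: "c \<in> A" and W: "open W"
  shows "(fst c \<inter> W, snd c) \<in> A"
proof (rule chartI[OF c])
  have inj: "inj_on (snd c) (fst c \<inter> W)" using chart_inj[OF c] inj_on_subset by blast
  show "open (fst c \<inter> W)" using chart_open[OF c] W by blast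
  show "inj_on (snd c) (fst c \<inter> W)" by fact
  show "open (snd c ` (fst c \<inter> W))" by (rule chart_open_image[OF c W])
  show "hol_at (snd c) p" if "p \<in> fst c \<inter> W" for p using hol_at_coordinate[OF c] that by blast
  show "holo_at (snd c \<circ> inv_into (fst c \<inter> W) (snd c)) w" if "w \<in> snd c ` (fst c \<inter> W)" for w
  proof (rule holo_at_cong[OF _ holo_at_ident])
    show "\<forall>\<^sub>F w in nhds w. w = (snd c \<circ> inv_into (fst c \<inter> W) (snd c)) w"
      unfolding eventually_nhds using chart_open_image[OF c W] that
      by (intro exI[of _ "snd c ` (fst c \<inter> W)"]) (auto simp: inv_into_f_f[OF inj])
  qed
qed simp

text \<open>Used for charts moved by an automorphism, whose domain need not lie in the domain of one
  given chart as \<open>chartI\<close> demands. Openness, continuity and compatibility are local;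
  injectivity is not and is assumed.\<close>

lemma chart_local:
  assumes U: "open U" and inj: "inj_on \<psi> U"
    and loc: "\<And>p. p \<in> U \<Longrightarrow> \<exists>V. p \<in> V \<and> V \<subseteq> U \<and> (V, \<psi>) \<in> A"
  shows "(U, \<psi>) \<in> A"
proof (rule chart_maximal)
  have opimg: "open (\<psi> ` (U \<inter> W))" if W: "open W" for W
  proof (subst open_subopen, rule ballI)
    fix w assume "w \<in> \<psi> ` (U \<inter> W)"
    then obtain p where p: "p \<in> U" "p \<in> W" "w = \<psi> p" by blast
    obtain V where V: "p \<in> V" "V \<subseteq> U" "(V, \<psi>) \<in> A" using loc[OF p(1)] by blast
    have "open (\<psi> ` (V \<inter> W))" using chart_open_image[OF V(3) W] by simp
    then show "\<exists>T. open T \<and> w \<in> T \<and> T \<subseteq> \<psi> ` (U \<inter> W)"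
      using V p by (intro exI[of _ "\<psi> ` (V \<inter> W)"]) auto
  qed
  have op: "open (\<psi> ` U)" using opimg[of UNIV] by simp
  have invU: "inv_into U \<psi> (\<psi> q) = q" if "q \<in> U" for q using inj that by (simp add: inv_into_f_f)
  have hol: "hol_at \<psi> p" if "p \<in> U" for p
    using loc[OF that] hol_at_coordinate by fastforce
  have c1: "continuous_on U \<psi>"
    unfolding continuous_on_def using hol_at_tendsto[OF hol] by (auto intro!: tendsto_mono[OF inf_le1] simp: at_within_def)
  have c2: "continuous_on (\<psi> ` U) (inv_into U \<psi>)"
  proof (rule continuous_on_open_vimage[OF op, THEN iffD2], intro allI impI)
    fix B :: "'x set" assume B: "open B"
    have "inv_into U \<psi> -` B \<inter> \<psi> ` U = \<psi> ` (U \<inter> B)" by (auto simp: invU)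
    then show "open (inv_into U \<psi> -` B \<inter> \<psi> ` U)" using opimg[OF B] by simp
  qed
  have "homeomorphic_maps (top_of_set U) (top_of_set (\<psi> ` U)) \<psi> (inv_into U \<psi>)"
    unfolding homeomorphic_maps_def using c1 c2 invU
    by (auto simp: continuous_map_in_subtopology)
  then show "is_chart euclidean (U, \<psi>)"
    using U(1) op homeomorphic_maps_map by (auto simp: is_chart_def)
  fix c' assume c': "c' \<in> A"
  show "compatible (U, \<psi>) c'"
    unfolding compatible_def
  proof
    show "holo (transition (U, \<psi>) c') (snd (U, \<psi>) ` (fst (U, \<psi>) \<inter> fst c'))"
    proof (rule holo_if_holo_at)
      fix w assume "w \<in> snd (U, \<psi>) ` (fst (U, \<psi>) \<inter> fst c')"
      then obtain p where p: "p \<in> U" "p \<in> fst c'" "w = \<psi> p" by auto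
      obtain V where V: "p \<in> V" "V \<subseteq> U" "(V, \<psi>) \<in> A" using loc[OF p(1)] by blast
      have "holo_at (transition (V, \<psi>) c') w" using transition_holo[OF V(3) c', of p] V p by simp
      then show "holo_at (transition (U, \<psi>) c') w"
      proof (rule holo_at_cong[rotated])
        have injV: "inj_on \<psi> V" using inj V(2) inj_on_subset by blast
        show "\<forall>\<^sub>F w in nhds w. transition (V, \<psi>) c' w = transition (U, \<psi>) c' w"
          unfolding eventually_nhds
        proof (intro exI[of _ "\<psi> ` V"] conjI ballI)
          show "open (\<psi> ` V)" using chart_open(2)[OF V(3)] by simp
          show "transition (V, \<psi>) c' w = transition (U, \<psi>) c' w" if "w \<in> \<psi> ` V" for w
            using that V(2) by (auto simp: transition_def invU inv_into_f_f[OF injV])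
        qed (use p V in simp)
      qed
    qed
    show "holo (transition c' (U, \<psi>)) (snd c' ` (fst (U, \<psi>) \<inter> fst c'))"
    proof (rule holo_if_holo_at)
      fix w assume "w \<in> snd c' ` (fst (U, \<psi>) \<inter> fst c')"
      then obtain p where p: "p \<in> U" "p \<in> fst c'" "w = snd c' p" by auto
      show "holo_at (transition c' (U, \<psi>)) w"
        using hol_at_chart[OF hol[OF p(1)] c' p(2)] p(3) by (simp add: transition_def comp_def)
    qed
  qed
qed

text \<open>The inverse function theorem in the coordinates of c; the source of the charts in which
  the sections become coordinates.\<close>

lemma chart_from_derivative:
  assumes c: "c \<in> A" "p \<in> fst c" and W: "open W" "p \<in> W"
    and hol: "\<And>q. q \<in> W \<Longrightarrow> hol_at \<psi> q"
    and inj: "\<And>h. frechet_derivative (\<psi> \<circ> cinv c) (at (snd c p)) h = 0 \<Longrightarrow> h = 0"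
  obtains U where "(U, \<psi>) \<in> A" "p \<in> U" "U \<subseteq> W" "U \<subseteq> fst c"
proof -
  let ?T = "\<psi> \<circ> cinv c"
  obtain V where V: "open V" "snd c p \<in> V" "V \<subseteq> snd c ` (fst c \<inter> W)" "inj_on ?T V" "open (?T ` V)"
    "\<And>w. w \<in> ?T ` V \<Longrightarrow> holo_at (inv_into V ?T) w"
  proof (rule local_inverse[of "snd c ` (fst c \<inter> W)" "snd c p" ?T])
    show "open (snd c ` (fst c \<inter> W))" by (rule chart_open_image[OF c(1) W(1)])
    show "holo_at ?T y" if "y \<in> snd c ` (fst c \<inter> W)" for y
      using that hol_at_chart[OF hol c(1)] by blast
  qed (use c W inj in auto)
  define U where "U = fst c \<inter> snd c -` V"
  have opU: "open U" unfolding U_def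
    using continuous_open_preimage[OF chart_continuous chart_open(1) V(1)] c(1) by blast
  have UV: "snd c ` U = V" using V(3) by (auto simp: U_def)
  have UW: "U \<subseteq> W"
  proof
    fix q assume q: "q \<in> U"
    then obtain q' where "q' \<in> fst c" "q' \<in> W" "snd c q = snd c q'" using V(3) by (auto simp: U_def)
    then show "q \<in> W" using q chart_inj[OF c(1)] by (auto simp: U_def inj_on_def)
  qed
  have T: "?T (snd c q) = \<psi> q" if "q \<in> U" for q using that by (simp add: U_def chart_cinv[OF c(1)])
  have img: "\<psi> ` U = ?T ` V" unfolding UV[symmetric] image_image using T by (intro image_cong) auto
  have injU: "inj_on \<psi> U"
  proof (rule inj_onI)
    fix q q' assume q: "q \<in> U" "q' \<in> U" "\<psi> q = \<psi> q'"
    then have "?T (snd c q) = ?T (snd c q')" by (simp only: T)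
    then have "snd c q = snd c q'" using V(4) q by (auto simp: inj_on_def U_def)
    then show "q = q'" using q chart_inj[OF c(1)] by (auto simp: U_def inj_on_def)
  qed
  have "(U, \<psi>) \<in> A"
  proof (rule chartI[OF c(1) opU _ injU])
    show "U \<subseteq> fst c" by (auto simp: U_def)
    show "open (\<psi> ` U)" using V(5) img by simp
    show "hol_at \<psi> q" if "q \<in> U" for q using that hol UW by blast
    fix w assume w: "w \<in> \<psi> ` U"
    show "holo_at (snd c \<circ> inv_into U \<psi>) w"
    proof (rule holo_at_cong[OF _ V(6)])
      show "w \<in> ?T ` V" using w img by simp
      show "\<forall>\<^sub>F w in nhds w. inv_into V ?T w = (snd c \<circ> inv_into U \<psi>) w"
        unfolding eventually_nhds
      proof (intro exI[of _ "\<psi> ` U"] conjI ballI)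
        show "open (\<psi> ` U)" using V(5) img by simp
        fix w' assume "w' \<in> \<psi> ` U"
        then obtain q where q: "q \<in> U" "w' = \<psi> q" by blast
        have "inv_into V ?T w' = snd c q" using V(4) q T[OF q(1)] by (metis UV image_eqI inv_into_f_f)
        then show "inv_into V ?T w' = (snd c \<circ> inv_into U \<psi>) w'" using q injU by (simp add: inv_into_f_f)
      qed fact
    qed
  qed
  moreover have "p \<in> U" using c V(2) by (simp add: U_def)
  ultimately show ?thesis using that UW by (auto simp: U_def)
qed

end

section \<open>Tangent vectors and top forms\<close>

context cmfd
begin

definition tvec :: "('x, 'n cvec) chart \<Rightarrow> 'x \<Rightarrow> 'n cvec \<Rightarrow> ('x, 'n cvec) tvec" where
  "tvec c p h = (\<lambda>c'. if c' \<in> A \<and> p \<in> fst c' then frechet_derivative (transition c c') (at (snd c p)) h else 0)"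

lemma coord_vec_tvec: "coord_vec A c j p = tvec c p (axis (coord j) 1)"
  by (simp add: coord_vec_def tvec_def)

lemma transition_chain:
  assumes "c \<in> A" "c' \<in> A" "c'' \<in> A" "p \<in> fst c" "p \<in> fst c'" "p \<in> fst c''"
  shows "frechet_derivative (transition c' c'') (at (snd c' p)) (frechet_derivative (transition c c') (at (snd c p)) h) =
    frechet_derivative (transition c c'') (at (snd c p)) h"
proof -
  have ev: "\<forall>\<^sub>F w in nhds (snd c p). transition c' c'' (transition c c' w) = transition c c'' w"
    using eventually_transition[OF assms(1,2,4,5)] by eventually_elim (simp add: transition_def)
  have "frechet_derivative (\<lambda>w. transition c' c'' (transition c c' w)) (at (snd c p)) h =
      frechet_derivative (transition c' c'') (at (transition c c' (snd c p))) (frechet_derivative (transition c c') (at (snd c p)) h)"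
    by (rule frechet_derivative_compose_holo) (use assms transition_holo transition_at in auto)
  then show ?thesis using frechet_derivative_cong[OF ev] assms by (simp add: transition_at)
qed

lemma transition_self:
  assumes "c \<in> A" "p \<in> fst c"
  shows "frechet_derivative (transition c c) (at (snd c p)) h = h"
proof -
  have ev: "\<forall>\<^sub>F w in nhds (snd c p). transition c c w = w"
    using eventually_chart[OF assms, of "\<lambda>_. True"] by (auto elim!: eventually_mono simp: transition_def f_inv_into_f)
  have "frechet_derivative (\<lambda>w. w) (at (snd c p)) h = h"
    using frechet_derivative_at[OF has_derivative_ident] by metis
  then show ?thesis using frechet_derivative_cong[OF ev] by simp
qed

lemma transition_linear:
  assumes "c \<in> A" "c' \<in> A" "p \<in> fst c" "p \<in> fst c'"
  shows "frechet_derivative (transition c c') (at (snd c p)) (a *c h + b *c k) =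
    a *c frechet_derivative (transition c c') (at (snd c p)) h + b *c frechet_derivative (transition c c') (at (snd c p)) k"
proof -
  note h = transition_holo[OF assms]
  have lin: "linear (frechet_derivative (transition c c') (at (snd c p)))"
    using holo_at_linear[OF h] by (rule bounded_linear.linear)
  show ?thesis by (simp only: linear_add[OF lin] holo_at_derivative(2)[OF h])
qed

lemma tvec_tangent: "c \<in> A \<Longrightarrow> p \<in> fst c \<Longrightarrow> tvec c p h \<in> tangent A p"
  by (auto simp: tangent_def tvec_def transition_chain)

lemma tvec_self: "c \<in> A \<Longrightarrow> p \<in> fst c \<Longrightarrow> tvec c p h c = h"
  by (simp add: tvec_def transition_self)

lemma tangent_transition:
  "v \<in> tangent A p \<Longrightarrow> c \<in> A \<Longrightarrow> c' \<in> A \<Longrightarrow> p \<in> fst c \<Longrightarrow> p \<in> fst c' \<Longrightarrow>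
    v c' = frechet_derivative (transition c c') (at (snd c p)) (v c)"
  unfolding tangent_def by blast

lemma tangent_outside: "v \<in> tangent A p \<Longrightarrow> \<not> (c \<in> A \<and> p \<in> fst c) \<Longrightarrow> v c = 0"
  unfolding tangent_def by blast

lemma tangent_eq_tvec:
  assumes "v \<in> tangent A p" "c \<in> A" "p \<in> fst c"
  shows "v = tvec c p (v c)"
proof
  fix c'
  show "v c' = tvec c p (v c) c'"
    using tangent_transition[OF assms(1,2) _ assms(3), of c'] tangent_outside[OF assms(1), of c']
    by (auto simp: tvec_def)
qed

lemma tangent_eqI:
  "v \<in> tangent A p \<Longrightarrow> w \<in> tangent A p \<Longrightarrow> c \<in> A \<Longrightarrow> p \<in> fst c \<Longrightarrow> v c = w c \<Longrightarrow> v = w"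
  using tangent_eq_tvec by metis

lemma lin_closed_tangent: "lin_closed (tangent A p)"
  unfolding lin_closed_def
proof (intro ballI allI)
  fix v w and a b :: complex
  assume v: "v \<in> tangent A p" and w: "w \<in> tangent A p"
  show "(\<lambda>c. a *c v c + b *c w c) \<in> tangent A p"
    unfolding tangent_def
  proof (intro CollectI conjI allI ballI impI)
    fix c assume c: "\<not> (c \<in> A \<and> p \<in> fst c)"
    show "a *c v c + b *c w c = 0"
      by (simp only: tangent_outside[OF v c] tangent_outside[OF w c] cscale_zero_right add_0)
  next
    fix c c' assume c: "c \<in> A" "c' \<in> A" "p \<in> fst c" "p \<in> fst c'"
    show "a *c v c' + b *c w c' = frechet_derivative (transition c c') (at (snd c p)) (a *c v c + b *c w c)"
      using tangent_transition[OF v c] tangent_transition[OF w c] transition_linear[OF c] by simp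
  qed
qed

lemma zero_tangent: "(\<lambda>c. 0) \<in> tangent A p"
proof -
  obtain c where c: "c \<in> A" "p \<in> fst c" using chart_cover by blast
  have "(\<lambda>c'. 0 *c tvec c p 0 c' + 0 *c tvec c p 0 c') \<in> tangent A p"
    using lin_closed_tangent tvec_tangent[OF c] unfolding lin_closed_def by blast
  then show ?thesis by (simp only: cscale_zero_left add_0)
qed

lemma coord_vec_tangent: "c \<in> A \<Longrightarrow> p \<in> fst c \<Longrightarrow> coord_vec A c j p \<in> tangent A p"
  by (simp add: coord_vec_tvec tvec_tangent)

lemma coord_vec_self: "c \<in> A \<Longrightarrow> p \<in> fst c \<Longrightarrow> coord_vec A c j p c = axis (coord j) 1"
  by (simp add: coord_vec_tvec tvec_self)

lemma tangent_expand:
  assumes v: "v \<in> tangent A p" and c: "c \<in> A" "p \<in> fst c"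
  shows "v = lincomb CARD('n) (\<lambda>l. v c $ coord l) (\<lambda>l. coord_vec A c l p)"
proof (rule tangent_eqI[OF v _ c])
  show "lincomb CARD('n) (\<lambda>l. v c $ coord l) (\<lambda>l. coord_vec A c l p) \<in> tangent A p"
    by (rule lincomb_in[OF lin_closed_tangent coord_vec_tangent[OF c] zero_tangent])
  show "v c = lincomb CARD('n) (\<lambda>l. v c $ coord l) (\<lambda>l. coord_vec A c l p) c"
    unfolding lincomb_def coord_vec_self[OF c] by (rule vec_coord_expansion)
qed

abbreviation top_form :: "('x, 'n cvec) chart \<Rightarrow> 'x \<Rightarrow> ('x, 'n cvec) tvec form" where
  "top_form c p \<equiv> coord_form c (tangent A p) 0 CARD('n)"

lemma top_form_alt: "top_form c p \<in> alt_forms CARD('n) (tangent A p)"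
  by (rule alt_forms_coord_form[OF lin_closed_tangent])

lemma top_form_basis:
  assumes "c \<in> A" "p \<in> fst c"
  shows "top_form c p (\<lambda>j. coord_vec A c j p) = 1"
proof -
  have "top_form c p (\<lambda>j. coord_vec A c j p) = leibniz_det CARD('n) (\<lambda>i j. if i = j then 1 else 0)"
    using assms
    by (auto simp: coord_form_def coord_vec_tangent coord_vec_self axis_def coord_eq_iff intro!: leibniz_det_cong)
  then show ?thesis by (simp add: leibniz_det_one)
qed

text \<open>One-dimensionality of the top exterior power, from \<open>alt_forms_det\<close> in the
  coordinate basis. With the top form of another chart as \<kappa> it is the transformation rule by
  the Jacobian determinant.\<close>

lemma alt_form_top:
  assumes \<kappa>: "\<kappa> \<in> alt_forms CARD('n) (tangent A p)" and c: "c \<in> A" "p \<in> fst c"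
  shows "\<kappa> u = \<kappa> (\<lambda>j. coord_vec A c j p) * top_form c p u"
proof (cases "\<forall>j<CARD('n). u j \<in> tangent A p")
  case True
  have "\<kappa> u = leibniz_det CARD('n) (\<lambda>l j. u j c $ coord l) * \<kappa> (\<lambda>j. coord_vec A c j p)"
    by (rule alt_forms_det[OF \<kappa> lin_closed_tangent zero_tangent coord_vec_tangent[OF c]])
       (use tangent_expand[OF _ c] True in blast)
  then show ?thesis using True by (simp add: coord_form_def)
next
  case False
  then obtain j where j: "j < CARD('n)" "u j \<notin> tangent A p" by blast
  show ?thesis
    by (simp only: alt_forms_outside[OF \<kappa>, where i=j and u=u, OF j]
        alt_forms_outside[OF top_form_alt, where i=j and u=u, OF j] mult_zero_right)
qed

subsection \<open>Differentials\<close>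

text \<open>\<open>differential\<close> uses a chart picked by choice; the chain rule along the
  transition map removes the dependence.\<close>

lemma differential_chart:
  assumes f: "hol_at f p" and v: "v \<in> tangent A p" and c: "c \<in> A" "p \<in> fst c"
  shows "differential A f p v = frechet_derivative (f \<circ> cinv c) (at (snd c p)) (v c)"
proof -
  define c0 where "c0 = chart_at A p"
  have c0: "c0 \<in> A" "p \<in> fst c0" using chart_at by (auto simp: c0_def)
  have ev: "\<forall>\<^sub>F w in nhds (snd c0 p). (f \<circ> cinv c) (transition c0 c w) = (f \<circ> cinv c0) w"
    using eventually_transition[OF c0(1) c(1) c0(2) c(2)] by eventually_elim simp
  have "frechet_derivative (\<lambda>w. (f \<circ> cinv c) (transition c0 c w)) (at (snd c0 p)) (v c0) =
      frechet_derivative (f \<circ> cinv c) (at (transition c0 c (snd c0 p))) (frechet_derivative (transition c0 c) (at (snd c0 p)) (v c0))"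
    by (rule frechet_derivative_compose_holo[OF transition_holo[OF c0(1) c(1) c0(2) c(2)]])
       (simp only: transition_at[OF c0] hol_at_chart[OF f c])
  also have "frechet_derivative (transition c0 c) (at (snd c0 p)) (v c0) = v c"
    using tangent_transition[OF v c0(1) c(1) c0(2) c(2)] by simp
  finally show ?thesis
    using frechet_derivative_cong[OF ev] c0 by (simp add: differential_def c0_def[symmetric] Let_def transition_at comp_def)
qed

lemma differential_cong:
  assumes "\<forall>\<^sub>F q in nhds p. f q = g q"
  shows "differential A f p v = differential A g p v"
proof -
  have "\<forall>\<^sub>F w in nhds (snd (chart_at A p) p). (f \<circ> cinv (chart_at A p)) w = (g \<circ> cinv (chart_at A p)) w"
    using eventually_chart[OF chart_at assms] by (auto elim: eventually_mono)
  from frechet_derivative_cong[OF this] show ?thesis by (simp only: differential_def Let_def)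
qed

lemma differential_coordinate:
  assumes v: "v \<in> tangent A p" and c: "c \<in> A" "p \<in> fst c"
  shows "differential A (\<lambda>q. snd c q $ i) p v = v c $ i"
proof -
  have hol: "hol_at (\<lambda>q. snd c q $ i) p" by (rule hol_at_nth[OF hol_at_coordinate[OF c]])
  have ev: "\<forall>\<^sub>F w in nhds (snd c p). ((\<lambda>q. snd c q $ i) \<circ> cinv c) w = w $ i"
    using eventually_chart[OF c, of "\<lambda>_. True"] by (auto elim!: eventually_mono simp: f_inv_into_f)
  have "frechet_derivative (\<lambda>w::'n cvec. w $ i) (at (snd c p)) = (\<lambda>w. w $ i)"
    using frechet_derivative_at[OF bounded_linear_imp_has_derivative[OF bounded_linear_vec_nth]] by metis
  then show ?thesis
    unfolding differential_chart[OF hol v c] frechet_derivative_cong[OF ev] by simp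
qed

text \<open>The Leibniz rule at a zero of h, where the term with du drops out. Thus a change of
  frame only multiplies the differential of a section along its zero set.\<close>

lemma differential_mult_zero:
  assumes "hol_at u p" "hol_at h p" "h p = 0" and v: "v \<in> tangent A p"
  shows "differential A (\<lambda>q. u q * h q) p v = u p * differential A h p v"
proof -
  obtain c where c: "c \<in> A" "p \<in> fst c" using chart_cover by blast
  note hu = hol_at_chart[OF assms(1) c] and hh = hol_at_chart[OF assms(2) c]
  have comp: "(\<lambda>q. u q * h q) \<circ> cinv c = (\<lambda>w. (u \<circ> cinv c) w * (h \<circ> cinv c) w)" by (simp add: comp_def)
  note D = frechet_derivative_at[OF has_derivative_mult[OF holo_at_derivative(1)[OF hu] holo_at_derivative(1)[OF hh]]]
  have "frechet_derivative (\<lambda>w. (u \<circ> cinv c) w * (h \<circ> cinv c) w) (at (snd c p)) (v c) =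
    (u \<circ> cinv c) (snd c p) * frechet_derivative (h \<circ> cinv c) (at (snd c p)) (v c) +
    frechet_derivative (u \<circ> cinv c) (at (snd c p)) (v c) * (h \<circ> cinv c) (snd c p)"
    by (rule fun_cong[OF D, symmetric])
  then show ?thesis
    unfolding differential_chart[OF hol_at_mult[OF assms(1,2)] v c] differential_chart[OF assms(2) v c] comp
    by (simp add: chart_cinv c assms(3))
qed

lemma differential_linear:
  assumes f: "hol_at f p" and v: "v \<in> tangent A p" "w \<in> tangent A p"
  shows "differential A f p (\<lambda>c. a *c v c + b *c w c) = a * differential A f p v + b * differential A f p w"
proof -
  obtain c where c: "c \<in> A" "p \<in> fst c" using chart_cover by blast
  note h = hol_at_chart[OF f c]
  have vw: "(\<lambda>c. a *c v c + b *c w c) \<in> tangent A p"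
    using lin_closed_tangent v unfolding lin_closed_def by blast
  have "linear (frechet_derivative (f \<circ> cinv c) (at (snd c p)))"
    using holo_at_linear[OF h] bounded_linear.linear by blast
  then show ?thesis
    unfolding differential_chart[OF f vw c] differential_chart[OF f v(1) c] differential_chart[OF f v(2) c]
    by (simp add: linear_add holo_at_derivative(2)[OF h] cscale_complex)
qed

lemma differential_coord_vec_expand:
  assumes f: "hol_at f p" and v: "v \<in> tangent A p" and c: "c \<in> A" "p \<in> fst c"
  shows "differential A f p v = (\<Sum>l<CARD('n). v c $ coord l * differential A f p (coord_vec A c l p))"
proof -
  note h = hol_at_chart[OF f c]
  let ?D = "frechet_derivative (f \<circ> cinv c) (at (snd c p))"
  have lin: "linear ?D" using holo_at_linear[OF h] bounded_linear.linear by blast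
  have "differential A f p v = ?D (\<Sum>l<CARD('n). (v c $ coord l) *c axis (coord l) 1)"
    unfolding differential_chart[OF f v c] by (rule arg_cong[OF vec_coord_expansion])
  also have "\<dots> = (\<Sum>l<CARD('n). v c $ coord l * ?D (axis (coord l) 1))"
    by (simp add: linear_sum[OF lin] holo_at_derivative(2)[OF h] cscale_complex)
  finally show ?thesis
    by (simp add: differential_chart[OF f coord_vec_tangent[OF c] c] coord_vec_self[OF c])
qed

lemma holo_at_chart_derivative:
  assumes c: "c \<in> A" "p \<in> fst c" and W: "open W" "p \<in> W" and f: "\<And>q. q \<in> W \<Longrightarrow> hol_at f q"
  shows "holo_at (\<lambda>w. frechet_derivative (f \<circ> cinv c) (at w) h :: complex) (snd c p)"
proof (rule holo_at_frechet_derivative[OF chart_open_image[OF c(1) W(1)]])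
  show "holo_at (f \<circ> cinv c) y" if "y \<in> snd c ` (fst c \<inter> W)" for y
    using that hol_at_chart[OF f c(1)] by blast
qed (use c W in blast)

lemma holo_at_transition_derivative:
  assumes c: "c \<in> A" "c' \<in> A" "p \<in> fst c" "p \<in> fst c'"
  shows "holo_at (\<lambda>w. frechet_derivative (transition c c') (at w) h) (snd c p)"
proof (rule holo_at_frechet_derivative_vec[OF chart_open_image[OF c(1) chart_open(1)[OF c(2)]]])
  show "holo_at (transition c c') y" if "y \<in> snd c ` (fst c \<inter> fst c')" for y
    using that transition_holo[OF c(1,2)] by blast
qed (use c in blast)

end

section \<open>Line bundles\<close>

text \<open>A basis vector of the fiber at p. Fibers are handled through the scalar multiples of one
  such vector, that is through \<open>ratio\<close>; every nonzero vector of the fiber is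
  one.\<close>

definition frame_vec :: "('x, 'l) line_bundle \<Rightarrow> 'x \<Rightarrow> 'l \<Rightarrow> bool" where
  "frame_vec E p e \<longleftrightarrow> e \<in> fiber E p \<and> bij_betw (\<lambda>c. Smul E c e) UNIV (fiber E p) \<and>
     (\<forall>a b. Smul E a (Smul E b e) = Smul E (a * b) e)"

lemma fiber_frame_ex: "frame_vec E p e \<Longrightarrow> u \<in> fiber E p \<Longrightarrow> \<exists>c. u = Smul E c e"
  unfolding frame_vec_def bij_betw_def by (metis imageE)

lemma frame_inj: "frame_vec E p e \<Longrightarrow> Smul E c e = Smul E c' e \<Longrightarrow> c = c'"
  unfolding frame_vec_def bij_betw_def inj_on_def by blast

lemma frame_Smul_in: "frame_vec E p e \<Longrightarrow> Smul E c e \<in> fiber E p"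
  unfolding frame_vec_def bij_betw_def by blast

lemma frame_Smul_Smul: "frame_vec E p e \<Longrightarrow> Smul E a (Smul E b e) = Smul E (a * b) e"
  unfolding frame_vec_def by blast

lemma ratio_Smul_frame:
  assumes "frame_vec E p e"
  shows "ratio E (Smul E c e) e = c"
  unfolding ratio_def by (rule the_equality) (auto dest: frame_inj[OF assms])

lemma ratio_eq:
  assumes "frame_vec E p e" "u \<in> fiber E p"
  shows "u = Smul E (ratio E u e) e"
  using fiber_frame_ex[OF assms] ratio_Smul_frame[OF assms(1)] by metis

text \<open>No law 1 e = e is part of the structure. Write e = c e; multiplying by 1 gives 1 e = c e
  by the associative law, so c = 1 by injectivity.\<close>

lemma frame_Smul_one:
  assumes "frame_vec E p e"
  shows "Smul E 1 e = e"
proof -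
  have "e \<in> fiber E p" using assms by (simp add: frame_vec_def)
  then obtain c where c: "e = Smul E c e" using fiber_frame_ex[OF assms] by blast
  have "Smul E (1 * c) e = Smul E 1 (Smul E c e)" using frame_Smul_Smul[OF assms] by simp
  also have "\<dots> = Smul E 1 e" using c by simp
  finally have "c = 1" using frame_inj[OF assms] by simp
  then show ?thesis using c by simp
qed

lemma ratio_self: "frame_vec E p e \<Longrightarrow> ratio E e e = 1"
  using ratio_Smul_frame[of E p e 1] frame_Smul_one[of E p e] by simp

lemma fiber_Smul_in: "frame_vec E p e \<Longrightarrow> u \<in> fiber E p \<Longrightarrow> Smul E c u \<in> fiber E p"
  using fiber_frame_ex[of E p e u] by (auto simp: frame_Smul_Smul frame_Smul_in)

lemma ratio_Smul:
  assumes "frame_vec E p e" "u \<in> fiber E p"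
  shows "ratio E (Smul E c u) e = c * ratio E u e"
proof -
  have "Smul E c u = Smul E (c * ratio E u e) e"
    using ratio_eq[OF assms] frame_Smul_Smul[OF assms(1)] by metis
  then show ?thesis using ratio_Smul_frame[OF assms(1)] by simp
qed

lemma frame_change:
  assumes "frame_vec E p e" "c \<noteq> 0"
  shows "frame_vec E p (Smul E c e)"
  unfolding frame_vec_def
proof (intro conjI allI)
  show "Smul E c e \<in> fiber E p" by (rule frame_Smul_in[OF assms(1)])
  have "bij_betw ((\<lambda>a. Smul E a e) \<circ> (\<lambda>a. a * c)) UNIV (fiber E p)"
  proof (rule bij_betw_trans)
    show "bij_betw (\<lambda>a. a * c) UNIV UNIV"
      by (rule bij_betw_byWitness[where f'="\<lambda>a. a / c"]) (use assms in auto)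
    show "bij_betw (\<lambda>a. Smul E a e) UNIV (fiber E p)" using assms by (simp add: frame_vec_def)
  qed
  then show "bij_betw (\<lambda>a. Smul E a (Smul E c e)) UNIV (fiber E p)"
    by (simp add: comp_def frame_Smul_Smul[OF assms(1)])
  show "Smul E a (Smul E b (Smul E c e)) = Smul E (a * b) (Smul E c e)" for a b
    by (simp add: frame_Smul_Smul[OF assms(1)] mult.assoc)
qed

lemma nonzero_iff_ratio:
  assumes "frame_vec E p e" "u \<in> fiber E p"
  shows "u \<in> nonzero E \<longleftrightarrow> ratio E u e \<noteq> 0"
proof -
  have "u \<in> Tot E" using assms(2) by (simp add: fiber_def)
  moreover have "Smul E 0 u = u \<longleftrightarrow> ratio E u e = 0"
  proof -
    have "Smul E 0 u = Smul E 0 e"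
      using ratio_eq[OF assms] frame_Smul_Smul[OF assms(1)] by (metis mult_zero_left)
    then show ?thesis using ratio_eq[OF assms] frame_inj[OF assms(1)] by metis
  qed
  ultimately show ?thesis by (simp add: nonzero_def)
qed

lemma frame_nonzero: "frame_vec E p e \<Longrightarrow> e \<in> nonzero E"
  using nonzero_iff_ratio[of E p e e] ratio_self[of E p e] by (simp add: frame_vec_def)

lemma frame_fiber: "frame_vec E p e \<Longrightarrow> e \<in> fiber E p"
  by (simp add: frame_vec_def)

lemma nonzero_frame:
  assumes "frame_vec E p e" "u \<in> fiber E p" "u \<in> nonzero E"
  shows "frame_vec E p u"
  using frame_change[OF assms(1), of "ratio E u e"] nonzero_iff_ratio[OF assms(1,2)] assms(3)
    ratio_eq[OF assms(1,2)] by simp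

lemma ratio_trans:
  assumes "frame_vec E p e" "frame_vec E p e'" "u \<in> fiber E p"
  shows "ratio E u e' = ratio E u e * ratio E e e'"
proof -
  have "ratio E u e' = ratio E (Smul E (ratio E u e) e) e'" using ratio_eq[OF assms(1,3)] by simp
  also have "\<dots> = ratio E u e * ratio E e e'" by (rule ratio_Smul[OF assms(2) frame_fiber[OF assms(1)]])
  finally show ?thesis .
qed

lemma ratio_frame_nonzero: "frame_vec E p e \<Longrightarrow> frame_vec E p e' \<Longrightarrow> ratio E e' e \<noteq> 0"
  using nonzero_iff_ratio[OF _ frame_fiber] frame_nonzero by metis

lemma fiber_Proj: "u \<in> fiber E p \<Longrightarrow> Proj E u = p" "u \<in> fiber E p \<Longrightarrow> u \<in> Tot E"
  by (auto simp: fiber_def)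

lemma frame_vec_Proj: "frame_vec E p e \<Longrightarrow> Proj E e = p"
  using frame_fiber fiber_Proj by metis

definition has_lines :: "('x, 'l) line_bundle \<Rightarrow> bool" where
  "has_lines E \<longleftrightarrow> (\<forall>p. \<exists>e. frame_vec E p e)"

lemma has_lines_frame: "has_lines E \<Longrightarrow> e \<in> nonzero E \<Longrightarrow> Proj E e = p \<Longrightarrow> frame_vec E p e"
proof -
  assume E: "has_lines E" and e: "e \<in> nonzero E" "Proj E e = p"
  obtain e0 where e0: "frame_vec E p e0" using E by (auto simp: has_lines_def)
  have "e \<in> fiber E p" using e by (simp add: nonzero_def fiber_def)
  then show "frame_vec E p e" using nonzero_frame[OF e0] e(1) by blast
qed

subsection \<open>Tensor products of lines\<close>

lemma fst_tens: "fst (tens E F u v) = Proj E u"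
  by (simp add: tens_def)

lemma fst_tens_list: "fst (tens_list L s p u) = p"
  by (simp add: tens_list_def)

lemma mem_fiber_tensor: "t \<in> fiber (tensor_bundle E F) p \<longleftrightarrow>
    (\<exists>u v. t = tens E F u v \<and> u \<in> Tot E \<and> v \<in> fiber F (Proj E u)) \<and> fst t = p"
  unfolding fiber_def[of "tensor_bundle E F"] by (simp add: tensor_bundle_def)

lemma mem_fiber_tensor_list: "t \<in> fiber (tensor_list_bundle L s) p \<longleftrightarrow>
    (\<exists>p' c u. t = (p', \<lambda>e. c * snd (tens_list L s p' u) e) \<and> (\<forall>i<s. u i \<in> fiber (L i) p')) \<and> fst t = p"
  unfolding fiber_def[of "tensor_list_bundle L s"] by (simp add: tensor_list_bundle_def)

lemma tens_fiber:
  assumes "u \<in> fiber E p" "v \<in> fiber F p"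
  shows "tens E F u v \<in> fiber (tensor_bundle E F) p"
proof -
  have "u \<in> Tot E \<and> v \<in> fiber F (Proj E u) \<and> Proj E u = p" using assms by (auto simp: fiber_def)
  then show ?thesis
    unfolding mem_fiber_tensor fst_tens by blast
qed

text \<open>In the encoding of tensors by coefficients, bilinearity is the cocycle rule
  \<open>ratio_trans\<close> in each factor.\<close>

lemma tens_frame_expand:
  assumes E: "has_lines E" and F: "has_lines F" and e: "frame_vec E p e" and f: "frame_vec F p f"
    and u: "u \<in> fiber E p" and v: "v \<in> fiber F p"
  shows "tens E F u v = Smul (tensor_bundle E F) (ratio E u e * ratio F v f) (tens E F e f)"
proof -
  have "ratio E u e' * ratio F v f' = ratio E u e * ratio F v f * (ratio E e e' * ratio F f f')"
    if "e' \<in> nonzero E" "f' \<in> nonzero F" "Proj E e' = p" "Proj F f' = p" for e' f'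
    using ratio_trans[OF e has_lines_frame[OF E that(1,3)] u] ratio_trans[OF f has_lines_frame[OF F that(2,4)] v]
    by simp
  then show ?thesis
    using fiber_Proj(1)[OF u] frame_vec_Proj[OF e]
    by (auto simp: tens_def tensor_bundle_def fun_eq_iff)
qed

lemma tens_eval:
  assumes "frame_vec E p e" "frame_vec F p f"
  shows "snd (tens E F e f) (e, f) = 1" "fst (tens E F e f) = p"
  using assms by (auto simp: tens_def frame_nonzero frame_vec_Proj ratio_self)

text \<open>Each fiber vector is a pure tensor, so \<open>tens_frame_expand\<close> gives
  surjectivity of c \<mapsto> c (e \<otimes> f); evaluating the coefficient function at the pair (e,
  f) recovers c and gives injectivity.\<close>

lemma frame_vec_tens:
  assumes E: "has_lines E" and F: "has_lines F" and e: "frame_vec E p e" and f: "frame_vec F p f"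
  shows "frame_vec (tensor_bundle E F) p (tens E F e f)"
proof -
  let ?T = "tensor_bundle E F"
  have fib: "fiber ?T p = {tens E F u v | u v. u \<in> fiber E p \<and> v \<in> fiber F p}"
  proof (intro equalityI subsetI)
    fix t assume "t \<in> fiber ?T p"
    then have "(\<exists>u v. t = tens E F u v \<and> u \<in> Tot E \<and> v \<in> fiber F (Proj E u)) \<and> fst t = p"
      by (simp only: mem_fiber_tensor)
    then obtain u v where uv: "t = tens E F u v" "u \<in> Tot E" "v \<in> fiber F (Proj E u)" and "fst t = p"
      by blast
    then have "Proj E u = p" by (simp only: fst_tens)
    with uv have "u \<in> fiber E p" "v \<in> fiber F p" by (simp_all add: fiber_def)
    with uv(1) show "t \<in> {tens E F u v | u v. u \<in> fiber E p \<and> v \<in> fiber F p}" by blast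
  next
    fix t assume "t \<in> {tens E F u v | u v. u \<in> fiber E p \<and> v \<in> fiber F p}"
    then obtain u v where "t = tens E F u v" "u \<in> fiber E p" "v \<in> fiber F p" by blast
    then show "t \<in> fiber ?T p" by (simp only: tens_fiber)
  qed
  have sm: "Smul ?T c t = (fst t, \<lambda>x. c * snd t x)" for c t by (simp add: tensor_bundle_def)
  have "(\<lambda>c. Smul ?T c (tens E F e f)) ` UNIV = fiber ?T p"
  proof (intro equalityI subsetI)
    fix t assume "t \<in> (\<lambda>c. Smul ?T c (tens E F e f)) ` UNIV"
    then obtain c where t: "t = Smul ?T c (tens E F e f)" by blast
    have "tens E F (Smul E c e) f = Smul ?T (ratio E (Smul E c e) e * ratio F f f) (tens E F e f)"
      by (rule tens_frame_expand[OF E F e f frame_Smul_in[OF e] frame_fiber[OF f]])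
    then have "t = tens E F (Smul E c e) f" by (simp add: t ratio_Smul_frame[OF e] ratio_self[OF f])
    then show "t \<in> fiber ?T p" unfolding fib using frame_Smul_in[OF e] frame_fiber[OF f] by blast
  next
    fix t assume "t \<in> fiber ?T p"
    then show "t \<in> (\<lambda>c. Smul ?T c (tens E F e f)) ` UNIV"
      unfolding fib using tens_frame_expand[OF E F e f] by auto
  qed
  moreover have "inj (\<lambda>c. Smul ?T c (tens E F e f))"
  proof (rule injI)
    fix a b assume "Smul ?T a (tens E F e f) = Smul ?T b (tens E F e f)"
    then have "(\<lambda>x. a * snd (tens E F e f) x) = (\<lambda>x. b * snd (tens E F e f) x)" unfolding sm by blast
    then have "a * snd (tens E F e f) (e, f) = b * snd (tens E F e f) (e, f)" by (rule fun_cong)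
    then show "a = b" by (simp add: tens_eval[OF e f])
  qed
  moreover have "tens E F e f \<in> fiber ?T p" by (rule tens_fiber[OF frame_fiber[OF e] frame_fiber[OF f]])
  ultimately show ?thesis
    unfolding frame_vec_def bij_betw_def by (simp add: sm mult.assoc)
qed

lemma ratio_tens:
  assumes E: "has_lines E" and F: "has_lines F" and e: "frame_vec E p e" and f: "frame_vec F p f"
    and u: "u \<in> fiber E p" and v: "v \<in> fiber F p"
  shows "ratio (tensor_bundle E F) (tens E F u v) (tens E F e f) = ratio E u e * ratio F v f"
  unfolding tens_frame_expand[OF assms] by (rule ratio_Smul_frame[OF frame_vec_tens[OF E F e f]])


lemma tens_list_expand:
  assumes L: "\<And>i. i < s \<Longrightarrow> has_lines (L i)" and e: "\<And>i. i < s \<Longrightarrow> frame_vec (L i) p (e i)"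
    and u: "\<And>i. i < s \<Longrightarrow> u i \<in> fiber (L i) p"
  shows "tens_list L s p u = Smul (tensor_list_bundle L s) (\<Prod>i<s. ratio (L i) (u i) (e i)) (tens_list L s p e)"
proof -
  have "(\<Prod>i<s. ratio (L i) (u i) (e' i)) = (\<Prod>i<s. ratio (L i) (u i) (e i)) * (\<Prod>i<s. ratio (L i) (e i) (e' i))"
    if "\<forall>i<s. e' i \<in> nonzero (L i) \<and> Proj (L i) (e' i) = p" for e'
    unfolding prod.distrib[symmetric]
    by (rule prod.cong[OF refl], rule ratio_trans[OF e has_lines_frame[OF L] u]) (use that in auto)
  then show ?thesis by (auto simp: tens_list_def tensor_list_bundle_def fun_eq_iff)
qed

lemma tens_list_eval:
  assumes e: "\<And>i. i < s \<Longrightarrow> frame_vec (L i) p (e i)"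
  shows "snd (tens_list L s p e) e = 1"
proof -
  have "(\<Prod>i<s. ratio (L i) (e i) (e i)) = 1" by (rule prod.neutral) (use ratio_self[OF e] in auto)
  moreover have "\<forall>i<s. e i \<in> nonzero (L i) \<and> Proj (L i) (e i) = p"
    using frame_nonzero[OF e] frame_vec_Proj[OF e] by blast
  ultimately show ?thesis by (simp add: tens_list_def)
qed

text \<open>As for two factors. The explicit scalar in the total space keeps the fibers lines also
  for s = 0, where the empty product has no vector to absorb it.\<close>

lemma frame_vec_tens_list:
  assumes L: "\<And>i. i < s \<Longrightarrow> has_lines (L i)" and e: "\<And>i. i < s \<Longrightarrow> frame_vec (L i) p (e i)"
  shows "frame_vec (tensor_list_bundle L s) p (tens_list L s p e)"
proof -
  let ?T = "tensor_list_bundle L s"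
  have sm: "Smul ?T c t = (fst t, \<lambda>x. c * snd t x)" for c t by (simp add: tensor_list_bundle_def)
  have fib: "fiber ?T p = {Smul ?T c (tens_list L s p u) | c u. \<forall>i<s. u i \<in> fiber (L i) p}"
  proof (intro equalityI subsetI)
    fix t assume "t \<in> fiber ?T p"
    then have "(\<exists>p' c u. t = (p', \<lambda>e. c * snd (tens_list L s p' u) e) \<and> (\<forall>i<s. u i \<in> fiber (L i) p')) \<and> fst t = p"
      by (simp only: mem_fiber_tensor_list)
    then obtain c u where "t = (p, \<lambda>e. c * snd (tens_list L s p u) e)" "\<forall>i<s. u i \<in> fiber (L i) p" by auto
    then show "t \<in> {Smul ?T c (tens_list L s p u) | c u. \<forall>i<s. u i \<in> fiber (L i) p}"
      unfolding sm fst_tens_list by blast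
  next
    fix t assume "t \<in> {Smul ?T c (tens_list L s p u) | c u. \<forall>i<s. u i \<in> fiber (L i) p}"
    then obtain c u where t: "t = (p, \<lambda>e. c * snd (tens_list L s p u) e)" "\<forall>i<s. u i \<in> fiber (L i) p"
      unfolding sm fst_tens_list by blast
    then have "(\<exists>p' c u. t = (p', \<lambda>e. c * snd (tens_list L s p' u) e) \<and> (\<forall>i<s. u i \<in> fiber (L i) p')) \<and> fst t = p"
      by auto
    then show "t \<in> fiber ?T p"
      by (simp only: mem_fiber_tensor_list)
  qed
  have "(\<lambda>c. Smul ?T c (tens_list L s p e)) ` UNIV = fiber ?T p"
  proof (intro equalityI subsetI)
    fix t assume "t \<in> (\<lambda>c. Smul ?T c (tens_list L s p e)) ` UNIV"
    then show "t \<in> fiber ?T p" unfolding fib using frame_fiber[OF e] by blast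
  next
    fix t assume "t \<in> fiber ?T p"
    then obtain c u where t: "t = Smul ?T c (tens_list L s p u)" "\<forall>i<s. u i \<in> fiber (L i) p" unfolding fib by blast
    have "t = Smul ?T (c * (\<Prod>i<s. ratio (L i) (u i) (e i))) (tens_list L s p e)"
      unfolding t(1) by (subst tens_list_expand[of s L p e u]) (use L e t(2) in \<open>auto simp: sm mult.assoc\<close>)
    then show "t \<in> (\<lambda>c. Smul ?T c (tens_list L s p e)) ` UNIV" by blast
  qed
  moreover have "inj (\<lambda>c. Smul ?T c (tens_list L s p e))"
  proof (rule injI)
    fix a b assume "Smul ?T a (tens_list L s p e) = Smul ?T b (tens_list L s p e)"
    then have "a * snd (tens_list L s p e) e = b * snd (tens_list L s p e) e"
      unfolding sm by (auto dest!: fun_cong[where x=e])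
    moreover have "snd (tens_list L s p e) e = 1" by (rule tens_list_eval) (use e in auto)
    ultimately show "a = b" by simp
  qed
  moreover have "tens_list L s p e \<in> fiber ?T p"
  proof -
    have "tens_list L s p e = Smul ?T 1 (tens_list L s p e)" by (simp add: sm)
    then show ?thesis unfolding fib using frame_fiber[OF e] by blast
  qed
  ultimately show ?thesis
    unfolding frame_vec_def bij_betw_def by (simp add: sm mult.assoc)
qed

lemma has_lines_tensor_list: "(\<And>i. i < s \<Longrightarrow> has_lines (L i)) \<Longrightarrow> has_lines (tensor_list_bundle L s)"
proof -
  assume L: "\<And>i. i < s \<Longrightarrow> has_lines (L i)"
  show ?thesis unfolding has_lines_def
  proof
    fix p
    have "\<forall>i. \<exists>e. i < s \<longrightarrow> frame_vec (L i) p e" using L by (auto simp: has_lines_def)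
    then obtain e where e: "\<And>i. i < s \<Longrightarrow> frame_vec (L i) p (e i)" by metis
    have "frame_vec (tensor_list_bundle L s) p (tens_list L s p e)"
      by (rule frame_vec_tens_list) (use L e in auto)
    then show "\<exists>e. frame_vec (tensor_list_bundle L s) p e" by blast
  qed
qed

lemma ratio_tens_list:
  assumes L: "\<And>i. i < s \<Longrightarrow> has_lines (L i)" and e: "\<And>i. i < s \<Longrightarrow> frame_vec (L i) p (e i)"
    and u: "\<And>i. i < s \<Longrightarrow> u i \<in> fiber (L i) p"
  shows "ratio (tensor_list_bundle L s) (tens_list L s p u) (tens_list L s p e) = (\<Prod>i<s. ratio (L i) (u i) (e i))"
proof -
  have "frame_vec (tensor_list_bundle L s) p (tens_list L s p e)"
    by (rule frame_vec_tens_list) (use L e in auto)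
  from ratio_Smul_frame[OF this] show ?thesis
    by (subst tens_list_expand[of s L p e u]) (use L e u in auto)
qed

lemma tens_list_fiber:
  assumes "\<And>i. i < s \<Longrightarrow> u i \<in> fiber (L i) p"
  shows "tens_list L s p u \<in> fiber (tensor_list_bundle L s) p"
proof -
  have "tens_list L s p u = (p, \<lambda>e. 1 * snd (tens_list L s p u) e)" by (simp add: tens_list_def)
  then have "\<exists>p' c v. tens_list L s p u = (p', \<lambda>e. c * snd (tens_list L s p' v) e) \<and> (\<forall>i<s. v i \<in> fiber (L i) p')"
    using assms by (intro exI[of _ p] exI[of _ "1::complex"] exI[of _ u] conjI allI impI)
  then have "(\<exists>p' c v. tens_list L s p u = (p', \<lambda>e. c * snd (tens_list L s p' v) e) \<and> (\<forall>i<s. v i \<in> fiber (L i) p'))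
      \<and> fst (tens_list L s p u) = p"
    unfolding fst_tens_list by simp
  then show ?thesis
    by (simp only: mem_fiber_tensor_list)
qed

section \<open>Completion of independent linear forms to a coordinate system\<close>

lemma independent_rows_extend:
  fixes r :: "nat \<Rightarrow> 'n::finite cvec"
  assumes "m \<le> CARD('n)" "\<And>c. (\<Sum>i<m. c i *s r i) = 0 \<Longrightarrow> \<forall>i<m. c i = 0"
  shows "\<exists>r'. (\<forall>i<m. r' i = r i) \<and> (\<forall>c. (\<Sum>i<CARD('n). c i *s r' i) = 0 \<longrightarrow> (\<forall>i<CARD('n). c i = 0))"
  using assms
proof (induction "CARD('n) - m" arbitrary: m r)
  case 0
  then have "m = CARD('n)" by simp
  with 0 show ?case by blast
next
  case (Suc k)
  then have m: "m < CARD('n)" by simp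
  \<comment> \<open>Fewer than \<open>CARD('n)\<close> vectors cannot span, so a vector outside the
    span can be appended as row m.\<close>
  have "vec.span (r ` {..<m}) \<noteq> UNIV"
  proof
    assume "vec.span (r ` {..<m}) = UNIV"
    then have "vec.dim (UNIV :: 'n cvec set) \<le> card (r ` {..<m})"
      by (intro vec.dim_le_card) auto
    also have "\<dots> \<le> m" using card_image_le[of "{..<m}" r] by simp
    finally have "vec.dim (UNIV :: 'n cvec set) \<le> m" .
    then show False using m unfolding vec_dim_card by simp
  qed
  then obtain x where x: "x \<notin> vec.span (r ` {..<m})" by blast
  define r1 where "r1 = r(m := x)"
  have r1: "r1 i = r i" if "i < m" for i using that by (simp add: r1_def)
  have indep: "\<forall>i<Suc m. c i = 0" if c: "(\<Sum>i<Suc m. c i *s r1 i) = 0" for c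
  proof -
    have sum: "(\<Sum>i<m. c i *s r i) + c m *s x = 0"
      using c r1 by (simp add: r1_def)
    have "c m = 0"
    proof (rule ccontr)
      assume cm: "c m \<noteq> 0"
      have "c m *s x = - (\<Sum>i<m. c i *s r i)" using sum by (simp only: add_eq_0_iff)
      moreover have "(\<Sum>i<m. c i *s r i) \<in> vec.span (r ` {..<m})"
        by (intro vec.span_sum vec.span_scale vec.span_base) auto
      ultimately have "c m *s x \<in> vec.span (r ` {..<m})" by (simp add: vec.span_neg)
      then have "(1 / c m) *s (c m *s x) \<in> vec.span (r ` {..<m})" by (rule vec.span_scale)
      then show False using x cm by (simp add: vector_smult_assoc)
    qed
    then show ?thesis using sum Suc.prems(2)[of c] by (auto simp: less_Suc_eq)
  qed
  have k: "k = CARD('n) - Suc m" using Suc.hyps(2) by simp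
  have "\<exists>r'. (\<forall>i<Suc m. r' i = r1 i) \<and> (\<forall>c. (\<Sum>i<CARD('n). c i *s r' i) = 0 \<longrightarrow> (\<forall>i<CARD('n). c i = 0))"
    by (rule Suc.hyps(1)[OF k _ indep]) (use m in simp)
  then obtain r' where r': "\<forall>i<Suc m. r' i = r1 i"
    "\<forall>c. (\<Sum>i<CARD('n). c i *s r' i) = 0 \<longrightarrow> (\<forall>i<CARD('n). c i = 0)"
    by blast
  then show ?case using r1 by (intro exI[of _ r']) auto
qed

lemma independent_rows_kernel:
  fixes r :: "nat \<Rightarrow> 'n::{finite, linorder} cvec" and h :: "'n cvec"
  assumes indep: "\<And>c. (\<Sum>i<CARD('n). c i *s r i) = 0 \<Longrightarrow> \<forall>i<CARD('n). c i = 0"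
    and h: "\<And>i. i < CARD('n) \<Longrightarrow> (\<Sum>l<CARD('n). r i $ coord l * h $ coord l) = 0"
  shows "h = 0"
proof -
  \<comment> \<open>Independent rows make the determinant nonzero; the same criterion for the
    transpose says that the columns are independent, that is h = 0.\<close>
  have "leibniz_det CARD('n) (\<lambda>i l. r i $ coord l) \<noteq> 0"
    unfolding leibniz_det_nonzero_iff
  proof (intro allI impI)
    fix c i assume c: "\<forall>l<CARD('n). (\<Sum>i<CARD('n). c i * r i $ (coord l :: 'n)) = 0" and i: "i < CARD('n)"
    have "(\<Sum>i<CARD('n). c i *s r i) = 0"
      by (rule vec_eq_coord) (use c in \<open>simp add: sum_component\<close>)
    then show "c i = 0" using indep i by blast
  qed
  then have "leibniz_det CARD('n) (\<lambda>l i. r i $ coord l) \<noteq> 0"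
    by (subst leibniz_det_transpose)
  from iffD1[OF leibniz_det_nonzero_iff this, THEN spec, of "\<lambda>l. h $ coord l"]
  have "\<forall>l<CARD('n). h $ coord l = 0" using h by (simp add: mult.commute)
  then show ?thesis by (intro vec_eq_coord) simp
qed

section \<open>Sections of line bundles in local frames\<close>

lemma bundle_frame:
  assumes "is_line_bundle A E" "(U, e) \<in> Frames E"
  shows "open U" "p \<in> U \<Longrightarrow> frame_vec E p (e p)"
  using assms unfolding is_line_bundle_def frame_vec_def by blast+

lemma bundle_cover:
  assumes "is_line_bundle A E"
  shows "\<exists>U e. (U, e) \<in> Frames E \<and> p \<in> U"
proof -
  have "p \<in> (\<Union>(U, e)\<in>Frames E. U)" using assms by (simp add: is_line_bundle_def)
  then show ?thesis by blast
qed

lemma bundle_has_lines: "is_line_bundle A E \<Longrightarrow> has_lines E"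
  unfolding has_lines_def using bundle_cover bundle_frame(2) by metis

lemma bundle_ratio_add:
  assumes E: "is_line_bundle A E" and e: "(U, e) \<in> Frames E" "p \<in> U"
    and u: "u \<in> fiber E p" "v \<in> fiber E p"
  shows "ratio E (Add E u v) (e p) = ratio E u (e p) + ratio E v (e p)"
proof -
  note f = bundle_frame(2)[OF E e]
  have "Add E (Smul E a (e p)) (Smul E b (e p)) = Smul E (a + b) (e p)" for a b
    using E e unfolding is_line_bundle_def by blast
  then have "Add E u v = Smul E (ratio E u (e p) + ratio E v (e p)) (e p)"
    using ratio_eq[OF f u(1)] ratio_eq[OF f u(2)] by metis
  then show ?thesis by (simp only: ratio_Smul_frame[OF f])
qed

context cmfd
begin

lemma holo_section_fiber: "holo_section A E W \<sigma> \<Longrightarrow> p \<in> W \<Longrightarrow> \<sigma> p \<in> fiber E p"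
  by (simp add: holo_section_def)

lemma holo_section_hol:
  assumes E: "is_line_bundle A E" and \<sigma>: "holo_section A E W \<sigma>" and W: "open W" "p \<in> W"
    and e: "(U, e) \<in> Frames E" "p \<in> U"
  shows "hol_at (\<lambda>q. ratio E (\<sigma> q) (e q)) p"
proof -
  have "holo_fun A (U \<inter> W) (\<lambda>p. ratio E (\<sigma> p) (e p))"
    using \<sigma> e(1) unfolding holo_section_def by blast
  then show ?thesis using holo_fun_iff[OF open_Int[OF bundle_frame(1)[OF E e(1)] W(1)]] W e by blast
qed

lemma frames_local_frame:
  assumes E: "is_line_bundle A E" and e: "(U, e) \<in> Frames E"
  shows "local_frame A E U e"
  unfolding local_frame_def holo_section_def
proof (intro conjI ballI)
  show "open U" by (rule bundle_frame(1)[OF E e])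
  show "e p \<in> fiber E p" if "p \<in> U" for p by (rule frame_fiber[OF bundle_frame(2)[OF E e that]])
  show "e p \<in> nonzero E" if "p \<in> U" for p by (rule frame_nonzero[OF bundle_frame(2)[OF E e that]])
  fix Vf assume "Vf \<in> Frames E"
  then obtain V f where Vf: "Vf = (V, f)" "(V, f) \<in> Frames E" by (cases Vf) auto
  show "case Vf of (V, f) \<Rightarrow> holo_fun A (V \<inter> U) (\<lambda>p. ratio E (e p) (f p))"
    unfolding Vf(1) prod.case using E e Vf(2) unfolding is_line_bundle_def by blast
qed

lemma local_frame_frame_vec:
  assumes "is_line_bundle A E" "local_frame A E U e" "p \<in> U"
  shows "frame_vec E p (e p)"
  using has_lines_frame[OF bundle_has_lines[OF assms(1)]] assms(2,3) fiber_Proj(1)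
  unfolding local_frame_def holo_section_def by metis

lemma local_frame_subset: "local_frame A E U e \<Longrightarrow> open V \<Longrightarrow> V \<subseteq> U \<Longrightarrow> is_line_bundle A E \<Longrightarrow> local_frame A E V e"
  unfolding local_frame_def
proof (intro conjI ballI)
  assume U: "open U \<and> holo_section A E U e \<and> (\<forall>p\<in>U. e p \<in> nonzero E)" and V: "open V" "V \<subseteq> U"
    and E: "is_line_bundle A E"
  show "open V" by fact
  show "e p \<in> nonzero E" if "p \<in> V" for p using U V that by blast
  show "holo_section A E V e"
    unfolding holo_section_def
  proof (intro conjI ballI)
    show "e p \<in> fiber E p" if "p \<in> V" for p using U V that holo_section_fiber by blast
    fix Wf assume "Wf \<in> Frames E"
    then obtain W f where Wf: "Wf = (W, f)" "(W, f) \<in> Frames E" by (cases Wf) auto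
    have "hol_at (\<lambda>p. ratio E (e p) (f p)) p" if "p \<in> W \<inter> V" for p
      using holo_section_hol[OF E _ _ _ Wf(2)] U V that by blast
    then show "case Wf of (W, f) \<Rightarrow> holo_fun A (W \<inter> V) (\<lambda>p. ratio E (e p) (f p))"
      unfolding Wf(1) prod.case using holo_fun_iff[OF open_Int[OF bundle_frame(1)[OF E Wf(2)] V(1)]] by blast
  qed
qed

text \<open>Holomorphy of a section is tested against \<open>Frames\<close> only; the ratio to
  another local frame e is the quotient of two ratios to a member f of \<open>Frames\<close>, and
  the denominator has no zeros.\<close>

lemma local_frame_hol:
  assumes E: "is_line_bundle A E" and e: "local_frame A E U e" "p \<in> U"
    and \<sigma>: "holo_section A E W \<sigma>" and W: "open W" "p \<in> W"
  shows "hol_at (\<lambda>q. ratio E (\<sigma> q) (e q)) p"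
proof -
  obtain V f where Vf: "(V, f) \<in> Frames E" "p \<in> V" using bundle_cover[OF E] by blast
  have U: "open U" "holo_section A E U e" using e by (auto simp: local_frame_def)
  have eq: "ratio E (\<sigma> q) (f q) = ratio E (\<sigma> q) (e q) * ratio E (e q) (f q)"
    and nz: "ratio E (e q) (f q) \<noteq> 0" if q: "q \<in> U \<inter> (V \<inter> W)" for q
  proof -
    have 1: "frame_vec E q (e q)" using local_frame_frame_vec[OF E e(1)] q by blast
    have 2: "frame_vec E q (f q)" using bundle_frame(2)[OF E Vf(1)] q by blast
    have 3: "\<sigma> q \<in> fiber E q" using holo_section_fiber[OF \<sigma>] q by blast
    show "ratio E (\<sigma> q) (f q) = ratio E (\<sigma> q) (e q) * ratio E (e q) (f q)" by (rule ratio_trans[OF 1 2 3])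
    show "ratio E (e q) (f q) \<noteq> 0" by (rule ratio_frame_nonzero[OF 2 1])
  qed
  have "hol_at (\<lambda>q. ratio E (\<sigma> q) (f q) / ratio E (e q) (f q)) p"
    by (rule hol_at_divide[OF holo_section_hol[OF E \<sigma> W Vf] holo_section_hol[OF E U(2,1) e(2) Vf]])
       (use nz e Vf W in blast)
  then show ?thesis
  proof (rule hol_at_cong)
    have "open (U \<inter> (V \<inter> W))" using U(1) bundle_frame(1)[OF E Vf(1)] W(1) by blast
    then have "\<forall>\<^sub>F q in nhds p. q \<in> U \<inter> (V \<inter> W)" by (rule eventually_in) (use e Vf W in blast)
    then show "\<forall>\<^sub>F q in nhds p. ratio E (\<sigma> q) (f q) / ratio E (e q) (f q) = ratio E (\<sigma> q) (e q)"
      by eventually_elim (simp add: eq nz)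
  qed
qed

subsection \<open>The canonical bundle\<close>

lemma mem_fiber_canonical: "\<eta> \<in> fiber (canonical_bundle A) p \<longleftrightarrow> fst \<eta> = p \<and> snd \<eta> \<in> alt_forms CARD('n) (tangent A p)"
  unfolding fiber_def canonical_bundle_def by (cases \<eta>) auto

lemma Smul_canonical: "Smul (canonical_bundle A) c \<eta> = (fst \<eta>, \<lambda>u. c * snd \<eta> u)"
  by (simp add: canonical_bundle_def)

lemma frame_vec_canonical:
  assumes c: "c \<in> A" "p \<in> fst c"
  shows "frame_vec (canonical_bundle A) p (p, top_form c p)"
  unfolding frame_vec_def
proof (intro conjI allI)
  let ?K = "canonical_bundle A"
  show in_fiber: "(p, top_form c p) \<in> fiber ?K p" by (simp add: mem_fiber_canonical top_form_alt)
  show "bij_betw (\<lambda>a. Smul ?K a (p, top_form c p)) UNIV (fiber ?K p)"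
    unfolding bij_betw_def
  proof
    show "inj (\<lambda>a. Smul ?K a (p, top_form c p))"
    proof (rule injI)
      fix a b assume "Smul ?K a (p, top_form c p) = Smul ?K b (p, top_form c p)"
      then have "(\<lambda>u. a * top_form c p u) = (\<lambda>u. b * top_form c p u)" by (simp add: Smul_canonical)
      from fun_cong[OF this, of "\<lambda>j. coord_vec A c j p"] show "a = b" by (simp add: top_form_basis[OF c])
    qed
    show "range (\<lambda>a. Smul ?K a (p, top_form c p)) = fiber ?K p"
    proof (intro equalityI subsetI)
      fix \<eta> assume "\<eta> \<in> range (\<lambda>a. Smul ?K a (p, top_form c p))"
      then obtain a where "\<eta> = Smul ?K a (p, top_form c p)" by blast
      then show "\<eta> \<in> fiber ?K p"
        by (simp add: Smul_canonical mem_fiber_canonical alt_forms_scale[OF top_form_alt])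
    next
      fix \<eta> assume \<eta>: "\<eta> \<in> fiber ?K p"
      have "\<eta> = Smul ?K (snd \<eta> (\<lambda>j. coord_vec A c j p)) (p, top_form c p)"
      proof (rule prod_eqI)
        show "snd \<eta> = snd (Smul ?K (snd \<eta> (\<lambda>j. coord_vec A c j p)) (p, top_form c p))"
          unfolding Smul_canonical snd_conv
          by (rule ext, rule alt_form_top[OF _ c]) (use \<eta> in \<open>simp add: mem_fiber_canonical\<close>)
      qed (use \<eta> in \<open>simp add: Smul_canonical mem_fiber_canonical\<close>)
      then show "\<eta> \<in> range (\<lambda>a. Smul ?K a (p, top_form c p))" by blast
    qed
  qed
qed (simp add: Smul_canonical mult.assoc)

lemma has_lines_canonical: "has_lines (canonical_bundle A)"
  unfolding has_lines_def using frame_vec_canonical chart_cover by metis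

lemma ratio_canonical:
  assumes c: "c \<in> A" "p \<in> fst c" and \<alpha>: "\<alpha> \<in> alt_forms CARD('n) (tangent A p)"
  shows "ratio (canonical_bundle A) (p, \<alpha>) (p, top_form c p) = \<alpha> (\<lambda>j. coord_vec A c j p)"
proof -
  have "(p, \<alpha>) = Smul (canonical_bundle A) (\<alpha> (\<lambda>j. coord_vec A c j p)) (p, top_form c p)"
    unfolding Smul_canonical fst_conv snd_conv by (intro prod_eqI ext) (simp_all only: fst_conv snd_conv alt_form_top[OF \<alpha> c, symmetric])
  then show ?thesis by (metis ratio_Smul_frame[OF frame_vec_canonical[OF c]])
qed

end

section \<open>The adjunction isomorphism\<close>

locale adjunction = cmfd A for A :: "('x::topological_space, 'n::{finite, linorder} cvec) chart set" +
  fixes L :: "nat \<Rightarrow> ('x, 'l) line_bundle" and s :: nat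
  assumes s_less: "s < CARD('n)" and L_bundle: "\<And>i. i < s \<Longrightarrow> is_line_bundle A (L i)"
begin

abbreviation TL where "TL \<equiv> tensor_list_bundle L s"

abbreviation KX where "KX \<equiv> canonical_bundle A"

text \<open>The frame \<open>e\<^sub>1 \<otimes> ... \<otimes> e\<^sub>s \<otimes> dz\<^sub>1 \<and>
  ... \<and> dz\<^sub>d\<close> of L + K_X at p.\<close>

definition lkframe :: "(nat \<Rightarrow> 'x \<Rightarrow> 'l) \<Rightarrow> ('x, 'n cvec) chart \<Rightarrow> 'x \<Rightarrow> _" where
  "lkframe e c p = tens TL KX (tens_list L s p (\<lambda>i. e i p)) (p, top_form c p)"

text \<open>The local coefficient g of \<tau> in the adjunction formula.\<close>

definition lkcoeff :: "('x \<Rightarrow> _) \<Rightarrow> (nat \<Rightarrow> 'x \<Rightarrow> 'l) \<Rightarrow> ('x, 'n cvec) chart \<Rightarrow> 'x \<Rightarrow> complex" where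
  "lkcoeff \<tau> e c p = ratio (LK A L s) (\<tau> p) (lkframe e c p)"

text \<open>Each frame may live on its own neighbourhood of p.\<close>

definition frames_at :: "(nat \<Rightarrow> 'x \<Rightarrow> 'l) \<Rightarrow> 'x \<Rightarrow> bool" where
  "frames_at e p \<longleftrightarrow> (\<forall>i<s. \<exists>U. p \<in> U \<and> local_frame A (L i) U (e i))"

definition sect :: "(nat \<Rightarrow> 'x \<Rightarrow> 'l) \<Rightarrow> (nat \<Rightarrow> 'x \<Rightarrow> 'l) \<Rightarrow> nat \<Rightarrow> 'x \<Rightarrow> complex" where
  "sect \<sigma> e i q = ratio (L i) (\<sigma> i q) (e i q)"

lemma L_lines: "i < s \<Longrightarrow> has_lines (L i)"
  using bundle_has_lines L_bundle by blast

lemma TL_lines: "has_lines TL"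
  by (rule has_lines_tensor_list) (rule L_lines)

lemma frames_at_vec: "frames_at e p \<Longrightarrow> i < s \<Longrightarrow> frame_vec (L i) p (e i p)"
  unfolding frames_at_def using local_frame_frame_vec[OF L_bundle] by blast

lemma frames_at_eventually:
  assumes "frames_at e p"
  shows "\<forall>\<^sub>F q in nhds p. frames_at e q"
proof -
  obtain U where U: "\<And>i. i < s \<Longrightarrow> p \<in> U i \<and> local_frame A (L i) (U i) (e i)"
    using assms unfolding frames_at_def by metis
  have "\<forall>\<^sub>F q in nhds p. \<forall>i\<in>{..<s}. q \<in> U i"
    using U by (intro eventually_ball_finite ballI eventually_in) (auto simp: local_frame_def)
  then show ?thesis by eventually_elim (use U in \<open>auto simp: frames_at_def\<close>)
qed

lemma frames_at_exist: "\<exists>e. frames_at e p"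
proof -
  have "\<forall>i. \<exists>U e. i < s \<longrightarrow> (U, e) \<in> Frames (L i) \<and> p \<in> U" using bundle_cover[OF L_bundle] by blast
  then obtain U e where "\<And>i. i < s \<Longrightarrow> (U i, e i) \<in> Frames (L i) \<and> p \<in> U i" by metis
  then show ?thesis unfolding frames_at_def using frames_local_frame[OF L_bundle] by blast
qed

lemma frames_at_Frames:
  assumes "\<And>i. i < s \<Longrightarrow> (U i, e i) \<in> Frames (L i) \<and> p \<in> U i"
  shows "frames_at e p"
  unfolding frames_at_def using assms frames_local_frame[OF L_bundle] by blast

lemma frames_at_hol:
  assumes "frames_at e p" "i < s" "holo_section A (L i) W f" "open W" "p \<in> W"
  shows "hol_at (\<lambda>q. ratio (L i) (f q) (e i q)) p"
  using assms local_frame_hol[OF L_bundle] unfolding frames_at_def by blast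

lemma frames_at_ratio_hol:
  assumes "frames_at e p" "frames_at e' p" "i < s"
  shows "hol_at (\<lambda>q. ratio (L i) (e i q) (e' i q)) p"
proof -
  obtain U where "p \<in> U" "local_frame A (L i) U (e i)" using assms unfolding frames_at_def by blast
  then show ?thesis using frames_at_hol[OF assms(2,3)] by (auto simp: local_frame_def)
qed

lemma lkframe_frame:
  assumes e: "\<And>i. i < s \<Longrightarrow> frame_vec (L i) p (e i p)" and c: "c \<in> A" "p \<in> fst c"
  shows "frame_vec (LK A L s) p (lkframe e c p)"
  unfolding lkframe_def
proof (rule frame_vec_tens[OF TL_lines has_lines_canonical _ frame_vec_canonical[OF c]])
  show "frame_vec TL p (tens_list L s p (\<lambda>i. e i p))"
    by (rule frame_vec_tens_list) (use L_lines e in auto)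
qed

lemma lkcoeff_eq:
  assumes e: "\<And>i. i < s \<Longrightarrow> frame_vec (L i) p (e i p)" and c: "c \<in> A" "p \<in> fst c"
    and \<tau>: "\<tau> p \<in> fiber (LK A L s) p"
  shows "\<tau> p = Smul (LK A L s) (lkcoeff \<tau> e c p) (lkframe e c p)"
  unfolding lkcoeff_def by (rule ratio_eq[OF lkframe_frame[where e=e and p=p and c=c, OF e c] \<tau>])

text \<open>The transition function of L + K_X: the frame changes of the \<open>L i\<close> times
  the Jacobian determinant of the chart c with respect to c'.\<close>

lemma lkcoeff_change:
  assumes e: "\<And>i. i < s \<Longrightarrow> frame_vec (L i) p (e i p)" and c: "c \<in> A" "p \<in> fst c"
    and e': "\<And>i. i < s \<Longrightarrow> frame_vec (L i) p (e' i p)" and c': "c' \<in> A" "p \<in> fst c'"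
    and \<tau>: "\<tau> p \<in> fiber (LK A L s) p"
  shows "lkcoeff \<tau> e' c' p = lkcoeff \<tau> e c p * ((\<Prod>i<s. ratio (L i) (e i p) (e' i p)) * top_form c p (\<lambda>j. coord_vec A c' j p))"
proof -
  have "lkcoeff \<tau> e' c' p = lkcoeff \<tau> e c p * ratio (LK A L s) (lkframe e c p) (lkframe e' c' p)"
    unfolding lkcoeff_def by (rule ratio_trans[OF lkframe_frame[where e=e and p=p and c=c, OF e c]
        lkframe_frame[where e=e' and p=p and c=c', OF e' c'] \<tau>])
  also have "ratio (LK A L s) (lkframe e c p) (lkframe e' c' p) =
      ratio TL (tens_list L s p (\<lambda>i. e i p)) (tens_list L s p (\<lambda>i. e' i p)) *
      ratio KX (p, top_form c p) (p, top_form c' p)"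
    unfolding lkframe_def
  proof (rule ratio_tens[OF TL_lines has_lines_canonical _ frame_vec_canonical[OF c']])
    show "frame_vec TL p (tens_list L s p (\<lambda>i. e' i p))"
      by (rule frame_vec_tens_list) (use L_lines e' in auto)
    show "tens_list L s p (\<lambda>i. e i p) \<in> fiber TL p"
      by (rule tens_list_fiber, rule frame_fiber, rule e)
    show "(p, top_form c p) \<in> fiber KX p" by (simp add: mem_fiber_canonical top_form_alt)
  qed
  also have "ratio TL (tens_list L s p (\<lambda>i. e i p)) (tens_list L s p (\<lambda>i. e' i p)) =
      (\<Prod>i<s. ratio (L i) (e i p) (e' i p))"
    by (rule ratio_tens_list, rule L_lines, assumption, rule e', assumption, rule frame_fiber, rule e)
  also have "ratio KX (p, top_form c p) (p, top_form c' p) = top_form c p (\<lambda>j. coord_vec A c' j p)"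
    by (rule ratio_canonical[OF c' top_form_alt])
  finally show ?thesis .
qed

text \<open>\<open>H0\<close> tests \<tau> only in frames built from \<open>Frames\<close>, which
  gives the claim for such frames f; the passage from f to e multiplies by holomorphic
  ratios.\<close>

lemma lkcoeff_hol:
  assumes \<tau>: "\<tau> \<in> H0 A (LK A L s)" and e: "frames_at e p" and c: "c \<in> A" "p \<in> fst c"
  shows "hol_at (lkcoeff \<tau> e c) p"
proof -
  have "\<forall>i. \<exists>U e. i < s \<longrightarrow> (U, e) \<in> Frames (L i) \<and> p \<in> U" using bundle_cover[OF L_bundle] by blast
  then obtain U f where f: "\<And>i. i < s \<Longrightarrow> (U i, f i) \<in> Frames (L i) \<and> p \<in> U i" by metis
  have fp: "frames_at f p" by (rule frames_at_Frames[OF f])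
  define W where "W = (\<Inter>i<s. U i) \<inter> fst c"
  have W: "open W" "p \<in> W"
    using f c bundle_frame(1)[OF L_bundle] chart_open(1)[OF c(1)] by (auto simp: W_def intro!: open_Int open_INT)
  have "(\<Inter>i<s. U i, \<lambda>p. tens_list L s p (\<lambda>i. f i p)) \<in> Frames TL"
    unfolding tensor_list_bundle_def using f by auto
  moreover have "(fst c, \<lambda>p. (p, top_form c p)) \<in> Frames KX"
    unfolding canonical_bundle_def line_bundle.simps using c by blast
  ultimately have "(W, lkframe f c) \<in> Frames (LK A L s)"
    unfolding tensor_bundle_def[of TL] W_def lkframe_def[abs_def]
    by (simp, intro exI conjI refl) auto
  then have "holo_fun A (W \<inter> UNIV) (\<lambda>p. ratio (LK A L s) (\<tau> p) (lkframe f c p))"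
    using \<tau> unfolding H0_def holo_section_def by blast
  then have hf: "hol_at (lkcoeff \<tau> f c) p"
    using holo_fun_iff[OF W(1)] W(2) by (simp add: lkcoeff_def[abs_def])
  have "hol_at (\<lambda>q. lkcoeff \<tau> f c q * (\<Prod>i<s. ratio (L i) (f i q) (e i q))) p"
    by (intro hol_at_mult hf hol_at_prod frames_at_ratio_hol fp e) simp
  then show ?thesis
  proof (rule hol_at_cong)
    show "\<forall>\<^sub>F q in nhds p. lkcoeff \<tau> f c q * (\<Prod>i<s. ratio (L i) (f i q) (e i q)) = lkcoeff \<tau> e c q"
      using frames_at_eventually[OF e] frames_at_eventually[OF fp] eventually_in[OF chart_open(1)[OF c(1)] c(2)]
    proof eventually_elim
      case (elim q)
      have "\<tau> q \<in> fiber (LK A L s) q" using \<tau> by (simp add: H0_def holo_section_def)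
      from lkcoeff_change[of q f c e c \<tau>, OF frames_at_vec[OF elim(2)] c(1) elim(3) frames_at_vec[OF elim(1)] c(1) elim(3) this]
      show ?case by (simp add: top_form_basis c elim)
    qed
  qed
qed

end

section \<open>Differentials of the sections, special data and the residue formula\<close>

context adjunction
begin

abbreviation dsect :: "(nat \<Rightarrow> 'x \<Rightarrow> 'l) \<Rightarrow> (nat \<Rightarrow> 'x \<Rightarrow> 'l) \<Rightarrow> nat \<Rightarrow> 'x \<Rightarrow> ('x, 'n cvec) tvec \<Rightarrow> complex" where
  "dsect \<sigma> e i p v \<equiv> differential A (sect \<sigma> e i) p v"

lemma Vstar_section: "\<sigma> \<in> Vstar A L s \<Longrightarrow> i < s \<Longrightarrow> holo_section A (L i) UNIV (\<sigma> i)"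
  by (auto simp: Vstar_def H0_def)

lemma Bset_Vstar: "\<sigma> \<in> Bset A L s \<Longrightarrow> \<sigma> \<in> Vstar A L s"
  by (simp add: Bset_def)

lemma Vstar_fiber: "\<sigma> \<in> Vstar A L s \<Longrightarrow> i < s \<Longrightarrow> \<sigma> i p \<in> fiber (L i) p"
  using Vstar_section holo_section_fiber by blast

lemma sect_hol: "\<sigma> \<in> Vstar A L s \<Longrightarrow> frames_at e p \<Longrightarrow> i < s \<Longrightarrow> hol_at (sect \<sigma> e i) p"
  unfolding sect_def[abs_def] using frames_at_hol[OF _ _ Vstar_section open_UNIV] by blast

lemma sect_eq: "\<sigma> \<in> Vstar A L s \<Longrightarrow> frames_at e p \<Longrightarrow> i < s \<Longrightarrow> \<sigma> i p = Smul (L i) (sect \<sigma> e i p) (e i p)"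
  unfolding sect_def using ratio_eq[OF frames_at_vec Vstar_fiber] by blast

lemma sect_zero_iff:
  assumes "\<sigma> \<in> Vstar A L s" "frames_at e p" "i < s"
  shows "p \<in> Yhyp (L i) (\<sigma> i) \<longleftrightarrow> sect \<sigma> e i p = 0"
  unfolding Yhyp_def sect_def
  using nonzero_iff_ratio[OF frames_at_vec[OF assms(2,3)] Vstar_fiber[OF assms(1,3)]] by simp

lemma Yset_iff:
  assumes "\<sigma> \<in> Vstar A L s" "frames_at e p"
  shows "p \<in> Yset L s \<sigma> \<longleftrightarrow> (\<forall>i<s. sect \<sigma> e i p = 0)"
  unfolding Yset_def using sect_zero_iff[OF assms] by auto

lemma polar_divisor_iff:
  assumes "\<sigma> \<in> Vstar A L s" "frames_at e p"
  shows "p \<in> polar_divisor L s \<sigma> \<longleftrightarrow> (\<exists>i<s. sect \<sigma> e i p = 0)"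
  unfolding polar_divisor_def using sect_zero_iff[OF assms] by auto

lemma sect_change:
  assumes "\<sigma> \<in> Vstar A L s" "frames_at e p" "frames_at e' p" "i < s"
  shows "sect \<sigma> e' i p = ratio (L i) (e i p) (e' i p) * sect \<sigma> e i p"
  unfolding sect_def
  using ratio_trans[OF frames_at_vec[OF assms(2,4)] frames_at_vec[OF assms(3,4)] Vstar_fiber[OF assms(1,4)]]
  by simp

lemma dsect_change:
  assumes \<sigma>: "\<sigma> \<in> Vstar A L s" and p: "p \<in> Yset L s \<sigma>" and e: "frames_at e p" "frames_at e' p"
    and i: "i < s" and v: "v \<in> tangent A p"
  shows "dsect \<sigma> e' i p v = ratio (L i) (e i p) (e' i p) * dsect \<sigma> e i p v"
proof -
  have "\<forall>\<^sub>F q in nhds p. sect \<sigma> e' i q = ratio (L i) (e i q) (e' i q) * sect \<sigma> e i q"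
    using frames_at_eventually[OF e(1)] frames_at_eventually[OF e(2)]
    by eventually_elim (rule sect_change[OF \<sigma> _ _ i])
  from differential_cong[OF this]
  have "dsect \<sigma> e' i p v = differential A (\<lambda>q. ratio (L i) (e i q) (e' i q) * sect \<sigma> e i q) p v" .
  also have "\<dots> = ratio (L i) (e i p) (e' i p) * dsect \<sigma> e i p v"
    by (rule differential_mult_zero[OF frames_at_ratio_hol[OF e i] sect_hol[OF \<sigma> e(1) i] _ v])
       (use Yset_iff[OF \<sigma> e(1)] p i in blast)
  finally show ?thesis .
qed

lemma tangentY_iff:
  assumes \<sigma>: "\<sigma> \<in> Vstar A L s" and p: "p \<in> Yset L s \<sigma>" and e: "frames_at e p"
  shows "v \<in> tangentY A L s \<sigma> p \<longleftrightarrow> v \<in> tangent A p \<and> (\<forall>i<s. dsect \<sigma> e i p v = 0)"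
proof
  assume v: "v \<in> tangentY A L s \<sigma> p"
  have "\<forall>i. \<exists>U f. i < s \<longrightarrow> (U, f) \<in> Frames (L i) \<and> p \<in> U" using bundle_cover[OF L_bundle] by blast
  then obtain U f where f: "\<And>i. i < s \<Longrightarrow> (U i, f i) \<in> Frames (L i) \<and> p \<in> U i" by metis
  have fp: "frames_at f p" by (rule frames_at_Frames[OF f])
  have vT: "v \<in> tangent A p" using v by (simp add: tangentY_def)
  have "dsect \<sigma> e i p v = 0" if i: "i < s" for i
  proof -
    have "differential A (\<lambda>q. ratio (L i) (\<sigma> i q) (f i q)) p v = 0"
      using v i f[OF i] unfolding tangentY_def by blast
    then have "dsect \<sigma> f i p v = 0" by (simp add: sect_def[abs_def])
    then show ?thesis using dsect_change[OF \<sigma> p fp e i vT] by simp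
  qed
  then show "v \<in> tangent A p \<and> (\<forall>i<s. dsect \<sigma> e i p v = 0)" using vT by blast
next
  assume v: "v \<in> tangent A p \<and> (\<forall>i<s. dsect \<sigma> e i p v = 0)"
  have "differential A (\<lambda>q. ratio (L i) (\<sigma> i q) (f q)) p v = 0"
    if i: "i < s" and f: "(U, f) \<in> Frames (L i)" "p \<in> U" for i U f
  proof -
    \<comment> \<open>The definition of \<open>tangentY\<close> tests one bundle at a time, while
      \<open>dsect_change\<close> compares whole tuples; so f is put into slot i of e.\<close>
    define e' where "e' = e(i := f)"
    have "frames_at e' p"
      using e f frames_local_frame[OF L_bundle[OF i] f(1)] unfolding frames_at_def e'_def by auto
    then have "dsect \<sigma> e' i p v = 0"
      using dsect_change[OF \<sigma> p e _ i, of e' v] v i by simp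
    then show ?thesis by (simp add: sect_def[abs_def] e'_def)
  qed
  then show "v \<in> tangentY A L s \<sigma> p" unfolding tangentY_def using v by blast
qed

lemma tangentY_tangent: "v \<in> tangentY A L s \<sigma> p \<Longrightarrow> v \<in> tangent A p"
  by (simp add: tangentY_def)

lemma lin_closed_tangentY:
  assumes \<sigma>: "\<sigma> \<in> Vstar A L s" and p: "p \<in> Yset L s \<sigma>"
  shows "lin_closed (tangentY A L s \<sigma> p)"
  unfolding lin_closed_def
proof (intro ballI allI)
  fix v w and a b :: complex
  assume vw: "v \<in> tangentY A L s \<sigma> p" "w \<in> tangentY A L s \<sigma> p"
  obtain e where e: "frames_at e p" using frames_at_exist by blast
  show "(\<lambda>c. a *c v c + b *c w c) \<in> tangentY A L s \<sigma> p"
    unfolding tangentY_iff[OF \<sigma> p e]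
  proof (intro conjI allI impI)
    show "(\<lambda>c. a *c v c + b *c w c) \<in> tangent A p"
      using lin_closed_tangent vw tangentY_tangent unfolding lin_closed_def by blast
    show "dsect \<sigma> e i p (\<lambda>c. a *c v c + b *c w c) = 0" if i: "i < s" for i
      using differential_linear[OF sect_hol[OF \<sigma> e i] tangentY_tangent[OF vw(1)] tangentY_tangent[OF vw(2)], of a b]
        vw i by (simp add: tangentY_iff[OF \<sigma> p e])
  qed
qed

text \<open>The normal form in which the adjunction isomorphism and the residue are defined. The
  equations hold on the whole chart domain; p is a marked point of it that need not lie on
  Y.\<close>

definition special :: "(nat \<Rightarrow> 'x \<Rightarrow> 'l) \<Rightarrow> ('x, 'n cvec) chart \<Rightarrow> (nat \<Rightarrow> 'x \<Rightarrow> 'l) \<Rightarrow> 'x \<Rightarrow> bool" where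
  "special \<sigma> c e p \<longleftrightarrow> c \<in> A \<and> p \<in> fst c \<and> (\<forall>i<s. local_frame A (L i) (fst c) (e i) \<and>
     (\<forall>q\<in>fst c. \<sigma> i q = Smul (L i) (snd c q $ coord i) (e i q)))"

lemma special_frames: "special \<sigma> c e p \<Longrightarrow> q \<in> fst c \<Longrightarrow> frames_at e q"
  unfolding special_def frames_at_def by blast

lemma special_chart: "special \<sigma> c e p \<Longrightarrow> c \<in> A" "special \<sigma> c e p \<Longrightarrow> p \<in> fst c"
  unfolding special_def by blast+

lemma special_sect:
  assumes sp: "special \<sigma> c e p" and q: "q \<in> fst c" and i: "i < s"
  shows "sect \<sigma> e i q = snd c q $ coord i"
proof -
  have "\<sigma> i q = Smul (L i) (snd c q $ coord i) (e i q)" using sp q i unfolding special_def by blast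
  then show ?thesis unfolding sect_def by (simp only: ratio_Smul_frame[OF frames_at_vec[OF special_frames[OF sp q] i]])
qed

lemma special_dsect:
  assumes sp: "special \<sigma> c e p" and i: "i < s" and v: "v \<in> tangent A p"
  shows "dsect \<sigma> e i p v = v c $ coord i"
proof -
  note c = special_chart[OF sp]
  have "\<forall>\<^sub>F q in nhds p. sect \<sigma> e i q = snd c q $ coord i"
    using eventually_in[OF chart_open(1)[OF c(1)] c(2)] by eventually_elim (rule special_sect[OF sp _ i])
  from differential_cong[OF this] show ?thesis using differential_coordinate[OF v c] by simp
qed

lemma special_tangentY:
  assumes \<sigma>: "\<sigma> \<in> Vstar A L s" and p: "p \<in> Yset L s \<sigma>" and sp: "special \<sigma> c e p"
  shows "v \<in> tangentY A L s \<sigma> p \<longleftrightarrow> v \<in> tangent A p \<and> (\<forall>i<s. v c $ coord i = 0)"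
  unfolding tangentY_iff[OF \<sigma> p special_frames[OF sp special_chart(2)[OF sp]]] using special_dsect[OF sp] by auto

text \<open>Arguments for a volume form: s arbitrary vectors v in front, d - s vectors u tangent to
  Y behind, in the order of \<open>dz\<^sub>1, ..., dz\<^sub>d\<close>. The differentials of the
  sections kill u, so a wedge product evaluated on such a tuple becomes a plain product.\<close>

definition join :: "(nat \<Rightarrow> 'b) \<Rightarrow> (nat \<Rightarrow> 'b) \<Rightarrow> nat \<Rightarrow> 'b" where
  "join v u = (\<lambda>j. if j < s then v j else u (j - s))"

text \<open>The residue formula \<open>\<alpha> \<and> d\<sigma>\<^sub>1 \<and> \<dots> \<and> d\<sigma>\<^sub>s = \<tau>\<close>, which characterizes the adjunction isomorphism in
  arbitrary frames and charts.\<close>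

definition residue_formula :: "(nat \<Rightarrow> 'x \<Rightarrow> 'l) \<Rightarrow> ('x \<Rightarrow> _) \<Rightarrow> 'x \<Rightarrow> ('x, 'n cvec) tvec form \<Rightarrow> bool" where
  "residue_formula \<sigma> \<tau> p \<alpha> \<longleftrightarrow> (\<forall>e c u v. frames_at e p \<and> c \<in> A \<and> p \<in> fst c \<and>
     (\<forall>j<CARD('n) - s. u j \<in> tangentY A L s \<sigma> p) \<and> (\<forall>j<s. v j \<in> tangent A p) \<longrightarrow>
     \<alpha> u * leibniz_det s (\<lambda>i j. dsect \<sigma> e i p (v j)) = lkcoeff \<tau> e c p * top_form c p (join v u))"

abbreviation special_form where
  "special_form \<sigma> \<tau> c e p \<equiv> (\<lambda>u. lkcoeff \<tau> e c p * coord_form c (tangentY A L s \<sigma> p) s (CARD('n) - s) u)"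

lemma join_tangent:
  assumes "\<And>j. j < CARD('n) - s \<Longrightarrow> u j \<in> tangent A p" "\<And>j. j < s \<Longrightarrow> v j \<in> tangent A p" "j < CARD('n)"
  shows "join v u j \<in> tangent A p"
  using assms s_less by (auto simp: join_def)

text \<open>In special coordinates the vectors u have vanishing first s components, so the matrix of
  \<open>join v u\<close> is block triangular and its determinant splits. For other frames and
  charts both sides change by the product of the frame ratios, while the Jacobian determinants
  cancel.\<close>

lemma special_residue_formula:
  assumes \<sigma>: "\<sigma> \<in> Vstar A L s" and p: "p \<in> Yset L s \<sigma>" and \<tau>: "\<tau> p \<in> fiber (LK A L s) p"
    and sp: "special \<sigma> c e p"
  shows "residue_formula \<sigma> \<tau> p (special_form \<sigma> \<tau> c e p)"
  unfolding residue_formula_def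
proof (intro allI impI)
  fix e' c' u v
  assume h: "frames_at e' p \<and> c' \<in> A \<and> p \<in> fst c' \<and> (\<forall>j<CARD('n) - s. u j \<in> tangentY A L s \<sigma> p) \<and> (\<forall>j<s. v j \<in> tangent A p)"
  note c = special_chart[OF sp]
  have e: "frames_at e p" by (rule special_frames[OF sp c(2)])
  have u: "u j \<in> tangentY A L s \<sigma> p" if "j < CARD('n) - s" for j using h that by blast
  have v: "v j \<in> tangent A p" if "j < s" for j using h that by blast
  have J: "join v u j \<in> tangent A p" if "j < CARD('n)" for j
    by (rule join_tangent[OF tangentY_tangent[OF u] v that])
  let ?r = "\<Prod>i<s. ratio (L i) (e i p) (e' i p)"
  have "top_form c p (join v u) = leibniz_det CARD('n) (\<lambda>i j. join v u j c $ coord i)"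
    using J by (simp add: coord_form_def)
  also have "\<dots> = leibniz_det s (\<lambda>i j. join v u j c $ coord i) *
      leibniz_det (CARD('n) - s) (\<lambda>i j. join v u (s + j) c $ coord (s + i))"
  proof (rule leibniz_det_block)
    fix i j assume "i < s" "s \<le> j" "j < CARD('n)"
    then show "join v u j c $ coord i = 0"
      using u[of "j - s"] special_tangentY[OF \<sigma> p sp] by (simp add: join_def)
  qed (use s_less in simp)
  also have "leibniz_det s (\<lambda>i j. join v u j c $ coord i) = leibniz_det s (\<lambda>i j. dsect \<sigma> e i p (v j))"
    by (rule leibniz_det_cong) (simp add: join_def special_dsect[OF sp] v)
  also have "leibniz_det (CARD('n) - s) (\<lambda>i j. join v u (s + j) c $ coord (s + i)) =
      coord_form c (tangentY A L s \<sigma> p) s (CARD('n) - s) u"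
    using u by (simp add: coord_form_def join_def)
  finally have 1: "top_form c p (join v u) = leibniz_det s (\<lambda>i j. dsect \<sigma> e i p (v j)) *
      coord_form c (tangentY A L s \<sigma> p) s (CARD('n) - s) u" .
  have "leibniz_det s (\<lambda>i j. dsect \<sigma> e' i p (v j)) =
      leibniz_det s (\<lambda>i j. ratio (L i) (e i p) (e' i p) * dsect \<sigma> e i p (v j))"
    by (rule leibniz_det_cong) (rule dsect_change[OF \<sigma> p e], use h v in auto)
  also have "\<dots> = ?r * leibniz_det s (\<lambda>i j. dsect \<sigma> e i p (v j))" by (rule leibniz_det_row_scale)
  finally have 2: "leibniz_det s (\<lambda>i j. dsect \<sigma> e' i p (v j)) = ?r * leibniz_det s (\<lambda>i j. dsect \<sigma> e i p (v j))" .
  have 3: "lkcoeff \<tau> e' c' p = lkcoeff \<tau> e c p * (?r * top_form c p (\<lambda>j. coord_vec A c' j p))"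
    by (rule lkcoeff_change) (use frames_at_vec e h c \<tau> in auto)
  have 4: "top_form c p (join v u) = top_form c p (\<lambda>j. coord_vec A c' j p) * top_form c' p (join v u)"
    by (rule alt_form_top[OF top_form_alt]) (use h in auto)
  have "lkcoeff \<tau> e' c' p * top_form c' p (join v u) =
      lkcoeff \<tau> e c p * ?r * (top_form c p (\<lambda>j. coord_vec A c' j p) * top_form c' p (join v u))"
    unfolding 3 by (simp only: mult_ac)
  also have "\<dots> = lkcoeff \<tau> e c p * ?r * (leibniz_det s (\<lambda>i j. dsect \<sigma> e i p (v j)) *
      coord_form c (tangentY A L s \<sigma> p) s (CARD('n) - s) u)"
    by (simp only: 4[symmetric] 1)
  finally show "special_form \<sigma> \<tau> c e p u * leibniz_det s (\<lambda>i j. dsect \<sigma> e' i p (v j)) =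
      lkcoeff \<tau> e' c' p * top_form c' p (join v u)"
    unfolding 2 by (simp only: mult_ac)
qed

text \<open>Take the functions that represent the sections in frames f as the first s coordinates
  and linear functions of an old chart as the others. Smoothness makes the s gradients independent;
  completing them to d independent rows makes the derivative injective. The frames stay as they
  are.\<close>

lemma special_exists:
  assumes \<sigma>: "\<sigma> \<in> Bset A L s" and p: "p \<in> Yset L s \<sigma>"
  shows "\<exists>c e. special \<sigma> c e p"
proof -
  note \<sigma>V = Bset_Vstar[OF \<sigma>]
  have "\<forall>i. \<exists>U f. i < s \<longrightarrow> (U, f) \<in> Frames (L i) \<and> p \<in> U" using bundle_cover[OF L_bundle] by blast
  then obtain U f where f: "\<And>i. i < s \<Longrightarrow> (U i, f i) \<in> Frames (L i) \<and> p \<in> U i" by metis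
  obtain c where c: "c \<in> A" "p \<in> fst c" using chart_cover by blast
  define W where "W = (\<Inter>i<s. U i) \<inter> fst c"
  have W: "open W" "p \<in> W"
    using f c bundle_frame(1)[OF L_bundle] chart_open(1)[OF c(1)] by (auto simp: W_def intro!: open_Int open_INT)
  have fW: "frames_at f q" if "q \<in> W" for q
    by (rule frames_at_Frames[of U]) (use f that in \<open>auto simp: W_def\<close>)
  have fp: "frames_at f p" by (rule fW[OF W(2)])
  \<comment> \<open>Gradients of the sections in the chart c; the definite description inverts the
    numbering \<open>coord\<close>.\<close>
  define r where "r = (\<lambda>i. (\<chi> q. dsect \<sigma> f i p (coord_vec A c (THE l. l < CARD('n) \<and> coord l = q) p)) :: 'n cvec)"
  have r: "r i $ coord l = dsect \<sigma> f i p (coord_vec A c l p)" if "l < CARD('n)" for i l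
  proof -
    have "(THE l'. l' < CARD('n) \<and> coord l' = (coord l :: 'n)) = l"
      using that coord_eq_iff[where 'n='n] by (intro the_equality) auto
    then show ?thesis by (simp add: r_def)
  qed
  have dr: "dsect \<sigma> f i p v = (\<Sum>l<CARD('n). r i $ coord l * v c $ coord l)" if "i < s" "v \<in> tangent A p" for i v
    using differential_coord_vec_expand[OF sect_hol[OF \<sigma>V fp that(1)] that(2) c]
    by (simp add: r mult.commute)
  have indep: "\<forall>i<s. a i = 0" if a: "(\<Sum>i<s. a i *s r i) = 0" for a
  proof -
    have "(\<Sum>i<s. a i * dsect \<sigma> f i p v) = 0" if v: "v \<in> tangent A p" for v
    proof -
      have "(\<Sum>i<s. a i * dsect \<sigma> f i p v) = (\<Sum>i<s. \<Sum>l<CARD('n). a i * r i $ coord l * v c $ coord l)"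
        by (rule sum.cong) (auto simp: dr[OF _ v] sum_distrib_left mult.assoc)
      also have "\<dots> = (\<Sum>l<CARD('n). (\<Sum>i<s. a i *s r i) $ coord l * v c $ coord l)"
        by (subst sum.swap) (simp add: sum_component sum_distrib_right)
      finally show ?thesis using a by simp
    qed
    moreover have "smooth_codim A L s \<sigma>" using \<sigma> by (simp add: Bset_def)
    ultimately show ?thesis
      using p f unfolding smooth_codim_def sect_def[abs_def] by blast
  qed
  obtain r' where r': "\<forall>i<s. r' i = r i"
    "\<forall>a. (\<Sum>i<CARD('n). a i *s r' i) = 0 \<longrightarrow> (\<forall>i<CARD('n). a i = 0)"
    using independent_rows_extend[of s r] s_less indep by auto
  define lf where "lf = (\<lambda>i (y::'n cvec). \<Sum>l<CARD('n). r' i $ coord l * y $ coord l)"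
  define ix where "ix = (\<lambda>q::'n. THE l. l < CARD('n) \<and> coord l = q)"
  have ix: "ix (coord l) = l" if "l < CARD('n)" for l
    unfolding ix_def using that coord_eq_iff[where 'n='n] by (intro the_equality) auto
  define \<psi> where "\<psi> = (\<lambda>x. (\<chi> q. if ix q < s then sect \<sigma> f (ix q) x else lf (ix q) (snd c x)) :: 'n cvec)"
  have \<psi>: "\<psi> x $ coord l = (if l < s then sect \<sigma> f l x else lf l (snd c x))" if "l < CARD('n)" for x l
    by (simp add: \<psi>_def ix[OF that])
  have lf_hol: "holo_at (lf i) y" for i y
    unfolding lf_def by (intro holo_at_sum holo_at_mult holo_at_const holo_at_nth holo_at_ident)
  have comp_hol: "hol_at (\<lambda>x. \<psi> x $ q) x" if x: "x \<in> W" for q x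
  proof -
    obtain l where l: "l < CARD('n)" "q = coord l" using coord_surj by metis
    have "hol_at (\<lambda>x. lf l (snd c x)) x"
      by (rule hol_at_compose[OF hol_at_coordinate[OF c(1)] lf_hol]) (use x in \<open>auto simp: W_def\<close>)
    then show ?thesis using sect_hol[OF \<sigma>V fW[OF x], of l] by (cases "l < s") (simp_all add: l \<psi>)
  qed
  have \<psi>_hol: "hol_at \<psi> x" if x: "x \<in> W" for x
  proof -
    have xc: "x \<in> fst c" using x by (simp add: W_def)
    show ?thesis
      by (rule hol_atI[OF c(1) xc], rule holo_at_vec)
         (use hol_at_chart[OF comp_hol[OF x] c(1) xc] in \<open>simp add: comp_def\<close>)
  qed
  have D: "frechet_derivative (\<psi> \<circ> cinv c) (at (snd c p)) h $ coord l = (\<Sum>k<CARD('n). r' l $ coord k * h $ coord k)"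
    if l: "l < CARD('n)" for h l
  proof -
    define v where "v = tvec c p h"
    have v: "v \<in> tangent A p" "v c = h" by (simp_all add: v_def tvec_tangent c tvec_self)
    have "frechet_derivative (\<psi> \<circ> cinv c) (at (snd c p)) h $ coord l =
        frechet_derivative (\<lambda>w. (\<psi> \<circ> cinv c) w $ coord l) (at (snd c p)) h"
      by (rule frechet_derivative_nth[symmetric, OF hol_at_chart[OF \<psi>_hol[OF W(2)] c]])
    also have "(\<lambda>w. (\<psi> \<circ> cinv c) w $ coord l) = (\<lambda>x. \<psi> x $ coord l) \<circ> cinv c" by (simp add: comp_def)
    also have "frechet_derivative \<dots> (at (snd c p)) h = differential A (\<lambda>x. \<psi> x $ coord l) p v"
      using differential_chart[OF comp_hol[OF W(2)] v(1) c] v(2) by simp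
    also have "\<dots> = (\<Sum>k<CARD('n). r' l $ coord k * h $ coord k)"
    proof (cases "l < s")
      case True
      then have "(\<lambda>x. \<psi> x $ coord l) = sect \<sigma> f l" by (auto simp: \<psi> l)
      then show ?thesis using dr[OF True v(1)] True r'(1) v(2) by simp
    next
      case False
      have hl: "hol_at (\<lambda>x. lf l (snd c x)) p" by (rule hol_at_compose[OF hol_at_coordinate[OF c] lf_hol])
      have "(\<lambda>x. \<psi> x $ coord l) = (\<lambda>x. lf l (snd c x))" using False by (auto simp: \<psi> l)
      then have "differential A (\<lambda>x. \<psi> x $ coord l) p v = frechet_derivative ((\<lambda>x. lf l (snd c x)) \<circ> cinv c) (at (snd c p)) h"
        using differential_chart[OF hl v(1) c] v(2) by simp
      also have "\<dots> = frechet_derivative (lf l) (at (snd c p)) h"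
      proof (rule fun_cong[OF frechet_derivative_cong])
        show "\<forall>\<^sub>F w in nhds (snd c p). ((\<lambda>x. lf l (snd c x)) \<circ> cinv c) w = lf l w"
          using eventually_chart[OF c, of "\<lambda>_. True"] by (auto elim!: eventually_mono simp: f_inv_into_f)
      qed
      also have "frechet_derivative (lf l) (at (snd c p)) = lf l"
      proof -
        have "bounded_linear (lf l)" unfolding lf_def
          by (intro bounded_linear_sum bounded_linear_const_mult bounded_linear_vec_nth)
        from frechet_derivative_at[OF bounded_linear_imp_has_derivative[OF this]] show ?thesis by metis
      qed
      finally show ?thesis by (simp add: lf_def)
    qed
    finally show ?thesis .
  qed
  have inj: "h = 0" if h: "frechet_derivative (\<psi> \<circ> cinv c) (at (snd c p)) h = 0" for h
  proof (rule independent_rows_kernel[of r'])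
    show "\<forall>i<CARD('n). a i = 0" if "(\<Sum>i<CARD('n). a i *s r' i) = 0" for a using r'(2) that by blast
    show "(\<Sum>l<CARD('n). r' i $ coord l * h $ coord l) = 0" if "i < CARD('n)" for i
      using D[OF that, of h] h by simp
  qed
  obtain V where V: "(V, \<psi>) \<in> A" "p \<in> V" "V \<subseteq> W" "V \<subseteq> fst c"
    by (rule chart_from_derivative[OF c W \<psi>_hol inj])
  have "special \<sigma> (V, \<psi>) f p"
    unfolding special_def fst_conv snd_conv
  proof (intro conjI allI impI ballI)
    fix i assume i: "i < s"
    have "V \<subseteq> U i" using V(3) i by (auto simp: W_def)
    then show "local_frame A (L i) V (f i)"
      using local_frame_subset[OF frames_local_frame[OF L_bundle[OF i]] _ _ L_bundle[OF i]] f[OF i] chart_open(1)[OF V(1)]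
      by auto
    fix q assume q: "q \<in> V"
    then have "frames_at f q" using V(3) fW by blast
    then show "\<sigma> i q = Smul (L i) (\<psi> q $ coord i) (f i q)"
      using sect_eq[OF \<sigma>V _ i] \<psi>[of i] i s_less by simp
  qed (use V in auto)
  then show ?thesis by blast
qed

text \<open>Converse of \<open>special_exists\<close>. It serves to show that B is stable under G,
  since special data can be moved by g. Evaluating a linear relation on the k-th coordinate vector
  isolates its k-th coefficient.\<close>

lemma special_smooth:
  assumes \<sigma>: "\<sigma> \<in> Vstar A L s" and sp: "\<And>p. p \<in> Yset L s \<sigma> \<Longrightarrow> \<exists>c e. special \<sigma> c e p"
  shows "\<sigma> \<in> Bset A L s"
  unfolding Bset_def smooth_codim_def
proof (intro CollectI conjI \<sigma> ballI allI impI)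
  fix p U f a k
  assume p: "p \<in> Yset L s \<sigma>" and f: "\<forall>i<s. (U i, f i) \<in> Frames (L i) \<and> p \<in> U i"
    and a: "\<forall>v\<in>tangent A p. (\<Sum>i<s. a i * differential A (\<lambda>q. ratio (L i) (\<sigma> i q) (f i q)) p v) = 0"
    and k: "k < s"
  obtain c e where sp: "special \<sigma> c e p" using sp[OF p] by blast
  note c = special_chart[OF sp]
  have e: "frames_at e p" by (rule special_frames[OF sp c(2)])
  have fp: "frames_at f p" by (rule frames_at_Frames) (use f in blast)
  define v where "v = coord_vec A c k p"
  have v: "v \<in> tangent A p" "v c = axis (coord k) 1" by (simp_all add: v_def coord_vec_tangent c coord_vec_self)
  have d: "dsect \<sigma> f i p v = ratio (L i) (e i p) (f i p) * (if i = k then 1 else 0)" if "i < s" for i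
    using dsect_change[OF \<sigma> p e fp that v(1)] special_dsect[OF sp that v(1)] v(2) that k s_less
    by (simp add: axis_def coord_eq_iff)
  have "0 = (\<Sum>i<s. a i * dsect \<sigma> f i p v)" using a v(1) by (simp add: sect_def[abs_def])
  also have "\<dots> = (\<Sum>i<s. if i = k then a k * ratio (L k) (e k p) (f k p) else 0)"
    by (rule sum.cong) (auto simp: d)
  also have "\<dots> = a k * ratio (L k) (e k p) (f k p)" using k by simp
  finally show "a k = 0"
    using ratio_frame_nonzero[OF frames_at_vec[OF fp k] frames_at_vec[OF e k]] by simp
qed

text \<open>Take for v the first s coordinate vectors of special data: the determinant on the left
  is then 1, and the formula gives the value on u.\<close>

lemma residue_formula_unique:
  assumes \<sigma>: "\<sigma> \<in> Vstar A L s" and p: "p \<in> Yset L s \<sigma>" and sp: "special \<sigma> c e p"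
    and \<alpha>: "residue_formula \<sigma> \<tau> p \<alpha>" and \<beta>: "residue_formula \<sigma> \<tau> p \<beta>"
    and u: "\<And>j. j < CARD('n) - s \<Longrightarrow> u j \<in> tangentY A L s \<sigma> p"
  shows "\<alpha> u = \<beta> u"
proof -
  note c = special_chart[OF sp]
  have e: "frames_at e p" by (rule special_frames[OF sp c(2)])
  define v where "v = (\<lambda>j. coord_vec A c j p)"
  have "leibniz_det s (\<lambda>i j. dsect \<sigma> e i p (v j)) = leibniz_det s (\<lambda>i j. if i = j then 1 else 0)"
    using s_less by (intro leibniz_det_cong)
      (auto simp: special_dsect[OF sp] v_def coord_vec_tangent c coord_vec_self axis_def coord_eq_iff)
  then have one: "leibniz_det s (\<lambda>i j. dsect \<sigma> e i p (v j)) = 1" by (simp add: leibniz_det_one)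
  have "\<forall>j<s. v j \<in> tangent A p" by (simp add: v_def coord_vec_tangent c)
  then have "\<gamma> u * leibniz_det s (\<lambda>i j. dsect \<sigma> e i p (v j)) = lkcoeff \<tau> e c p * top_form c p (join v u)"
    if "residue_formula \<sigma> \<tau> p \<gamma>" for \<gamma>
    using that e c u unfolding residue_formula_def by blast
  from this[OF \<alpha>] this[OF \<beta>] show ?thesis using one by simp
qed

lemma coord_form_outside: "\<not> (\<forall>j<k. u j \<in> T) \<Longrightarrow> coord_form c T m k u = 0"
  by (auto simp: coord_form_def)

lemma special_form_unique:
  assumes \<sigma>: "\<sigma> \<in> Vstar A L s" and p: "p \<in> Yset L s \<sigma>" and \<tau>: "\<tau> p \<in> fiber (LK A L s) p"
    and sp: "special \<sigma> c e p" and sp': "special \<sigma> c' e' p"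
  shows "special_form \<sigma> \<tau> c e p = special_form \<sigma> \<tau> c' e' p"
proof
  fix u
  show "special_form \<sigma> \<tau> c e p u = special_form \<sigma> \<tau> c' e' p u"
  proof (cases "\<forall>j<CARD('n) - s. u j \<in> tangentY A L s \<sigma> p")
    case True
    then show ?thesis
      using residue_formula_unique[OF \<sigma> p sp special_residue_formula[where \<tau>=\<tau>, OF \<sigma> p \<tau> sp]
          special_residue_formula[where \<tau>=\<tau>, OF \<sigma> p \<tau> sp']] by blast
  qed (simp add: coord_form_outside)
qed

text \<open>\<open>R_at\<close> asks for one form matching all special data at p. The data at hand
  fix it, and all others give the same form because the residue formula determines its values on
  tangent vectors of Y.\<close>

lemma R_at_special:
  assumes \<sigma>: "\<sigma> \<in> Vstar A L s" and p: "p \<in> Yset L s \<sigma>" and \<tau>: "\<tau> p \<in> fiber (LK A L s) p"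
    and sp: "special \<sigma> c e p"
  shows "R_at A L s \<sigma> \<tau> p = special_form \<sigma> \<tau> c e p"
proof -
  have "R_at A L s \<sigma> \<tau> p =
     (THE \<alpha>. \<forall>U z e g. (U, z) \<in> A \<and> p \<in> U \<and>
        (\<forall>i<s. local_frame A (L i) U (e i) \<and> (\<forall>q\<in>U. \<sigma> i q = Smul (L i) (z q $ coord i) (e i q))) \<and>
        \<tau> p = Smul (LK A L s) g (tens (tensor_list_bundle L s) (canonical_bundle A)
                 (tens_list L s p (\<lambda>i. e i p)) (p, coord_form (U, z) (tangent A p) 0 CARD('n))) \<longrightarrow>
        \<alpha> = (\<lambda>u. g * coord_form (U, z) (tangentY A L s \<sigma> p) s (CARD('n) - s) u))"
    unfolding R_at_def using p by simp
  also have "\<dots> = special_form \<sigma> \<tau> c e p"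
  proof (rule the_equality)
    show "\<forall>U z f g. (U, z) \<in> A \<and> p \<in> U \<and>
        (\<forall>i<s. local_frame A (L i) U (f i) \<and> (\<forall>q\<in>U. \<sigma> i q = Smul (L i) (z q $ coord i) (f i q))) \<and>
        \<tau> p = Smul (LK A L s) g (tens (tensor_list_bundle L s) (canonical_bundle A)
                 (tens_list L s p (\<lambda>i. f i p)) (p, coord_form (U, z) (tangent A p) 0 CARD('n))) \<longrightarrow>
        special_form \<sigma> \<tau> c e p = (\<lambda>u. g * coord_form (U, z) (tangentY A L s \<sigma> p) s (CARD('n) - s) u)"
    proof (intro allI impI)
      fix U z f g
      assume h: "(U, z) \<in> A \<and> p \<in> U \<and>
        (\<forall>i<s. local_frame A (L i) U (f i) \<and> (\<forall>q\<in>U. \<sigma> i q = Smul (L i) (z q $ coord i) (f i q))) \<and>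
        \<tau> p = Smul (LK A L s) g (tens (tensor_list_bundle L s) (canonical_bundle A)
                 (tens_list L s p (\<lambda>i. f i p)) (p, coord_form (U, z) (tangent A p) 0 CARD('n)))"
      have sp': "special \<sigma> (U, z) f p" using h unfolding special_def by simp
      have "frame_vec (LK A L s) p (lkframe f (U, z) p)"
        by (rule lkframe_frame) (use frames_at_vec[OF special_frames[OF sp' special_chart(2)[OF sp']]] h in auto)
      moreover have "\<tau> p = Smul (LK A L s) g (lkframe f (U, z) p)" using h unfolding lkframe_def by blast
      ultimately have "lkcoeff \<tau> f (U, z) p = g" unfolding lkcoeff_def by (simp only: ratio_Smul_frame)
      then show "special_form \<sigma> \<tau> c e p = (\<lambda>u. g * coord_form (U, z) (tangentY A L s \<sigma> p) s (CARD('n) - s) u)"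
        using special_form_unique[where \<tau>=\<tau>, OF \<sigma> p \<tau> sp sp'] by simp
    qed
  next
    fix \<alpha>
    assume h: "\<forall>U z f g. (U, z) \<in> A \<and> p \<in> U \<and>
        (\<forall>i<s. local_frame A (L i) U (f i) \<and> (\<forall>q\<in>U. \<sigma> i q = Smul (L i) (z q $ coord i) (f i q))) \<and>
        \<tau> p = Smul (LK A L s) g (tens (tensor_list_bundle L s) (canonical_bundle A)
                 (tens_list L s p (\<lambda>i. f i p)) (p, coord_form (U, z) (tangent A p) 0 CARD('n))) \<longrightarrow>
        \<alpha> = (\<lambda>u. g * coord_form (U, z) (tangentY A L s \<sigma> p) s (CARD('n) - s) u)"
    obtain U z where c: "c = (U, z)" by (cases c)
    have "\<tau> p = Smul (LK A L s) (lkcoeff \<tau> e c p) (lkframe e c p)"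
      by (rule lkcoeff_eq) (use frames_at_vec[OF special_frames[OF sp special_chart(2)[OF sp]]] special_chart[OF sp] \<tau> in auto)
    then show "\<alpha> = special_form \<sigma> \<tau> c e p"
      using h[rule_format, of U z e "lkcoeff \<tau> e c p"] sp unfolding special_def lkframe_def c by simp
  qed
  finally show ?thesis .
qed

lemma R_at_residue_formula:
  assumes \<sigma>: "\<sigma> \<in> Bset A L s" and p: "p \<in> Yset L s \<sigma>" and \<tau>: "\<tau> p \<in> fiber (LK A L s) p"
  shows "residue_formula \<sigma> \<tau> p (R_at A L s \<sigma> \<tau> p)"
  using special_exists[OF \<sigma> p] R_at_special[where \<tau>=\<tau>, OF Bset_Vstar[OF \<sigma>] p \<tau>]
    special_residue_formula[where \<tau>=\<tau>, OF Bset_Vstar[OF \<sigma>] p \<tau>] by metis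

lemma R_at_alt_forms:
  assumes \<sigma>: "\<sigma> \<in> Bset A L s" and p: "p \<in> Yset L s \<sigma>" and \<tau>: "\<tau> p \<in> fiber (LK A L s) p"
  shows "R_at A L s \<sigma> \<tau> p \<in> alt_forms (CARD('n) - s) (tangentY A L s \<sigma> p)"
proof -
  obtain c e where sp: "special \<sigma> c e p" using special_exists[OF \<sigma> p] by blast
  show ?thesis
    unfolding R_at_special[where \<tau>=\<tau>, OF Bset_Vstar[OF \<sigma>] p \<tau> sp]
    by (rule alt_forms_scale[OF alt_forms_coord_form[OF lin_closed_tangentY[OF Bset_Vstar[OF \<sigma>] p]]])
qed

end

text \<open>Applied to open pieces of linear subspaces, where \<open>holo\<close> asks for a
  derivative within the subspace: that of a local extension to a full neighbourhood serves.\<close>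

lemma holo_locally_extends:
  assumes "\<And>x. x \<in> S \<Longrightarrow> \<exists>h. holo_at h x \<and> (\<forall>\<^sub>F y in nhds x. y \<in> S \<longrightarrow> f y = h y)"
  shows "holo f S"
  unfolding holo_def
proof
  fix x assume x: "x \<in> S"
  obtain h where h: "holo_at h x" "\<forall>\<^sub>F y in nhds x. y \<in> S \<longrightarrow> f y = h y" using assms[OF x] by blast
  have "(h has_derivative frechet_derivative h (at x)) (at x within S)"
    by (rule has_derivative_at_withinI[OF holo_at_derivative(1)[OF h(1)]])
  then have "(f has_derivative frechet_derivative h (at x)) (at x within S)"
  proof (rule has_derivative_transform_eventually)
    show "\<forall>\<^sub>F y in at x within S. h y = f y"
      using h(2) unfolding eventually_at_filter by (auto elim!: eventually_mono)
    show "h x = f x" using eventually_nhds_x_imp_x[OF h(2)] x by simp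
  qed (rule x)
  then show "\<exists>f'. (f has_derivative f') (at x within S) \<and> (\<forall>c v. f' (c *c v) = c *c f' v)"
    using holo_at_derivative(2)[OF h(1)] by blast
qed

lemma frechet_derivative_zero_line:
  assumes F: "holo_at F w" and z: "\<forall>\<^sub>F t in nhds (0::complex). F (w + t *c h) = (0::complex)"
  shows "frechet_derivative F (at w) h = 0"
proof -
  have "holo_at F (w + 0 *c h)" using F by (simp add: cscale_zero_left)
  from line_derivative[OF this]
  have 1: "((\<lambda>z. F (w + z *c h)) has_field_derivative frechet_derivative F (at w) h) (at 0)"
    by (simp add: cscale_zero_left)
  have "((\<lambda>z. 0::complex) has_field_derivative frechet_derivative F (at w) h) (at 0)"
    by (rule DERIV_cong_ev[THEN iffD1, OF refl z refl 1])
  then show ?thesis using DERIV_unique DERIV_const by blast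
qed

lemma frechet_derivative_slice:
  assumes F: "holo_at F (v, w)"
  shows "frechet_derivative (\<lambda>w. F (v, w)) (at w) h = frechet_derivative F (at (v, w)) (0, h)"
proof -
  have 1: "((\<lambda>w. (v, w)) has_derivative (\<lambda>h. (0, h))) (at w)" by (auto intro!: derivative_eq_intros)
  from has_derivative_compose[OF 1 holo_at_derivative(1)[OF F]]
  have "((\<lambda>w. F (v, w)) has_derivative (\<lambda>h. frechet_derivative F (at (v, w)) (0, h))) (at w)" .
  from frechet_derivative_at[OF this] show ?thesis by metis
qed

section \<open>Holomorphy of the residue\<close>

context adjunction
begin

text \<open>In contrast to \<open>frames_at\<close>, the frames belong to \<open>Frames\<close>:
  smoothness is tested in these, and additivity of the fiber coordinate is available for
  them.\<close>

definition Frames_on :: "(nat \<Rightarrow> 'x set) \<Rightarrow> (nat \<Rightarrow> 'x \<Rightarrow> 'l) \<Rightarrow> bool" where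
  "Frames_on U e \<longleftrightarrow> (\<forall>i<s. (U i, e i) \<in> Frames (L i))"

lemma Frames_on_exist: "\<exists>U e. Frames_on U e \<and> p \<in> (\<Inter>i<s. U i)"
proof -
  have "\<forall>i. \<exists>U f. i < s \<longrightarrow> (U, f) \<in> Frames (L i) \<and> p \<in> U" using bundle_cover[OF L_bundle] by blast
  then obtain U f where "\<And>i. i < s \<Longrightarrow> (U i, f i) \<in> Frames (L i) \<and> p \<in> U i" by metis
  then have "Frames_on U f \<and> p \<in> (\<Inter>i<s. U i)" by (auto simp: Frames_on_def)
  then show ?thesis by blast
qed

lemma Frames_on_open: "Frames_on U e \<Longrightarrow> open (\<Inter>i<s. U i)"
  by (intro open_INT) (auto simp: Frames_on_def intro: bundle_frame(1)[OF L_bundle])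

lemma Frames_on_frames_at: "Frames_on U e \<Longrightarrow> p \<in> (\<Inter>i<s. U i) \<Longrightarrow> frames_at e p"
  by (rule frames_at_Frames[of U]) (auto simp: Frames_on_def)

lemma residue_formulaD:
  assumes "residue_formula \<sigma> \<tau> p \<alpha>" "frames_at e p" "c \<in> A" "p \<in> fst c"
    "\<And>j. j < CARD('n) - s \<Longrightarrow> u j \<in> tangentY A L s \<sigma> p" "\<And>j. j < s \<Longrightarrow> v j \<in> tangent A p"
  shows "\<alpha> u * leibniz_det s (\<lambda>i j. dsect \<sigma> e i p (v j)) = lkcoeff \<tau> e c p * top_form c p (join v u)"
  using assms unfolding residue_formula_def by blast

text \<open>In a chart that merely cuts out Y as a set, moving along a coordinate j \<ge> s stays in
  Y, so the differentials of the sections vanish there and these directions are tangent to Y.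
  Independence of the differentials then makes the block of the first s directions invertible, and
  the residue formula on coordinate vectors can be solved for the coefficient.\<close>

lemma slice_residue:
  assumes \<sigma>: "\<sigma> \<in> Bset A L s" and \<tau>: "\<tau> p \<in> fiber (LK A L s) p" and c: "c \<in> A" "p \<in> fst c"
    and e: "Frames_on U e" "p \<in> (\<Inter>i<s. U i)"
    and slice: "\<And>q. q \<in> fst c \<Longrightarrow> q \<in> Yset L s \<sigma> \<longleftrightarrow> (\<forall>i<s. snd c q $ coord i = 0)"
    and p: "p \<in> Yset L s \<sigma>"
  shows "leibniz_det s (\<lambda>i j. dsect \<sigma> e i p (coord_vec A c j p)) \<noteq> 0"
    and "R_at A L s \<sigma> \<tau> p (\<lambda>j. coord_vec A c (s + j) p) =
      lkcoeff \<tau> e c p / leibniz_det s (\<lambda>i j. dsect \<sigma> e i p (coord_vec A c j p))"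
proof -
  note \<sigma>V = Bset_Vstar[OF \<sigma>]
  have ep: "frames_at e p" by (rule Frames_on_frames_at[OF e])
  have zero: "dsect \<sigma> e i p (coord_vec A c j p) = 0" if i: "i < s" and j: "s \<le> j" "j < CARD('n)" for i j
  proof -
    let ?F = "sect \<sigma> e i \<circ> cinv c"
    have hol: "holo_at ?F (snd c p)" by (rule hol_at_chart[OF sect_hol[OF \<sigma>V ep i] c])
    have "\<forall>\<^sub>F q in nhds p. q \<in> (\<Inter>i<s. U i)" by (rule eventually_in[OF Frames_on_open[OF e(1)] e(2)])
    from eventually_chart[OF c this]
    obtain O' where O': "open O'" "snd c p \<in> O'"
      "\<And>w. w \<in> O' \<Longrightarrow> w \<in> snd c ` fst c \<and> cinv c w \<in> (\<Inter>i<s. U i)" by (auto simp: eventually_nhds)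
    have "frechet_derivative ?F (at (snd c p)) (axis (coord j) 1) = 0"
    proof (rule frechet_derivative_zero_line[OF hol])
      define g where "g = (\<lambda>t::complex. snd c p + t *c axis (coord j) 1)"
      have "isCont g 0" unfolding g_def
        by (intro continuous_intros linear_continuous_at bounded_linear_cscale_left)
      then have "(g \<longlongrightarrow> g 0) (nhds 0)"
        by (simp only: isCont_def tendsto_at_iff_tendsto_nhds)
      then have "\<forall>\<^sub>F t in nhds 0. g t \<in> O'"
        using O'(1,2) by (intro topological_tendstoD) (simp_all add: cscale_zero_left g_def)
      then have "\<forall>\<^sub>F t::complex in nhds 0. snd c p + t *c axis (coord j) 1 \<in> O'" by (simp only: g_def)
      then show "\<forall>\<^sub>F t in nhds (0::complex). ?F (snd c p + t *c axis (coord j) 1) = 0"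
      proof eventually_elim
        case (elim t)
        let ?w = "snd c p + t *c axis (coord j) 1"
        have w: "?w \<in> snd c ` fst c" "cinv c ?w \<in> (\<Inter>i<s. U i)" using O'(3)[OF elim] by auto
        note q = cinv_chart[OF w(1)]
        have "snd c (cinv c ?w) $ coord k = 0" if k: "k < s" for k
        proof -
          have "snd c p $ coord k = 0" using slice[OF c(2)] p k by blast
          moreover have "(axis (coord j) 1 :: 'n cvec) $ coord k = 0"
            using k j by (simp add: axis_def coord_eq_iff)
          ultimately show ?thesis using q by (simp add: cscale_complex)
        qed
        then have "cinv c ?w \<in> Yset L s \<sigma>" using slice q by blast
        then show ?case using Yset_iff[OF \<sigma>V Frames_on_frames_at[OF e(1) w(2)]] i by simp
      qed
    qed
    then show ?thesis
      using differential_chart[OF sect_hol[OF \<sigma>V ep i] coord_vec_tangent[OF c] c] by (simp add: coord_vec_self[OF c])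
  qed
  \<comment> \<open>A relation between the rows of the block extends to all coordinate directions,
    because the other entries are 0, and so to all tangent vectors; smoothness excludes it.\<close>
  show nz: "leibniz_det s (\<lambda>i j. dsect \<sigma> e i p (coord_vec A c j p)) \<noteq> 0"
    unfolding leibniz_det_nonzero_iff
  proof (intro allI impI)
    fix a k assume a: "\<forall>j<s. (\<Sum>i<s. a i * dsect \<sigma> e i p (coord_vec A c j p)) = 0" and k: "k < s"
    have a': "(\<Sum>i<s. a i * dsect \<sigma> e i p (coord_vec A c j p)) = 0" if "j < CARD('n)" for j
      using a zero[of _ j] that by (cases "j < s") auto
    have "(\<Sum>i<s. a i * dsect \<sigma> e i p v) = 0" if v: "v \<in> tangent A p" for v
    proof -
      have "(\<Sum>i<s. a i * dsect \<sigma> e i p v) =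
          (\<Sum>i<s. \<Sum>l<CARD('n). v c $ coord l * (a i * dsect \<sigma> e i p (coord_vec A c l p)))"
        by (rule sum.cong[OF refl], subst differential_coord_vec_expand[OF sect_hol[OF \<sigma>V ep] v c])
           (auto simp: sum_distrib_left mult_ac)
      also have "\<dots> = (\<Sum>l<CARD('n). v c $ coord l * (\<Sum>i<s. a i * dsect \<sigma> e i p (coord_vec A c l p)))"
        by (subst sum.swap) (simp add: sum_distrib_left)
      also have "\<dots> = 0" by (simp add: a')
      finally show ?thesis .
    qed
    moreover have "smooth_codim A L s \<sigma>" using \<sigma> by (simp add: Bset_def)
    moreover have "\<forall>i<s. (U i, e i) \<in> Frames (L i) \<and> p \<in> U i" using e by (auto simp: Frames_on_def)
    ultimately show "a k = 0"
      using p k unfolding smooth_codim_def sect_def[abs_def] by blast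
  qed
  have uT: "\<forall>j<CARD('n) - s. coord_vec A c (s + j) p \<in> tangentY A L s \<sigma> p"
    using zero by (auto simp: tangentY_iff[OF \<sigma>V p ep] coord_vec_tangent[OF c])
  have vT: "\<forall>j<s. coord_vec A c j p \<in> tangent A p" by (simp add: coord_vec_tangent[OF c])
  have join: "join (\<lambda>j. coord_vec A c j p) (\<lambda>j. coord_vec A c (s + j) p) = (\<lambda>j. coord_vec A c j p)"
    by (auto simp: join_def fun_eq_iff)
  have "R_at A L s \<sigma> \<tau> p (\<lambda>j. coord_vec A c (s + j) p) * leibniz_det s (\<lambda>i j. dsect \<sigma> e i p (coord_vec A c j p)) =
      lkcoeff \<tau> e c p * top_form c p (join (\<lambda>j. coord_vec A c j p) (\<lambda>j. coord_vec A c (s + j) p))"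
    by (rule residue_formulaD[OF R_at_residue_formula[where \<tau>=\<tau>, OF \<sigma> p \<tau>] ep c]) (use uT vT in blast)+
  then show "R_at A L s \<sigma> \<tau> p (\<lambda>j. coord_vec A c (s + j) p) =
      lkcoeff \<tau> e c p / leibniz_det s (\<lambda>i j. dsect \<sigma> e i p (coord_vec A c j p))"
    using nz by (simp add: join top_form_basis[OF c] eq_divide_eq)
qed

lemma H0_fiber: "\<tau> \<in> H0 A E \<Longrightarrow> \<tau> p \<in> fiber E p"
  by (simp add: H0_def holo_section_def)

lemma R_at_H0KY:
  assumes \<sigma>: "\<sigma> \<in> Bset A L s" and \<tau>: "\<tau> \<in> H0 A (LK A L s)"
  shows "R_at A L s \<sigma> \<tau> \<in> H0KY A L s \<sigma>"
  unfolding H0KY_def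
proof (intro CollectI conjI allI impI ballI)
  show "R_at A L s \<sigma> \<tau> p = (\<lambda>_. 0)" if "p \<notin> Yset L s \<sigma>" for p using that by (simp add: R_at_def)
  show "R_at A L s \<sigma> \<tau> p \<in> alt_forms (CARD('n) - s) (tangentY A L s \<sigma> p)" if "p \<in> Yset L s \<sigma>" for p
    by (rule R_at_alt_forms[where \<tau>=\<tau>, OF \<sigma> that H0_fiber[OF \<tau>]])
  fix c assume cA: "c \<in> A"
  show "case c of (U, z) \<Rightarrow> Yset L s \<sigma> \<inter> U = {p \<in> U. \<forall>i<s. z p $ coord i = 0} \<longrightarrow>
    holo (\<lambda>w. let p = inv_into U z w in R_at A L s \<sigma> \<tau> p (\<lambda>j. coord_vec A (U, z) (s + j) p)) (z ` (Yset L s \<sigma> \<inter> U))"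
  proof (simp only: split_beta, intro impI, rule holo_locally_extends)
    fix w0
    assume sl: "Yset L s \<sigma> \<inter> fst c = {p \<in> fst c. \<forall>i<s. snd c p $ coord i = 0}"
      and w0: "w0 \<in> snd c ` (Yset L s \<sigma> \<inter> fst c)"
    obtain p0 where p0: "p0 \<in> Yset L s \<sigma>" "p0 \<in> fst c" "w0 = snd c p0" using w0 by blast
    obtain U e where e: "Frames_on U e" "p0 \<in> (\<Inter>i<s. U i)" using Frames_on_exist by blast
    note \<sigma>V = Bset_Vstar[OF \<sigma>]
    have slice: "q \<in> Yset L s \<sigma> \<longleftrightarrow> (\<forall>i<s. snd c q $ coord i = 0)" if "q \<in> fst c" for q
      using sl that by blast
    \<comment> \<open>The quotient of \<open>slice_residue\<close> in coordinates. It makes sense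
      off Y as well and so extends the coefficient to a neighbourhood.\<close>
    define h where "h = (\<lambda>w. (lkcoeff \<tau> e c \<circ> cinv c) w /
      leibniz_det s (\<lambda>i j. frechet_derivative (sect \<sigma> e i \<circ> cinv c) (at w) (axis (coord j) 1)))"
    have det: "leibniz_det s (\<lambda>i j. frechet_derivative (sect \<sigma> e i \<circ> cinv c) (at (snd c q)) (axis (coord j) 1)) =
        leibniz_det s (\<lambda>i j. dsect \<sigma> e i q (coord_vec A c j q))" if q: "q \<in> fst c" "q \<in> (\<Inter>i<s. U i)" for q
    proof (rule leibniz_det_cong)
      fix i j assume "i < s" "j < s"
      then show "frechet_derivative (sect \<sigma> e i \<circ> cinv c) (at (snd c q)) (axis (coord j) 1) = dsect \<sigma> e i q (coord_vec A c j q)"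
        using differential_chart[OF sect_hol[OF \<sigma>V Frames_on_frames_at[OF e(1) q(2)]] coord_vec_tangent[OF cA q(1)] cA q(1)]
        by (simp add: coord_vec_self[OF cA q(1)])
    qed
    show "\<exists>h. holo_at h w0 \<and> (\<forall>\<^sub>F w in nhds w0. w \<in> snd c ` (Yset L s \<sigma> \<inter> fst c) \<longrightarrow>
      (let p = cinv c w in R_at A L s \<sigma> \<tau> p (\<lambda>j. coord_vec A (fst c, snd c) (s + j) p)) = h w)"
    proof (intro exI[of _ h] conjI)
      show "holo_at h w0"
        unfolding h_def p0(3)
      proof (intro holo_at_divide holo_at_leibniz_det)
        show "holo_at (lkcoeff \<tau> e c \<circ> cinv c) (snd c p0)"
          by (rule hol_at_chart[OF lkcoeff_hol[OF \<tau> Frames_on_frames_at[OF e] cA p0(2)] cA p0(2)])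
        show "holo_at (\<lambda>w. frechet_derivative (sect \<sigma> e i \<circ> cinv c) (at w) (axis (coord j) 1)) (snd c p0)" if "i < s" "j < s" for i j
          by (rule holo_at_chart_derivative[OF cA p0(2) Frames_on_open[OF e(1)] e(2)])
             (rule sect_hol[OF \<sigma>V Frames_on_frames_at[OF e(1)] that(1)])
        show "leibniz_det s (\<lambda>i j. frechet_derivative (sect \<sigma> e i \<circ> cinv c) (at (snd c p0)) (axis (coord j) 1)) \<noteq> 0"
          unfolding det[OF p0(2) e(2)] by (rule slice_residue(1)[where \<tau>=\<tau>, OF \<sigma> H0_fiber[OF \<tau>] cA p0(2) e slice p0(1)])
      qed
      show "\<forall>\<^sub>F w in nhds w0. w \<in> snd c ` (Yset L s \<sigma> \<inter> fst c) \<longrightarrow>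
        (let p = cinv c w in R_at A L s \<sigma> \<tau> p (\<lambda>j. coord_vec A (fst c, snd c) (s + j) p)) = h w"
        using eventually_chart[OF cA p0(2) eventually_in[OF Frames_on_open[OF e(1)] e(2)]]
        unfolding p0(3)
      proof eventually_elim
        case (elim w)
        show ?case
        proof
          assume "w \<in> snd c ` (Yset L s \<sigma> \<inter> fst c)"
          then obtain q where q: "q \<in> Yset L s \<sigma>" "q \<in> fst c" "w = snd c q" by blast
          have wq: "cinv c w = q" unfolding q(3) by (rule chart_cinv[OF cA q(2)])
          have qU: "q \<in> (\<Inter>i<s. U i)" using elim wq by blast
          show "(let p = cinv c w in R_at A L s \<sigma> \<tau> p (\<lambda>j. coord_vec A (fst c, snd c) (s + j) p)) = h w"
            using slice_residue(2)[where \<tau>=\<tau>, OF \<sigma> H0_fiber[OF \<tau>] cA q(2) e(1) qU slice q(1)] det[OF q(2) qU]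
            by (simp add: h_def Let_def wq q(3)[symmetric])
        qed
      qed
    qed
  qed
qed

subsection \<open>Holomorphy along the family\<close>

lemma sect_linear_coords:
  fixes \<Psi> :: "'v::complex_model \<Rightarrow> nat \<Rightarrow> 'x \<Rightarrow> 'l"
  assumes \<Psi>: "linear_coords A L s \<Psi>" and e: "Frames_on U e" "p \<in> (\<Inter>i<s. U i)" and i: "i < s"
  shows "sect (\<Psi> (v + w)) e i p = sect (\<Psi> v) e i p + sect (\<Psi> w) e i p"
    and "sect (\<Psi> (c *c v)) e i p = c * sect (\<Psi> v) e i p"
proof -
  have V: "\<Psi> v \<in> Vstar A L s" for v using \<Psi> by (auto simp: linear_coords_def bij_betw_def)
  have f: "(U i, e i) \<in> Frames (L i)" "p \<in> U i" using e i by (auto simp: Frames_on_def)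
  have add: "\<Psi> (v + w) i p = Add (L i) (\<Psi> v i p) (\<Psi> w i p)" for v w
    using \<Psi> i unfolding linear_coords_def by blast
  have sc: "\<Psi> (c *c v) i p = Smul (L i) c (\<Psi> v i p)" for c v
    using \<Psi> i unfolding linear_coords_def by blast
  show "sect (\<Psi> (v + w)) e i p = sect (\<Psi> v) e i p + sect (\<Psi> w) e i p"
    unfolding sect_def add by (rule bundle_ratio_add[OF L_bundle[OF i] f Vstar_fiber[OF V i] Vstar_fiber[OF V i]])
  show "sect (\<Psi> (c *c v)) e i p = c * sect (\<Psi> v) e i p"
    unfolding sect_def sc by (rule ratio_Smul[OF frames_at_vec[OF Frames_on_frames_at[OF e] i] Vstar_fiber[OF V i]])
qed

text \<open>By linearity \<Psi> v is a combination of finitely many fixed sections: holomorphic in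
  the parameter through the coordinate functionals, and in the point through the fixed
  sections.\<close>

lemma sect_joint_holo:
  fixes \<Psi> :: "'v::complex_model \<Rightarrow> nat \<Rightarrow> 'x \<Rightarrow> 'l"
  assumes \<Psi>: "linear_coords A L s \<Psi>" and e: "Frames_on U e" "p \<in> (\<Inter>i<s. U i)" and i: "i < s"
    and c: "c \<in> A" "p \<in> fst c"
  shows "holo_at (\<lambda>q. sect (\<Psi> (fst q)) e i (cinv c (snd q))) (v, snd c p)"
proof -
  have V: "\<Psi> v \<in> Vstar A L s" for v using \<Psi> by (auto simp: linear_coords_def bij_betw_def)
  obtain S :: "'v set" and a where S: "finite S" "\<And>v. v = (\<Sum>b\<in>S. a b v *c b)" "\<And>b x. b \<in> S \<Longrightarrow> holo_at (a b) x"
    using complex_coordinates[where 'v='v] by metis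
  have lin: "sect (\<Psi> v) e i q = (\<Sum>b\<in>S. a b v * sect (\<Psi> b) e i q)" if q: "q \<in> (\<Inter>i<s. U i)" for v q
  proof -
    have "sect (\<Psi> (\<Sum>b\<in>T. a b v *c b)) e i q = (\<Sum>b\<in>T. a b v * sect (\<Psi> b) e i q)" if "finite T" for T
      using that
    proof (induction T rule: finite_induct)
      case empty
      show ?case using sect_linear_coords(2)[OF \<Psi> e(1) q i, of 0 0] by (simp add: cscale_zero_left)
    next
      case (insert b T)
      then show ?case by (simp add: sect_linear_coords[OF \<Psi> e(1) q i])
    qed
    from this[OF S(1)] show ?thesis by (simp only: S(2)[symmetric])
  qed
  have "holo_at (\<lambda>q. \<Sum>b\<in>S. a b (fst q) * (sect (\<Psi> b) e i \<circ> cinv c) (snd q)) (v, snd c p)"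
  proof (intro holo_at_sum holo_at_mult)
    fix b assume b: "b \<in> S"
    show "holo_at (\<lambda>q. a b (fst q)) (v, snd c p)"
      by (rule holo_at_compose[OF holo_at_fst[OF holo_at_ident]]) (rule S(3)[OF b])
    show "holo_at (\<lambda>q. (sect (\<Psi> b) e i \<circ> cinv c) (snd q)) (v, snd c p)"
      by (rule holo_at_compose[OF holo_at_snd[OF holo_at_ident]], unfold snd_conv)
         (rule hol_at_chart[OF sect_hol[OF V Frames_on_frames_at[OF e] i] c])
  qed
  then show ?thesis
  proof (rule holo_at_cong[rotated])
    have "\<forall>\<^sub>F w in nhds (snd c p). cinv c w \<in> (\<Inter>i<s. U i)"
      using eventually_chart[OF c eventually_in[OF Frames_on_open[OF e(1)] e(2)]] by (auto elim: eventually_mono)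
    then obtain O' where O': "open O'" "snd c p \<in> O'" "\<And>w. w \<in> O' \<Longrightarrow> cinv c w \<in> (\<Inter>i<s. U i)"
      unfolding eventually_nhds by blast
    show "\<forall>\<^sub>F q in nhds (v, snd c p). (\<Sum>b\<in>S. a b (fst q) * (sect (\<Psi> b) e i \<circ> cinv c) (snd q)) = sect (\<Psi> (fst q)) e i (cinv c (snd q))"
      unfolding eventually_nhds
    proof (intro exI[of _ "UNIV \<times> O'"] conjI ballI)
      show "open (UNIV \<times> O' :: ('v \<times> 'n cvec) set)" using O'(1) by (intro open_Times open_UNIV)
      fix q assume "q \<in> (UNIV :: 'v set) \<times> O'"
      then show "(\<Sum>b\<in>S. a b (fst q) * (sect (\<Psi> b) e i \<circ> cinv c) (snd q)) = sect (\<Psi> (fst q)) e i (cinv c (snd q))"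
        using lin[OF O'(3)] by auto
    qed (use O' in simp)
  qed
qed

text \<open>The quotient of \<open>slice_residue\<close> with varying parameter. The slice chart now
  depends on v, so everything is rewritten through Y(v, w), the coordinate in one fixed chart c of
  the point with family coordinate w: the Jacobian determinant of Y converts the coefficient of
  \<tau> from c to the slice chart, and the derivatives in w of the sections composed with Y give
  the denominator.\<close>

lemma R_map_family_holo:
  fixes \<Psi> :: "'v::complex_model \<Rightarrow> nat \<Rightarrow> 'x \<Rightarrow> 'l"
  assumes \<Psi>: "linear_coords A L s \<Psi>" and \<tau>: "\<tau> \<in> H0 A (LK A L s)" and fc: "family_chart A L s \<Psi> N \<zeta>"
  shows "holo (\<lambda>(v, w). let c = ({x. (v, x) \<in> N}, \<lambda>x. \<zeta> (v, x)); p = inv_into (fst c) (snd c) w in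
             R_map A L s \<tau> (\<Psi> v) p (\<lambda>j. coord_vec A c (s + j) p))
       {(v, \<zeta> (v, x)) | v x. (v, x) \<in> N \<and> x \<in> Yset L s (\<Psi> v)}"
proof (rule holo_locally_extends)
  let ?S = "{(v, \<zeta> (v, x)) | v x. (v, x) \<in> N \<and> x \<in> Yset L s (\<Psi> v)}"
  fix q0 assume "q0 \<in> ?S"
  then obtain v0 x0 where q0: "q0 = (v0, \<zeta> (v0, x0))" "(v0, x0) \<in> N" "x0 \<in> Yset L s (\<Psi> v0)" by blast
  have V: "\<Psi> v \<in> Vstar A L s" for v using \<Psi> by (auto simp: linear_coords_def bij_betw_def)
  \<comment> \<open>The chart of X that the family chart induces at the parameter v.\<close>
  define cv where "cv = (\<lambda>v. ({x. (v, x) \<in> N}, \<lambda>x. \<zeta> (v, x)))"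
  have cvA: "cv v \<in> A" if "(v, x) \<in> N" for v x
    using fc that unfolding family_chart_def cv_def by force
  have cvB: "\<Psi> v \<in> Bset A L s" if "(v, x) \<in> N" for v x
    using fc that unfolding family_chart_def by force
  have cv_slice: "x \<in> Yset L s (\<Psi> v) \<longleftrightarrow> (\<forall>i<s. snd (cv v) x $ coord i = 0)" if "x \<in> fst (cv v)" for v x
    using fc that unfolding family_chart_def cv_def by auto
  have cv_fst: "x \<in> fst (cv v) \<longleftrightarrow> (v, x) \<in> N" for v x by (simp add: cv_def)
  have cv_snd: "snd (cv v) x = \<zeta> (v, x)" for v x by (simp add: cv_def)
  obtain c where c: "c \<in> A" "x0 \<in> fst c" using chart_cover by blast
  obtain U e where e: "Frames_on U e" "x0 \<in> (\<Inter>i<s. U i)" using Frames_on_exist by blast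
  \<comment> \<open>Product chart of the parameter space and c; holomorphy of \<zeta> is given in
    such charts through \<open>inv_into\<close>.\<close>
  let ?pc = "\<lambda>(y::'v, z). (id y, snd c z)"
  have inv_pc: "inv_into (UNIV \<times> fst c) ?pc (v, snd c x) = (v, x)" if "x \<in> fst c" for v x
  proof -
    have "inj_on ?pc (UNIV \<times> fst c)" using chart_inj[OF c(1)] by (auto simp: inj_on_def)
    from inv_into_f_f[OF this, of "(v, x)"] that show ?thesis by simp
  qed
  have pc: "(UNIV \<times> fst c, ?pc) \<in> prod_atlas {(UNIV, id)} A"
    unfolding prod_atlas_def using c(1) by (intro CollectI exI[of _ UNIV] exI[of _ id] exI[of _ "fst c"] exI[of _ "snd c"]) simp
  have "mholo (prod_atlas {(UNIV, id)} A) {(UNIV, id)} N \<zeta>" using fc by (simp add: family_chart_def)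
  then have "open (?pc ` ((UNIV \<times> fst c) \<inter> N \<inter> \<zeta> -` UNIV)) \<and>
      holo (id \<circ> \<zeta> \<circ> inv_into (UNIV \<times> fst c) ?pc) (?pc ` ((UNIV \<times> fst c) \<inter> N \<inter> \<zeta> -` UNIV))"
    using pc unfolding mholo_def by fast
  then have opI: "open (?pc ` ((UNIV \<times> fst c) \<inter> N))"
    and hoI: "holo (\<zeta> \<circ> inv_into (UNIV \<times> fst c) ?pc) (?pc ` ((UNIV \<times> fst c) \<inter> N))" by simp_all
  \<comment> \<open>The pairs of a parameter and a c-coordinate whose point lies in the family chart
    and in the domains of all frames.\<close>
  define W where "W = ?pc ` ((UNIV \<times> fst c) \<inter> N) \<inter> (UNIV \<times> snd c ` (fst c \<inter> (\<Inter>i<s. U i)))"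
  have opW: "open W" unfolding W_def
    by (intro open_Int opI open_Times open_UNIV chart_open_image[OF c(1) Frames_on_open[OF e(1)]])
  have W_iff: "(v, y) \<in> W \<longleftrightarrow> (\<exists>x. (v, x) \<in> N \<and> x \<in> fst c \<and> x \<in> (\<Inter>i<s. U i) \<and> y = snd c x)" for v y
  proof
    assume "(v, y) \<in> W"
    then obtain x x' where x: "(v, x) \<in> N" "x \<in> fst c" "y = snd c x" "x' \<in> fst c" "x' \<in> (\<Inter>i<s. U i)" "y = snd c x'"
      unfolding W_def by auto
    then have "x = x'" using chart_inj[OF c(1)] by (auto simp: inj_on_def)
    then show "\<exists>x. (v, x) \<in> N \<and> x \<in> fst c \<and> x \<in> (\<Inter>i<s. U i) \<and> y = snd c x" using x by blast
  next
    assume "\<exists>x. (v, x) \<in> N \<and> x \<in> fst c \<and> x \<in> (\<Inter>i<s. U i) \<and> y = snd c x"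
    then obtain x where "(v, x) \<in> N" "x \<in> fst c" "x \<in> (\<Inter>i<s. U i)" "y = snd c x" by blast
    then show "(v, y) \<in> W" unfolding W_def by (auto intro!: image_eqI[of _ _ "(v, x)"])
  qed
  define T where "T = (\<lambda>q::'v \<times> 'n cvec. \<zeta> (fst q, cinv c (snd q)))"
  have T: "T (v, snd c x) = \<zeta> (v, x)" if "x \<in> fst c" for v x
    by (simp add: T_def chart_cinv[OF c(1) that])
  have holT: "holo_at T q" if q: "q \<in> W" for q
  proof (rule holo_at_cong)
    show "holo_at (\<zeta> \<circ> inv_into (UNIV \<times> fst c) ?pc) q"
      using hoI holo_on_open[OF opI] q unfolding W_def by blast
    show "\<forall>\<^sub>F q in nhds q. (\<zeta> \<circ> inv_into (UNIV \<times> fst c) ?pc) q = T q"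
      unfolding eventually_nhds
    proof (intro exI[of _ W] conjI ballI opW q)
      fix q' assume q': "q' \<in> W"
      obtain v y where vy: "q' = (v, y)" by (cases q')
      obtain x where x: "x \<in> fst c" "y = snd c x" using q' unfolding vy W_iff by blast
      show "(\<zeta> \<circ> inv_into (UNIV \<times> fst c) ?pc) q' = T q'"
        by (simp only: vy x(2) comp_apply inv_pc[OF x(1)] T[OF x(1)])
    qed
  qed
  \<comment> \<open>For fixed v the map T is the transition from c to the slice chart
    \<open>cv v\<close>, and the derivative of the reverse transition inverts its
    derivative.\<close>
  have injT: "h = 0" if vy: "(v, y) \<in> W" and h: "frechet_derivative T (at (v, y)) (0, h) = 0" for v y h
  proof -
    obtain x where x: "(v, x) \<in> N" "x \<in> fst c" "y = snd c x" using vy W_iff by blast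
    have xv: "x \<in> fst (cv v)" using x(1) cv_fst by blast
    have "frechet_derivative (\<lambda>y. T (v, y)) (at y) h = 0"
      using frechet_derivative_slice[OF holT[OF vy]] h by simp
    moreover have "(\<lambda>y. T (v, y)) = transition c (cv v)" by (simp add: T_def transition_def cv_def fun_eq_iff)
    ultimately have 0: "frechet_derivative (transition c (cv v)) (at (snd c x)) h = 0" by (simp add: x(3))
    have "h = frechet_derivative (transition (cv v) c) (at (snd (cv v) x)) (frechet_derivative (transition c (cv v)) (at (snd c x)) h)"
      using transition_chain[OF c(1) cvA[OF x(1)] c(1) x(2) xv x(2)] transition_self[OF c(1) x(2)] by simp
    also have "\<dots> = 0" unfolding 0
      by (rule linear_0[OF bounded_linear.linear[OF holo_at_linear[OF transition_holo[OF cvA[OF x(1)] c(1) xv x(2)]]]])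
    finally show ?thesis .
  qed
  define Y where "Y = (\<lambda>q::'v \<times> 'n cvec. snd c (cinv (cv (fst q)) (snd q)))"
  have YT: "Y (v, T (v, y)) = y" if vy: "(v, y) \<in> W" for v y
  proof -
    obtain x where x: "(v, x) \<in> N" "x \<in> fst c" "y = snd c x" using vy W_iff by blast
    have xv: "x \<in> fst (cv v)" using x(1) cv_fst by blast
    have "cinv (cv v) (snd (cv v) x) = x" by (rule chart_cinv[OF cvA[OF x(1)] xv])
    then show ?thesis by (simp add: Y_def x(3) T[OF x(2)] cv_snd)
  qed
  \<comment> \<open>The same region in family coordinates; it is open because, by
    \<open>evY\<close>, near each of its points Y maps back into W.\<close>
  define O' where "O' = (\<lambda>q. (fst q, T q)) ` W"
  have holY: "holo_at Y q" and evY: "\<forall>\<^sub>F q in nhds q. (fst q, Y q) \<in> W \<and> T (fst q, Y q) = snd q" if q: "q \<in> O'" for q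
  proof -
    obtain v y where vy: "(v, y) \<in> W" "q = (v, T (v, y))" using q unfolding O'_def by force
    show "holo_at Y q" "\<forall>\<^sub>F q in nhds q. (fst q, Y q) \<in> W \<and> T (fst q, Y q) = snd q"
      unfolding vy(2) using holo_at_param_inverse[OF opW vy(1) holT injT[OF vy(1)] YT] by blast+
  qed
  have opO: "open O'"
  proof (subst open_subopen, rule ballI)
    fix q assume "q \<in> O'"
    from evY[OF this] obtain B where B: "open B" "q \<in> B" "\<And>q. q \<in> B \<Longrightarrow> (fst q, Y q) \<in> W \<and> T (fst q, Y q) = snd q"
      unfolding eventually_nhds by blast
    have "B \<subseteq> O'"
    proof
      fix q assume "q \<in> B"
      from B(3)[OF this] show "q \<in> O'" unfolding O'_def by (intro image_eqI[of _ _ "(fst q, Y q)"]) auto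
    qed
    then show "\<exists>T. open T \<and> q \<in> T \<and> T \<subseteq> O'" using B by blast
  qed
  \<comment> \<open>P q is the point of X with family coordinates q, and Y q is its coordinate in
    c.\<close>
  define P where "P = (\<lambda>q::'v \<times> 'n cvec. cinv (cv (fst q)) (snd q))"
  have Pq: "(fst q, P q) \<in> N" "P q \<in> fst c" "P q \<in> (\<Inter>i<s. U i)" "snd (cv (fst q)) (P q) = snd q" "Y q = snd c (P q)"
    "snd q \<in> snd (cv (fst q)) ` fst (cv (fst q))" if q: "q \<in> O'" for q
  proof -
    obtain v y where vy: "(v, y) \<in> W" "q = (v, T (v, y))" using q unfolding O'_def by force
    obtain x where x: "(v, x) \<in> N" "x \<in> fst c" "x \<in> (\<Inter>i<s. U i)" "y = snd c x" using vy(1) W_iff by blast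
    have xv: "x \<in> fst (cv v)" using x(1) cv_fst by blast
    have qe: "q = (v, snd (cv v) x)" using vy(2) x(4) T[OF x(2)] by (simp add: cv_snd)
    have "P q = x" unfolding P_def qe fst_conv snd_conv by (rule chart_cinv[OF cvA[OF x(1)] xv])
    then show "(fst q, P q) \<in> N" "P q \<in> fst c" "P q \<in> (\<Inter>i<s. U i)" "snd (cv (fst q)) (P q) = snd q" "Y q = snd c (P q)"
      "snd q \<in> snd (cv (fst q)) ` fst (cv (fst q))"
      using x xv qe by (simp_all add: Y_def P_def)
  qed
  have q0O: "q0 \<in> O'" unfolding O'_def q0(1)
  proof (rule image_eqI[of _ _ "(v0, snd c x0)"])
    show "(v0, snd c x0) \<in> W" unfolding W_iff using q0 c e by blast
  qed (simp add: T[OF c(2)])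
  define G where "G = (\<lambda>i (q::'v \<times> 'n cvec). sect (\<Psi> (fst q)) e i (cinv c (Y q)))"
  have holG: "holo_at (G i) q" if q: "q \<in> O'" and i: "i < s" for q i
  proof -
    have "holo_at (\<lambda>q. (fst q, Y q)) q" by (rule holo_at_Pair[OF holo_at_fst[OF holo_at_ident] holY[OF q]])
    moreover have "holo_at (\<lambda>q. sect (\<Psi> (fst q)) e i (cinv c (snd q))) (fst q, Y q)"
      unfolding Pq(5)[OF q] by (rule sect_joint_holo[OF \<Psi> e(1) Pq(3)[OF q] i c(1) Pq(2)[OF q]])
    ultimately show ?thesis unfolding G_def using holo_at_compose by fastforce
  qed
  have dG: "dsect (\<Psi> (fst q)) e i (P q) (coord_vec A (cv (fst q)) j (P q)) =
      frechet_derivative (G i) (at q) (0, axis (coord j) 1)" if q: "q \<in> O'" and i: "i < s" for q i j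
  proof -
    define v w where "v = fst q" and "w = snd q"
    have qvw: "q = (v, w)" by (simp add: v_def w_def)
    have PN: "(v, P q) \<in> N" using Pq(1)[OF q] by (simp add: v_def)
    note cvv = cvA[OF PN]
    have Pv: "P q \<in> fst (cv v)" using PN cv_fst by blast
    have sP: "snd (cv v) (P q) = w" using Pq(4)[OF q] by (simp add: v_def w_def)
    have "dsect (\<Psi> v) e i (P q) (coord_vec A (cv v) j (P q)) =
        frechet_derivative (sect (\<Psi> v) e i \<circ> cinv (cv v)) (at w) (axis (coord j) 1)"
      using differential_chart[OF sect_hol[OF V Frames_on_frames_at[OF e(1) Pq(3)[OF q]] i] coord_vec_tangent[OF cvv Pv] cvv Pv]
      by (simp add: sP coord_vec_self[OF cvv Pv])
    also have "frechet_derivative (sect (\<Psi> v) e i \<circ> cinv (cv v)) (at w) = frechet_derivative (\<lambda>w. G i (v, w)) (at w)"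
    proof (rule frechet_derivative_cong)
      have "\<forall>\<^sub>F q' in nhds (v, w). q' \<in> O'" using opO q qvw by (auto simp: eventually_nhds)
      moreover have "filterlim (\<lambda>w. (v, w)) (nhds (v, w)) (nhds w)"
        by (intro tendsto_Pair tendsto_const filterlim_ident)
      ultimately have "\<forall>\<^sub>F w' in nhds w. (v, w') \<in> O'" unfolding filterlim_iff by blast
      then show "\<forall>\<^sub>F w' in nhds w. (sect (\<Psi> v) e i \<circ> cinv (cv v)) w' = G i (v, w')"
      proof eventually_elim
        case (elim w')
        have "cinv c (Y (v, w')) = P (v, w')" unfolding Pq(5)[OF elim] by (rule chart_cinv[OF c(1) Pq(2)[OF elim]])
        then show ?case by (simp add: G_def P_def)
      qed
    qed
    also have "\<dots> (axis (coord j) 1) = frechet_derivative (G i) (at (v, w)) (0, axis (coord j) 1)"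
      by (rule frechet_derivative_slice) (use holG[OF q i] qvw in simp)
    finally show ?thesis by (simp add: qvw)
  qed
  have dY: "coord_vec A (cv (fst q)) j (P q) c = frechet_derivative Y (at q) (0, axis (coord j) 1)" if q: "q \<in> O'" for q j
  proof -
    define v w where "v = fst q" and "w = snd q"
    have qvw: "q = (v, w)" by (simp add: v_def w_def)
    have sP: "snd (cv v) (P q) = w" using Pq(4)[OF q] by (simp add: v_def w_def)
    have "coord_vec A (cv v) j (P q) c = frechet_derivative (transition (cv v) c) (at w) (axis (coord j) 1)"
      using c(1) Pq(2)[OF q] sP by (simp add: coord_vec_def)
    also have "transition (cv v) c = (\<lambda>w. Y (v, w))" by (simp add: transition_def Y_def fun_eq_iff)
    also have "frechet_derivative (\<lambda>w. Y (v, w)) (at w) (axis (coord j) 1) = frechet_derivative Y (at (v, w)) (0, axis (coord j) 1)"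
      by (rule frechet_derivative_slice) (use holY[OF q] qvw in simp)
    finally show ?thesis by (simp add: qvw)
  qed
  \<comment> \<open>The numerator is the coefficient of \<tau> in the slice chart, written as its
    c-coefficient times the Jacobian determinant. In contrast to the residue, h makes sense on O'
    also off the family Y.\<close>
  define h where "h = (\<lambda>q. (lkcoeff \<tau> e c \<circ> cinv c) (Y q) *
      leibniz_det CARD('n) (\<lambda>i j. frechet_derivative Y (at q) (0, axis (coord j) 1) $ coord i) /
      leibniz_det s (\<lambda>i j. frechet_derivative (G i) (at q) (0, axis (coord j) 1)))"
  have Rval: "R_at A L s (\<Psi> (fst q)) \<tau> (P q) (\<lambda>j. coord_vec A (cv (fst q)) (s + j) (P q)) = h q"
    and nz: "leibniz_det s (\<lambda>i j. frechet_derivative (G i) (at q) (0, axis (coord j) 1)) \<noteq> 0"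
    if q: "q \<in> O'" and Yq: "P q \<in> Yset L s (\<Psi> (fst q))" for q
  proof -
    define v where "v = fst q"
    have PN: "(v, P q) \<in> N" using Pq(1)[OF q] by (simp add: v_def)
    note cvv = cvA[OF PN]
    have Pv: "P q \<in> fst (cv v)" using PN cv_fst by blast
    note sr = slice_residue[where \<tau>=\<tau>, OF cvB[OF PN] H0_fiber[OF \<tau>] cvv Pv e(1) Pq(3)[OF q] cv_slice Yq[folded v_def]]
    have det: "leibniz_det s (\<lambda>i j. dsect (\<Psi> v) e i (P q) (coord_vec A (cv v) j (P q))) =
        leibniz_det s (\<lambda>i j. frechet_derivative (G i) (at q) (0, axis (coord j) 1))"
      by (rule leibniz_det_cong) (simp add: v_def dG[OF q])
    show "leibniz_det s (\<lambda>i j. frechet_derivative (G i) (at q) (0, axis (coord j) 1)) \<noteq> 0"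
      using sr(1) unfolding det .
    have ep: "frames_at e (P q)" by (rule Frames_on_frames_at[OF e(1) Pq(3)[OF q]])
    have "lkcoeff \<tau> e (cv v) (P q) = lkcoeff \<tau> e c (P q) *
        ((\<Prod>i<s. ratio (L i) (e i (P q)) (e i (P q))) * top_form c (P q) (\<lambda>j. coord_vec A (cv v) j (P q)))"
      by (rule lkcoeff_change) (use frames_at_vec[OF ep] c(1) Pq(2)[OF q] cvv Pv H0_fiber[OF \<tau>] in auto)
    also have "(\<Prod>i<s. ratio (L i) (e i (P q)) (e i (P q))) = 1"
      by (rule prod.neutral) (use ratio_self[OF frames_at_vec[OF ep]] in auto)
    also have "top_form c (P q) (\<lambda>j. coord_vec A (cv v) j (P q)) =
        leibniz_det CARD('n) (\<lambda>i j. frechet_derivative Y (at q) (0, axis (coord j) 1) $ coord i)"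
      using coord_vec_tangent[OF cvv Pv] dY[OF q] by (simp add: coord_form_def v_def)
    also have "lkcoeff \<tau> e c (P q) = (lkcoeff \<tau> e c \<circ> cinv c) (Y q)"
      by (simp add: Pq(5)[OF q] chart_cinv[OF c(1) Pq(2)[OF q]])
    finally show "R_at A L s (\<Psi> (fst q)) \<tau> (P q) (\<lambda>j. coord_vec A (cv (fst q)) (s + j) (P q)) = h q"
      using sr(2) unfolding det by (simp add: h_def v_def)
  qed
  have P0: "P q0 = x0"
    using chart_cinv[OF cvA[OF q0(2)], of x0] q0(1,2) by (simp add: P_def cv_fst cv_snd)
  show "\<exists>h. holo_at h q0 \<and> (\<forall>\<^sub>F q in nhds q0. q \<in> ?S \<longrightarrow>
      (case q of (v, w) \<Rightarrow> let c = ({x. (v, x) \<in> N}, \<lambda>x. \<zeta> (v, x)); p = inv_into (fst c) (snd c) w in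
         R_map A L s \<tau> (\<Psi> v) p (\<lambda>j. coord_vec A c (s + j) p)) = h q)"
  proof (intro exI[of _ h] conjI)
    show "holo_at h q0"
      unfolding h_def
    proof (intro holo_at_divide holo_at_mult holo_at_leibniz_det)
      have "holo_at (lkcoeff \<tau> e c \<circ> cinv c) (Y q0)"
        unfolding Pq(5)[OF q0O]
        by (rule hol_at_chart[OF lkcoeff_hol[OF \<tau> Frames_on_frames_at[OF e(1) Pq(3)[OF q0O]] c(1) Pq(2)[OF q0O]] c(1) Pq(2)[OF q0O]])
      then show "holo_at (\<lambda>q. (lkcoeff \<tau> e c \<circ> cinv c) (Y q)) q0" by (rule holo_at_compose[OF holY[OF q0O]])
      show "holo_at (\<lambda>q. frechet_derivative Y (at q) (0, axis (coord j) 1) $ coord i) q0" for i j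
        by (rule holo_at_nth, rule holo_at_frechet_derivative_vec[OF opO q0O holY])
      show "holo_at (\<lambda>q. frechet_derivative (G i) (at q) (0, axis (coord j) 1)) q0" if "i < s" "j < s" for i j
        by (rule holo_at_frechet_derivative[OF opO q0O holG[OF _ that(1)]])
      show "leibniz_det s (\<lambda>i j. frechet_derivative (G i) (at q0) (0, axis (coord j) 1)) \<noteq> 0"
        by (rule nz[OF q0O], unfold P0) (simp add: q0(1,3))
    qed
    show "\<forall>\<^sub>F q in nhds q0. q \<in> ?S \<longrightarrow>
      (case q of (v, w) \<Rightarrow> let c = ({x. (v, x) \<in> N}, \<lambda>x. \<zeta> (v, x)); p = inv_into (fst c) (snd c) w in
         R_map A L s \<tau> (\<Psi> v) p (\<lambda>j. coord_vec A c (s + j) p)) = h q"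
      unfolding eventually_nhds
    proof (intro exI[of _ O'] conjI ballI impI opO q0O)
      fix q assume q: "q \<in> O'" "q \<in> ?S"
      obtain v x where vx: "q = (v, \<zeta> (v, x))" "(v, x) \<in> N" "x \<in> Yset L s (\<Psi> v)" using q(2) by blast
      have Px: "P q = x" using chart_cinv[OF cvA[OF vx(2)], of x] vx(1,2) by (simp add: P_def cv_fst cv_snd)
      have "R_at A L s (\<Psi> v) \<tau> (P q) (\<lambda>j. coord_vec A (cv v) (s + j) (P q)) = h q"
        using Rval[OF q(1)] vx Px by simp
      then show "(case q of (v, w) \<Rightarrow> let c = ({x. (v, x) \<in> N}, \<lambda>x. \<zeta> (v, x)); p = inv_into (fst c) (snd c) w in
         R_map A L s \<tau> (\<Psi> v) p (\<lambda>j. coord_vec A c (s + j) p)) = h q"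
        using cvB[OF vx(2)] by (simp add: vx(1) R_map_def P_def cv_def Let_def)
    qed
  qed
qed

lemma R_map_H0Htop:
  fixes \<Psi> :: "'v::complex_model \<Rightarrow> nat \<Rightarrow> 'x \<Rightarrow> 'l"
  assumes "linear_coords A L s \<Psi>" "\<tau> \<in> H0 A (LK A L s)"
  shows "R_map A L s \<tau> \<in> H0Htop A L s \<Psi>"
  unfolding H0Htop_def
proof (intro CollectI conjI allI impI)
  show "R_map A L s \<tau> \<in> PiE (Bset A L s) (H0KY A L s)"
    unfolding R_map_def using R_at_H0KY[OF _ assms(2)] by auto
qed (rule R_map_family_holo[OF assms])

end

section \<open>Associated line bundles\<close>

text \<open>The algebraic part of \<open>holo_character\<close>, shared by the characters chi(h) and
  chi(h) h.\<close>

definition mult_char :: "(complex \<Rightarrow> complex) \<Rightarrow> bool" where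
  "mult_char ch \<longleftrightarrow> (\<forall>h. h \<noteq> 0 \<longrightarrow> ch h \<noteq> 0) \<and> (\<forall>h k. h \<noteq> 0 \<longrightarrow> k \<noteq> 0 \<longrightarrow> ch (h * k) = ch h * ch k)"

lemma mult_char_one: "mult_char ch \<Longrightarrow> ch 1 = 1"
  unfolding mult_char_def by (metis mult_cancel_right1 mult_1 one_neq_zero)

lemma mult_char_twist: "mult_char ch \<Longrightarrow> mult_char (\<lambda>h. ch h * h)"
  by (auto simp: mult_char_def)

lemma mem_assoc_class: "(m', v') \<in> assoc_class K ch m v \<longleftrightarrow> (\<exists>h. h \<noteq> 0 \<and> m' = Smul K (inverse h) m \<and> v' = ch h * v)"
  by (auto simp: assoc_class_def)

lemma assoc_class_self:
  assumes "mult_char ch" "frame_vec K p m"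
  shows "(m, v) \<in> assoc_class K ch m v"
  unfolding mem_assoc_class using frame_Smul_one[OF assms(2)] mult_char_one[OF assms(1)]
  by (intro exI[of _ 1]) simp

text \<open>Scalars act freely on nonzero vectors: the scalar carrying (m, v') to (m, v) fixes m, so
  it is 1.\<close>

lemma assoc_class_inj:
  assumes ch: "mult_char ch" and m: "frame_vec K p m" and eq: "assoc_class K ch m v = assoc_class K ch m v'"
  shows "v = v'"
proof -
  have "(m, v) \<in> assoc_class K ch m v'" using assoc_class_self[OF ch m, of v] eq by simp
  then obtain h where h: "h \<noteq> 0" "m = Smul K (inverse h) m" "v = ch h * v'" unfolding mem_assoc_class by blast
  have "Smul K 1 m = Smul K (inverse h) m" using h(2) frame_Smul_one[OF m] by simp
  then have "inverse h = 1" using frame_inj[OF m] by metis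
  then have "h = 1" by (simp add: inverse_eq_1_iff)
  then show ?thesis using h(3) mult_char_one[OF ch] by simp
qed

text \<open>The group element h = c carries (c m, v) to (m, chi(c) v); the two orbits are
  reparametrized by h \<mapsto> h / c.\<close>

lemma assoc_class_Smul:
  fixes K :: "('x, 'k) line_bundle"
  assumes ch: "mult_char ch" and m: "frame_vec K p m" and c: "c \<noteq> 0"
  shows "assoc_class K ch (Smul K c m) v = assoc_class K ch m (ch c * v)"
proof (rule Set.set_eqI)
  fix x :: "'k \<times> complex"
  obtain m' v' where x: "x = (m', v')" by (cases x)
  have sm: "Smul K a (Smul K c m) = Smul K (a * c) m" for a by (rule frame_Smul_Smul[OF m])
  have chm: "ch (h * k) = ch h * ch k" if "h \<noteq> 0" "k \<noteq> 0" for h k using ch that by (simp add: mult_char_def)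
  show "x \<in> assoc_class K ch (Smul K c m) v \<longleftrightarrow> x \<in> assoc_class K ch m (ch c * v)"
    unfolding x mem_assoc_class sm
  proof
    assume "\<exists>h. h \<noteq> 0 \<and> m' = Smul K (inverse h * c) m \<and> v' = ch h * v"
    then obtain h where h: "h \<noteq> 0" "m' = Smul K (inverse h * c) m" "v' = ch h * v" by blast
    have "ch h = ch (h / c) * ch c" using chm[of "h / c" c] h(1) c by simp
    then show "\<exists>h. h \<noteq> 0 \<and> m' = Smul K (inverse h) m \<and> v' = ch h * (ch c * v)"
      using h c by (intro exI[of _ "h / c"]) (simp add: field_simps)
  next
    assume "\<exists>h. h \<noteq> 0 \<and> m' = Smul K (inverse h) m \<and> v' = ch h * (ch c * v)"
    then obtain h where h: "h \<noteq> 0" "m' = Smul K (inverse h) m" "v' = ch h * (ch c * v)" by blast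
    then show "\<exists>h. h \<noteq> 0 \<and> m' = Smul K (inverse h * c) m \<and> v' = ch h * v"
      using c chm[of h c] by (intro exI[of _ "h * c"]) (simp add: field_simps)
  qed
qed

lemma assoc_class_scale:
  fixes K :: "('x, 'k) line_bundle"
  shows "Smul (assoc_bundle K ch) c (assoc_class K ch m v) = assoc_class K ch m (c * v)"
proof (rule Set.set_eqI)
  fix x :: "'k \<times> complex"
  obtain m' v' where x: "x = (m', v')" by (cases x)
  show "x \<in> Smul (assoc_bundle K ch) c (assoc_class K ch m v) \<longleftrightarrow> x \<in> assoc_class K ch m (c * v)"
    unfolding x assoc_bundle_def by (auto simp: mem_assoc_class)
qed

lemma assoc_Proj:
  assumes ch: "mult_char ch" and m: "frame_vec K p m"
  shows "Proj (assoc_bundle K ch) (assoc_class K ch m v) = p"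
proof -
  have "(THE q. \<exists>m' v'. (m', v') \<in> assoc_class K ch m v \<and> Proj K m' = q) = p"
  proof (rule the_equality)
    show "\<exists>m' v'. (m', v') \<in> assoc_class K ch m v \<and> Proj K m' = p"
      using assoc_class_self[OF ch m] frame_vec_Proj[OF m] by blast
    show "q = p" if "\<exists>m' v'. (m', v') \<in> assoc_class K ch m v \<and> Proj K m' = q" for q
      using that fiber_Proj(1)[OF frame_Smul_in[OF m]] unfolding mem_assoc_class by blast
  qed
  then show ?thesis by (simp add: assoc_bundle_def)
qed

lemma assoc_class_exists:
  assumes K: "has_lines K" and ch: "mult_char ch" and m: "frame_vec K p m"
    and q: "q \<in> Tot (assoc_bundle K ch)" "Proj (assoc_bundle K ch) q = p"
  shows "\<exists>v. q = assoc_class K ch m v"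
proof -
  obtain m0 v0 where m0: "q = assoc_class K ch m0 v0" "m0 \<in> nonzero K" using q(1) by (auto simp: assoc_bundle_def)
  have f: "frame_vec K (Proj K m0) m0" by (rule has_lines_frame[OF K m0(2) refl])
  have "Proj K m0 = p" using assoc_Proj[OF ch f, of v0] q(2) m0(1) by simp
  then have f: "frame_vec K p m0" using f by simp
  have "q = assoc_class K ch (Smul K (ratio K m0 m) m) v0" using m0(1) ratio_eq[OF m frame_fiber[OF f]] by simp
  also have "\<dots> = assoc_class K ch m (ch (ratio K m0 m) * v0)"
    by (rule assoc_class_Smul[OF ch m ratio_frame_nonzero[OF m f]])
  finally show ?thesis by blast
qed

section \<open>The total space of the canonical bundle\<close>

context cmfd
begin

lemma mem_K_chart: "\<eta> \<in> fst (K_chart A c) \<longleftrightarrow> snd \<eta> \<in> alt_forms CARD('n) (tangent A (fst \<eta>)) \<and> fst \<eta> \<in> fst c"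
  unfolding K_chart_def canonical_bundle_def by (cases \<eta>) auto

lemma snd_K_chart: "snd (K_chart A c) \<eta> = (snd \<eta> (\<lambda>j. coord_vec A c j (fst \<eta>)), snd c (fst \<eta>))"
  by (simp add: K_chart_def)

lemma inv_K_chart:
  assumes c: "c \<in> A" "q \<in> fst c"
  shows "inv_into (fst (K_chart A c)) (snd (K_chart A c)) (z, snd c q) = (q, \<lambda>u. z * top_form c q u)"
proof -
  let ?\<eta> = "(q, \<lambda>u. z * top_form c q u)"
  have inj: "inj_on (snd (K_chart A c)) (fst (K_chart A c))"
  proof (rule inj_onI)
    fix \<eta> \<theta> assume \<eta>: "\<eta> \<in> fst (K_chart A c)" "\<theta> \<in> fst (K_chart A c)" and eq: "snd (K_chart A c) \<eta> = snd (K_chart A c) \<theta>"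
    have eq': "snd \<eta> (\<lambda>j. coord_vec A c j (fst \<eta>)) = snd \<theta> (\<lambda>j. coord_vec A c j (fst \<theta>))" "snd c (fst \<eta>) = snd c (fst \<theta>)"
      using eq by (simp_all add: snd_K_chart)
    have f: "fst \<eta> = fst \<theta>" using eq'(2) \<eta> chart_inj[OF c(1)] by (auto simp: mem_K_chart inj_on_def)
    show "\<eta> = \<theta>"
    proof (rule prod_eqI[OF f], rule ext)
      fix u
      have "snd \<eta> u = snd \<eta> (\<lambda>j. coord_vec A c j (fst \<eta>)) * top_form c (fst \<eta>) u"
        by (rule alt_form_top) (use \<eta> c(1) in \<open>auto simp: mem_K_chart\<close>)
      moreover have "snd \<theta> u = snd \<theta> (\<lambda>j. coord_vec A c j (fst \<theta>)) * top_form c (fst \<theta>) u"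
        by (rule alt_form_top) (use \<eta> c(1) in \<open>auto simp: mem_K_chart\<close>)
      ultimately show "snd \<eta> u = snd \<theta> u" using eq'(1) f by metis
    qed
  qed
  have "?\<eta> \<in> fst (K_chart A c)" using c by (simp add: mem_K_chart alt_forms_scale[OF top_form_alt])
  moreover have "snd (K_chart A c) ?\<eta> = (z, snd c q)" by (simp add: snd_K_chart top_form_basis[OF c])
  ultimately show ?thesis using inv_into_f_f[OF inj] by metis
qed

lemma K_transition_at:
  assumes "c \<in> A" "q \<in> fst c"
  shows "transition (K_chart A c) (K_chart A c') (z, snd c q) =
    (z * top_form c q (\<lambda>j. coord_vec A c' j q), snd c' q)"
  by (simp add: transition_def inv_K_chart[OF assms] snd_K_chart)

lemma eventually_snd_chart:
  assumes "c \<in> A" "p \<in> fst c" "\<forall>\<^sub>F q in nhds p. P q"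
  shows "\<forall>\<^sub>F x in nhds (z::complex, snd c p). snd x \<in> snd c ` fst c \<and> P (cinv c (snd x))"
proof -
  have "filterlim snd (nhds (snd c p)) (nhds (z, snd c p))"
    using tendsto_snd[OF filterlim_ident[of "nhds (z, snd c p)"]] by simp
  then show ?thesis using eventually_chart[OF assms] unfolding filterlim_iff by blast
qed

lemma K_transition_holo:
  assumes c: "c \<in> A" "c' \<in> A" "p \<in> fst c" "p \<in> fst c'"
  shows "holo_at (transition (K_chart A c) (K_chart A c')) (z, snd c p)"
proof (rule holo_at_cong)
  \<comment> \<open>The coordinate change of K_X: the fiber coordinate is multiplied by the Jacobian
    determinant of the reverse coordinate change, taken at the image point.\<close>
  define f where "f = (\<lambda>x::complex \<times> 'n cvec. (fst x * leibniz_det CARD('n)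
      (\<lambda>i j. frechet_derivative (transition c' c) (at (transition c c' (snd x))) (axis (coord j) 1) $ coord i), transition c c' (snd x)))"
  have ht: "holo_at (\<lambda>x. transition c c' (snd x)) (z, snd c p)"
    by (rule holo_at_compose[OF holo_at_snd[OF holo_at_ident]], unfold snd_conv) (rule transition_holo[OF c])
  show "holo_at f (z, snd c p)"
    unfolding f_def
  proof (intro holo_at_Pair holo_at_mult holo_at_leibniz_det ht holo_at_fst holo_at_ident holo_at_nth)
    fix i j
    have "holo_at (\<lambda>w. frechet_derivative (transition c' c) (at w) (axis (coord j) 1)) (transition c c' (snd (z, snd c p)))"
      unfolding snd_conv transition_at[OF c(1,3)] by (rule holo_at_transition_derivative[OF c(2,1,4,3)])
    then show "holo_at (\<lambda>x. frechet_derivative (transition c' c) (at (transition c c' (snd x))) (axis (coord j) 1)) (z, snd c p)"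
      by (rule holo_at_compose[OF ht])
  qed
  show "\<forall>\<^sub>F x in nhds (z, snd c p). f x = transition (K_chart A c) (K_chart A c') x"
    using eventually_snd_chart[OF c(1,3) eventually_in[OF chart_open(1)[OF c(2)] c(4)]]
  proof eventually_elim
    case (elim x)
    define q where "q = cinv c (snd x)"
    have q: "q \<in> fst c" "q \<in> fst c'" "snd c q = snd x" using elim cinv_chart[of "snd x" c] by (auto simp: q_def)
    have "top_form c q (\<lambda>j. coord_vec A c' j q) = leibniz_det CARD('n) (\<lambda>i j. coord_vec A c' j q c $ coord i)"
      by (simp add: coord_form_def coord_vec_tangent[OF c(2) q(2)])
    also have "\<dots> = leibniz_det CARD('n) (\<lambda>i j. frechet_derivative (transition c' c) (at (snd c' q)) (axis (coord j) 1) $ coord i)"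
      using c(1) q by (simp add: coord_vec_def)
    finally have "transition (K_chart A c) (K_chart A c') (fst x, snd c q) =
      (fst x * leibniz_det CARD('n) (\<lambda>i j. frechet_derivative (transition c' c) (at (snd c' q)) (axis (coord j) 1) $ coord i), snd c' q)"
      using K_transition_at[OF c(1) q(1), of c' "fst x"] by simp
    moreover have "transition c c' (snd x) = snd c' q" using transition_at[OF c(1) q(1), of c'] q(3) by simp
    ultimately show ?case using q(3) by (simp add: f_def)
  qed
qed

text \<open>The base part of a coordinate change of K_X ignores the fiber coordinate, and so does
  its derivative.\<close>

lemma K_transition_derivative:
  assumes c: "c \<in> A" "c' \<in> A" "p \<in> fst c" "p \<in> fst c'"
  shows "snd (frechet_derivative (transition (K_chart A c) (K_chart A c')) (at (z, snd c p)) h) =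
    frechet_derivative (transition c c') (at (snd c p)) (snd h)"
proof -
  let ?T = "transition (K_chart A c) (K_chart A c')"
  note hT = K_transition_holo[OF c, of z]
  have s1: "((\<lambda>x. snd (?T x)) has_derivative (\<lambda>h. snd (frechet_derivative ?T (at (z, snd c p)) h))) (at (z, snd c p))"
    by (rule has_derivative_snd[OF holo_at_derivative(1)[OF hT]])
  have s2: "((\<lambda>x. transition c c' (snd x)) has_derivative (\<lambda>h. frechet_derivative (transition c c') (at (snd c p)) (snd h))) (at (z, snd c p))"
    using has_derivative_compose[OF has_derivative_snd[OF has_derivative_ident], of "transition c c'" _ "(z, snd c p)" UNIV]
      holo_at_derivative(1)[OF transition_holo[OF c]] by simp
  have "\<forall>\<^sub>F x in nhds (z, snd c p). snd (?T x) = transition c c' (snd x)"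
    using eventually_snd_chart[OF c(1,3) eventually_in[OF chart_open(1)[OF c(2)] c(4)], of z]
  proof eventually_elim
    case (elim x)
    define q where "q = cinv c (snd x)"
    have q: "q \<in> fst c" "snd c q = snd x" using elim cinv_chart[of "snd x" c] by (auto simp: q_def)
    show ?case using K_transition_at[OF c(1) q(1), of c' "fst x"] transition_at[OF c(1) q(1), of c'] q(2) by simp
  qed
  from has_derivative_nhds_cong[OF s1 this] s2
  have "(\<lambda>h. snd (frechet_derivative ?T (at (z, snd c p)) h)) = (\<lambda>h. frechet_derivative (transition c c') (at (snd c p)) (snd h))"
    by (rule has_derivative_unique)
  then show ?thesis by (rule fun_cong)
qed

text \<open>The chain rule; that the transitions of K_X compose comes from the product rule for
  Jacobian determinants, an instance of \<open>alt_form_top\<close>.\<close>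

lemma K_transition_chain:
  assumes c: "c \<in> A" "c' \<in> A" "c'' \<in> A" "p \<in> fst c" "p \<in> fst c'" "p \<in> fst c''" and m: "m \<in> fst (K_chart A c)" "fst m = p"
  shows "frechet_derivative (transition (K_chart A c') (K_chart A c'')) (at (snd (K_chart A c') m))
      (frechet_derivative (transition (K_chart A c) (K_chart A c')) (at (snd (K_chart A c) m)) h) =
    frechet_derivative (transition (K_chart A c) (K_chart A c'')) (at (snd (K_chart A c) m)) h"
proof -
  define z where "z = snd m (\<lambda>j. coord_vec A c j p)"
  have sm: "snd (K_chart A c) m = (z, snd c p)" by (simp add: snd_K_chart m(2) z_def)
  have m_eq: "m = (p, \<lambda>u. z * top_form c p u)"
  proof (rule prod_eqI)
    show "snd m = snd (p, \<lambda>u. z * top_form c p u)"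
      unfolding snd_conv z_def by (rule ext, rule alt_form_top[OF _ c(1,4)]) (use m in \<open>simp add: mem_K_chart\<close>)
  qed (simp add: m(2))
  have sm': "snd (K_chart A c') m = transition (K_chart A c) (K_chart A c') (z, snd c p)"
    by (simp add: transition_def inv_K_chart[OF c(1,4)] m_eq[symmetric])
  define z' where "z' = fst (snd (K_chart A c') m)"
  have sm'': "snd (K_chart A c') m = (z', snd c' p)" by (simp add: snd_K_chart m(2) z'_def)
  have ev: "\<forall>\<^sub>F x in nhds (z, snd c p). transition (K_chart A c') (K_chart A c'') (transition (K_chart A c) (K_chart A c') x) =
      transition (K_chart A c) (K_chart A c'') x"
    using eventually_snd_chart[OF c(1,4) eventually_in[OF chart_open(1)[OF c(2)] c(5)]]
  proof eventually_elim
    case (elim x)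
    define q where "q = cinv c (snd x)"
    have q: "q \<in> fst c" "q \<in> fst c'" "snd c q = snd x" using elim cinv_chart[of "snd x" c] by (auto simp: q_def)
    have "transition (K_chart A c') (K_chart A c'') (fst x * top_form c q (\<lambda>j. coord_vec A c' j q), snd c' q) =
       ((fst x * top_form c q (\<lambda>j. coord_vec A c' j q)) * top_form c' q (\<lambda>j. coord_vec A c'' j q), snd c'' q)"
      by (rule K_transition_at[OF c(2) q(2)])
    moreover have "top_form c q (\<lambda>j. coord_vec A c'' j q) =
        top_form c q (\<lambda>j. coord_vec A c' j q) * top_form c' q (\<lambda>j. coord_vec A c'' j q)"
      by (rule alt_form_top[OF top_form_alt c(2) q(2)])
    ultimately show ?case
      using K_transition_at[OF c(1) q(1), of c' "fst x"] K_transition_at[OF c(1) q(1), of c'' "fst x"]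
      by (simp only: q(3) prod.collapse mult.assoc)
  qed
  have "frechet_derivative (\<lambda>x. transition (K_chart A c') (K_chart A c'') (transition (K_chart A c) (K_chart A c') x)) (at (z, snd c p)) h =
      frechet_derivative (transition (K_chart A c') (K_chart A c'')) (at (transition (K_chart A c) (K_chart A c') (z, snd c p)))
        (frechet_derivative (transition (K_chart A c) (K_chart A c')) (at (z, snd c p)) h)"
  proof (rule frechet_derivative_compose_holo[OF K_transition_holo[OF c(1,2,4,5)]])
    show "holo_at (transition (K_chart A c') (K_chart A c'')) (transition (K_chart A c) (K_chart A c') (z, snd c p))"
      unfolding sm'[symmetric] sm'' by (rule K_transition_holo[OF c(2,3,5,6)])
  qed
  then show ?thesis using frechet_derivative_cong[OF ev] by (simp only: sm sm'[symmetric])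
qed

lemma K_dproj_tangent:
  assumes m: "m \<in> nonzero (canonical_bundle A)" "fst m = p" and W: "W \<in> tangent (K_atlas A) m"
  shows "K_dproj A m W \<in> tangent A p"
  unfolding tangent_def
proof (intro CollectI conjI allI ballI impI)
  show "K_dproj A m W c = 0" if "\<not> (c \<in> A \<and> p \<in> fst c)" for c
    using that m(2) unfolding K_dproj_def by (simp only: if_False)
  fix c c' assume c: "c \<in> A" "c' \<in> A" "p \<in> fst c" "p \<in> fst c'"
  have mK: "m \<in> fst (K_chart A k)" if "p \<in> fst k" for k
    using m that by (auto simp: mem_K_chart nonzero_def canonical_bundle_def)
  have "W (K_chart A c') = frechet_derivative (transition (K_chart A c) (K_chart A c')) (at (snd (K_chart A c) m)) (W (K_chart A c))"
    using W c mK[OF c(3)] mK[OF c(4)] unfolding tangent_def K_atlas_def by blast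
  then show "K_dproj A m W c' = frechet_derivative (transition c c') (at (snd c p)) (K_dproj A m W c)"
    using K_transition_derivative[OF c] c m(2) by (simp add: K_dproj_def snd_K_chart)
qed

text \<open>The lift has fiber component 0 in one chosen chart and is carried to the others by the
  coordinate changes. Surjectivity is what makes a form on X determined by its pullback to
  K_X.\<close>

lemma K_dproj_surj:
  assumes m: "m \<in> nonzero (canonical_bundle A)" "fst m = p" and v: "v \<in> tangent A p"
  shows "\<exists>W. W \<in> tangent (K_atlas A) m \<and> K_dproj A m W = v"
proof -
  obtain c where c: "c \<in> A" "p \<in> fst c" using chart_cover by blast
  have mK: "m \<in> fst (K_chart A k) \<longleftrightarrow> p \<in> fst k" for k
    using m by (auto simp: mem_K_chart nonzero_def canonical_bundle_def)
  define W where "W = (\<lambda>k. if k \<in> K_atlas A \<and> m \<in> fst k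
    then frechet_derivative (transition (K_chart A c) k) (at (snd (K_chart A c) m)) (0, v c) else 0)"
  have "W \<in> tangent (K_atlas A) m"
    unfolding tangent_def
  proof (intro CollectI conjI allI ballI impI)
    show "W k = 0" if "\<not> (k \<in> K_atlas A \<and> m \<in> fst k)" for k using that unfolding W_def by (simp only: if_False)
    fix k k' assume k: "k \<in> K_atlas A" "k' \<in> K_atlas A" "m \<in> fst k" "m \<in> fst k'"
    obtain c1 c2 where c12: "k = K_chart A c1" "c1 \<in> A" "k' = K_chart A c2" "c2 \<in> A"
      using k(1,2) unfolding K_atlas_def by blast
    have p12: "p \<in> fst c1" "p \<in> fst c2" using k(3,4) mK c12 by auto
    have "W k = frechet_derivative (transition (K_chart A c) k) (at (snd (K_chart A c) m)) (0, v c)"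
      "W k' = frechet_derivative (transition (K_chart A c) k') (at (snd (K_chart A c) m)) (0, v c)"
      using k by (simp_all add: W_def)
    then show "W k' = frechet_derivative (transition k k') (at (snd k m)) (W k)"
      unfolding c12 using K_transition_chain[OF c(1) c12(2,4) c(2) p12 mK[THEN iffD2, OF c(2)] m(2)] by simp
  qed
  moreover have "K_dproj A m W = v"
  proof
    fix c'
    show "K_dproj A m W c' = v c'"
    proof (cases "c' \<in> A \<and> p \<in> fst c'")
      case True
      then have "W (K_chart A c') = frechet_derivative (transition (K_chart A c) (K_chart A c')) (at (snd (K_chart A c) m)) (0, v c)"
        unfolding W_def using mK by (auto simp: K_atlas_def)
      then have "K_dproj A m W c' = frechet_derivative (transition c c') (at (snd c p)) (v c)"
        using K_transition_derivative[OF c(1) _ c(2)] True m(2) by (simp add: K_dproj_def snd_K_chart)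
      then show ?thesis using tangent_transition[OF v c(1) _ c(2), of c'] True by simp
    next
      case False
      then show ?thesis using tangent_outside[OF v False] m(2) unfolding K_dproj_def by (simp only: if_False)
    qed
  qed
  ultimately show ?thesis by blast
qed

text \<open>The Euler field has components (z, 0), so expanding along its column leaves z times
  \<open>dw\<^sub>1 \<and> ... \<and> dw\<^sub>d\<close> on the projected vectors. As z is the fiber
  coordinate of m, this is m itself: the tautological form.\<close>

lemma contract_omega_hat:
  assumes m: "m \<in> nonzero (canonical_bundle A)" "fst m = p" and W: "\<And>j. j < CARD('n) \<Longrightarrow> W j \<in> tangent (K_atlas A) m"
  shows "contract (euler_field A m) (omega_hat A m) W = snd m (\<lambda>j. K_dproj A m (W j))"
proof -
  define c where "c = chart_at A p"
  have c: "c \<in> A" "p \<in> fst c" using chart_at by (auto simp: c_def)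
  define k where "k = K_chart A c"
  have mK: "m \<in> fst k" and alt: "snd m \<in> alt_forms CARD('n) (tangent A p)"
    using m c by (auto simp: mem_K_chart nonzero_def canonical_bundle_def k_def)
  have kA: "k \<in> K_atlas A" using c by (auto simp: K_atlas_def k_def)
  define z where "z = snd m (\<lambda>j. coord_vec A c j p)"
  have eul: "euler_field A m k = (z, 0)"
    using kA mK m(2) by (simp add: euler_field_def k_def snd_K_chart z_def)
  define a where "a = (\<lambda>i j. case i of 0 \<Rightarrow> fst ((case_nat (euler_field A m) W j) k)
      | Suc i' \<Rightarrow> snd ((case_nat (euler_field A m) W j) k) $ (coord i' :: 'n))"
  have "contract (euler_field A m) (omega_hat A m) W = leibniz_det (Suc CARD('n)) a"
    by (simp add: contract_def omega_hat_def m(2) c_def[symmetric] k_def[symmetric] Let_def a_def)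
  also have "\<dots> = a 0 0 * leibniz_det CARD('n) (\<lambda>i j. a (Suc i) (Suc j))"
  proof (rule leibniz_det_block_col)
    fix i :: nat assume "0 < i" "i < Suc CARD('n)"
    then show "a i 0 = 0" using eul by (cases i) (auto simp: a_def)
  qed
  also have "a 0 0 = z" using eul by (simp add: a_def)
  also have "leibniz_det CARD('n) (\<lambda>i j. a (Suc i) (Suc j)) = top_form c p (\<lambda>j. K_dproj A m (W j))"
    using K_dproj_tangent[OF m W] c m(2) by (simp add: a_def coord_form_def K_dproj_def k_def)
  also have "z * \<dots> = snd m (\<lambda>j. K_dproj A m (W j))"
    unfolding z_def by (rule alt_form_top[OF alt c, symmetric])
  finally show ?thesis .
qed

end

section \<open>The form \<open>\<tau>\<Omega>\<^sub>\<sigma>\<close> and its residue\<close>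

context adjunction
begin

lemma polar_complement_frame:
  assumes \<sigma>: "\<sigma> \<in> Vstar A L s" and p: "p \<notin> polar_divisor L s \<sigma>" and i: "i < s"
  shows "frame_vec (L i) p (\<sigma> i p)"
proof -
  have "\<sigma> i p \<in> nonzero (L i)" using p i by (auto simp: polar_divisor_def Yhyp_def)
  then show ?thesis using has_lines_frame[OF L_lines[OF i]] fiber_Proj(1)[OF Vstar_fiber[OF \<sigma> i]] by blast
qed

text \<open>Where no \<open>\<sigma>\<^sub>i\<close> vanishes, the sections are themselves a frame;
  dividing \<tau> by their product means taking its coefficient in this frame.\<close>

lemma lkcoeff_section:
  assumes \<sigma>: "\<sigma> \<in> Vstar A L s" and p: "p \<notin> polar_divisor L s \<sigma>"
    and e: "\<And>i. i < s \<Longrightarrow> frame_vec (L i) p (e i p)" and c: "c \<in> A" "p \<in> fst c"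
    and \<tau>: "\<tau> p \<in> fiber (LK A L s) p"
  shows "lkcoeff \<tau> \<sigma> c p = lkcoeff \<tau> e c p / (\<Prod>i<s. ratio (L i) (\<sigma> i p) (e i p))"
proof -
  have f: "frame_vec (L i) p (\<sigma> i p)" if "i < s" for i by (rule polar_complement_frame[OF \<sigma> p that])
  have "lkcoeff \<tau> \<sigma> c p = lkcoeff \<tau> e c p * ((\<Prod>i<s. ratio (L i) (e i p) (\<sigma> i p)) * top_form c p (\<lambda>j. coord_vec A c j p))"
    by (rule lkcoeff_change) (use e f c \<tau> in auto)
  moreover have "(\<Prod>i<s. ratio (L i) (e i p) (\<sigma> i p)) * (\<Prod>i<s. ratio (L i) (\<sigma> i p) (e i p)) = 1"
    unfolding prod.distrib[symmetric]
  proof (rule prod.neutral, rule ballI)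
    fix i assume "i \<in> {..<s}"
    then have i: "i < s" by simp
    show "ratio (L i) (e i p) (\<sigma> i p) * ratio (L i) (\<sigma> i p) (e i p) = 1"
      using ratio_trans[OF f[OF i] e[OF i] frame_fiber[OF e[OF i]]] ratio_self[OF e[OF i]] by simp
  qed
  moreover have "(\<Prod>i<s. ratio (L i) (\<sigma> i p) (e i p)) \<noteq> 0"
    using ratio_frame_nonzero[OF e f] by simp
  ultimately show ?thesis by (simp add: top_form_basis[OF c] field_simps)
qed

lemma tau_Omega_eq:
  assumes ch: "holo_character chi" and iso: "line_bundle_iso A TL (assoc_bundle KX chi) \<Phi>"
    and \<sigma>: "\<sigma> \<in> Vstar A L s" and \<tau>: "\<And>p. \<tau> p \<in> fiber (LK A L s) p"
    and p: "p \<notin> polar_divisor L s \<sigma>" and c: "c \<in> A" "p \<in> fst c"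
  shows "tau_Omega A L s chi \<Phi> \<tau> \<sigma> p = (\<lambda>u. lkcoeff \<tau> \<sigma> c p * top_form c p u)"
proof -
  have mch: "mult_char chi" using ch by (auto simp: mult_char_def holo_character_def)
  define chi' where "chi' = (\<lambda>h. chi h * h)"
  have mch': "mult_char chi'" unfolding chi'_def by (rule mult_char_twist[OF mch])
  let ?AB = "assoc_bundle KX chi"
  have bij: "bij_betw \<Phi> (Tot TL) (Tot ?AB)" using iso by (simp add: line_bundle_iso_def)
  have \<Phi>P: "Proj ?AB (\<Phi> u) = Proj TL u" and \<Phi>S: "\<Phi> (Smul TL a u) = Smul ?AB a (\<Phi> u)" if "u \<in> Tot TL" for u a
    using iso that unfolding line_bundle_iso_def by blast+
  define u0 where "u0 = tens_list L s p (\<lambda>i. \<sigma> i p)"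
  have f: "frame_vec (L i) p (\<sigma> i p)" if "i < s" for i by (rule polar_complement_frame[OF \<sigma> p that])
  have u0: "frame_vec TL p u0" unfolding u0_def
    by (rule frame_vec_tens_list) (use L_lines f in auto)
  have u0T: "u0 \<in> Tot TL" by (rule fiber_Proj(2)[OF frame_fiber[OF u0]])
  have class_ex: "\<exists>a. \<Phi> u = assoc_class KX chi m a" if u: "u \<in> fiber TL p" and m: "frame_vec KX p m" for u m
  proof (rule assoc_class_exists[OF has_lines_canonical mch m])
    show "\<Phi> u \<in> Tot ?AB" using bij fiber_Proj(2)[OF u] by (auto simp: bij_betw_def)
    show "Proj ?AB (\<Phi> u) = p" using \<Phi>P[OF fiber_Proj(2)[OF u]] fiber_Proj(1)[OF u] by simp
  qed
  \<comment> \<open>If a were 0, \<Phi> would send u0 and 0 u0 to the same class, against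
    injectivity.\<close>
  have class_nz: "a \<noteq> 0" if a: "\<Phi> u0 = assoc_class KX chi m a" for m a
  proof
    assume "a = 0"
    then have "\<Phi> (Smul TL 0 u0) = \<Phi> u0" using \<Phi>S[OF u0T, of 0] a by (simp add: assoc_class_scale)
    moreover have "Smul TL 0 u0 \<in> Tot TL" by (rule fiber_Proj(2)[OF frame_Smul_in[OF u0]])
    ultimately have "Smul TL 0 u0 = u0" using bij u0T by (auto simp: bij_betw_def inj_on_def)
    then show False using frame_nonzero[OF u0] by (simp add: nonzero_def)
  qed
  have tens_scale: "tens TL KX (Smul TL a u0) (Smul KX b m) = Smul (LK A L s) (a * b) (tens TL KX u0 m)"
    if m: "frame_vec KX p m" for a b m
    using tens_frame_expand[OF TL_lines has_lines_canonical u0 m frame_Smul_in[OF u0] frame_Smul_in[OF m]]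
    by (simp add: ratio_Smul_frame[OF u0] ratio_Smul_frame[OF m])
  have frame_t: "frame_vec (LK A L s) p (tens TL KX u0 m)" if m: "frame_vec KX p m" for m
    by (rule frame_vec_tens[OF TL_lines has_lines_canonical u0 m])
  have tens_scale1: "tens TL KX u0 (Smul KX b m) = Smul (LK A L s) b (tens TL KX u0 m)" if m: "frame_vec KX p m" for b m
    using tens_scale[OF m, of 1 b] frame_Smul_one[OF u0] by simp
  \<comment> \<open>\<open>assoc_twist\<close> is a description over all decompositions of \<tau> p.
    Another one uses u = x u0 and m' = y m; then x a = chi(y) a' and b = x b' y, from which
    [m', a' b'] = [m, a b] follows.\<close>
  have twist: "assoc_twist TL KX chi \<Phi> (\<tau> p) = assoc_class KX chi' m (a * b)"
    if m: "frame_vec KX p m" and a: "\<Phi> u0 = assoc_class KX chi m a" and b: "\<tau> p = Smul (LK A L s) b (tens TL KX u0 m)" for m a b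
    unfolding assoc_twist_def chi'_def[symmetric]
  proof (rule the_equality)
    show "\<exists>u m' a' b'. u \<in> Tot TL \<and> m' \<in> nonzero KX \<and> Proj KX m' = Proj TL u \<and>
       \<tau> p = tens TL KX u (Smul KX b' m') \<and> \<Phi> u = assoc_class KX chi m' a' \<and>
       assoc_class KX chi' m (a * b) = assoc_class KX chi' m' (a' * b')"
      using u0T frame_nonzero[OF m] frame_vec_Proj[OF m] frame_vec_Proj[OF u0] a b tens_scale1[OF m, of b]
      by (intro exI[of _ u0] exI[of _ m] exI[of _ a] exI[of _ b] conjI) auto
    fix q
    assume "\<exists>u m' a' b'. u \<in> Tot TL \<and> m' \<in> nonzero KX \<and> Proj KX m' = Proj TL u \<and>
       \<tau> p = tens TL KX u (Smul KX b' m') \<and> \<Phi> u = assoc_class KX chi m' a' \<and>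
       q = assoc_class KX chi' m' (a' * b')"
    then obtain u m' a' b' where h: "u \<in> Tot TL" "m' \<in> nonzero KX" "Proj KX m' = Proj TL u"
       "\<tau> p = tens TL KX u (Smul KX b' m')" "\<Phi> u = assoc_class KX chi m' a'" "q = assoc_class KX chi' m' (a' * b')"
      by blast
    have "fst (\<tau> p) = p" using \<tau>[of p] by (simp add: mem_fiber_tensor)
    then have pu: "Proj TL u = p" unfolding h(4) fst_tens .
    have m': "frame_vec KX p m'" using has_lines_frame[OF has_lines_canonical h(2)] h(3) pu by simp
    have uf: "u \<in> fiber TL p" using h(1) pu by (simp add: fiber_def)
    define x where "x = ratio TL u u0"
    have u: "u = Smul TL x u0" unfolding x_def by (rule ratio_eq[OF u0 uf])
    define y where "y = ratio KX m' m"
    have m'y: "m' = Smul KX y m" unfolding y_def by (rule ratio_eq[OF m frame_fiber[OF m']])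
    have y: "y \<noteq> 0" unfolding y_def by (rule ratio_frame_nonzero[OF m m'])
    have "\<Phi> u = assoc_class KX chi m (x * a)" using \<Phi>S[OF u0T, of x] by (simp add: u a assoc_class_scale)
    moreover have "\<Phi> u = assoc_class KX chi m (chi y * a')" unfolding h(5) m'y by (rule assoc_class_Smul[OF mch m y])
    ultimately have xa: "x * a = chi y * a'" using assoc_class_inj[OF mch m] by metis
    have "\<tau> p = tens TL KX (Smul TL x u0) (Smul KX (b' * y) m)" unfolding h(4) u m'y by (simp add: frame_Smul_Smul[OF m])
    also have "\<dots> = Smul (LK A L s) (x * (b' * y)) (tens TL KX u0 m)" by (rule tens_scale[OF m])
    finally have "b = x * (b' * y)" using b frame_inj[OF frame_t[OF m]] by metis
    then have "chi' y * (a' * b') = a * b" unfolding chi'_def using xa by (simp add: mult_ac)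
    then show "q = assoc_class KX chi' m (a * b)" unfolding h(6) m'y using assoc_class_Smul[OF mch' m y, of "a' * b'"] by simp
  qed
  define g where "g = lkcoeff \<tau> \<sigma> c p"
  have top: "frame_vec KX p (p, top_form c p)" by (rule frame_vec_canonical[OF c])
  have \<tau>g: "\<tau> p = Smul (LK A L s) g (tens TL KX u0 (p, top_form c p))"
    using lkcoeff_eq[where e=\<sigma> and p=p and c=c and \<tau>=\<tau>, OF f c \<tau>] by (simp add: g_def lkframe_def u0_def)
  let ?ft = "assoc_fun KX (\<lambda>h. chi h * h) (\<lambda>q. assoc_twist TL KX chi \<Phi> (\<tau> q))"
  let ?fs = "assoc_fun KX chi (\<lambda>q. \<Phi> (tens_list L s q (\<lambda>i. \<sigma> i q)))"
  \<comment> \<open>With m equal to z times the top form of c, the function of \<tau> is a g / z,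
    that of the product of the sections is a, and the contraction contributes z: both a and z
    cancel.\<close>
  have main: "?ft m * contract (euler_field A m) (omega_hat A m) W / ?fs m = g * top_form c p (\<lambda>j. K_dproj A m (W j))"
    if m: "m \<in> nonzero KX" "Proj KX m = p" and W: "\<And>j. j < CARD('n) \<Longrightarrow> W j \<in> tangent (K_atlas A) m" for m W
  proof -
    have mf: "frame_vec KX p m" by (rule has_lines_frame[OF has_lines_canonical m])
    obtain a where a: "\<Phi> u0 = assoc_class KX chi m a" using class_ex[OF frame_fiber[OF u0] mf] by blast
    define z where "z = snd m (\<lambda>j. coord_vec A c j p)"
    have fm: "fst m = p" "snd m \<in> alt_forms CARD('n) (tangent A p)"
      using frame_fiber[OF mf] by (simp_all add: mem_fiber_canonical)
    have "ratio KX m (p, top_form c p) = z"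
      using ratio_canonical[OF c fm(2)] fm(1) by (simp add: z_def prod_eq_iff[symmetric]) (metis prod.collapse)
    then have mz: "m = Smul KX z (p, top_form c p)" "z \<noteq> 0"
      using ratio_eq[OF top frame_fiber[OF mf]] ratio_frame_nonzero[OF top mf] by auto
    have "tens TL KX u0 m = Smul (LK A L s) z (tens TL KX u0 (p, top_form c p))"
      using tens_scale1[OF top, of z] mz(1) by simp
    then have b: "\<tau> p = Smul (LK A L s) (g / z) (tens TL KX u0 m)"
      using \<tau>g frame_Smul_Smul[OF frame_t[OF top], of "g / z" z] mz(2) by simp
    have "?fs m = a"
      unfolding assoc_fun_def m(2) u0_def[symmetric] a
      by (rule the_equality) (use assoc_class_inj[OF mch mf] in auto)
    moreover have "?ft m = a * (g / z)"
      unfolding assoc_fun_def m(2) twist[OF mf a b] chi'_def[symmetric]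
      by (rule the_equality) (use assoc_class_inj[OF mch' mf] in auto)
    moreover have "contract (euler_field A m) (omega_hat A m) W = z * top_form c p (\<lambda>j. K_dproj A m (W j))"
    proof -
      have "contract (euler_field A m) (omega_hat A m) W = snd m (\<lambda>j. K_dproj A m (W j))"
        by (rule contract_omega_hat[OF m(1) fm(1)]) (rule W)
      also have "\<dots> = z * top_form c p (\<lambda>j. K_dproj A m (W j))" unfolding z_def by (rule alt_form_top[OF fm(2) c])
      finally show ?thesis .
    qed
    ultimately show ?thesis using class_nz[OF a] mz(2) by simp
  qed
  have "tau_Omega A L s chi \<Phi> \<tau> \<sigma> p = (THE \<beta>. \<beta> \<in> alt_forms CARD('n) (tangent A p) \<and>
          (\<forall>m\<in>nonzero KX. Proj KX m = p \<longrightarrow> (\<forall>W. (\<forall>j<CARD('n). W j \<in> tangent (K_atlas A) m) \<longrightarrow>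
             \<beta> (\<lambda>j. K_dproj A m (W j)) = ?ft m * contract (euler_field A m) (omega_hat A m) W / ?fs m)))"
    unfolding tau_Omega_def Let_def using p by simp
  also have "\<dots> = (\<lambda>u. g * top_form c p u)"
  proof (rule the_equality)
    show "(\<lambda>u. g * top_form c p u) \<in> alt_forms CARD('n) (tangent A p) \<and>
          (\<forall>m\<in>nonzero KX. Proj KX m = p \<longrightarrow> (\<forall>W. (\<forall>j<CARD('n). W j \<in> tangent (K_atlas A) m) \<longrightarrow>
             g * top_form c p (\<lambda>j. K_dproj A m (W j)) = ?ft m * contract (euler_field A m) (omega_hat A m) W / ?fs m))"
      using main alt_forms_scale[OF top_form_alt] by simp
    fix \<beta>
    assume \<beta>: "\<beta> \<in> alt_forms CARD('n) (tangent A p) \<and>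
          (\<forall>m\<in>nonzero KX. Proj KX m = p \<longrightarrow> (\<forall>W. (\<forall>j<CARD('n). W j \<in> tangent (K_atlas A) m) \<longrightarrow>
             \<beta> (\<lambda>j. K_dproj A m (W j)) = ?ft m * contract (euler_field A m) (omega_hat A m) W / ?fs m))"
    then have \<beta>alt: "\<beta> \<in> alt_forms CARD('n) (tangent A p)" by blast
    define m where "m = (p, top_form c p)"
    have m: "m \<in> nonzero KX" "Proj KX m = p" "fst m = p"
      using frame_nonzero[OF top] frame_vec_Proj[OF top] by (simp_all add: m_def)
    show "\<beta> = (\<lambda>u. g * top_form c p u)"
    proof
      fix u
      show "\<beta> u = g * top_form c p u"
      proof (cases "\<forall>j<CARD('n). u j \<in> tangent A p")
        case True
        then have "\<forall>j. \<exists>W. j < CARD('n) \<longrightarrow> W \<in> tangent (K_atlas A) m \<and> K_dproj A m W = u j"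
          using K_dproj_surj[OF m(1,3)] by blast
        then obtain W where W: "\<And>j. j < CARD('n) \<Longrightarrow> W j \<in> tangent (K_atlas A) m \<and> K_dproj A m (W j) = u j" by metis
        have "\<beta> u = \<beta> (\<lambda>j. K_dproj A m (W j))" by (rule alt_forms_cong[OF \<beta>alt]) (simp add: W)
        also have "\<dots> = ?ft m * contract (euler_field A m) (omega_hat A m) W / ?fs m" using \<beta> m W by blast
        also have "\<dots> = g * top_form c p (\<lambda>j. K_dproj A m (W j))" by (rule main[OF m(1,2)]) (use W in blast)
        also have "top_form c p (\<lambda>j. K_dproj A m (W j)) = top_form c p u" by (rule alt_forms_cong[OF top_form_alt]) (simp add: W)
        finally show ?thesis .
      next
        case False
        then obtain j where j: "j < CARD('n)" "u j \<notin> tangent A p" by blast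
        show ?thesis
          by (simp only: alt_forms_outside[OF \<beta>alt, where i=j and u=u, OF j]
              alt_forms_outside[OF top_form_alt, where i=j and u=u, OF j] mult_zero_right)
      qed
    qed
  qed
  finally show ?thesis by (simp add: g_def)
qed

lemma tau_Omega_local:
  assumes ch: "holo_character chi" and iso: "line_bundle_iso A TL (assoc_bundle KX chi) \<Phi>"
    and \<sigma>: "\<sigma> \<in> Vstar A L s" and \<tau>: "\<tau> \<in> H0 A (LK A L s)"
    and p: "p \<notin> polar_divisor L s \<sigma>" and c: "c \<in> A" "p \<in> fst c"
    and e: "\<And>i. i < s \<Longrightarrow> frame_vec (L i) p (e i p)"
  shows "tau_Omega A L s chi \<Phi> \<tau> \<sigma> p =
    (\<lambda>u. lkcoeff \<tau> e c p / (\<Prod>i<s. ratio (L i) (\<sigma> i p) (e i p)) * top_form c p u)"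
proof -
  have "lkcoeff \<tau> \<sigma> c p = lkcoeff \<tau> e c p / (\<Prod>i<s. ratio (L i) (\<sigma> i p) (e i p))"
    by (rule lkcoeff_section[where e=e and \<tau>=\<tau> and p=p and c=c and \<sigma>=\<sigma>, OF \<sigma> p e c H0_fiber[OF \<tau>]])
  then show ?thesis
    unfolding tau_Omega_eq[where \<tau>=\<tau> and p=p and c=c and \<sigma>=\<sigma>, OF ch iso \<sigma> H0_fiber[OF \<tau>] p c] by simp
qed

lemma local_frames_hol:
  assumes \<tau>: "\<tau> \<in> H0 A (LK A L s)" and c: "c \<in> A" and e: "\<And>i. i < s \<Longrightarrow> local_frame A (L i) (fst c) (e i)"
    and p: "p \<in> fst c"
  shows "hol_at (lkcoeff \<tau> e c) p"
  by (rule lkcoeff_hol[OF \<tau> _ c p]) (use e p in \<open>auto simp: frames_at_def\<close>)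

lemma tau_Omega_polar_forms:
  assumes ch: "holo_character chi" and iso: "line_bundle_iso A TL (assoc_bundle KX chi) \<Phi>"
    and \<sigma>: "\<sigma> \<in> Vstar A L s" and \<tau>: "\<tau> \<in> H0 A (LK A L s)"
  shows "tau_Omega A L s chi \<Phi> \<tau> \<sigma> \<in> polar_forms A L s \<sigma>"
  unfolding polar_forms_def
proof (intro CollectI conjI ballI allI impI)
  show "tau_Omega A L s chi \<Phi> \<tau> \<sigma> p = (\<lambda>_. 0)" if "p \<in> polar_divisor L s \<sigma>" for p
    using that by (simp add: tau_Omega_def Let_def)
  fix c e assume c: "c \<in> A" and e: "\<forall>i<s. local_frame A (L i) (fst c) (e i)"
  show "\<exists>g. holo_fun A (fst c) g \<and> (\<forall>p\<in>fst c - polar_divisor L s \<sigma>. tau_Omega A L s chi \<Phi> \<tau> \<sigma> p =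
     (\<lambda>u. g p / (\<Prod>i<s. ratio (L i) (\<sigma> i p) (e i p)) * top_form c p u))"
  proof (intro exI[of _ "lkcoeff \<tau> e c"] conjI ballI)
    show "holo_fun A (fst c) (lkcoeff \<tau> e c)"
      unfolding holo_fun_iff[OF chart_open(1)[OF c]] using local_frames_hol[OF \<tau> c] e by blast
    show "tau_Omega A L s chi \<Phi> \<tau> \<sigma> p = (\<lambda>u. lkcoeff \<tau> e c p / (\<Prod>i<s. ratio (L i) (\<sigma> i p) (e i p)) * top_form c p u)"
      if "p \<in> fst c - polar_divisor L s \<sigma>" for p
      by (rule tau_Omega_local[where e=e and p=p and c=c and \<tau>=\<tau> and \<sigma>=\<sigma>, OF ch iso \<sigma> \<tau> _ c]) (use that e local_frame_frame_vec[OF L_bundle] in auto)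
  qed
qed

lemma special_polar_iff:
  assumes \<sigma>: "\<sigma> \<in> Vstar A L s" and sp: "special \<sigma> c e p" and q: "q \<in> fst c"
  shows "q \<in> polar_divisor L s \<sigma> \<longleftrightarrow> (\<exists>i<s. snd c q $ coord i = 0)"
  using polar_divisor_iff[OF \<sigma> special_frames[OF sp q]] special_sect[OF sp q] by auto

text \<open>The coefficient of a polar form is seen only off the polar divisor. Approach p along the
  diagonal direction (1, ..., 1): there the first s coordinates equal t \<noteq> 0, so f and g
  agree, and continuity gives equality at p.\<close>

lemma special_coefficient_unique:
  assumes \<sigma>: "\<sigma> \<in> Vstar A L s" and p: "p \<in> Yset L s \<sigma>" and sp: "special \<sigma> c e p"
    and f: "hol_at f p" and g: "hol_at g p"
    and eq: "\<And>q. q \<in> fst c - polar_divisor L s \<sigma> \<Longrightarrow> f q = g q"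
  shows "f p = (g p :: complex)"
proof -
  note c = special_chart[OF sp]
  define b :: "'n cvec" where "b = (\<chi> i. 1)"
  define l where "l = (\<lambda>t::complex. snd c p + t *c b)"
  have l0: "l 0 = snd c p" by (simp add: l_def cscale_zero_left)
  have cl: "isCont l 0" unfolding l_def
    by (intro continuous_intros linear_continuous_at bounded_linear_cscale_left)
  have zero: "snd c p $ coord i = 0" if "i < s" for i
    using Yset_iff[OF \<sigma> special_frames[OF sp c(2)]] p that special_sect[OF sp c(2) that] by auto
  have lim: "((\<lambda>t. h (cinv c (l t))) \<longlongrightarrow> h p) (at 0)" if h: "hol_at h p" for h :: "'x \<Rightarrow> complex"
  proof -
    have "isCont (h \<circ> cinv c) (l 0)" unfolding l0 by (rule holo_at_isCont[OF hol_at_chart[OF h c]])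
    from isCont_o2[OF cl this] have "isCont (\<lambda>t. (h \<circ> cinv c) (l t)) 0" .
    then have "((\<lambda>t. (h \<circ> cinv c) (l t)) \<longlongrightarrow> (h \<circ> cinv c) (l 0)) (at 0)" unfolding isCont_def .
    then show ?thesis by (simp add: l0 chart_cinv[OF c])
  qed
  have "open (snd c ` fst c)" "l 0 \<in> snd c ` fst c" using chart_open(2)[OF c(1)] c(2) l0 by auto
  then have "\<forall>\<^sub>F t in at 0. l t \<in> snd c ` fst c"
    using cl unfolding isCont_def by (rule topological_tendstoD[rotated])
  moreover have "\<forall>\<^sub>F t::complex in at 0. t \<noteq> 0" by (simp add: eventually_at_filter)
  ultimately have "\<forall>\<^sub>F t in at 0. f (cinv c (l t)) = g (cinv c (l t))"
  proof eventually_elim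
    case (elim t)
    note q = cinv_chart[OF elim(1)]
    have "snd c (cinv c (l t)) $ coord i = t" if "i < s" for i
      using q zero[OF that] by (simp add: l_def b_def cscale_complex)
    then have "cinv c (l t) \<notin> polar_divisor L s \<sigma>" using special_polar_iff[OF \<sigma> sp] q elim(2) by auto
    then show ?case using eq q by blast
  qed
  then have "((\<lambda>t. g (cinv c (l t))) \<longlongrightarrow> f p) (at 0)" by (rule Lim_transform_eventually[OF lim[OF f]])
  then show ?thesis using lim[OF g] by (intro tendsto_unique[of "at (0::complex)"]) auto
qed

lemma local_equation_special:
  assumes c: "c \<in> A" "p \<in> fst c" and eq: "\<forall>i<s. local_equation A (L i) (\<sigma> i) (fst c) (\<lambda>p. snd c p $ coord i)"
  shows "\<exists>e. special \<sigma> c e p"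
proof -
  have "\<forall>i. \<exists>e. i < s \<longrightarrow> local_frame A (L i) (fst c) e \<and> (\<forall>q\<in>fst c. \<sigma> i q = Smul (L i) (snd c q $ coord i) (e q))"
    using eq unfolding local_equation_def by blast
  then obtain e where "\<And>i. i < s \<Longrightarrow> local_frame A (L i) (fst c) (e i) \<and> (\<forall>q\<in>fst c. \<sigma> i q = Smul (L i) (snd c q $ coord i) (e i q))"
    by metis
  then have "special \<sigma> c e p" using c by (simp add: special_def)
  then show ?thesis by blast
qed

text \<open>\<open>Res\<close> is a definite description. For existence, admissible data on a chart
  that meets Y are special data, where the coefficient of the polar form is that of \<tau>. For
  uniqueness, special data exist at each point of Y, and both sides vanish off Y.\<close>

lemma R_at_eq_Res:
  assumes ch: "holo_character chi" and iso: "line_bundle_iso A TL (assoc_bundle KX chi) \<Phi>"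
    and \<sigma>: "\<sigma> \<in> Bset A L s" and \<tau>: "\<tau> \<in> H0 A (LK A L s)"
  shows "Res A L s \<sigma> (tau_Omega A L s chi \<Phi> \<tau> \<sigma>) = R_at A L s \<sigma> \<tau>"
proof -
  let ?\<beta> = "tau_Omega A L s chi \<Phi> \<tau> \<sigma>"
  note \<sigma>V = Bset_Vstar[OF \<sigma>]
  have \<beta>: "?\<beta> q = (\<lambda>u. lkcoeff \<tau> e c q / (\<Prod>i<s. snd c q $ coord i) * top_form c q u)"
    if sp: "special \<sigma> c e p" and q: "q \<in> fst c" "q \<notin> polar_divisor L s \<sigma>" for c e p q
  proof -
    have fr: "frames_at e q" by (rule special_frames[OF sp q(1)])
    have "(\<Prod>i<s. ratio (L i) (\<sigma> i q) (e i q)) = (\<Prod>i<s. snd c q $ coord i)"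
      by (rule prod.cong) (use special_sect[OF sp q(1)] in \<open>auto simp: sect_def\<close>)
    then show ?thesis
      using tau_Omega_local[where e=e and p=q and c=c and \<tau>=\<tau> and \<sigma>=\<sigma>, OF ch iso \<sigma>V \<tau> q(2) special_chart(1)[OF sp] q(1) frames_at_vec[OF fr]] by simp
  qed
  let ?P = "\<lambda>r. r \<in> H0KY A L s \<sigma> \<and>
     (\<forall>(U, z)\<in>A. \<forall>g. (\<forall>i<s. local_equation A (L i) (\<sigma> i) U (\<lambda>p. z p $ coord i)) \<and> holo_fun A U g \<and>
        (\<forall>p\<in>U - polar_divisor L s \<sigma>. ?\<beta> p =
           (\<lambda>u. g p / (\<Prod>i<s. z p $ coord i) * coord_form (U, z) (tangent A p) 0 CARD('n) u)) \<longrightarrow>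
        (\<forall>p\<in>U \<inter> Yset L s \<sigma>. r p = (\<lambda>u. g p * coord_form (U, z) (tangentY A L s \<sigma> p) s (CARD('n) - s) u)))"
  have PD: "r p = (\<lambda>u. g p * coord_form c (tangentY A L s \<sigma> p) s (CARD('n) - s) u)"
    if "?P r" "c \<in> A" "\<forall>i<s. local_equation A (L i) (\<sigma> i) (fst c) (\<lambda>p. snd c p $ coord i)" "holo_fun A (fst c) g"
      "\<forall>p\<in>fst c - polar_divisor L s \<sigma>. ?\<beta> p = (\<lambda>u. g p / (\<Prod>i<s. snd c p $ coord i) * top_form c p u)"
      "p \<in> fst c" "p \<in> Yset L s \<sigma>" for r c g p
    using that by (cases c) auto
  have PR: "?P (R_at A L s \<sigma> \<tau>)"
  proof (intro conjI ballI)
    show "R_at A L s \<sigma> \<tau> \<in> H0KY A L s \<sigma>" by (rule R_at_H0KY[OF \<sigma> \<tau>])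
    fix c assume cA: "c \<in> A"
    have "R_at A L s \<sigma> \<tau> p = (\<lambda>u. g p * coord_form c (tangentY A L s \<sigma> p) s (CARD('n) - s) u)"
      if le: "\<forall>i<s. local_equation A (L i) (\<sigma> i) (fst c) (\<lambda>p. snd c p $ coord i)" and g: "holo_fun A (fst c) g"
        and b: "\<forall>p\<in>fst c - polar_divisor L s \<sigma>. ?\<beta> p = (\<lambda>u. g p / (\<Prod>i<s. snd c p $ coord i) * top_form c p u)"
        and p: "p \<in> fst c" "p \<in> Yset L s \<sigma>" for g p
    proof -
      obtain e where sp: "special \<sigma> c e p" using local_equation_special[OF cA p(1) le] by blast
      have "lkcoeff \<tau> e c p = g p"
      proof (rule special_coefficient_unique[OF \<sigma>V p(2) sp])
        show "hol_at (lkcoeff \<tau> e c) p" by (rule lkcoeff_hol[OF \<tau> special_frames[OF sp p(1)] cA p(1)])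
        show "hol_at g p" using g p(1) unfolding holo_fun_iff[OF chart_open(1)[OF cA]] by blast
        fix q assume q: "q \<in> fst c - polar_divisor L s \<sigma>"
        have nz: "(\<Prod>i<s. snd c q $ coord i) \<noteq> 0" using special_polar_iff[OF \<sigma>V sp, of q] q by auto
        have "(\<lambda>u. lkcoeff \<tau> e c q / (\<Prod>i<s. snd c q $ coord i) * top_form c q u) =
            (\<lambda>u. g q / (\<Prod>i<s. snd c q $ coord i) * top_form c q u)"
          using \<beta>[OF sp, of q] b[rule_format, OF q] q by simp
        from fun_cong[OF this, of "\<lambda>j. coord_vec A c j q"] show "lkcoeff \<tau> e c q = g q"
          using nz q by (simp add: top_form_basis[OF cA])
      qed
      then show ?thesis
        using R_at_special[where \<tau>=\<tau>, OF \<sigma>V p(2) H0_fiber[OF \<tau>] sp] by simp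
    qed
    then show "case c of (U, z) \<Rightarrow> \<forall>g. (\<forall>i<s. local_equation A (L i) (\<sigma> i) U (\<lambda>p. z p $ coord i)) \<and> holo_fun A U g \<and>
        (\<forall>p\<in>U - polar_divisor L s \<sigma>. ?\<beta> p =
           (\<lambda>u. g p / (\<Prod>i<s. z p $ coord i) * coord_form (U, z) (tangent A p) 0 CARD('n) u)) \<longrightarrow>
        (\<forall>p\<in>U \<inter> Yset L s \<sigma>. R_at A L s \<sigma> \<tau> p = (\<lambda>u. g p * coord_form (U, z) (tangentY A L s \<sigma> p) s (CARD('n) - s) u))"
      by (cases c) auto
  qed
  show ?thesis
    unfolding Res_def
  proof (rule the_equality, rule PR)
    fix r assume r: "?P r"
    show "r = R_at A L s \<sigma> \<tau>"
    proof
      fix p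
      show "r p = R_at A L s \<sigma> \<tau> p"
      proof (cases "p \<in> Yset L s \<sigma>")
        case True
        obtain c e where sp: "special \<sigma> c e p" using special_exists[OF \<sigma> True] by blast
        note c = special_chart[OF sp]
        have lf: "\<And>i. i < s \<Longrightarrow> local_frame A (L i) (fst c) (e i)" using sp by (simp add: special_def)
        have "r p = (\<lambda>u. lkcoeff \<tau> e c p * coord_form c (tangentY A L s \<sigma> p) s (CARD('n) - s) u)"
        proof (rule PD[OF r c(1) _ _ _ c(2) True])
          show "\<forall>i<s. local_equation A (L i) (\<sigma> i) (fst c) (\<lambda>p. snd c p $ coord i)"
            using sp unfolding special_def local_equation_def by blast
          show "holo_fun A (fst c) (lkcoeff \<tau> e c)"
            unfolding holo_fun_iff[OF chart_open(1)[OF c(1)]] using local_frames_hol[OF \<tau> c(1) lf] by blast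
          show "\<forall>p\<in>fst c - polar_divisor L s \<sigma>. ?\<beta> p = (\<lambda>u. lkcoeff \<tau> e c p / (\<Prod>i<s. snd c p $ coord i) * top_form c p u)"
            using \<beta>[OF sp] by blast
        qed
        then show ?thesis using R_at_special[where \<tau>=\<tau>, OF \<sigma>V True H0_fiber[OF \<tau>] sp] by simp
      next
        case False
        have "r \<in> H0KY A L s \<sigma>" using r by blast
        then show ?thesis using False by (simp add: H0KY_def R_at_def)
      qed
    qed
  qed
qed

end

section \<open>Equivariance\<close>

text \<open>The chart carried along by a bijection g: domain g(U), coordinates those of the
  preimage. Between a chart and its moved copy g is the identity in coordinates, so coordinates of
  points and components of vectors do not change.\<close>

definition move_chart :: "('x \<Rightarrow> 'x) \<Rightarrow> ('x, 'e) chart \<Rightarrow> ('x, 'e) chart" where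
  "move_chart g c = (inv g -` fst c, snd c \<circ> inv g)"

lemma move_chart_simps [simp]:
  "fst (move_chart g c) = inv g -` fst c" "snd (move_chart g c) q = snd c (inv g q)"
  by (simp_all add: move_chart_def)

lemma push_vec_inv_component: "push_vec (inv g) v c = v (move_chart g c)"
  by (simp add: push_vec_def move_chart_def split_def)

lemma push_vec_component: "bij g \<Longrightarrow> push_vec g v c = v (move_chart (inv g) c)"
  using push_vec_inv_component[of "inv g" v c] by (simp add: inv_inv_eq)

lemma move_move_chart:
  assumes "bij g"
  shows "move_chart g (move_chart (inv g) c) = c" "move_chart (inv g) (move_chart g c) = c"
proof -
  have [simp]: "inv (inv g) = g" "g (inv g q) = q" "inv g (g q) = q" for q
    using assms by (simp_all add: inv_inv_eq bij_is_inj bij_is_surj surj_f_inv_f)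
  show "move_chart g (move_chart (inv g) c) = c" "move_chart (inv g) (move_chart g c) = c"
    by (cases c; simp add: move_chart_def vimage_def comp_def)+
qed

lemma push_vec_push_vec:
  assumes "bij g"
  shows "push_vec g (push_vec (inv g) v) = v" "push_vec (inv g) (push_vec g v) = v"
  by (rule ext, simp only: push_vec_inv_component push_vec_component[OF assms] move_move_chart[OF assms])+

lemma push_form_coord_form:
  assumes "\<And>v. push_vec (inv g) v \<in> T \<longleftrightarrow> v \<in> T'"
  shows "push_form g (coord_form c T m k) = coord_form (move_chart g c) T' m k"
  by (rule ext) (auto simp: push_form_def coord_form_def assms push_vec_inv_component)

lemma Aut_bij: "g \<in> Aut A \<Longrightarrow> bij g"
  by (simp add: Aut_def)

lemma Aut_inv: "g \<in> Aut A \<Longrightarrow> inv g \<in> Aut A"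
  by (simp add: Aut_def bij_imp_bij_inv inv_inv_eq)

context cmfd
begin

lemma Aut_chart_domain:
  assumes g: "g \<in> Aut A" and c: "c \<in> A" and c0: "c0 \<in> A"
  shows "open (snd c0 ` (fst c0 \<inter> g -` fst c))" "holo (snd c \<circ> g \<circ> cinv c0) (snd c0 ` (fst c0 \<inter> g -` fst c))"
proof -
  have "mholo A A UNIV g" using g by (simp add: Aut_def)
  then show "open (snd c0 ` (fst c0 \<inter> g -` fst c))" "holo (snd c \<circ> g \<circ> cinv c0) (snd c0 ` (fst c0 \<inter> g -` fst c))"
    using c c0 by (auto simp: mholo_def split_def)
qed

lemma Aut_hol:
  assumes g: "g \<in> Aut A" and c: "c \<in> A" "g p \<in> fst c"
  shows "hol_at (\<lambda>q. snd c (g q)) p"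
proof -
  obtain c0 where c0: "c0 \<in> A" "p \<in> fst c0" using chart_cover by blast
  have "holo_at (snd c \<circ> g \<circ> cinv c0) (snd c0 p)"
    using Aut_chart_domain[OF g c(1) c0(1)] holo_on_open c c0 by blast
  then show ?thesis by (intro hol_atI[OF c0]) (simp add: comp_def)
qed

lemma Aut_open:
  assumes g: "g \<in> Aut A" and W: "open W"
  shows "open (g -` W)"
proof (subst open_subopen, rule ballI)
  fix p assume p: "p \<in> g -` W"
  obtain c where c: "c \<in> A" "g p \<in> fst c" using chart_cover by blast
  obtain c0 where c0: "c0 \<in> A" "p \<in> fst c0" using chart_cover by blast
  let ?c = "(fst c \<inter> W, snd c)"
  have op: "open (snd c0 ` (fst c0 \<inter> g -` (fst c \<inter> W)))"
    using Aut_chart_domain(1)[OF g chart_restrict[OF c(1) W] c0(1)] by simp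
  have "open (fst c0 \<inter> snd c0 -` (snd c0 ` (fst c0 \<inter> g -` (fst c \<inter> W))))"
    using continuous_open_preimage[OF chart_continuous chart_open(1) op] c0(1) by blast
  moreover have "fst c0 \<inter> snd c0 -` (snd c0 ` (fst c0 \<inter> g -` (fst c \<inter> W))) = fst c0 \<inter> g -` (fst c \<inter> W)"
    using chart_inj[OF c0(1)] by (auto simp: inj_on_def)
  ultimately show "\<exists>T. open T \<and> p \<in> T \<and> T \<subseteq> g -` W"
    using p c c0 by (intro exI[of _ "fst c0 \<inter> g -` (fst c \<inter> W)"]) auto
qed

lemma hol_at_Aut:
  assumes g: "g \<in> Aut A" and f: "hol_at f (g p)"
  shows "hol_at (\<lambda>q. f (g q)) p"
proof -
  obtain c where c: "c \<in> A" "g p \<in> fst c" using chart_cover by blast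
  have "hol_at (\<lambda>q. (f \<circ> cinv c) (snd c (g q))) p"
    by (rule hol_at_compose[OF Aut_hol[OF g c]]) (rule hol_at_chart[OF f c])
  then show ?thesis
  proof (rule hol_at_cong)
    show "\<forall>\<^sub>F q in nhds p. (f \<circ> cinv c) (snd c (g q)) = f (g q)"
      using eventually_in[OF Aut_open[OF g chart_open(1)[OF c(1)]], of p] c
      by (auto elim!: eventually_mono simp: chart_cinv)
  qed
qed

text \<open>The moved domain may stretch over several chart domains, so the claim is made local by
  \<open>chart_local\<close>; on the part V inside the domain of one chart c0, \<open>chartI\<close>
  applies by holomorphy of g and its inverse.\<close>

lemma move_chart_in:
  assumes g: "g \<in> Aut A" and c: "c \<in> A"
  shows "move_chart g c \<in> A"
  unfolding move_chart_def
proof (rule chart_local)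
  have bij: "bij (inv g)" using Aut_bij[OF Aut_inv[OF g]] .
  show "open (inv g -` fst c)" by (rule Aut_open[OF Aut_inv[OF g] chart_open(1)[OF c]])
  show inj: "inj_on (snd c \<circ> inv g) (inv g -` fst c)"
    using chart_inj[OF c] bij_is_inj[OF bij] by (auto simp: inj_on_def)
  fix p assume p: "p \<in> inv g -` fst c"
  obtain c0 where c0: "c0 \<in> A" "p \<in> fst c0" using chart_cover by blast
  define V where "V = fst c0 \<inter> inv g -` fst c"
  have gi: "inv g (g q) = q" "g (inv g q) = q" for q
    using Aut_bij[OF g] by (simp_all add: bij_is_inj bij_is_surj surj_f_inv_f)
  have injV: "inj_on (snd c \<circ> inv g) V" using inj by (rule inj_on_subset) (auto simp: V_def)
  have img: "(snd c \<circ> inv g) ` V = snd c ` (fst c \<inter> g -` fst c0)"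
  proof
    show "(snd c \<circ> inv g) ` V \<subseteq> snd c ` (fst c \<inter> g -` fst c0)" by (auto simp: V_def gi)
    show "snd c ` (fst c \<inter> g -` fst c0) \<subseteq> (snd c \<circ> inv g) ` V"
    proof
      fix w assume "w \<in> snd c ` (fst c \<inter> g -` fst c0)"
      then obtain q where "q \<in> fst c" "g q \<in> fst c0" "w = snd c q" by blast
      then have "g q \<in> V" "w = (snd c \<circ> inv g) (g q)" by (simp_all add: V_def gi)
      then show "w \<in> (snd c \<circ> inv g) ` V" by blast
    qed
  qed
  have op: "open (snd c ` (fst c \<inter> g -` fst c0))"
    by (rule chart_open_image[OF c Aut_open[OF g chart_open(1)[OF c0(1)]]])
  have "(V, snd c \<circ> inv g) \<in> A"
  proof (rule chartI[OF c0(1)])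
    show "open V" unfolding V_def using chart_open(1)[OF c0(1)] Aut_open[OF Aut_inv[OF g] chart_open(1)[OF c]] by blast
    show "V \<subseteq> fst c0" by (auto simp: V_def)
    show "inj_on (snd c \<circ> inv g) V" by fact
    show "open ((snd c \<circ> inv g) ` V)" unfolding img by (rule op)
    show "hol_at (snd c \<circ> inv g) q" if "q \<in> V" for q
      using Aut_hol[OF Aut_inv[OF g] c] that by (simp add: V_def comp_def)
    fix w assume "w \<in> (snd c \<circ> inv g) ` V"
    then have w: "w \<in> snd c ` (fst c \<inter> g -` fst c0)" unfolding img .
    then obtain q where q: "q \<in> fst c" "g q \<in> fst c0" "w = snd c q" by blast
    have "holo_at ((\<lambda>q. snd c0 (g q)) \<circ> cinv c) w"
      unfolding q(3) by (rule hol_at_chart[OF Aut_hol[OF g c0(1) q(2)] c q(1)])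
    then show "holo_at (snd c0 \<circ> inv_into V (snd c \<circ> inv g)) w"
    proof (rule holo_at_cong[rotated])
      show "\<forall>\<^sub>F w in nhds w. ((\<lambda>q. snd c0 (g q)) \<circ> cinv c) w = (snd c0 \<circ> inv_into V (snd c \<circ> inv g)) w"
        unfolding eventually_nhds
      proof (intro exI[of _ "snd c ` (fst c \<inter> g -` fst c0)"] conjI ballI op w)
        fix w assume "w \<in> snd c ` (fst c \<inter> g -` fst c0)"
        then obtain q where q: "q \<in> fst c" "g q \<in> fst c0" "w = snd c q" by blast
        have "inv_into V (snd c \<circ> inv g) ((snd c \<circ> inv g) (g q)) = g q"
          by (rule inv_into_f_f[OF injV]) (use q in \<open>simp add: V_def gi\<close>)
        then show "((\<lambda>q. snd c0 (g q)) \<circ> cinv c) w = (snd c0 \<circ> inv_into V (snd c \<circ> inv g)) w"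
          using q by (simp add: gi chart_cinv[OF c])
      qed
    qed
  qed
  then show "\<exists>V. p \<in> V \<and> V \<subseteq> inv g -` fst c \<and> (V, snd c \<circ> inv g) \<in> A"
    using c0 p by (intro exI[of _ V]) (simp add: V_def)
qed

lemma move_chart_in_iff: "g \<in> Aut A \<Longrightarrow> move_chart g c \<in> A \<longleftrightarrow> c \<in> A"
  using move_chart_in[of g c] move_chart_in[OF Aut_inv, of g "move_chart g c"] move_move_chart(2)[OF Aut_bij] by metis

lemma transition_move_chart:
  assumes g: "g \<in> Aut A" and c: "c \<in> A" "p \<in> fst c"
  shows "frechet_derivative (transition (move_chart g c) (move_chart g c')) (at (snd c p)) =
    frechet_derivative (transition c c') (at (snd c p))"
proof (rule frechet_derivative_cong)
  have gi: "inv g (g q) = q" "g (inv g q) = q" for q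
    using Aut_bij[OF g] by (simp_all add: bij_is_inj bij_is_surj surj_f_inv_f)
  show "\<forall>\<^sub>F w in nhds (snd c p). transition (move_chart g c) (move_chart g c') w = transition c c' w"
    unfolding eventually_nhds
  proof (intro exI[of _ "snd c ` fst c"] conjI ballI)
    show "open (snd c ` fst c)" by (rule chart_open(2)[OF c(1)])
    show "snd c p \<in> snd c ` fst c" using c by blast
    fix w assume "w \<in> snd c ` fst c"
    then obtain q where q: "q \<in> fst c" "w = snd c q" by blast
    have "cinv (move_chart g c) (snd (move_chart g c) (g q)) = g q"
      by (rule chart_cinv[OF move_chart_in[OF g c(1)]]) (simp add: gi q)
    then show "transition (move_chart g c) (move_chart g c') w = transition c c' w"
      using q by (simp add: transition_def gi chart_cinv[OF c(1)])
  qed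
qed

lemma push_vec_tangent:
  assumes g: "g \<in> Aut A" and v: "v \<in> tangent A (g p)"
  shows "push_vec (inv g) v \<in> tangent A p"
  unfolding tangent_def
proof (intro CollectI conjI allI ballI impI)
  have gi: "inv g (g p) = p" using Aut_bij[OF g] by (simp add: bij_is_inj)
  show "push_vec (inv g) v c = 0" if "\<not> (c \<in> A \<and> p \<in> fst c)" for c
    unfolding push_vec_inv_component
    by (rule tangent_outside[OF v]) (use that in \<open>simp add: move_chart_in_iff[OF g] gi\<close>)
  fix c c' assume c: "c \<in> A" "c' \<in> A" "p \<in> fst c" "p \<in> fst c'"
  have "v (move_chart g c') = frechet_derivative (transition (move_chart g c) (move_chart g c')) (at (snd (move_chart g c) (g p))) (v (move_chart g c))"
    by (rule tangent_transition[OF v]) (use c in \<open>simp_all add: move_chart_in[OF g] gi\<close>)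
  then show "push_vec (inv g) v c' = frechet_derivative (transition c c') (at (snd c p)) (push_vec (inv g) v c)"
    by (simp add: push_vec_inv_component gi transition_move_chart[OF g c(1,3)])
qed

lemma push_vec_tangent_iff:
  assumes g: "g \<in> Aut A"
  shows "push_vec (inv g) v \<in> tangent A p \<longleftrightarrow> v \<in> tangent A (g p)"
proof
  assume "push_vec (inv g) v \<in> tangent A p"
  moreover have "inv g (g p) = p" using Aut_bij[OF g] by (simp add: bij_is_inj)
  ultimately have "push_vec (inv (inv g)) (push_vec (inv g) v) \<in> tangent A (g p)"
    by (intro push_vec_tangent[OF Aut_inv[OF g]]) simp
  then show "v \<in> tangent A (g p)" by (simp add: inv_inv_eq[OF Aut_bij[OF g]] push_vec_push_vec[OF Aut_bij[OF g]])
qed (rule push_vec_tangent[OF g])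

end

text \<open>\<open>tens_act\<close> is a description over all decompositions of a tensor. A
  decomposition of t (e \<otimes> f) consists of x e and y f with x y = t, and the image depends on
  the product x y only.\<close>

lemma tens_act_frame:
  assumes E: "has_lines E" and F: "has_lines F" and e: "frame_vec E p e" and f: "frame_vec F p f"
    and e': "frame_vec E p' e'" and f': "frame_vec F p' f'"
    and a: "\<And>x. a (Smul E x e) = Smul E x e'" and b: "\<And>y. b (Smul F y f) = Smul F y f'"
  shows "tens_act E F a b (Smul (tensor_bundle E F) t (tens E F e f)) = Smul (tensor_bundle E F) t (tens E F e' f')"
proof -
  have expand: "tens E F (Smul E x d) (Smul F y h) = Smul (tensor_bundle E F) (x * y) (tens E F d h)"
    if d: "frame_vec E q d" and h: "frame_vec F q h" for x y d h q
    using tens_frame_expand[OF E F d h frame_Smul_in[OF d] frame_Smul_in[OF h]]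
    by (simp only: ratio_Smul_frame[OF d] ratio_Smul_frame[OF h])
  have ef: "frame_vec (tensor_bundle E F) p (tens E F e f)" by (rule frame_vec_tens[OF E F e f])
  show ?thesis unfolding tens_act_def
  proof (rule the_equality, intro exI conjI)
    show "Smul E t e \<in> Tot E" by (rule fiber_Proj(2)[OF frame_Smul_in[OF e]])
    show "f \<in> fiber F (Proj E (Smul E t e))"
      using fiber_Proj(1)[OF frame_Smul_in[OF e]] frame_fiber[OF f] by simp
    show "Smul (tensor_bundle E F) t (tens E F e f) = tens E F (Smul E t e) f"
      using expand[OF e f, of t 1] frame_Smul_one[OF f] by simp
    show "Smul (tensor_bundle E F) t (tens E F e' f') = tens E F (a (Smul E t e)) (b f)"
      using expand[OF e' f', of t 1] frame_Smul_one[OF f'] b[of 1] frame_Smul_one[OF f] by (simp add: a)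
    fix w assume "\<exists>u v. u \<in> Tot E \<and> v \<in> fiber F (Proj E u) \<and>
      Smul (tensor_bundle E F) t (tens E F e f) = tens E F u v \<and> w = tens E F (a u) (b v)"
    then obtain u v where uv: "u \<in> Tot E" "v \<in> fiber F (Proj E u)"
      "Smul (tensor_bundle E F) t (tens E F e f) = tens E F u v" "w = tens E F (a u) (b v)" by blast
    have "fst (Smul (tensor_bundle E F) t (tens E F e f)) = p"
      using tens_eval(2)[OF e f] by (simp add: tensor_bundle_def)
    then have "Proj E u = p" using uv(3) fst_tens by metis
    then have "u \<in> fiber E p" "v \<in> fiber F p" using uv by (simp_all add: fiber_def)
    then obtain x y where xy: "u = Smul E x e" "v = Smul F y f"
      using fiber_frame_ex[OF e] fiber_frame_ex[OF f] by metis
    have "t = x * y" using uv(3) unfolding xy expand[OF e f] by (rule frame_inj[OF ef])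
    then show "w = Smul (tensor_bundle E F) t (tens E F e' f')" using uv(4) by (simp add: xy a b expand[OF e' f'])
  qed
qed

text \<open>Decompositions differ in the scalar c and in the factors, but c times the product r of
  the ratios is always t, and the image depends on this number only.\<close>

lemma tens_list_act_frame:
  assumes L: "\<And>i. i < s \<Longrightarrow> has_lines (L i)" and e: "\<And>i. i < s \<Longrightarrow> frame_vec (L i) p (e i)"
    and e': "\<And>i. i < s \<Longrightarrow> frame_vec (L i) (g p) (a i (e i))"
    and a: "\<And>i x. i < s \<Longrightarrow> a i (Smul (L i) x (e i)) = Smul (L i) x (a i (e i))"
  shows "tens_list_act L s g a (Smul (tensor_list_bundle L s) t (tens_list L s p e)) =
    Smul (tensor_list_bundle L s) t (tens_list L s (g p) (\<lambda>i. a i (e i)))"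
  unfolding tens_list_act_def
proof (rule the_equality)
  let ?T = "tensor_list_bundle L s"
  have fr: "frame_vec ?T p (tens_list L s p e)" by (rule frame_vec_tens_list[OF L e])
  have fr': "frame_vec ?T (g p) (tens_list L s (g p) (\<lambda>i. a i (e i)))" by (rule frame_vec_tens_list[OF L e'])
  show "\<exists>p' c u. (\<forall>i<s. u i \<in> fiber (L i) p') \<and> Smul ?T t (tens_list L s p e) = Smul ?T c (tens_list L s p' u) \<and>
      Smul ?T t (tens_list L s (g p) (\<lambda>i. a i (e i))) = Smul ?T c (tens_list L s (g p') (\<lambda>i. a i (u i)))"
    using frame_fiber[OF e] by blast
  fix w assume "\<exists>p' c u. (\<forall>i<s. u i \<in> fiber (L i) p') \<and> Smul ?T t (tens_list L s p e) = Smul ?T c (tens_list L s p' u) \<and>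
      w = Smul ?T c (tens_list L s (g p') (\<lambda>i. a i (u i)))"
  then obtain p' c u where u: "\<And>i. i < s \<Longrightarrow> u i \<in> fiber (L i) p'"
    "Smul ?T t (tens_list L s p e) = Smul ?T c (tens_list L s p' u)"
    "w = Smul ?T c (tens_list L s (g p') (\<lambda>i. a i (u i)))" by blast
  have "fst (Smul ?T x (tens_list L s q d)) = q" for x q d by (simp add: tensor_list_bundle_def fst_tens_list)
  then have p': "p' = p" using u(2) by metis
  note u = u[unfolded p']
  define r where "r = (\<Prod>i<s. ratio (L i) (u i) (e i))"
  have au: "a i (u i) = Smul (L i) (ratio (L i) (u i) (e i)) (a i (e i))" if "i < s" for i
    using a[OF that] ratio_eq[OF e u(1), OF that that] by metis
  have "Smul ?T t (tens_list L s p e) = Smul ?T (c * r) (tens_list L s p e)"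
    unfolding u(2) r_def using tens_list_expand[OF L e u(1)] frame_Smul_Smul[OF fr] by simp
  then have t: "t = c * r" by (rule frame_inj[OF fr])
  have "tens_list L s (g p) (\<lambda>i. a i (u i)) =
      Smul ?T (\<Prod>i<s. ratio (L i) (a i (u i)) (a i (e i))) (tens_list L s (g p) (\<lambda>i. a i (e i)))"
    by (rule tens_list_expand[OF L e']) (auto simp: au intro: frame_Smul_in[OF e'])
  also have "(\<Prod>i<s. ratio (L i) (a i (u i)) (a i (e i))) = r"
    unfolding r_def by (rule prod.cong) (auto simp: au ratio_Smul_frame[OF e'])
  finally show "w = Smul ?T t (tens_list L s (g p) (\<lambda>i. a i (e i)))"
    using u(3) frame_Smul_Smul[OF fr'] by (simp add: t)
qed

section \<open>The lifted action of G on sections, special data and residues\<close>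

locale equivariant_adjunction = adjunction A L s
  for A :: "('x::topological_space, 'n::{finite, linorder} cvec) chart set"
    and L :: "nat \<Rightarrow> ('x, 'l) line_bundle" and s :: nat +
  fixes G :: "('x \<Rightarrow> 'x) set" and TG :: "('x \<Rightarrow> 'x) topology"
    and AG :: "('x \<Rightarrow> 'x, 'm::complex_model) chart set"
    and \<rho> :: "nat \<Rightarrow> ('x \<Rightarrow> 'x) \<Rightarrow> 'l \<Rightarrow> 'l"
  assumes G_subgroup: "complex_lie_subgroup A G TG AG"
    and L_equivariant: "\<And>i. i < s \<Longrightarrow> equivariant_structure A G AG (L i) (\<rho> i)"
begin

lemma G_Aut: "g \<in> G \<Longrightarrow> g \<in> Aut A"
  and G_inv: "g \<in> G \<Longrightarrow> inv g \<in> G"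
  using G_subgroup by (auto simp: complex_lie_subgroup_def)

lemma G_inverse: "g \<in> G \<Longrightarrow> g (inv g q) = q" "g \<in> G \<Longrightarrow> inv g (g q) = q" "g \<in> G \<Longrightarrow> inv (inv g) = g"
  using Aut_bij[OF G_Aut] by (simp_all add: bij_is_inj bij_is_surj surj_f_inv_f inv_inv_eq)

text \<open>The lifted action is holomorphic on the product of G and the total space; a chart of G
  around g makes it possible to hold g fixed there.\<close>

lemma G_chart:
  assumes "g \<in> G"
  obtains W \<gamma> where "(W, \<gamma>) \<in> AG" "g \<in> W" "inj_on \<gamma> W"
proof -
  have TG: "topspace TG = G" "(\<Union>c\<in>AG. fst c) = topspace TG" "\<And>c. c \<in> AG \<Longrightarrow> is_chart TG c"
    using G_subgroup by (auto simp: complex_lie_subgroup_def complex_manifold_def)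
  then obtain W \<gamma> where W: "(W, \<gamma>) \<in> AG" "g \<in> W" using assms by force
  have h: "openin TG W" "homeomorphic_map (subtopology TG W) (top_of_set (\<gamma> ` W)) \<gamma>"
    using TG(3)[OF W(1)] by (simp_all add: is_chart_def)
  have "inj_on \<gamma> W"
    using homeomorphic_imp_injective_map[OF h(2)] openin_subset[OF h(1)] by (simp add: Int_absorb1)
  then show ?thesis using that W by blast
qed

lemma \<rho>_fiber: "i < s \<Longrightarrow> g \<in> G \<Longrightarrow> u \<in> fiber (L i) p \<Longrightarrow> \<rho> i g u \<in> fiber (L i) (g p)"
  using L_equivariant[of i] by (auto simp: equivariant_structure_def fiber_def)

lemma \<rho>_Smul: "i < s \<Longrightarrow> g \<in> G \<Longrightarrow> u \<in> fiber (L i) p \<Longrightarrow> \<rho> i g (Smul (L i) x u) = Smul (L i) x (\<rho> i g u)"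
  using L_equivariant[of i] by (auto simp: equivariant_structure_def fiber_def)

lemma \<rho>_inverse:
  assumes "i < s" "g \<in> G" "u \<in> fiber (L i) p"
  shows "\<rho> i g (\<rho> i (inv g) u) = u" "\<rho> i (inv g) (\<rho> i g u) = u"
proof -
  have c: "g \<circ> inv g = id" "inv g \<circ> g = id" using assms(2) by (auto simp: fun_eq_iff G_inverse)
  have u: "u \<in> Tot (L i)" using assms(3) by (simp add: fiber_def)
  have e: "\<forall>u\<in>Tot (L i). \<rho> i id u = u" "\<forall>g\<in>G. \<forall>h\<in>G. \<forall>u\<in>Tot (L i). \<rho> i (g \<circ> h) u = \<rho> i g (\<rho> i h u)"
    using L_equivariant[OF assms(1)] by (simp_all add: equivariant_structure_def)
  have "\<rho> i (g \<circ> inv g) u = \<rho> i g (\<rho> i (inv g) u)" "\<rho> i (inv g \<circ> g) u = \<rho> i (inv g) (\<rho> i g u)"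
    using e(2) u assms(2) G_inv by blast+
  then show "\<rho> i g (\<rho> i (inv g) u) = u" "\<rho> i (inv g) (\<rho> i g u) = u" using e(1) u by (simp_all add: c)
qed

lemma \<rho>_nonzero_iff:
  assumes i: "i < s" and g: "g \<in> G" and u: "u \<in> fiber (L i) p"
  shows "\<rho> i g u \<in> nonzero (L i) \<longleftrightarrow> u \<in> nonzero (L i)"
proof -
  obtain e where e: "frame_vec (L i) p e" using L_lines[OF i] by (auto simp: has_lines_def)
  have 0: "Smul (L i) 0 u \<in> fiber (L i) p" by (rule fiber_Smul_in[OF e u])
  have "\<rho> i g (Smul (L i) 0 u) = \<rho> i g u \<longleftrightarrow> Smul (L i) 0 u = u"
    using \<rho>_inverse(2)[OF i g u] \<rho>_inverse(2)[OF i g 0] by metis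
  then show ?thesis
    using u \<rho>_fiber[OF i g u] \<rho>_Smul[OF i g u] by (auto simp: nonzero_def fiber_def)
qed

lemma \<rho>_frame:
  assumes i: "i < s" and g: "g \<in> G" and e: "frame_vec (L i) p e"
  shows "frame_vec (L i) (g p) (\<rho> i g e)"
proof (rule has_lines_frame[OF L_lines[OF i]])
  show "\<rho> i g e \<in> nonzero (L i)" using \<rho>_nonzero_iff[OF i g frame_fiber[OF e]] frame_nonzero[OF e] by simp
  show "Proj (L i) (\<rho> i g e) = g p" by (rule fiber_Proj(1)[OF \<rho>_fiber[OF i g frame_fiber[OF e]]])
qed

text \<open>In product charts q goes to the constant coordinate of g together with the coordinates
  of \<open>\<sigma> q\<close>, which is holomorphic; following this by the action in charts and
  taking the fiber coordinate gives the ratio.\<close>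

lemma \<rho>_hol:
  assumes i: "i < s" and g: "g \<in> G" and \<sigma>: "holo_section A (L i) W \<sigma>" and W: "open W" "p \<in> W"
    and e': "(U', e') \<in> Frames (L i)" "g p \<in> U'"
  shows "hol_at (\<lambda>q. ratio (L i) (\<rho> i g (\<sigma> q)) (e' (g q))) p"
proof -
  let ?E = "L i"
  obtain c where c: "c \<in> A" "p \<in> fst c" using chart_cover by blast
  obtain c' where c': "c' \<in> A" "g p \<in> fst c'" using chart_cover by blast
  obtain V e where e: "(V, e) \<in> Frames ?E" "p \<in> V" using bundle_cover[OF L_bundle[OF i]] by blast
  obtain N \<gamma> where \<gamma>: "(N, \<gamma>) \<in> AG" "g \<in> N" "inj_on \<gamma> N" by (rule G_chart[OF g])
  define D where "D = {u \<in> Tot ?E. Proj ?E u \<in> fst c \<inter> V}"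
  define \<psi> where "\<psi> = (\<lambda>u. (ratio ?E u (e (Proj ?E u)), snd c (Proj ?E u)))"
  define D' where "D' = {u \<in> Tot ?E. Proj ?E u \<in> fst c' \<inter> U'}"
  define \<psi>' where "\<psi>' = (\<lambda>u. (ratio ?E u (e' (Proj ?E u)), snd c' (Proj ?E u)))"
  define F where "F = (\<lambda>(h, u). \<rho> i h u)"
  define \<Gamma> where "\<Gamma> = (\<lambda>(h, u). (\<gamma> h, \<psi> u))"
  have "(D, \<psi>) \<in> total_atlas A ?E"
    unfolding total_atlas_def D_def \<psi>_def using c(1) e(1) by (cases c) auto
  then have C: "(N \<times> D, \<Gamma>) \<in> prod_atlas AG (total_atlas A ?E)"
    unfolding prod_atlas_def \<Gamma>_def using \<gamma>(1) by blast
  have C': "(D', \<psi>') \<in> total_atlas A ?E"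
    unfolding total_atlas_def D'_def \<psi>'_def using c'(1) e'(1) by (cases c') auto
  have "mholo (prod_atlas AG (total_atlas A ?E)) (total_atlas A ?E) (G \<times> Tot ?E) F"
    using L_equivariant[OF i] by (simp add: equivariant_structure_def F_def)
  then have hol: "open (\<Gamma> ` ((N \<times> D) \<inter> (G \<times> Tot ?E) \<inter> F -` D'))"
    "holo (\<psi>' \<circ> F \<circ> inv_into (N \<times> D) \<Gamma>) (\<Gamma> ` ((N \<times> D) \<inter> (G \<times> Tot ?E) \<inter> F -` D'))"
    using C C' unfolding mholo_def by fastforce+
  have inj\<psi>: "inj_on \<psi> D"
  proof (rule inj_onI)
    fix u v assume u: "u \<in> D" "v \<in> D" "\<psi> u = \<psi> v"
    have P: "Proj ?E u = Proj ?E v" using u chart_inj[OF c(1)] by (auto simp: D_def \<psi>_def inj_on_def)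
    have f: "frame_vec ?E (Proj ?E u) (e (Proj ?E u))"
      by (rule bundle_frame(2)[OF L_bundle[OF i] e(1)]) (use u in \<open>simp add: D_def\<close>)
    have "u = Smul ?E (ratio ?E u (e (Proj ?E u))) (e (Proj ?E u))"
      "v = Smul ?E (ratio ?E v (e (Proj ?E u))) (e (Proj ?E u))"
      by (rule ratio_eq[OF f], use u P in \<open>simp add: D_def fiber_def\<close>)+
    then show "u = v" using u(3) P by (simp add: \<psi>_def)
  qed
  have inj: "inj_on \<Gamma> (N \<times> D)"
    using \<gamma>(3) inj\<psi> by (auto simp: inj_on_def \<Gamma>_def)
  \<comment> \<open>The neighbourhood of p on which \<open>\<sigma> q\<close> and its image under g
    stay inside the two bundle charts.\<close>
  define W' where "W' = W \<inter> fst c \<inter> V \<inter> g -` (fst c' \<inter> U')"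
  have W': "open W'" "p \<in> W'"
    unfolding W'_def using W c e c' e' chart_open(1) bundle_frame(1)[OF L_bundle[OF i]] Aut_open[OF G_Aut[OF g]]
    by (blast intro: open_Int)+
  have fib: "\<sigma> q \<in> fiber ?E q" if "q \<in> W'" for q
    by (rule holo_section_fiber[OF \<sigma>]) (use that in \<open>simp add: W'_def\<close>)
  define x where "x = (\<lambda>q. \<Gamma> (g, \<sigma> q))"
  have dom: "(g, \<sigma> q) \<in> (N \<times> D) \<inter> (G \<times> Tot ?E) \<inter> F -` D'" if q: "q \<in> W'" for q
    using \<gamma>(2) g fib[OF q] \<rho>_fiber[OF i g fib[OF q]] q by (simp add: D_def D'_def F_def fiber_def W'_def)
  have xq: "x q = (\<gamma> g, ratio ?E (\<sigma> q) (e q), snd c q)" if "q \<in> W'" for q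
    using fib[OF that] by (simp add: x_def \<Gamma>_def \<psi>_def fiber_def)
  have "hol_at (\<lambda>q. (\<gamma> g, ratio ?E (\<sigma> q) (e q), snd c q)) p"
    by (intro hol_at_Pair hol_at_const holo_section_hol[OF L_bundle[OF i] \<sigma> W e] hol_at_coordinate c)
  then have "hol_at x p"
    by (rule hol_at_cong) (use eventually_in[OF W'] in \<open>auto elim!: eventually_mono simp: xq\<close>)
  moreover have "holo_at (\<psi>' \<circ> F \<circ> inv_into (N \<times> D) \<Gamma>) (x p)"
    using holo_on_open[OF hol(1)] hol(2) dom[OF W'(2)] unfolding x_def by blast
  then have "holo_at (\<lambda>w. fst ((\<psi>' \<circ> F \<circ> inv_into (N \<times> D) \<Gamma>) w)) (x p)" by (rule holo_at_fst)
  ultimately have "hol_at (\<lambda>q. fst ((\<psi>' \<circ> F \<circ> inv_into (N \<times> D) \<Gamma>) (x q))) p" by (rule hol_at_compose)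
  then show ?thesis
  proof (rule hol_at_cong)
    have "fst ((\<psi>' \<circ> F \<circ> inv_into (N \<times> D) \<Gamma>) (x q)) = ratio ?E (\<rho> i g (\<sigma> q)) (e' (g q))" if q: "q \<in> W'" for q
    proof -
      have "inv_into (N \<times> D) \<Gamma> (x q) = (g, \<sigma> q)"
        unfolding x_def by (rule inv_into_f_f[OF inj]) (use dom[OF q] in blast)
      then show ?thesis using fiber_Proj(1)[OF \<rho>_fiber[OF i g fib[OF q]]] by (simp add: F_def \<psi>'_def)
    qed
    then show "\<forall>\<^sub>F q in nhds p. fst ((\<psi>' \<circ> F \<circ> inv_into (N \<times> D) \<Gamma>) (x q)) = ratio ?E (\<rho> i g (\<sigma> q)) (e' (g q))"
      using eventually_in[OF W'] by (auto elim!: eventually_mono)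
  qed
qed

lemma section_act_apply: "section_act g a \<sigma> q = a (\<sigma> (inv g q))"
  by (simp add: section_act_def)

lemma section_act_holo:
  assumes i: "i < s" and g: "g \<in> G" and \<sigma>: "holo_section A (L i) W \<sigma>" and W: "open W"
  shows "holo_section A (L i) (inv g -` W) (section_act g (\<rho> i g) \<sigma>)"
  unfolding holo_section_def
proof (intro conjI ballI)
  note gA = G_Aut[OF G_inv[OF g]]
  show "section_act g (\<rho> i g) \<sigma> q \<in> fiber (L i) q" if "q \<in> inv g -` W" for q
    using \<rho>_fiber[OF i g holo_section_fiber[OF \<sigma>], of "inv g q"] that by (simp add: section_act_apply G_inverse[OF g])
  fix f assume f: "f \<in> Frames (L i)"
  obtain U e where Ue: "f = (U, e)" by (cases f)
  have e: "(U, e) \<in> Frames (L i)" using f Ue by simp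
  have opU: "open (U \<inter> inv g -` W)" using bundle_frame(1)[OF L_bundle[OF i] e] Aut_open[OF gA W] by blast
  have "hol_at (\<lambda>q. ratio (L i) (section_act g (\<rho> i g) \<sigma> q) (e q)) q" if q: "q \<in> U \<inter> inv g -` W" for q
  proof -
    have "hol_at (\<lambda>q. ratio (L i) (\<rho> i g (\<sigma> q)) (e (g q))) (inv g q)"
      by (rule \<rho>_hol[OF i g \<sigma> W _ e]) (use q in \<open>auto simp: G_inverse[OF g]\<close>)
    from hol_at_Aut[OF gA this] show ?thesis by (simp add: section_act_apply G_inverse[OF g])
  qed
  then show "case f of (U, e) \<Rightarrow> holo_fun A (U \<inter> inv g -` W) (\<lambda>p. ratio (L i) (section_act g (\<rho> i g) \<sigma> p) (e p))"
    unfolding Ue prod.case holo_fun_iff[OF opU] by blast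
qed

lemma section_act_local_frame:
  assumes i: "i < s" and g: "g \<in> G" and e: "local_frame A (L i) U e"
  shows "local_frame A (L i) (inv g -` U) (section_act g (\<rho> i g) e)"
  unfolding local_frame_def
proof (intro conjI ballI)
  have U: "open U" "holo_section A (L i) U e" "\<And>p. p \<in> U \<Longrightarrow> e p \<in> nonzero (L i)"
    using e by (simp_all add: local_frame_def)
  show "open (inv g -` U)" by (rule Aut_open[OF G_Aut[OF G_inv[OF g]] U(1)])
  show "holo_section A (L i) (inv g -` U) (section_act g (\<rho> i g) e)" by (rule section_act_holo[OF i g U(2,1)])
  show "section_act g (\<rho> i g) e p \<in> nonzero (L i)" if "p \<in> inv g -` U" for p
    using \<rho>_nonzero_iff[OF i g holo_section_fiber[OF U(2)], of "inv g p"] U(3) that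
    by (simp add: section_act_apply)
qed

lemma Vstar_act_apply: "i < s \<Longrightarrow> Vstar_act s \<rho> g \<sigma> i q = \<rho> i g (\<sigma> i (inv g q))"
  by (simp add: Vstar_act_def section_act_apply)

lemma Vstar_act_in:
  assumes g: "g \<in> G" and \<sigma>: "\<sigma> \<in> Vstar A L s"
  shows "Vstar_act s \<rho> g \<sigma> \<in> Vstar A L s"
proof -
  have "section_act g (\<rho> i g) (\<sigma> i) \<in> H0 A (L i)" if i: "i < s" for i
    using section_act_holo[OF i g Vstar_section[OF \<sigma> i]] by (simp add: H0_def)
  then show ?thesis by (auto simp: Vstar_def Vstar_act_def)
qed

lemma Vstar_act_inverse:
  assumes g: "g \<in> G" and \<sigma>: "\<sigma> \<in> Vstar A L s"
  shows "Vstar_act s \<rho> g (Vstar_act s \<rho> (inv g) \<sigma>) = \<sigma>"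
proof (rule ext)
  fix i
  show "Vstar_act s \<rho> g (Vstar_act s \<rho> (inv g) \<sigma>) i = \<sigma> i"
  proof (cases "i < s")
    case True
    then show ?thesis
      by (intro ext) (simp add: Vstar_act_apply G_inverse[OF g] \<rho>_inverse[OF True g Vstar_fiber[OF \<sigma> True]])
  next
    case False
    then show ?thesis using \<sigma> by (auto simp: Vstar_def Vstar_act_def PiE_def extensional_def)
  qed
qed

lemma Yset_act:
  assumes g: "g \<in> G" and \<sigma>: "\<sigma> \<in> Vstar A L s"
  shows "g p \<in> Yset L s (Vstar_act s \<rho> g \<sigma>) \<longleftrightarrow> p \<in> Yset L s \<sigma>"
  by (auto simp: Yset_def Yhyp_def Vstar_act_apply G_inverse[OF g] \<rho>_nonzero_iff[OF _ g Vstar_fiber[OF \<sigma>]])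

lemma special_act:
  assumes g: "g \<in> G" and \<sigma>: "\<sigma> \<in> Vstar A L s" and sp: "special \<sigma> c e p"
  shows "special (Vstar_act s \<rho> g \<sigma>) (move_chart g c) (\<lambda>i. section_act g (\<rho> i g) (e i)) (g p)"
  unfolding special_def
proof (intro conjI allI impI ballI)
  have c: "c \<in> A" "p \<in> fst c" using special_chart[OF sp] by blast+
  show "move_chart g c \<in> A" by (rule move_chart_in[OF G_Aut[OF g] c(1)])
  show "g p \<in> fst (move_chart g c)" using c by (simp add: G_inverse[OF g])
  fix i assume i: "i < s"
  have e: "local_frame A (L i) (fst c) (e i)" "\<And>q. q \<in> fst c \<Longrightarrow> \<sigma> i q = Smul (L i) (snd c q $ coord i) (e i q)"
    using sp i by (auto simp: special_def)
  show "local_frame A (L i) (fst (move_chart g c)) (section_act g (\<rho> i g) (e i))"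
    unfolding move_chart_simps by (rule section_act_local_frame[OF i g e(1)])
  fix q assume "q \<in> fst (move_chart g c)"
  then have q: "inv g q \<in> fst c" by simp
  show "Vstar_act s \<rho> g \<sigma> i q = Smul (L i) (snd (move_chart g c) q $ coord i) (section_act g (\<rho> i g) (e i) q)"
    using \<rho>_Smul[OF i g frame_fiber[OF local_frame_frame_vec[OF L_bundle[OF i] e(1) q]]] e(2)[OF q]
    by (simp add: Vstar_act_apply[OF i] section_act_apply)
qed

lemma Bset_act:
  assumes g: "g \<in> G" and \<sigma>: "\<sigma> \<in> Bset A L s"
  shows "Vstar_act s \<rho> g \<sigma> \<in> Bset A L s"
proof (rule special_smooth[OF Vstar_act_in[OF g Bset_Vstar[OF \<sigma>]]])
  fix p assume "p \<in> Yset L s (Vstar_act s \<rho> g \<sigma>)"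
  then have "inv g p \<in> Yset L s \<sigma>" using Yset_act[OF g Bset_Vstar[OF \<sigma>], of "inv g p"] by (simp add: G_inverse[OF g])
  then obtain c e where "special \<sigma> c e (inv g p)" using special_exists[OF \<sigma>] by blast
  from special_act[OF g Bset_Vstar[OF \<sigma>] this] show "\<exists>c e. special (Vstar_act s \<rho> g \<sigma>) c e p"
    unfolding G_inverse[OF g] by blast
qed

lemma LK_act_lkframe:
  assumes g: "g \<in> G" and e: "\<And>i. i < s \<Longrightarrow> frame_vec (L i) p (e i p)" and c: "c \<in> A" "p \<in> fst c"
  shows "LK_act A L s \<rho> g (Smul (LK A L s) t (lkframe e c p)) =
    Smul (LK A L s) t (lkframe (\<lambda>i. section_act g (\<rho> i g) (e i)) (move_chart g c) (g p))"
proof -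
  have fr: "frame_vec (L i) (g p) (\<rho> i g (e i p))" if "i < s" for i by (rule \<rho>_frame[OF that g e[OF that]])
  have c': "move_chart g c \<in> A" "g p \<in> fst (move_chart g c)"
    using move_chart_in[OF G_Aut[OF g] c(1)] c(2) by (simp_all add: G_inverse[OF g])
  have top: "push_form g (top_form c p) = top_form (move_chart g c) (g p)"
    by (rule push_form_coord_form[OF push_vec_tangent_iff[OF G_Aut[OF g]]])
  have eq: "lkframe (\<lambda>i. section_act g (\<rho> i g) (e i)) (move_chart g c) (g p) =
      tens TL KX (tens_list L s (g p) (\<lambda>i. \<rho> i g (e i p))) (g p, top_form (move_chart g c) (g p))"
    by (simp add: lkframe_def section_act_apply G_inverse[OF g])
  show ?thesis
    unfolding eq unfolding lkframe_def
  proof (rule tens_act_frame[OF TL_lines has_lines_canonical])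
    show "frame_vec TL p (tens_list L s p (\<lambda>i. e i p))" by (rule frame_vec_tens_list[OF L_lines e])
    show "frame_vec KX p (p, top_form c p)" by (rule frame_vec_canonical[OF c])
    show "frame_vec TL (g p) (tens_list L s (g p) (\<lambda>i. \<rho> i g (e i p)))" by (rule frame_vec_tens_list[OF L_lines fr])
    show "frame_vec KX (g p) (g p, top_form (move_chart g c) (g p))" by (rule frame_vec_canonical[OF c'])
    show "tens_list_act L s g (\<lambda>i. \<rho> i g) (Smul TL x (tens_list L s p (\<lambda>i. e i p))) =
        Smul TL x (tens_list L s (g p) (\<lambda>i. \<rho> i g (e i p)))" for x
      by (rule tens_list_act_frame[where e="\<lambda>i. e i p" and a="\<lambda>i. \<rho> i g" and p=p and g=g, OF L_lines e fr]) (auto intro: \<rho>_Smul[OF _ g frame_fiber[OF e]])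
    show "canonical_act g (Smul KX y (p, top_form c p)) = Smul KX y (g p, top_form (move_chart g c) (g p))" for y
      unfolding Smul_canonical canonical_act_def top[symmetric] by (simp add: push_form_def)
  qed
qed

lemma R_at_equivariant:
  assumes g: "g \<in> G" and \<tau>: "\<tau> \<in> H0 A (LK A L s)" and \<sigma>: "\<sigma> \<in> Bset A L s"
  shows "R_at A L s (Vstar_act s \<rho> g \<sigma>) (section_act g (LK_act A L s \<rho> g) \<tau>) (g p) =
    push_form g (R_at A L s \<sigma> \<tau> p)"
proof (cases "p \<in> Yset L s \<sigma>")
  case False
  then show ?thesis using Yset_act[OF g Bset_Vstar[OF \<sigma>]] by (simp add: R_at_def push_form_def)
next
  case True
  let ?\<sigma> = "Vstar_act s \<rho> g \<sigma>" and ?\<tau> = "section_act g (LK_act A L s \<rho> g) \<tau>"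
  note \<sigma>V = Bset_Vstar[OF \<sigma>]
  note \<sigma>V' = Vstar_act_in[OF g \<sigma>V]
  have p': "g p \<in> Yset L s ?\<sigma>" using True Yset_act[OF g \<sigma>V] by blast
  obtain c e where sp: "special \<sigma> c e p" using special_exists[OF \<sigma> True] by blast
  define e' where "e' = (\<lambda>i. section_act g (\<rho> i g) (e i))"
  have sp': "special ?\<sigma> (move_chart g c) e' (g p)" unfolding e'_def by (rule special_act[OF g \<sigma>V sp])
  note c = special_chart[OF sp]
  note c' = special_chart[OF sp']
  have e: "frame_vec (L i) p (e i p)" if "i < s" for i
    by (rule frames_at_vec[OF special_frames[OF sp c(2)] that])
  have e': "frame_vec (L i) (g p) (e' i (g p))" if "i < s" for i
    by (rule frames_at_vec[OF special_frames[OF sp' c'(2)] that])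
  have fr': "frame_vec (LK A L s) (g p) (lkframe e' (move_chart g c) (g p))" by (rule lkframe_frame[where e=e' and p="g p", OF e' c'])
  have \<tau>p: "?\<tau> (g p) = Smul (LK A L s) (lkcoeff \<tau> e c p) (lkframe e' (move_chart g c) (g p))"
  proof -
    have "?\<tau> (g p) = LK_act A L s \<rho> g (Smul (LK A L s) (lkcoeff \<tau> e c p) (lkframe e c p))"
      unfolding section_act_apply G_inverse[OF g]
      by (rule arg_cong[OF lkcoeff_eq[where e=e and p=p and \<tau>=\<tau>, OF e c H0_fiber[OF \<tau>]]])
    also have "\<dots> = Smul (LK A L s) (lkcoeff \<tau> e c p) (lkframe e' (move_chart g c) (g p))"
      unfolding e'_def by (rule LK_act_lkframe[where e=e and p=p, OF g e c])
    finally show ?thesis .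
  qed
  have \<tau>f: "?\<tau> (g p) \<in> fiber (LK A L s) (g p)" unfolding \<tau>p by (rule frame_Smul_in[OF fr'])
  have co: "lkcoeff ?\<tau> e' (move_chart g c) (g p) = lkcoeff \<tau> e c p"
    unfolding lkcoeff_def[of ?\<tau>] \<tau>p by (rule ratio_Smul_frame[OF fr'])
  \<comment> \<open>In special charts both tangent spaces are cut out by the first s components, and
    moved charts keep components.\<close>
  have TY: "push_vec (inv g) v \<in> tangentY A L s \<sigma> p \<longleftrightarrow> v \<in> tangentY A L s ?\<sigma> (g p)" for v
    unfolding special_tangentY[OF \<sigma>V True sp] special_tangentY[OF \<sigma>V' p' sp']
      push_vec_tangent_iff[OF G_Aut[OF g]] push_vec_inv_component ..
  have "R_at A L s ?\<sigma> ?\<tau> (g p) = (\<lambda>u. lkcoeff \<tau> e c p * coord_form (move_chart g c) (tangentY A L s ?\<sigma> (g p)) s (CARD('n) - s) u)"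
    unfolding R_at_special[where \<tau>="?\<tau>" and p="g p", OF \<sigma>V' p' \<tau>f sp'] co ..
  also have "\<dots> = (\<lambda>u. lkcoeff \<tau> e c p * push_form g (coord_form c (tangentY A L s \<sigma> p) s (CARD('n) - s)) u)"
    unfolding push_form_coord_form[of g "tangentY A L s \<sigma> p" "tangentY A L s ?\<sigma> (g p)", OF TY] ..
  also have "\<dots> = push_form g (R_at A L s \<sigma> \<tau> p)"
    unfolding R_at_special[where \<tau>=\<tau> and p=p, OF \<sigma>V True H0_fiber[OF \<tau>] sp] push_form_def ..
  finally show ?thesis .
qed

theorem R_map_equivariant:
  assumes g: "g \<in> G" and \<tau>: "\<tau> \<in> H0 A (LK A L s)"
  shows "R_map A L s (section_act g (LK_act A L s \<rho> g) \<tau>) = Htop_act A L s \<rho> g (R_map A L s \<tau>)"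
proof (rule ext)
  fix \<sigma>
  show "R_map A L s (section_act g (LK_act A L s \<rho> g) \<tau>) \<sigma> = Htop_act A L s \<rho> g (R_map A L s \<tau>) \<sigma>"
  proof (cases "\<sigma> \<in> Bset A L s")
    case True
    \<comment> \<open>\<open>R_at_equivariant\<close> is used at the preimages of \<sigma> and p
      under g, so that applying g returns to \<sigma> and p.\<close>
    let ?\<sigma> = "Vstar_act s \<rho> (inv g) \<sigma>"
    have B: "?\<sigma> \<in> Bset A L s" by (rule Bset_act[OF G_inv[OF g] True])
    have "R_at A L s \<sigma> (section_act g (LK_act A L s \<rho> g) \<tau>) p = push_form g (R_at A L s ?\<sigma> \<tau> (inv g p))" for p
      using R_at_equivariant[where p="inv g p" and \<tau>=\<tau>, OF g \<tau> B]
      by (simp only: G_inverse[OF g] Vstar_act_inverse[OF g Bset_Vstar[OF True]])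
    then show ?thesis using True B by (simp add: R_map_def Htop_act_def fun_eq_iff)
  qed (simp add: R_map_def Htop_act_def)
qed

end

theorem theorem6p6:
  fixes A :: "('x::topological_space, 'n::{finite, linorder} cvec) chart set"
    and G :: "('x \<Rightarrow> 'x) set" and TG :: "('x \<Rightarrow> 'x) topology"
    and AG :: "('x \<Rightarrow> 'x, 'm::complex_model) chart set"
    and L :: "nat \<Rightarrow> ('x, 'l) line_bundle" and \<rho> :: "nat \<Rightarrow> ('x \<Rightarrow> 'x) \<Rightarrow> 'l \<Rightarrow> 'l"
    and s :: nat and chi :: "complex \<Rightarrow> complex"
    and \<Psi> :: "'v::complex_model \<Rightarrow> nat \<Rightarrow> 'x \<Rightarrow> 'l"
  assumes X_manifold: "complex_manifold (euclidean :: 'x topology) A"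
    and X_compact: "compact (UNIV :: 'x set)" and X_connected: "connected (UNIV :: 'x set)"
    and G_subgroup: "complex_lie_subgroup A G TG AG"
    and s_less: "s < CARD('n)"
    and L_bundle: "\<forall>i<s. is_line_bundle A (L i)"
    and L_nontrivial: "\<forall>i<s. \<not> trivial_bundle A (L i)"
    and L_equivariant: "\<forall>i<s. equivariant_structure A G AG (L i) (\<rho> i)"
    and LK_sections: "\<exists>\<tau>\<in>H0 A (LK A L s). \<exists>p. \<tau> p \<in> nonzero (LK A L s)"
    and L_bpf: "\<forall>i<s. base_point_free A (L i)"
    and character: "holo_character chi"
    and L_chi: "line_bundle_iso A (tensor_list_bundle L s) (assoc_bundle (canonical_bundle A) chi) \<Phi>"
    and V_coords: "linear_coords A L s \<Psi>"
    and h0_locally_constant: "\<forall>v. \<Psi> v \<in> Bset A L s \<longrightarrow>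
      (\<forall>\<^sub>F v' in nhds v. \<Psi> v' \<in> Bset A L s \<longrightarrow> hdim (H0KY A L s (\<Psi> v')) = hdim (H0KY A L s (\<Psi> v)))"
  shows "R_map A L s \<in> H0 A (LK A L s) \<rightarrow> H0Htop A L s \<Psi> \<and>
    (\<forall>g\<in>G. \<forall>\<tau>\<in>H0 A (LK A L s).
      R_map A L s (section_act g (LK_act A L s \<rho> g) \<tau>) = Htop_act A L s \<rho> g (R_map A L s \<tau>)) \<and>
    (\<forall>\<tau>\<in>H0 A (LK A L s). \<forall>\<sigma>\<in>Bset A L s.
      tau_Omega A L s chi \<Phi> \<tau> \<sigma> \<in> polar_forms A L s \<sigma> \<and>
      R_map A L s \<tau> \<sigma> = Res A L s \<sigma> (tau_Omega A L s chi \<Phi> \<tau> \<sigma>))"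
proof -
  interpret equivariant_adjunction A L s G TG AG \<rho>
    by unfold_locales (use X_manifold s_less L_bundle G_subgroup L_equivariant in auto)
  have "R_map A L s \<tau> \<sigma> = Res A L s \<sigma> (tau_Omega A L s chi \<Phi> \<tau> \<sigma>)"
    if "\<tau> \<in> H0 A (LK A L s)" "\<sigma> \<in> Bset A L s" for \<tau> \<sigma>
    using R_at_eq_Res[OF character L_chi that(2,1)] that(2) by (simp add: R_map_def)
  then show ?thesis
    using R_map_H0Htop[OF V_coords] R_map_equivariant tau_Omega_polar_forms[OF character L_chi Bset_Vstar] by blast
qed

end
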